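(* Let $\beta\in(0,1)$, and let $C_\beta>0$ be a constant such that for every $f\in B_b(0,T;C_0^\infty(\mathbb{R}^N))$ the unique solution $u$ of $\partial_tu=L^{\mathrm{ou}}u+f$ on $(0,T)\times\mathbb{R}^N$, $u(0,\cdot)=0$, satisfies $$\sup_{0\le t\le T}\|u(t,\cdot)\|_{C^{2+\beta}_{b,d}}\le C_\beta\sup_{0\le t\le T}\|f(t,\cdot)\|_{C^\beta_{b,d}} .$$ Let $t\mapsto S(t)$, $t\in[0,T]$, be a continuous map with values in the symmetric non-negative definite $N\times N$ real matrices. Then for every $f\in B_b(0,T;C_0^\infty(\mathbb{R}^N))$ the unique solution $u_S$ of $$\partial_tu_S(t,z)=L^{\mathrm{ou},S}_tu_S(t,z)+f(t,z)\ \text{ on }(0,T)\times\mathbb{R}^N,\qquad u_S(0,z)=0\ \text{ on }\mathbb{R}^N,$$ satisfies, with the same constant $C_\beta$, $$\sup_{0\le t\le T}\|u_S(t,\cdot)\|_{C^{2+\beta}_{b,d}}\le C_\beta\sup_{0\le t\le T}\|f(t,\cdot)\|_{C^\beta_{b,d}} .$$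
   Context: Fix $T>0$ and $\mathbb{R}^N=\mathbb{R}^{d_0}\times\mathbb{R}^{d_1}$, $d_0\ge1$, $d_0+d_1=N$. Let $B=\begin{pmatrix}B_0&0\\0&0\end{pmatrix}\in\mathbb{R}^{N\times N}$, where $B_0$ is a symmetric $d_0\times d_0$ matrix with $\nu|\xi|^2\le\langle B_0\xi,\xi\rangle\le\nu^{-1}|\xi|^2$ for all $\xi\in\mathbb{R}^{d_0}$, for some $\nu>0$. Let $A\in\mathbb{R}^{N\times N}$ be such that $A,B$ satisfy the Kalman condition $\mathrm{Rank}[B,AB,\dots,A^kB]=N$ for some non-negative integer $k$, written in the following block form: $d_1=\sum_{i=1}^k\mathfrak{d}_i$ with positive integers $\mathfrak{d}_1,\dots,\mathfrak{d}_k$, $\mathfrak{d}_0=d_0$, and in the decomposition $\mathbb{R}^N=\mathbb{R}^{\mathfrak{d}_0}\times\mathbb{R}^{\mathfrak{d}_1}\times\dots\times\mathbb{R}^{\mathfrak{d}_k}$, $$A=\begin{pmatrix}\ast&\ast&\cdots&\cdots&\ast\\ \mathscr{A}^1&\ast&\ddots&\ddots&\vdots\\ 0&\mathscr{A}^2&\ast&\ddots&\vdots\\ \vdots&\ddots&\ddots&\ddots&\ast\\ 0&\cdots&0&\mathscr{A}^k&\ast\end{pmatrix},$$ where $\mathscr{A}^i$ is a $\mathfrak{d}_i\times\mathfrak{d}_{i-1}$ matrix of rank $\mathfrak{d}_i$ and the blocks $\ast$ are arbitrary. Write $z=(x,y_1,\dots,y_k)$ accordingly. Operators: $$L^{\mathrm{ou}}f(z)=\mathrm{Tr}(BD^2f(z))+\langle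 Az,Df(z)\rangle,\qquad L_t^{\mathrm{ou},S}f(z)=L^{\mathrm{ou}}f(z)+\mathrm{Tr}(S(t)D^2f(z)),$$ with $D^2$ the full spatial Hessian. $B_b(0,T;C_0^\infty(\mathbb{R}^N))$ is the space of bounded Borel functions $\phi:[0,T]\times\mathbb{R}^N\to\mathbb{R}$ such that: $\phi(t,\cdot)$ is smooth with compact support for every $t$; for each $n\in\mathbb{N}$ the $C^n(\mathbb{R}^N)$-norms of $\phi(t,\cdot)$ are bounded uniformly in $t$; the supports of all $\phi(t,\cdot)$ lie in one common ball; and for every $z$ the map $t\mapsto\phi(t,z)$ is continuous except at finitely many points of $[0,T]$. Notion of solution: a solution of $\partial_tv=\mathcal{L}_tv+f$, $v(0,\cdot)=0$, is a bounded continuous function $v:[0,T]\times\mathbb{R}^N\to\mathbb{R}$ with $v(t,\cdot)\in C^2(\mathbb{R}^N)$ for every $t\in[0,T]$ and $v(t,z)=\int_0^t\big(f(s,z)+\mathcal{L}_sv(s,z)\big)ds$ for all $(t,z)\in[0,T]\times\mathbb{R}^N$. Hölder norms: for an integer $\ell\ge0$ and $\theta\in(0,1)$, a function $\phi:\mathbb{R}^m\to\mathbb{R}$ is in $C_b^{\ell+\theta}(\mathbb{R}^m)$ if it has continuous derivatives up to order $\ell$ and $$\|\phi\|_{C_b^{\ell+\theta}}=\sum_{i=0}^{\ell}\sup_{|\vartheta|=i}\|D^\vartheta\phi\|_\infty+\sup_{|\vartheta|=\ell}\sup_{x\ne y}\frac{|D^\vartheta\phi(x)-D^\vartheta\phi(y)|}{|x-y|^\theta}<\infty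 .$$ Let $E_i:\mathbb{R}^{\mathfrak{d}_i}\to\mathbb{R}^N$, $i=0,\dots,k$, be the canonical embedding into the $i$-th block. For non-integer $\gamma\in(0,3)$ (such that $\gamma/(1+2i)$ is non-integer for all $i$, as is the case for $\gamma=\beta$ and $\gamma=2+\beta$ with $\beta\in(0,1)$), $$\|\phi\|_{C^\gamma_{b,d}}=\sup_{z_0\in\mathbb{R}^N}\|\phi(z_0+E_0(\cdot))\|_{C_b^\gamma(\mathbb{R}^{\mathfrak{d}_0})}+\sum_{i=1}^k\sup_{z_0\in\mathbb{R}^N}\|\phi(z_0+E_i(\cdot))\|_{C_b^{\gamma/(1+2i)}(\mathbb{R}^{\mathfrak{d}_i})} .$$ A finite constant $C_\beta$ with the property assumed for the unperturbed problem is known to exist. *)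

theory Defs
  imports "HOL-Analysis.Analysis"
begin

section \<open>Coordinate blocks\<close>

text \<open>
  The number \<open>k\<close> of blocks and their sizes are variable, so the factors of
  \<open>\<real>\<^sup>N = \<real>\<^sup>d\<^sub>0 \<times> \<dots> \<times> \<real>\<^sup>d\<^sub>k\<close> are not types. The coordinates are
  indexed by \<open>'n\<close> with \<open>N = CARD('n)\<close>, and a map \<open>blk :: 'n \<Rightarrow> nat\<close> with range
  \<open>{0..k}\<close> sends each coordinate to the number of its block; the \<open>i\<close>-th block has size
  \<open>d\<^sub>i = card (block blk i)\<close>. For an index set \<open>I\<close>, the space \<open>\<real>\<^sup>I\<close> is identified with the
  coordinate subspace of \<open>\<real>\<^sup>N\<close>, and the canonical embedding with the inclusion.
\<close>

definition block :: "('n \<Rightarrow> nat) \<Rightarrow> nat \<Rightarrow> 'n set" where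
  "block blk i = {p. blk p = i}"

definition coord_space :: "'n set \<Rightarrow> (real^'n::finite) set" where
  "coord_space I = {x. \<forall>p. p \<notin> I \<longrightarrow> x $ p = 0}"

section \<open>Assumptions on the matrices\<close>

definition sym_nonneg_matrix :: "real^'n^'n::finite \<Rightarrow> bool" where
  "sym_nonneg_matrix M \<longleftrightarrow> transpose M = M \<and> (\<forall>\<xi>. 0 \<le> (M *v \<xi>) \<bullet> \<xi>)"

definition elliptic_first_block :: "('n::finite \<Rightarrow> nat) \<Rightarrow> real \<Rightarrow> real^'n^'n \<Rightarrow> bool" where
  "elliptic_first_block blk \<nu> B \<longleftrightarrow>
     (\<forall>p q. \<not> (p \<in> block blk 0 \<and> q \<in> block blk 0) \<longrightarrow> B $ p $ q = 0) \<and>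
     transpose B = B \<and>
     (\<forall>\<xi>\<in>coord_space (block blk 0).
        \<nu> * (norm \<xi>)\<^sup>2 \<le> (B *v \<xi>) \<bullet> \<xi> \<and> (B *v \<xi>) \<bullet> \<xi> \<le> inverse \<nu> * (norm \<xi>)\<^sup>2)"

text \<open>Column rank of \<open>[B, AB, \<dots>, A\<^sup>kB]\<close>.\<close>

definition kalman_rank :: "real^'n^'n::finite \<Rightarrow> real^'n^'n \<Rightarrow> nat \<Rightarrow> nat" where
  "kalman_rank A B k = dim (\<Union>j\<le>k. columns ((((**) A) ^^ j) B))"

text \<open>The block of \<open>M\<close> with rows in \<open>P\<close> and columns in \<open>Q\<close>, padded with zeros (which does not
  change its rank).\<close>

definition submatrix_padded :: "'n set \<Rightarrow> 'n set \<Rightarrow> real^'n^'n::finite \<Rightarrow> real^'n^'n" where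
  "submatrix_padded P Q M = (\<chi> p q. if p \<in> P \<and> q \<in> Q then M $ p $ q else 0)"

definition kalman_block_form :: "('n::finite \<Rightarrow> nat) \<Rightarrow> nat \<Rightarrow> real^'n^'n \<Rightarrow> bool" where
  "kalman_block_form blk k A \<longleftrightarrow>
     (\<forall>p q. blk p > blk q + 1 \<longrightarrow> A $ p $ q = 0) \<and>
     (\<forall>i\<in>{1..k}. rank (submatrix_padded (block blk i) (block blk (i - 1)) A) = card (block blk i))"

section \<open>Partial derivatives and Hoelder norms\<close>

definition pdiff :: "'n \<Rightarrow> (real^'n::finite \<Rightarrow> real) \<Rightarrow> real^'n \<Rightarrow> real" where
  "pdiff p f x = deriv (\<lambda>h. f (x + h *\<^sub>R axis p 1)) 0"

text \<open>A multi-index \<open>\<vartheta>\<close> is represented by a list of coordinates, with \<open>|\<vartheta>|\<close> its length.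
  For \<open>C\<^sup>n\<close> functions the order in the list is immaterial (Schwarz), so a supremum over all lists
  of a given length is the supremum over all multi-indices of that order.\<close>

definition pdiffs :: "'n list \<Rightarrow> (real^'n::finite \<Rightarrow> real) \<Rightarrow> real^'n \<Rightarrow> real" where
  "pdiffs ps f = foldr pdiff ps f"

definition multi_indices :: "'n set \<Rightarrow> nat \<Rightarrow> 'n list set" where
  "multi_indices I n = {ps. set ps \<subseteq> I \<and> length ps = n}"

text \<open>\<open>Cn_on I n f\<close>: as a function on \<open>\<real>\<^sup>I\<close>, \<open>f\<close> has continuous partial derivatives up to order
  \<open>n\<close>. Only the values of \<open>f\<close> on \<open>coord_space I\<close> matter, here and in the norms below, because the
  derivatives are taken at points of this space and along its own axes.\<close>

definition Cn_on :: "'n set \<Rightarrow> nat \<Rightarrow> (real^'n::finite \<Rightarrow> real) \<Rightarrow> bool" where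
  "Cn_on I n f \<longleftrightarrow>
     (\<forall>m\<le>n. \<forall>ps\<in>multi_indices I m. continuous_on (coord_space I) (pdiffs ps f)) \<and>
     (\<forall>m<n. \<forall>ps\<in>multi_indices I m. \<forall>p\<in>I. \<forall>x\<in>coord_space I.
        (\<lambda>h. pdiffs ps f (x + h *\<^sub>R axis p 1)) field_differentiable (at 0))"

definition Cn_norm :: "'n set \<Rightarrow> nat \<Rightarrow> (real^'n::finite \<Rightarrow> real) \<Rightarrow> ennreal" where
  "Cn_norm I n f =
     (\<Sum>i\<le>n. SUP ps\<in>multi_indices I i. SUP x\<in>coord_space I. ennreal \<bar>pdiffs ps f x\<bar>)"

definition holder_seminorm :: "'n set \<Rightarrow> nat \<Rightarrow> real \<Rightarrow> (real^'n::finite \<Rightarrow> real) \<Rightarrow> ennreal" where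
  "holder_seminorm I l \<theta> f =
     (SUP ps\<in>multi_indices I l.
        SUP (x, y)\<in>{(x, y). x \<in> coord_space I \<and> y \<in> coord_space I \<and> x \<noteq> y}.
          ennreal (\<bar>pdiffs ps f x - pdiffs ps f y\<bar> / norm (x - y) powr \<theta>))"

text \<open>The norm of \<open>C\<^sub>b\<^sup>\<gamma>(\<real>\<^sup>I)\<close> for non-integer \<open>\<gamma> = l + \<theta>\<close>; it is \<open>\<infinity>\<close> exactly
  for functions outside this space.\<close>

definition holder_norm :: "'n set \<Rightarrow> real \<Rightarrow> (real^'n::finite \<Rightarrow> real) \<Rightarrow> ennreal" where
  "holder_norm I \<gamma> f =
     (let l = nat \<lfloor>\<gamma>\<rfloor>; \<theta> = frac \<gamma> in
      if Cn_on I l f then Cn_norm I l f + holder_seminorm I l \<theta> f else \<infinity>)"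

definition aniso_holder_norm ::
  "('n \<Rightarrow> nat) \<Rightarrow> nat \<Rightarrow> real \<Rightarrow> (real^'n::finite \<Rightarrow> real) \<Rightarrow> ennreal" where
  "aniso_holder_norm blk k \<gamma> \<phi> =
     (SUP z0. holder_norm (block blk 0) \<gamma> (\<lambda>x. \<phi> (z0 + x))) +
     (\<Sum>i=1..k. SUP z0. holder_norm (block blk i) (\<gamma> / (1 + 2 * real i)) (\<lambda>x. \<phi> (z0 + x)))"

section \<open>Sources, operators and solutions\<close>

text \<open>The space \<open>B\<^sub>b(0,T;C\<^sub>0\<^sup>\<infinity>(\<real>\<^sup>N))\<close>. Functions of \<open>(t,z)\<close> are curried, and only their
  values for \<open>t \<in> [0,T]\<close> are meaningful.\<close>

definition Bb_Cc_infty :: "real \<Rightarrow> (real \<Rightarrow> real^'n::finite \<Rightarrow> real) set" where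
  "Bb_Cc_infty T = {\<phi>.
     (\<lambda>(t, z). \<phi> t z) \<in> borel_measurable (restrict_space borel ({0..T} \<times> UNIV)) \<and>
     bounded ((\<lambda>(t, z). \<phi> t z) ` ({0..T} \<times> UNIV)) \<and>
     (\<forall>t\<in>{0..T}. (\<forall>n. Cn_on UNIV n (\<phi> t)) \<and> compact (closure {z. \<phi> t z \<noteq> 0})) \<and>
     (\<forall>n. (SUP t\<in>{0..T}. Cn_norm UNIV n (\<phi> t)) < \<infinity>) \<and>
     (\<exists>a R. \<forall>t\<in>{0..T}. closure {z. \<phi> t z \<noteq> 0} \<subseteq> ball a R) \<and>
     (\<forall>z. \<exists>F. finite F \<and>
        (\<forall>t\<in>{0..T} - F. continuous (at t within {0..T}) (\<lambda>s. \<phi> s z)))}"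

definition gradient :: "(real^'n::finite \<Rightarrow> real) \<Rightarrow> real^'n \<Rightarrow> real^'n" where
  "gradient f z = (\<chi> p. pdiffs [p] f z)"

definition hessian :: "(real^'n::finite \<Rightarrow> real) \<Rightarrow> real^'n \<Rightarrow> real^'n^'n" where
  "hessian f z = (\<chi> p q. pdiffs [p, q] f z)"

definition L_ou :: "real^'n^'n::finite \<Rightarrow> real^'n^'n \<Rightarrow> (real^'n \<Rightarrow> real) \<Rightarrow> real^'n \<Rightarrow> real" where
  "L_ou A B f z = trace (B ** hessian f z) + (A *v z) \<bullet> gradient f z"

definition L_ou_S :: "real^'n^'n::finite \<Rightarrow> real^'n^'n \<Rightarrow> (real \<Rightarrow> real^'n^'n) \<Rightarrow>
    real \<Rightarrow> (real^'n \<Rightarrow> real) \<Rightarrow> real^'n \<Rightarrow> real" where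
  "L_ou_S A B S t f z = L_ou A B f z + trace (S t ** hessian f z)"

text \<open>\<open>v\<close> solves \<open>\<partial>\<^sub>t v = L\<^sub>t v + f\<close> on \<open>(0,T) \<times> \<real>\<^sup>N\<close> with \<open>v(0,\<cdot>) = 0\<close>. The integral is
  Lebesgue's; its existence is part of the definition since a non-integrable function
  would have integral \<open>0\<close>.\<close>

definition is_solution :: "real \<Rightarrow> (real \<Rightarrow> (real^'n::finite \<Rightarrow> real) \<Rightarrow> real^'n \<Rightarrow> real) \<Rightarrow>
    (real \<Rightarrow> real^'n \<Rightarrow> real) \<Rightarrow> (real \<Rightarrow> real^'n \<Rightarrow> real) \<Rightarrow> bool" where
  "is_solution T L f v \<longleftrightarrow>
     continuous_on ({0..T} \<times> UNIV) (\<lambda>(t, z). v t z) \<and>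
     bounded ((\<lambda>(t, z). v t z) ` ({0..T} \<times> UNIV)) \<and>
     (\<forall>t\<in>{0..T}. Cn_on UNIV 2 (v t)) \<and>
     (\<forall>t\<in>{0..T}. \<forall>z.
        set_integrable lborel {0..t} (\<lambda>s. f s z + L s (v s) z) \<and>
        v t z = (LBINT s:{0..t}. f s z + L s (v s) z))"

definition is_unique_solution :: "real \<Rightarrow> (real \<Rightarrow> (real^'n::finite \<Rightarrow> real) \<Rightarrow> real^'n \<Rightarrow> real) \<Rightarrow>
    (real \<Rightarrow> real^'n \<Rightarrow> real) \<Rightarrow> (real \<Rightarrow> real^'n \<Rightarrow> real) \<Rightarrow> bool" where
  "is_unique_solution T L f v \<longleftrightarrow>
     is_solution T L f v \<and> (\<forall>w. is_solution T L f w \<longrightarrow> (\<forall>t\<in>{0..T}. w t = v t))"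

definition schauder_estimate :: "real \<Rightarrow> ('n::finite \<Rightarrow> nat) \<Rightarrow> nat \<Rightarrow> real \<Rightarrow> real \<Rightarrow>
    (real \<Rightarrow> real^'n \<Rightarrow> real) \<Rightarrow> (real \<Rightarrow> real^'n \<Rightarrow> real) \<Rightarrow> bool" where
  "schauder_estimate T blk k \<beta> C f u \<longleftrightarrow>
     (SUP t\<in>{0..T}. aniso_holder_norm blk k (2 + \<beta>) (u t))
       \<le> ennreal C * (SUP t\<in>{0..T}. aniso_holder_norm blk k \<beta> (f t))"

end

theory Submission
  imports Defs
begin

text \<open>
  Adding a diffusion \<open>S\<close> is averaging over random translations. Let \<open>Y\<close> be a random walk whose increments
  have covariance \<open>2 \<integral> S\<close>, transported by the flow of \<open>A\<close>. Along each path the unperturbed problem with the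
  source \<open>f(s, z - e\<^sup>-\<^sup>s\<^sup>A Y\<^sub>s)\<close> satisfies the Schauder estimate with the same right-hand side, since the norms are
  translation invariant. Its solution, translated by \<open>e\<^sup>-\<^sup>t\<^sup>A Y\<^sub>t\<close> and averaged over the paths, converges to
  \<open>u\<^sub>S\<close> together with all its derivatives as the mesh tends to \<open>0\<close>; the Hoelder norms are convex and lower
  semicontinuous, so the constant survives. A walk has finitely many paths and the shifts are step functions in
  time, so the sources remain in \<open>B\<^sub>b(0,T;C\<^sub>0\<^sup>\<infinity>)\<close>.

  Existence is Duhamel's formula in the moving frame \<open>e\<^sup>t\<^sup>A z\<close>, where the drift disappears and the
  evolution is the Gaussian semigroup.

  Uniqueness is delicate because no joint regularity of \<open>D\<^sup>2v\<close> in \<open>(t, z)\<close> is assumed, so the integral equation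
  cannot be differentiated at a given time. The difference \<open>w\<close> of two solutions is shown to be a viscosity
  subsolution: if the property fails, a Baire argument on the closure \<open>K\<close> of the bad times yields an interval in
  which \<open>w\<close> is uniformly semiconcave at the times of \<open>K\<close>. There the integral equation bounds the growth of \<open>w\<close>,
  while on the gaps of \<open>K\<close> the subsolution property does, which is a contradiction.
\<close>

section \<open>Linear algebra and real functions\<close>

text \<open>In the frame e^{tA} z the source at time s contributes to the value at time t through a
  Gaussian average of F(s, .), and this average commutes with translations. Shifting the source by
  Y_s and the solution back by Y_t leaves the increment Y_t - Y_s; averaging over it composes the
  Gaussian of B with that of S between s and t, and the covariances add up to that of B + S. Only
  the covariance of the increments survives the limit, so a walk with finitely many values can
  replace a diffusion.

  Derivatives are handled through Taylor inequalities (\<open>jet\<close>), which averages, limits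
  and time integrals inherit. The Gaussian semigroup itself is a limit of walks, so the same
  one-step expansions yield its semigroup law, its generator and the convergence of the walks.

  For uniqueness, semiconcavity is the kind of bound that fits: it holds with some constant at each
  time, passes to limits in time, and, the diffusion matrix being nonnegative, bounds the right-hand
  side of the equation from above.\<close>

lemma quadratic_form_sum:
  fixes a :: "real^'n^'n::finite"
  shows "(a *v x) \<bullet> y = (\<Sum>i\<in>UNIV. \<Sum>j\<in>UNIV. a $ i $ j * x $ j * y $ i)"
  by (simp add: matrix_vector_mult_def inner_vec_def sum_distrib_right)

lemma bilinear_axis:
  fixes a :: "real^'n^'n::finite"
  shows "(a *v axis p 1) \<bullet> axis q 1 = a $ q $ p"
  by (simp add: inner_axis matrix_vector_mul_component)

text \<open>Symmetric elimination: the induction runs over the set of coordinates that carry nonzero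
  rows. A nonzero pivot contributes one column of the factor and leaves its Schur complement, which
  is again nonnegative and has one row less; a zero pivot forces its whole row to vanish.\<close>

lemma psd_factor_supported:
  fixes a :: "real^'n^'n::finite"
  assumes "finite P" "sym_nonneg_matrix a" "\<And>i j. i \<notin> P \<Longrightarrow> a $ i $ j = 0"
  shows "\<exists>\<sigma>::'n \<Rightarrow> real^'n. (\<forall>q. q \<notin> P \<longrightarrow> \<sigma> q = 0) \<and>
           (\<forall>i j. a $ i $ j = (\<Sum>p\<in>UNIV. \<sigma> p $ i * \<sigma> p $ j))"
  using assms
proof (induction P arbitrary: a rule: finite_induct)
  case empty
  then show ?case by (intro exI[of _ "\<lambda>_. 0"]) auto
next
  case (insert p P)
  have sym: "a $ i $ j = a $ j $ i" for i j
    using insert.prems(1) unfolding sym_nonneg_matrix_def by (metis transpose_def vec_lambda_beta)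
  have nn: "0 \<le> (a *v \<xi>) \<bullet> \<xi>" for \<xi>
    using insert.prems(1) unfolding sym_nonneg_matrix_def by blast
  have dg: "a $ q $ q \<ge> 0" for q
    using nn[of "axis q 1"] by (simp add: bilinear_axis)
  show ?case
  proof (cases "a $ p $ p = 0")
    case True
    have row: "a $ p $ q = 0" for q
    proof (rule ccontr)
      assume q: "a $ p $ q \<noteq> 0"
      have "0 \<le> 2 * x * a $ p $ q + a $ q $ q" for x :: real
      proof -
        have "(a *v (x *\<^sub>R axis p 1 + axis q 1)) \<bullet> (x *\<^sub>R axis p 1 + axis q 1)
          = x * x * ((a *v axis p 1) \<bullet> axis p 1) + x * ((a *v axis p 1) \<bullet> axis q 1)
            + x * ((a *v axis q 1) \<bullet> axis p 1) + (a *v axis q 1) \<bullet> axis q 1"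
          by (simp add: matrix_vector_right_distrib inner_add_left inner_add_right
              matrix_vector_mult_scaleR algebra_simps)
        also have "\<dots> = 2 * x * a $ p $ q + a $ q $ q"
          using sym[of p q] True by (simp add: bilinear_axis)
        finally show ?thesis using nn by metis
      qed
      \<comment> \<open>An affine function of x that stays nonnegative has slope 0; at this x its
        value is -1.\<close>
      from this[of "- (a $ q $ q + 1) / (2 * a $ p $ q)"] q show False by (simp add: field_simps)
    qed
    have "\<And>i j. i \<notin> P \<Longrightarrow> a $ i $ j = 0" using insert.prems(2) row by (metis insert_iff)
    from insert.IH[OF insert.prems(1) this] show ?thesis by auto
  next
    case False
    define d where "d = a $ p $ p"
    have d: "d > 0" using False dg[of p] unfolding d_def by linarith
    define b :: "real^'n^'n" where "b = (\<chi> i j. a $ i $ j - a $ p $ i * a $ p $ j / d)"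
    have quad: "(b *v \<xi>) \<bullet> \<xi> = (a *v \<xi>) \<bullet> \<xi> - (a $ p \<bullet> \<xi>)\<^sup>2 / d" for \<xi>
      unfolding quadratic_form_sum
      by (simp add: b_def algebra_simps sum_subtractf power2_eq_square inner_vec_def sum_divide_distrib
          sum_distrib_left sum_distrib_right)
    have "0 \<le> (b *v \<xi>) \<bullet> \<xi>" for \<xi>
    proof -
      \<comment> \<open>This c minimises the form of \<open>a\<close> at \<xi> - c e_p; the minimum
        is the form of the Schur complement \<open>b\<close> at \<xi>.\<close>
      define c where "c = (a $ p \<bullet> \<xi>) / d"
      have r: "a *v axis p 1 = a $ p"
        using sym by (simp add: vec_eq_iff matrix_vector_mul_component inner_axis)
      have ap: "(a *v \<xi>) \<bullet> axis p 1 = a $ p \<bullet> \<xi>"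
        by (simp add: inner_axis matrix_vector_mul_component)
      have "(a *v (\<xi> - c *\<^sub>R axis p 1)) \<bullet> (\<xi> - c *\<^sub>R axis p 1)
         = (a *v \<xi>) \<bullet> \<xi> - c * ((a *v \<xi>) \<bullet> axis p 1) - c * ((a *v axis p 1) \<bullet> \<xi>) + c * c * ((a *v axis p 1) \<bullet> axis p 1)"
        by (simp add: matrix_vector_mult_diff_distrib inner_diff_left inner_diff_right
              matrix_vector_mult_scaleR algebra_simps)
      also have "\<dots> = (a *v \<xi>) \<bullet> \<xi> - 2 * c * (a $ p \<bullet> \<xi>) + c * c * d"
        unfolding bilinear_axis ap by (simp add: r d_def)
      also have "\<dots> = (a *v \<xi>) \<bullet> \<xi> - (a $ p \<bullet> \<xi>)\<^sup>2 / d"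
        using d by (simp add: c_def power2_eq_square field_simps)
      finally show ?thesis using nn quad by metis
    qed
    moreover have "transpose b = b"
      using sym by (simp add: vec_eq_iff transpose_def b_def mult.commute)
    ultimately have "sym_nonneg_matrix b" unfolding sym_nonneg_matrix_def by blast
    moreover have "b $ i $ j = 0" if "i \<notin> P" for i j
    proof (cases "i = p")
      case True then show ?thesis using d by (simp add: b_def d_def)
    next
      case False
      then have "a $ i $ j = 0" "a $ i $ p = 0" using insert.prems(2) that by auto
      then show ?thesis using sym by (simp add: b_def)
    qed
    ultimately obtain \<sigma> where \<sigma>: "\<forall>q. q \<notin> P \<longrightarrow> \<sigma> q = 0"
       "\<And>i j. b $ i $ j = (\<Sum>p\<in>UNIV. \<sigma> p $ i * \<sigma> p $ j)"
      using insert.IH[of b] by blast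
    define \<tau> where "\<tau> = \<sigma>(p := (1 / sqrt d) *\<^sub>R a $ p)"
    have "a $ i $ j = (\<Sum>q\<in>UNIV. \<tau> q $ i * \<tau> q $ j)" for i j
    proof -
      have "(\<Sum>q\<in>UNIV. \<tau> q $ i * \<tau> q $ j) = \<tau> p $ i * \<tau> p $ j + (\<Sum>q\<in>UNIV - {p}. \<tau> q $ i * \<tau> q $ j)"
        by (simp add: sum.remove)
      also have "(\<Sum>q\<in>UNIV - {p}. \<tau> q $ i * \<tau> q $ j) = (\<Sum>q\<in>UNIV - {p}. \<sigma> q $ i * \<sigma> q $ j)"
        by (intro sum.cong) (auto simp: \<tau>_def)
      also have "\<dots> = b $ i $ j"
        using \<sigma>(1) insert.hyps(2) by (simp add: \<sigma>(2) sum.remove[of UNIV p])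
      also have "\<tau> p $ i * \<tau> p $ j = a $ p $ i * a $ p $ j / d"
        using d by (simp add: \<tau>_def)
      finally show ?thesis by (simp add: b_def)
    qed
    moreover have "\<forall>q. q \<notin> insert p P \<longrightarrow> \<tau> q = 0" using \<sigma>(1) by (auto simp: \<tau>_def)
    ultimately show ?thesis by blast
  qed
qed

text \<open>The columns of some matrix \<sigma> with a = \<sigma> \<sigma>^T. No regularity in
  \<open>a\<close> is claimed; only products summed over the columns enter later.\<close>

definition matrix_factor :: "real^'n^'n::finite \<Rightarrow> 'n \<Rightarrow> real^'n" where
  "matrix_factor a = (SOME \<sigma>. \<forall>i j. a $ i $ j = (\<Sum>p\<in>UNIV. \<sigma> p $ i * \<sigma> p $ j))"

lemma matrix_factor:
  fixes a :: "real^'n^'n::finite"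
  assumes "sym_nonneg_matrix a"
  shows "a $ i $ j = (\<Sum>p\<in>UNIV. matrix_factor a p $ i * matrix_factor a p $ j)"
proof -
  have "\<exists>\<sigma>::'n \<Rightarrow> real^'n. \<forall>i j. a $ i $ j = (\<Sum>p\<in>UNIV. \<sigma> p $ i * \<sigma> p $ j)"
    using psd_factor_supported[of UNIV a] assms by auto
  from someI_ex[OF this] show ?thesis unfolding matrix_factor_def by blast
qed

lemma trace_matrix_factor:
  fixes a :: "real^'n^'n::finite"
  assumes "sym_nonneg_matrix a"
  shows "trace a = (\<Sum>p\<in>UNIV. (norm (matrix_factor a p))\<^sup>2)"
proof -
  have "trace a = (\<Sum>i\<in>UNIV. \<Sum>p\<in>UNIV. matrix_factor a p $ i * matrix_factor a p $ i)"
    by (simp add: trace_def matrix_factor[OF assms, symmetric])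
  also have "\<dots> = (\<Sum>p\<in>UNIV. \<Sum>i\<in>UNIV. matrix_factor a p $ i * matrix_factor a p $ i)"
    by (rule sum.swap)
  finally show ?thesis by (simp add: power2_norm_eq_inner inner_vec_def)
qed

lemma trace_nonneg:
  fixes a :: "real^'n^'n::finite"
  assumes "sym_nonneg_matrix a"
  shows "0 \<le> trace a"
  unfolding trace_matrix_factor[OF assms] by (simp add: sum_nonneg)

lemma trace_mult_factor:
  fixes a :: "real^'n^'n::finite"
  assumes "sym_nonneg_matrix a"
  shows "trace (a ** H) = (\<Sum>p\<in>UNIV. (H *v matrix_factor a p) \<bullet> matrix_factor a p)"
proof -
  have sw: "(\<Sum>i\<in>UNIV. \<Sum>j\<in>UNIV. \<Sum>p\<in>UNIV. g i j p) = (\<Sum>p\<in>UNIV. \<Sum>j\<in>UNIV. \<Sum>i\<in>UNIV. g i j p)"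
    for g :: "'n \<Rightarrow> 'n \<Rightarrow> 'n \<Rightarrow> real"
  proof -
    have "(\<Sum>i\<in>UNIV. \<Sum>j\<in>UNIV. \<Sum>p\<in>UNIV. g i j p) = (\<Sum>i\<in>UNIV. \<Sum>p\<in>UNIV. \<Sum>j\<in>UNIV. g i j p)"
      by (intro sum.cong refl sum.swap)
    also have "\<dots> = (\<Sum>p\<in>UNIV. \<Sum>i\<in>UNIV. \<Sum>j\<in>UNIV. g i j p)" by (rule sum.swap)
    also have "\<dots> = (\<Sum>p\<in>UNIV. \<Sum>j\<in>UNIV. \<Sum>i\<in>UNIV. g i j p)"
      by (intro sum.cong refl sum.swap)
    finally show ?thesis .
  qed
  have "trace (a ** H) = (\<Sum>i\<in>UNIV. \<Sum>j\<in>UNIV. \<Sum>p\<in>UNIV. matrix_factor a p $ i * matrix_factor a p $ j * H $ j $ i)"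
    by (simp add: trace_def matrix_matrix_mult_def matrix_factor[OF assms, symmetric] sum_distrib_right[symmetric])
  also have "\<dots> = (\<Sum>p\<in>UNIV. \<Sum>j\<in>UNIV. \<Sum>i\<in>UNIV. matrix_factor a p $ i * matrix_factor a p $ j * H $ j $ i)"
    by (rule sw)
  also have "\<dots> = (\<Sum>p\<in>UNIV. (H *v matrix_factor a p) \<bullet> matrix_factor a p)"
    unfolding quadratic_form_sum by (intro sum.cong refl) (simp add: algebra_simps)
  finally show ?thesis .
qed

text \<open>With a = \<sigma> \<sigma>^T the trace is a sum of values of the quadratic form of H at
  the columns of \<sigma>, so a one-sided bound on this form is enough.\<close>

lemma trace_mult_le:
  fixes a :: "real^'n^'n::finite"
  assumes "sym_nonneg_matrix a" "\<And>v. (H *v v) \<bullet> v \<le> c * (norm v)\<^sup>2"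
  shows "trace (a ** H) \<le> c * trace a"
  unfolding trace_mult_factor[OF assms(1)] trace_matrix_factor[OF assms(1)] sum_distrib_left
  by (intro sum_mono assms(2))

section \<open>Real induction and functions with controlled one-sided growth\<close>

text \<open>Real induction: the supremum of the times up to which P holds is itself such a time by
  \<open>left\<close>, and \<open>right\<close> would push it further if it were smaller than
  b.\<close>

lemma real_right_induction:
  fixes a b :: real
  assumes ab: "a \<le> b"
    and left: "\<And>\<tau>. a < \<tau> \<Longrightarrow> \<tau> \<le> b \<Longrightarrow> (\<And>t. a \<le> t \<Longrightarrow> t < \<tau> \<Longrightarrow> P t) \<Longrightarrow> P \<tau>"
    and base: "P a"
    and right: "\<And>s. a \<le> s \<Longrightarrow> s < b \<Longrightarrow> (\<And>t. a \<le> t \<Longrightarrow> t \<le> s \<Longrightarrow> P t) \<Longrightarrow>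
       \<exists>\<gamma>>0. \<forall>t. s < t \<and> t < s + \<gamma> \<and> t \<le> b \<longrightarrow> P t"
  shows "P b"
proof -
  define X where "X = {s. a \<le> s \<and> s \<le> b \<and> (\<forall>t. a \<le> t \<and> t \<le> s \<longrightarrow> P t)}"
  define \<tau> where "\<tau> = Sup X"
  have aX: "a \<in> X" unfolding X_def using ab base by auto
  have bdd: "bdd_above X" unfolding X_def by (intro bdd_aboveI[of _ b]) auto
  have a\<tau>: "a \<le> \<tau>" unfolding \<tau>_def by (rule cSup_upper[OF aX bdd])
  have \<tau>b: "\<tau> \<le> b" unfolding \<tau>_def using aX by (intro cSup_least) (auto simp: X_def)
  have below: "P t" if "a \<le> t" "t < \<tau>" for t
    using that less_cSupE[of t X] aX unfolding \<tau>_def X_def by force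
  have P\<tau>: "P \<tau>"
    using left[of \<tau>] below base a\<tau> \<tau>b by (cases "a = \<tau>") auto
  have all: "P t" if "a \<le> t" "t \<le> \<tau>" for t
    using below P\<tau> that by (cases "t = \<tau>") auto
  show ?thesis
  proof (cases "\<tau> = b")
    case True then show ?thesis using P\<tau> by simp
  next
    case False
    then have "\<tau> < b" using \<tau>b by simp
    from right[OF a\<tau> this all] obtain \<gamma> where \<gamma>: "\<gamma> > 0" "\<And>t. \<tau> < t \<and> t < \<tau> + \<gamma> \<and> t \<le> b \<Longrightarrow> P t" by auto
    define s where "s = min b (\<tau> + \<gamma>/2)"
    have s: "\<tau> < s" "s < \<tau> + \<gamma>" "s \<le> b" using \<open>\<tau> < b\<close> \<gamma>(1) by (auto simp: s_def)
    have "s \<in> X" unfolding X_def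
      using a\<tau> s all \<gamma>(2) by (auto) (meson le_less_trans not_le order_less_imp_le)
    then have "s \<le> \<tau>" unfolding \<tau>_def by (rule cSup_upper[OF _ bdd])
    then show ?thesis using s by simp
  qed
qed

text \<open>Infinitesimal growth to the right of every point is paid for by the part of a neighbourhood
  that lies outside one of the sets \<open>E k\<close>. Enclosing each \<open>E k\<close> in an open set of almost the same
  measure makes the total cost arbitrarily small, so no density theorem is needed.\<close>

lemma nonincreasing_up_to_small_sets:
  fixes M :: "real \<Rightarrow> real" and E :: "nat \<Rightarrow> real set"
  assumes ab: "a \<le> b" and cont: "continuous_on {a..b} M"
    and E: "\<And>k. E k \<in> sets lebesgue" and C: "C \<ge> 0"
    and step: "\<And>s. a \<le> s \<Longrightarrow> s < b \<Longrightarrow> \<exists>k \<gamma>. s \<in> E k \<and> \<gamma> > 0 \<and>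
      (\<forall>t. s < t \<and> t < s + \<gamma> \<and> t \<le> b \<longrightarrow> M t - M s \<le> C * measure lebesgue ({s..t} - E k))"
  shows "M b \<le> M a"
proof (rule field_le_epsilon)
  fix e :: real assume e: "e > 0"
  \<comment> \<open>C + 1 instead of C keeps the quotient meaningful for C = 0.\<close>
  define \<epsilon> where "\<epsilon> = e / (C + 1)"
  have \<epsilon>: "\<epsilon> > 0" using e C by (simp add: \<epsilon>_def)
  \<comment> \<open>The excess measures of the open enclosures sum to at most \<epsilon>, however
    many of the sets are used.\<close>
  have "\<exists>U. open U \<and> E k \<subseteq> U \<and> U - E k \<in> lmeasurable \<and> emeasure lebesgue (U - E k) < ennreal (\<epsilon> / 2 * (1/2)^k)" for k
  proof -
    have "0 < \<epsilon> / 2 * (1/2)^k" using \<epsilon> by simp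
    from sets_lebesgue_outer_open[OF E[of k] this] show ?thesis by metis
  qed
  then obtain U where U: "\<And>k. open (U k)" "\<And>k. E k \<subseteq> U k" "\<And>k. U k - E k \<in> lmeasurable"
     "\<And>k. emeasure lebesgue (U k - E k) < ennreal (\<epsilon> / 2 * (1/2)^k)" by metis
  define W where "W k = U k - E k" for k
  have Wm: "W k \<in> lmeasurable" for k using U(3) by (simp add: W_def)
  have Wle: "measure lebesgue (W k) \<le> \<epsilon> / 2 * (1/2)^k" for k
  proof -
    have "ennreal (measure lebesgue (W k)) \<le> ennreal (\<epsilon> / 2 * (1/2)^k)"
      using U(4)[of k] emeasure_eq_measure2[OF Wm[of k]] by (simp add: W_def)
    then show ?thesis using \<epsilon> by (subst (asm) ennreal_le_iff) auto
  qed
  define g where "g t k = measure lebesgue ({a..t} \<inter> W k)" for t k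
  have gm: "{x..y} \<inter> W k \<in> lmeasurable" for x y k
    using fmeasurable_Int_fmeasurable[OF lmeasurable_cbox fmeasurableD[OF Wm], of x y k] by simp
  have gle: "g t k \<le> \<epsilon> / 2 * (1/2)^k" for t k
  proof -
    have "g t k \<le> measure lebesgue (W k)" unfolding g_def
      using Wm gm by (intro measure_mono_fmeasurable) (auto intro: fmeasurableD)
    then show ?thesis using Wle[of k] by simp
  qed
  have g0: "0 \<le> g t k" for t k by (simp add: g_def)
  have geo: "(\<lambda>k. \<epsilon> / 2 * (1/2)^k) sums (\<epsilon> / 2 * (1 / (1 - 1/2)))"
    by (intro sums_mult geometric_sums) simp
  have summ: "summable (g t)" for t
    by (rule summable_comparison_test'[OF sums_summable[OF geo], of 0]) (use gle g0 in auto)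
  \<comment> \<open>\<open>G t\<close> is the total excess met up to time t. It is nondecreasing and
    bounded by \<epsilon>, and its increment over an interval inside \<open>U k\<close> pays for the
    part of that interval outside \<open>E k\<close>.\<close>
  define G where "G t = suminf (g t)" for t
  have G\<epsilon>: "G t \<le> \<epsilon>" for t
  proof -
    have "G t \<le> (\<Sum>k. \<epsilon> / 2 * (1/2)^k)"
      unfolding G_def by (intro suminf_le summ sums_summable[OF geo] gle)
    also have "\<dots> = \<epsilon>" using sums_unique[OF geo] by simp
    finally show ?thesis .
  qed
  have G0: "0 \<le> G t" for t unfolding G_def by (intro suminf_nonneg summ g0)
  have gmono: "g s k \<le> g t k" if "s \<le> t" for s t k
    unfolding g_def using that gm by (intro measure_mono_fmeasurable) (auto intro: fmeasurableD)
  have Gmono: "G s \<le> G t" if "s \<le> t" for s t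
    unfolding G_def by (intro suminf_le gmono summ that)
  have Gstep: "measure lebesgue ({s..t} \<inter> W k) \<le> G t - G s" if "a \<le> s" "s \<le> t" for s t k
  proof -
    have eq: "{a..t} \<inter> W k = ({a..s} \<inter> W k) \<union> ({s..t} \<inter> W k)" using that by auto
    have "measure lebesgue (({a..s} \<inter> W k) \<inter> ({s..t} \<inter> W k)) \<le> measure lebesgue {s}"
      using that gm lmeasurable_cbox[of s s] by (intro measure_mono_fmeasurable) (auto intro: fmeasurableD)
    then have z: "measure lebesgue (({a..s} \<inter> W k) \<inter> ({s..t} \<inter> W k)) = 0"
      by (simp add: measure_le_0_iff)
    have "g t k = g s k + measure lebesgue ({s..t} \<inter> W k)"
      unfolding g_def eq using measure_Un3[OF gm gm, of a s k s t k] z by simp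
    moreover have "g t k - g s k \<le> G t - G s"
    proof -
      have "G t - G s = (\<Sum>k. g t k - g s k)" unfolding G_def by (rule suminf_diff[OF summ summ])
      also have "\<dots> \<ge> sum (\<lambda>k. g t k - g s k) {k}"
        by (intro sum_le_suminf summable_diff summ) (use gmono[OF that(2)] in auto)
      finally show ?thesis by simp
    qed
    ultimately show ?thesis by simp
  qed
  \<comment> \<open>The compensated function never exceeds its initial value. Limits from the left
    use the monotonicity of \<open>G\<close>; to the right of s, a neighbourhood inside
    \<open>U k\<close> turns the assumed growth bound into an increment of \<open>G\<close>.\<close>
  have "M b - C * G b \<le> M a - C * G a"
  proof (rule real_right_induction[where P = "\<lambda>t. M t - C * G t \<le> M a - C * G a" and a = a and b = b])
    show "M \<tau> - C * G \<tau> \<le> M a - C * G a"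
      if \<tau>: "a < \<tau>" "\<tau> \<le> b" and below: "\<And>t. a \<le> t \<Longrightarrow> t < \<tau> \<Longrightarrow> M t - C * G t \<le> M a - C * G a" for \<tau>
    proof -
      have "(M \<longlongrightarrow> M \<tau>) (at \<tau> within {a..\<tau>})"
        using cont \<tau> unfolding continuous_on_def by (meson atLeastAtMost_iff atLeastatMost_subset_iff less_imp_le order_refl tendsto_within_subset)
      then have "(M \<longlongrightarrow> M \<tau>) (at_left \<tau>)"
        using \<tau>(1) by (simp add: at_within_Icc_at_left)
      moreover have "eventually (\<lambda>t. M t \<le> C * G \<tau> + (M a - C * G a)) (at_left \<tau>)"
        unfolding eventually_at_left_field
      proof (intro exI[of _ a] conjI allI impI \<tau>(1))
        fix t assume "a < t" "t < \<tau>"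
        then have "M t \<le> C * G t + (M a - C * G a)" using below[of t] by simp
        also have "C * G t \<le> C * G \<tau>" using Gmono[of t \<tau>] \<open>t < \<tau>\<close> C by (intro mult_left_mono) auto
        finally show "M t \<le> C * G \<tau> + (M a - C * G a)" by simp
      qed
      ultimately have "M \<tau> \<le> C * G \<tau> + (M a - C * G a)"
        by (intro tendsto_upperbound[of M "M \<tau>" "at_left \<tau>"]) auto
      then show ?thesis by simp
    qed
    show "\<exists>\<gamma>>0. \<forall>t. s < t \<and> t < s + \<gamma> \<and> t \<le> b \<longrightarrow> M t - C * G t \<le> M a - C * G a"
      if s: "a \<le> s" "s < b" and below: "\<And>t. a \<le> t \<Longrightarrow> t \<le> s \<Longrightarrow> M t - C * G t \<le> M a - C * G a" for s
    proof -
      obtain k \<gamma> where k: "s \<in> E k" "\<gamma> > 0"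
        "\<And>t. s < t \<and> t < s + \<gamma> \<and> t \<le> b \<Longrightarrow> M t - M s \<le> C * measure lebesgue ({s..t} - E k)"
        using step[OF s] by blast
      obtain \<rho> where \<rho>: "\<rho> > 0" "ball s \<rho> \<subseteq> U k"
        using U(1)[of k] U(2)[of k] k(1) by (meson openE subsetD)
      have "M t - C * G t \<le> M a - C * G a" if t: "s < t" "t < s + min \<gamma> \<rho>" "t \<le> b" for t
      proof -
        have "{s..t} \<subseteq> ball s \<rho>" using t by (auto simp: dist_real_def)
        then have "{s..t} - E k = {s..t} \<inter> W k" using \<rho>(2) by (auto simp: W_def)
        then have "M t - M s \<le> C * measure lebesgue ({s..t} \<inter> W k)" using k(3)[of t] t by simp
        also have "\<dots> \<le> C * (G t - G s)" using Gstep[of s t k] s t C by (intro mult_left_mono) auto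
        finally show ?thesis using below[of s] s by (simp add: algebra_simps)
      qed
      then show ?thesis using k(2) \<rho>(1) by (intro exI[of _ "min \<gamma> \<rho>"]) auto
    qed
  qed (use ab in auto)
  then have "M b \<le> M a + C * (G b - G a)" by (simp add: algebra_simps)
  also have "C * (G b - G a) \<le> C * \<epsilon>" using G\<epsilon>[of b] G0[of a] C by (intro mult_left_mono) auto
  also have "C * \<epsilon> \<le> e" using C e by (simp add: \<epsilon>_def field_simps)
  finally show "M b \<le> M a + e" by simp
qed

section \<open>Functions with continuous partial derivatives\<close>

lemma coordinate_sum_norm_le:
  fixes v :: "real^'n::finite"
  assumes "\<And>p. \<bar>c p\<bar> \<le> \<bar>v $ p\<bar>"
  shows "norm (\<Sum>p\<in>P. c p *\<^sub>R axis p (1::real)) \<le> norm v"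
proof (rule norm_le_componentwise_cart)
  fix i
  have "(\<Sum>p\<in>P. c p *\<^sub>R axis p (1::real)) $ i = (\<Sum>p\<in>P. if p = i then c p else 0)"
    unfolding sum_component by (intro sum.cong) (auto simp: axis_def)
  also have "\<dots> = (if i \<in> P then c i else 0)" by (simp add: sum.delta)
  finally show "norm ((\<Sum>p\<in>P. c p *\<^sub>R axis p (1::real)) $ i) \<le> norm (v $ i)"
    using assms[of i] by simp
qed

text \<open>The increment is taken one coordinate at a time. Every intermediate point differs from x
  by a vector whose coordinates are at most those of v, so it stays in the ball where the partial
  derivatives are controlled.\<close>

lemma partial_derivatives_taylor1:
  fixes g :: "real^'n::finite \<Rightarrow> real"
  assumes d: "\<And>y p. ((\<lambda>h. g (y + h *\<^sub>R axis p 1)) has_real_derivative d p y) (at 0)"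
    and B: "\<And>y p. norm (y - x) \<le> norm v \<Longrightarrow> \<bar>d p y - d p x\<bar> \<le> B"
  shows "\<bar>g (x + v) - g x - (\<Sum>p\<in>UNIV. v $ p * d p x)\<bar> \<le> B * (\<Sum>p\<in>UNIV. \<bar>v $ p\<bar>)"
proof -
  have d': "((\<lambda>h. g (y + h *\<^sub>R axis p 1)) has_real_derivative d p (y + h *\<^sub>R axis p 1)) (at h)" for y p h
  proof -
    have "((\<lambda>k. g (y + h *\<^sub>R axis p 1 + k *\<^sub>R axis p 1)) has_real_derivative d p (y + h *\<^sub>R axis p 1)) (at (h - h))"
      using d by simp
    from DERIV_at_within_shift[where z = "-h", of "\<lambda>h. g (y + h *\<^sub>R axis p 1)"] this show ?thesis
      using DERIV_shift[of "\<lambda>k. g (y + k *\<^sub>R axis p 1)" "d p (y + h *\<^sub>R axis p 1)" 0 h]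
      by (simp add: algebra_simps)
  qed
  have "\<bar>g (x + (\<Sum>p\<in>P. v $ p *\<^sub>R axis p 1)) - g x - (\<Sum>p\<in>P. v $ p * d p x)\<bar> \<le> B * (\<Sum>p\<in>P. \<bar>v $ p\<bar>)" for P
    using finite[of P]
  proof (induction P rule: finite_induct)
    case empty then show ?case by simp
  next
    case (insert p P)
    define y where "y = x + (\<Sum>p\<in>P. v $ p *\<^sub>R axis p 1)"
    define f where "f h = g (y + h *\<^sub>R axis p 1) - h * d p x" for h
    have "norm (f (v $ p) - f 0) \<le> B * norm (v $ p - 0)"
    proof (rule field_differentiable_bound[of "{- \<bar>v $ p\<bar>..\<bar>v $ p\<bar>}" f "\<lambda>h. d p (y + h *\<^sub>R axis p 1) - d p x"])
      show "(f has_field_derivative d p (y + h *\<^sub>R axis p 1) - d p x) (at h within {- \<bar>v $ p\<bar>..\<bar>v $ p\<bar>})" for h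
        unfolding f_def by (rule has_field_derivative_at_within) (auto intro!: derivative_eq_intros d')
      show "norm (d p (y + h *\<^sub>R axis p 1) - d p x) \<le> B" if "h \<in> {- \<bar>v $ p\<bar>..\<bar>v $ p\<bar>}" for h
      proof -
        have "y + h *\<^sub>R axis p 1 - x = (\<Sum>q\<in>insert p P. (if q = p then h else v $ q) *\<^sub>R axis q 1)"
          unfolding y_def using insert.hyps by (simp add: sum.insert) (intro sum.cong, auto)
        also have "norm \<dots> \<le> norm v" using that by (intro coordinate_sum_norm_le) auto
        finally show ?thesis using B by simp
      qed
    qed auto
    then have 1: "\<bar>g (y + v $ p *\<^sub>R axis p 1) - g y - v $ p * d p x\<bar> \<le> B * \<bar>v $ p\<bar>"
      by (simp add: f_def algebra_simps)
    have "x + (\<Sum>q\<in>insert p P. v $ q *\<^sub>R axis q 1) = y + v $ p *\<^sub>R axis p 1"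
      using insert.hyps by (simp add: y_def algebra_simps)
    then show ?case using 1 insert by (simp add: y_def algebra_simps)
  qed
  from this[of UNIV] show ?thesis
    using basis_expansion[of v] by (simp add: scalar_mult_eq_scaleR)
qed

lemma sum_abs_le_norm:
  fixes v :: "real^'n::finite"
  shows "(\<Sum>p\<in>UNIV. \<bar>v $ p\<bar>) \<le> real CARD('n) * norm v"
  using sum_bounded_above[of UNIV "\<lambda>p. \<bar>v $ p\<bar>" "norm v"] component_le_norm_cart[of v] by simp

text \<open>Bridges \<open>Cn_on\<close>, which speaks of partial derivatives along the axes, to
  derivatives along arbitrary lines.\<close>

lemma has_derivative_of_continuous_partials:
  fixes g :: "real^'n::finite \<Rightarrow> real"
  assumes d: "\<And>y p. ((\<lambda>h. g (y + h *\<^sub>R axis p 1)) has_real_derivative d p y) (at 0)"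
    and cont: "\<And>p. continuous_on UNIV (d p)"
  shows "(g has_derivative (\<lambda>v. \<Sum>p\<in>UNIV. v $ p * d p x)) (at x)"
  unfolding has_derivative_at_alt
proof (intro conjI allI impI)
  show "bounded_linear (\<lambda>v. \<Sum>p\<in>UNIV. v $ p * d p x)"
    by (intro bounded_linear_sum bounded_linear_mult_const bounded_linear_vec_nth)
  fix e :: real assume e: "e > 0"
  define e' where "e' = e / real CARD('n)"
  have e': "e' > 0" using e by (simp add: e'_def)
  have "\<forall>p. \<exists>\<delta>>0. \<forall>y. norm (y - x) < \<delta> \<longrightarrow> \<bar>d p y - d p x\<bar> < e'"
    using cont e' unfolding continuous_on_iff by (metis UNIV_I dist_norm real_norm_def)
  then obtain \<delta> where \<delta>: "\<And>p. \<delta> p > 0" "\<And>p y. norm (y - x) < \<delta> p \<Longrightarrow> \<bar>d p y - d p x\<bar> < e'" by metis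
  have "Min (range \<delta>) > 0" using \<delta>(1) by (simp add: Min_gr_iff)
  moreover have "norm (g y - g x - (\<Sum>p\<in>UNIV. (y - x) $ p * d p x)) \<le> e * norm (y - x)"
    if "norm (y - x) < Min (range \<delta>)" for y
  proof -
    have lt: "norm (y - x) < \<delta> p" for p using that by (simp add: Min_gr_iff)
    have "\<bar>g (x + (y - x)) - g x - (\<Sum>p\<in>UNIV. (y - x) $ p * d p x)\<bar> \<le> e' * (\<Sum>p\<in>UNIV. \<bar>(y - x) $ p\<bar>)"
    proof (rule partial_derivatives_taylor1[OF d])
      fix y' p assume "norm (y' - x) \<le> norm (y - x)"
      then show "\<bar>d p y' - d p x\<bar> \<le> e'" using \<delta>(2)[of y' p] lt[of p] by simp
    qed
    also have "\<dots> \<le> e' * (real CARD('n) * norm (y - x))"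
      using e' sum_abs_le_norm[of "y - x"] by (intro mult_left_mono) auto
    also have "\<dots> = e * norm (y - x)" by (simp add: e'_def)
    finally show ?thesis by simp
  qed
  ultimately show "\<exists>d'>0. \<forall>y. norm (y - x) < d' \<longrightarrow> norm (g y - g x - (\<Sum>p\<in>UNIV. (y - x) $ p * d p x)) \<le> e * norm (y - x)"
    by blast
qed

lemma has_real_derivative_along_line:
  fixes g :: "real^'n::finite \<Rightarrow> real"
  assumes "(g has_derivative D) (at (x + r *\<^sub>R v))"
  shows "((\<lambda>r. g (x + r *\<^sub>R v)) has_real_derivative D v) (at r)"
proof -
  have "((\<lambda>r. x + r *\<^sub>R v) has_derivative (\<lambda>h. h *\<^sub>R v)) (at r)"
    by (auto intro!: derivative_eq_intros)
  from has_derivative_compose[OF this assms] have "((\<lambda>r. g (x + r *\<^sub>R v)) has_derivative (\<lambda>h. D (h *\<^sub>R v))) (at r)" .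
  moreover have "(\<lambda>h. D (h *\<^sub>R v)) = (*) (D v)"
    using linear_scale[OF has_derivative_linear[OF assms]] by (simp add: fun_eq_iff mult.commute)
  ultimately show ?thesis by (simp add: has_field_derivative_def)
qed

section \<open>Families of directional derivatives\<close>

definition norm_prod :: "'a::real_normed_vector list \<Rightarrow> real" where
  "norm_prod vs = prod_list (map norm vs)"

lemma norm_prod_simps [simp]:
  "norm_prod [] = 1" "norm_prod (v # vs) = norm v * norm_prod vs"
  by (simp_all add: norm_prod_def)

lemma norm_prod_append [simp]: "norm_prod (us @ vs) = norm_prod us * norm_prod vs"
  by (simp add: norm_prod_def)

lemma norm_prod_nonneg: "0 \<le> norm_prod vs"
  by (induction vs) auto

lemma norm_prod_replicate: "norm_prod (replicate m v) = norm v ^ m"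
  by (induction m) auto

text \<open>\<open>G [v\<^sub>1, \<dots>, v\<^sub>k]\<close> stands for the \<open>k\<close>-th derivative of \<open>G []\<close> in the directions
  \<open>v\<^sub>1, \<dots>, v\<^sub>k\<close>. Differentiability is encoded by a second-order Taylor bound, an inequality that
  is inherited by averages, pointwise limits and integrals.\<close>

definition jet :: "(nat \<Rightarrow> real) \<Rightarrow> ('a::euclidean_space list \<Rightarrow> 'a \<Rightarrow> real) \<Rightarrow> bool" where
  "jet M G \<longleftrightarrow>
     (\<forall>vs x. \<bar>G vs x\<bar> \<le> M (length vs) * norm_prod vs) \<and>
     (\<forall>vs x v. \<bar>G vs (x + v) - G vs x - G (v # vs) x\<bar> \<le> M (length vs + 2) * norm_prod vs * (norm v)\<^sup>2) \<and>
     (\<forall>us vs x. linear (\<lambda>v. G (us @ v # vs) x))"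

lemma jetI:
  assumes "\<And>vs x. \<bar>G vs x\<bar> \<le> M (length vs) * norm_prod vs"
    and "\<And>vs x v. \<bar>G vs (x + v) - G vs x - G (v # vs) x\<bar> \<le> M (length vs + 2) * norm_prod vs * (norm v)\<^sup>2"
    and "\<And>us v v' vs x. G (us @ (v + v') # vs) x = G (us @ v # vs) x + G (us @ v' # vs) x"
    and "\<And>us c v vs x. G (us @ (c *\<^sub>R v) # vs) x = c * G (us @ v # vs) x"
  shows "jet M G"
  unfolding jet_def using assms by (auto intro!: linearI)

lemma jet_bound: "jet M G \<Longrightarrow> \<bar>G vs x\<bar> \<le> M (length vs) * norm_prod vs"
  and jet_taylor1: "jet M G \<Longrightarrow> \<bar>G vs (x + v) - G vs x - G (v # vs) x\<bar> \<le> M (length vs + 2) * norm_prod vs * (norm v)\<^sup>2"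
  and jet_linear: "jet M G \<Longrightarrow> linear (\<lambda>v. G (us @ v # vs) x)"
  by (simp_all add: jet_def)

lemma jet_add: "jet M G \<Longrightarrow> G (us @ (v + v') # vs) x = G (us @ v # vs) x + G (us @ v' # vs) x"
  and jet_scale: "jet M G \<Longrightarrow> G (us @ (c *\<^sub>R v) # vs) x = c * G (us @ v # vs) x"
  using linear_add[OF jet_linear] linear_scale[OF jet_linear] by fastforce+

lemma jet_scale_head: "jet M G \<Longrightarrow> G ((c *\<^sub>R v) # vs) x = c * G (v # vs) x"
  using jet_scale[of M G "[]"] by simp

text \<open>Evaluation on k copies of a unit vector, for which \<open>norm_prod\<close> is
  1.\<close>

lemma jet_nonneg: "jet M G \<Longrightarrow> 0 \<le> M k"
proof -
  assume "jet M G"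
  then have "0 \<le> M (length (replicate k (SOME b::'a. b \<in> Basis))) * norm_prod (replicate k (SOME b::'a. b \<in> Basis))"
    using jet_bound[of M G "replicate k (SOME b::'a. b \<in> Basis)"] abs_ge_zero order_trans by blast
  then show ?thesis by (simp add: norm_prod_replicate norm_some_Basis)
qed

lemma has_real_derivative_quadratic_error:
  fixes f :: "real \<Rightarrow> real"
  assumes "\<And>h. \<bar>f (r + h) - f r - h * d\<bar> \<le> C * h\<^sup>2"
  shows "(f has_real_derivative d) (at r)"
  unfolding DERIV_def
proof (rule Lim_null[THEN iffD2], rule tendsto_rabs_zero_cancel, rule tendsto_sandwich)
  show "eventually (\<lambda>h. 0 \<le> \<bar>(f (r + h) - f r) / h - d\<bar>) (at 0)" by simp
  show "eventually (\<lambda>h. \<bar>(f (r + h) - f r) / h - d\<bar> \<le> C * \<bar>h\<bar>) (at 0)"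
    unfolding eventually_at_filter
  proof (rule always_eventually, intro allI impI)
    fix h :: real assume "h \<noteq> 0"
    then have "\<bar>(f (r + h) - f r) / h - d\<bar> = \<bar>f (r + h) - f r - h * d\<bar> / \<bar>h\<bar>"
      by (simp add: abs_divide[symmetric] diff_divide_distrib)
    also have "\<dots> \<le> C * h\<^sup>2 / \<bar>h\<bar>" using assms by (intro divide_right_mono) auto
    also have "\<dots> = C * \<bar>h\<bar>" using \<open>h \<noteq> 0\<close> by (simp add: power2_eq_square abs_if)
    finally show "\<bar>(f (r + h) - f r) / h - d\<bar> \<le> C * \<bar>h\<bar>" .
  qed
  show "((\<lambda>h. C * \<bar>h\<bar>) \<longlongrightarrow> 0) (at 0)"
    by (rule tendsto_eq_intros | simp)+
qed simp

lemma jet_derivative: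
  assumes "jet M G"
  shows "((\<lambda>r. G vs (x + r *\<^sub>R v)) has_real_derivative G (v # vs) (x + r *\<^sub>R v)) (at r)"
proof (rule has_real_derivative_quadratic_error[where C = "M (length vs + 2) * norm_prod vs * (norm v)\<^sup>2"])
  fix h :: real
  show "\<bar>G vs (x + (r + h) *\<^sub>R v) - G vs (x + r *\<^sub>R v) - h * G (v # vs) (x + r *\<^sub>R v)\<bar>
      \<le> M (length vs + 2) * norm_prod vs * (norm v)\<^sup>2 * h\<^sup>2"
    using jet_taylor1[OF assms, of vs "x + r *\<^sub>R v" "h *\<^sub>R v"]
    by (simp add: jet_scale_head[OF assms] power_mult_distrib algebra_simps)
qed

lemma jet_lipschitz:
  assumes "jet M G"
  shows "\<bar>G vs y - G vs x\<bar> \<le> M (length vs + 1) * norm_prod vs * norm (y - x)"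
proof -
  define f where "f r = G vs (x + r *\<^sub>R (y - x))" for r
  have "norm (f 1 - f 0) \<le> M (length vs + 1) * norm_prod vs * norm (y - x) * norm (1 - 0 :: real)"
  proof (rule field_differentiable_bound[of UNIV f "\<lambda>r. G ((y - x) # vs) (x + r *\<^sub>R (y - x))"])
    show "(f has_field_derivative G ((y - x) # vs) (x + r *\<^sub>R (y - x))) (at r within UNIV)" for r
      unfolding f_def by (simp add: jet_derivative[OF assms])
    show "norm (G ((y - x) # vs) (x + r *\<^sub>R (y - x))) \<le> M (length vs + 1) * norm_prod vs * norm (y - x)" for r
      using jet_bound[OF assms, of "(y - x) # vs"] by (simp add: mult_ac)
  qed auto
  then show ?thesis by (simp add: f_def)
qed

lemma jet_continuous: "jet M G \<Longrightarrow> continuous_on S (G vs)"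
proof (rule continuous_onI)
  fix x e assume *: "jet M G" "x \<in> S" "(e::real) > 0"
  define C where "C = M (length vs + 1) * norm_prod vs"
  have C: "C \<ge> 0" unfolding C_def by (intro mult_nonneg_nonneg jet_nonneg[OF *(1)] norm_prod_nonneg)
  show "\<exists>d>0. \<forall>x'\<in>S. dist x' x < d \<longrightarrow> dist (G vs x') (G vs x) \<le> e"
  proof (intro exI[of _ "e / (C + 1)"] conjI ballI impI)
    show "0 < e / (C + 1)" using * C by simp
    fix x' assume "dist x' x < e / (C + 1)"
    then have "(C + 1) * norm (x' - x) \<le> e" using C by (simp add: dist_norm field_simps)
    moreover have "C * norm (x' - x) \<le> (C + 1) * norm (x' - x)" by (intro mult_right_mono) auto
    ultimately show "dist (G vs x') (G vs x) \<le> e"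
      using jet_lipschitz[OF *(1), of vs x' x] by (simp add: dist_real_def C_def)
  qed
qed

lemma jet_mono: "jet M G \<Longrightarrow> (\<And>k. M k \<le> M' k) \<Longrightarrow> jet M' G"
  unfolding jet_def by (meson mult_right_mono norm_prod_nonneg order_trans zero_le_power2)

lemma jet_translate: "jet M G \<Longrightarrow> jet M (\<lambda>vs x. G vs (x + y))"
  using jet_taylor1[of M G _ "_ + y"] unfolding jet_def by (simp add: add_ac)

text \<open>The chain rule for a linear change of variables: each direction picks up one factor L,
  whence the powers of c.\<close>

lemma jet_compose_linear:
  fixes L :: "'a::euclidean_space \<Rightarrow> 'b::euclidean_space"
  assumes G: "jet M G" and L: "linear L" and c: "\<And>v. norm (L v) \<le> c * norm v" "c \<ge> 0"
  shows "jet (\<lambda>k. c ^ k * M k) (\<lambda>vs x. G (map L vs) (L x))"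
proof (rule jetI)
  have np: "norm_prod (map L vs) \<le> c ^ length vs * norm_prod vs" for vs
  proof (induction vs)
    case (Cons v vs)
    have "norm (L v) * norm_prod (map L vs) \<le> (c * norm v) * (c ^ length vs * norm_prod vs)"
      using Cons c by (intro mult_mono) (auto simp: norm_prod_nonneg)
    then show ?case by (simp add: mult_ac)
  qed simp
  fix vs :: "'a list" and x :: 'a
  have "\<bar>G (map L vs) (L x)\<bar> \<le> M (length vs) * norm_prod (map L vs)"
    using jet_bound[OF G, of "map L vs" "L x"] by simp
  also have "\<dots> \<le> M (length vs) * (c ^ length vs * norm_prod vs)"
    using np jet_nonneg[OF G] by (intro mult_left_mono) auto
  finally show "\<bar>G (map L vs) (L x)\<bar> \<le> c ^ length vs * M (length vs) * norm_prod vs"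
    by (simp add: mult_ac)
  fix v :: 'a
  have "\<bar>G (map L vs) (L x + L v) - G (map L vs) (L x) - G (L v # map L vs) (L x)\<bar>
      \<le> M (length vs + 2) * norm_prod (map L vs) * (norm (L v))\<^sup>2"
    using jet_taylor1[OF G, of "map L vs" "L x" "L v"] by simp
  also have "\<dots> \<le> M (length vs + 2) * (c ^ length vs * norm_prod vs) * (c * norm v)\<^sup>2"
    using np jet_nonneg[OF G] c norm_prod_nonneg by (intro mult_mono power_mono mult_nonneg_nonneg) (auto simp: norm_prod_nonneg)
  finally show "\<bar>G (map L vs) (L (x + v)) - G (map L vs) (L x) - G (map L (v # vs)) (L x)\<bar>
      \<le> c ^ (length vs + 2) * M (length vs + 2) * norm_prod vs * (norm v)\<^sup>2"
    by (simp add: linear_add[OF L] power_mult_distrib power_add power2_eq_square mult_ac)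
qed (simp_all add: linear_add[OF L] linear_scale[OF L] jet_add[OF G] jet_scale[OF G])

lemma jet_limit:
  assumes "\<And>n. jet M (G n)" and lim: "\<And>vs x. ((\<lambda>n. G n vs x) \<longlongrightarrow> H vs x) F" and "F \<noteq> bot"
  shows "jet M H"
proof (rule jetI)
  fix us vs :: "'b list" and x v v' :: 'b and c :: real
  show "\<bar>H vs x\<bar> \<le> M (length vs) * norm_prod vs"
    by (rule tendsto_upperbound[OF tendsto_rabs[OF lim] always_eventually assms(3)])
       (intro allI jet_bound[OF assms(1)])
  show "\<bar>H vs (x + v) - H vs x - H (v # vs) x\<bar> \<le> M (length vs + 2) * norm_prod vs * (norm v)\<^sup>2"
    by (rule tendsto_upperbound[OF tendsto_rabs[OF tendsto_diff[OF tendsto_diff[OF lim lim] lim]] always_eventually assms(3)])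
       (intro allI jet_taylor1[OF assms(1)])
  have "((\<lambda>n. G n (us @ (v + v') # vs) x) \<longlongrightarrow> H (us @ v # vs) x + H (us @ v' # vs) x) F"
    unfolding jet_add[OF assms(1)] by (intro tendsto_add lim)
  then show "H (us @ (v + v') # vs) x = H (us @ v # vs) x + H (us @ v' # vs) x"
    using lim tendsto_unique assms(3) by blast
  have "((\<lambda>n. G n (us @ (c *\<^sub>R v) # vs) x) \<longlongrightarrow> c * H (us @ v # vs) x) F"
    unfolding jet_scale[OF assms(1)] by (intro tendsto_mult_left lim)
  then show "H (us @ (c *\<^sub>R v) # vs) x = c * H (us @ v # vs) x"
    using lim tendsto_unique assms(3) by blast
qed

lemma jet_set_integral:
  fixes G :: "real \<Rightarrow> 'a::euclidean_space list \<Rightarrow> 'a \<Rightarrow> real"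
  assumes G: "\<And>s. s \<in> {a..b} \<Longrightarrow> jet M (G s)" and ab: "a \<le> b"
    and int: "\<And>vs x. set_integrable lborel {a..b} (\<lambda>s. G s vs x)"
  shows "jet (\<lambda>k. (b - a) * M k) (\<lambda>vs x. LBINT s:{a..b}. G s vs x)"
proof -
  have bd: "\<bar>LBINT s:{a..b}. g s\<bar> \<le> (b - a) * C"
    if g: "set_integrable lborel {a..b} g" and C: "\<And>s. s \<in> {a..b} \<Longrightarrow> \<bar>g s\<bar> \<le> C" for g C
  proof -
    have ci: "set_integrable lborel {a..b} (\<lambda>_. C)" by (rule borel_integrable_atLeastAtMost') simp
    have "\<bar>LBINT s:{a..b}. g s\<bar> \<le> (LBINT s:{a..b}. \<bar>g s\<bar>)"
      using set_integral_norm_bound[OF g] by simp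
    also have "\<dots> \<le> (LBINT s:{a..b}. C)" by (intro set_integral_mono set_integrable_abs g ci C)
    also have "\<dots> = (b - a) * C" using ab by (simp add: set_lebesgue_integral_def)
    finally show ?thesis .
  qed
  have "M k \<ge> 0" for k using jet_nonneg[OF G[of a]] ab by simp
  show ?thesis
  proof (rule jetI)
    fix us vs :: "'a list" and x v v' :: 'a and c :: real
    show "\<bar>LBINT s:{a..b}. G s vs x\<bar> \<le> (b - a) * M (length vs) * norm_prod vs"
      using bd[OF int jet_bound[OF G]] by (simp add: mult.assoc)
    have "(LBINT s:{a..b}. G s vs (x + v)) - (LBINT s:{a..b}. G s vs x) - (LBINT s:{a..b}. G s (v # vs) x)
        = (LBINT s:{a..b}. G s vs (x + v) - G s vs x - G s (v # vs) x)"
      by (simp add: set_integral_diff int)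
    also have "\<bar>\<dots>\<bar> \<le> (b - a) * (M (length vs + 2) * norm_prod vs * (norm v)\<^sup>2)"
      by (intro bd set_integral_diff int jet_taylor1[OF G])
    finally show "\<bar>(LBINT s:{a..b}. G s vs (x + v)) - (LBINT s:{a..b}. G s vs x) - (LBINT s:{a..b}. G s (v # vs) x)\<bar>
        \<le> (b - a) * M (length vs + 2) * norm_prod vs * (norm v)\<^sup>2" by (simp add: mult.assoc)
    have "(LBINT s:{a..b}. G s (us @ (v + v') # vs) x) = (LBINT s:{a..b}. G s (us @ v # vs) x + G s (us @ v' # vs) x)"
      by (intro set_lebesgue_integral_cong) (use jet_add[OF G] in auto)
    then show "(LBINT s:{a..b}. G s (us @ (v + v') # vs) x) = (LBINT s:{a..b}. G s (us @ v # vs) x) + (LBINT s:{a..b}. G s (us @ v' # vs) x)"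
      by (simp add: set_integral_add int)
    have "(LBINT s:{a..b}. G s (us @ (c *\<^sub>R v) # vs) x) = (LBINT s:{a..b}. c * G s (us @ v # vs) x)"
      by (intro set_lebesgue_integral_cong) (use jet_scale[OF G] in auto)
    then show "(LBINT s:{a..b}. G s (us @ (c *\<^sub>R v) # vs) x) = c * (LBINT s:{a..b}. G s (us @ v # vs) x)"
      by simp
  qed
qed

lemma jet_second_difference:
  assumes "jet M G"
  shows "\<bar>G vs (x + v) + G vs (x - v) - 2 * G vs x\<bar> \<le> 2 * M (length vs + 2) * norm_prod vs * (norm v)\<^sup>2"
  using jet_taylor1[OF assms, of vs x v] jet_taylor1[OF assms, of vs x "- v"]
    jet_scale_head[OF assms, of "-1" v vs x] by simp

text \<open>The sum of the values at x + r v and x - r v is even in r, so odd orders cancel and the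
  remainder is of order four; its constant 2/24 is rounded up to 1.\<close>

lemma jet_taylor4:
  assumes G: "jet M G"
  shows "\<bar>G vs (x + v) + G vs (x - v) - 2 * G vs x - G (v # v # vs) x\<bar>
      \<le> M (length vs + 4) * norm_prod vs * norm v ^ 4"
proof -
  \<comment> \<open>The sign (-1)^m makes \<open>diff m\<close> the m-th derivative in r of this
    even function.\<close>
  define diff where "diff m r = G (replicate m v @ vs) (x + r *\<^sub>R v) + (-1) ^ m * G (replicate m v @ vs) (x + (- r) *\<^sub>R v)" for m :: nat and r :: real
  have d: "(diff m has_real_derivative diff (Suc m) r) (at r)" for m r
  proof -
    have 1: "((\<lambda>r. G (replicate m v @ vs) (x + r *\<^sub>R v)) has_real_derivative G (replicate (Suc m) v @ vs) (x + r *\<^sub>R v)) (at r)" for r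
      using jet_derivative[OF G, of "replicate m v @ vs" x v r] by simp
    have "((\<lambda>r. G (replicate m v @ vs) (x + (- r) *\<^sub>R v)) has_real_derivative G (replicate (Suc m) v @ vs) (x + (- r) *\<^sub>R v) * (- 1)) (at r)"
      by (rule DERIV_chain2[OF 1]) (auto intro!: derivative_eq_intros)
    from DERIV_add[OF 1 DERIV_cmult[OF this, of "(-1)^m"]] show ?thesis
      unfolding diff_def by simp
  qed
  from Maclaurin2[of 1 diff "diff 0" 4] d obtain \<xi> where \<xi>: "0 < \<xi>" "\<xi> \<le> 1"
    "diff 0 1 = (\<Sum>m<4. diff m 0 / fact m * 1 ^ m) + diff 4 \<xi> / fact 4 * 1 ^ 4" by auto
  have "G vs (x + v) + G vs (x - v) = 2 * G vs x + G (v # v # vs) x + diff 4 \<xi> / 24"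
    using \<xi>(3) by (simp add: diff_def eval_nat_numeral fact_numeral)
  moreover have "\<bar>diff 4 \<xi>\<bar> \<le> 2 * (M (length vs + 4) * norm_prod vs * norm v ^ 4)"
    using jet_bound[OF G, of "replicate 4 v @ vs" "x + \<xi> *\<^sub>R v"] jet_bound[OF G, of "replicate 4 v @ vs" "x + (- \<xi>) *\<^sub>R v"]
    by (simp add: diff_def norm_prod_replicate mult_ac add.commute)
  moreover have "0 \<le> M (length vs + 4) * norm_prod vs * norm v ^ 4"
    by (intro mult_nonneg_nonneg jet_nonneg[OF G] norm_prod_nonneg) auto
  ultimately show ?thesis by linarith
qed

section \<open>Symmetric random walks and their limit\<close>

lemma sym_nonneg_scale: "sym_nonneg_matrix Q \<Longrightarrow> 0 \<le> c \<Longrightarrow> sym_nonneg_matrix (c *\<^sub>R (Q :: real^'n^'n::finite))"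
  unfolding sym_nonneg_matrix_def
  by (simp add: scaleR_matrix_vector_assoc[symmetric] transpose_scalar)

lemma sym_nonneg_add: "sym_nonneg_matrix P \<Longrightarrow> sym_nonneg_matrix Q \<Longrightarrow> sym_nonneg_matrix (P + (Q :: real^'n^'n::finite))"
proof -
  assume "sym_nonneg_matrix P" "sym_nonneg_matrix Q"
  moreover have "transpose (P + Q) = transpose P + transpose Q" by (simp add: transpose_def vec_eq_iff)
  ultimately show ?thesis unfolding sym_nonneg_matrix_def by (simp add: matrix_vector_mult_add_rdistrib inner_add_left)
qed

lemma trace_scale: "trace (c *\<^sub>R (Q :: real^'n^'n::finite)) = c * trace Q"
  by (simp add: trace_def sum_distrib_left)

text \<open>One of the 2 CARD('n) signed columns of a square root of Q, all equally likely. The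
  factor gives the step the covariance 2 Q, which makes Tr(Q D^2) the second-order term of
  \<open>walk_step Q\<close>.\<close>

definition walk_shift :: "real^'n^'n::finite \<Rightarrow> 'n \<times> bool \<Rightarrow> real^'n" where
  "walk_shift Q i = (sqrt (2 * real CARD('n)) * (if snd i then 1 else -1)) *\<^sub>R matrix_factor Q (fst i)"

definition walk_step :: "real^'n^'n::finite \<Rightarrow> (real^'n \<Rightarrow> real) \<Rightarrow> real^'n \<Rightarrow> real" where
  "walk_step Q g x = (\<Sum>i\<in>UNIV. g (x + walk_shift Q i)) / (2 * real CARD('n))"

text \<open>Averages over finitely many translates, seen as operators. Linearity, contraction in the
  sup norm and commutation with translations are what the induction on this predicate
  delivers.\<close>

inductive walk_op :: "((real^'n::finite \<Rightarrow> real) \<Rightarrow> real^'n \<Rightarrow> real) \<Rightarrow> bool" where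
  walk_op_id: "walk_op (\<lambda>g. g)"
| walk_op_step: "walk_op P \<Longrightarrow> walk_op (\<lambda>g. walk_step Q (P g))"

lemma walk_op_compose: "walk_op P \<Longrightarrow> walk_op P' \<Longrightarrow> walk_op (\<lambda>g. P (P' g))"
  by (induction rule: walk_op.induct) (auto intro: walk_op.intros)

lemma walk_op_funpow: "walk_op P \<Longrightarrow> walk_op (P ^^ n)"
proof (induction n)
  case 0 then show ?case using walk_op_id by (simp add: id_def)
next
  case (Suc n) then show ?case using walk_op_compose[of P "P ^^ n"] by (simp add: o_def)
qed

lemma walk_op_walk_step: "walk_op (walk_step Q)"
  using walk_op_step[OF walk_op_id] .

lemma walk_op_linear: "walk_op P \<Longrightarrow> P (\<lambda>y. a * g y + b * h y) x = a * P g x + b * P h x"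
proof (induction arbitrary: x rule: walk_op.induct)
  case (walk_op_step P Q)
  then have "P (\<lambda>y. a * g y + b * h y) = (\<lambda>x. a * P g x + b * P h x)" by auto
  then show ?case
    by (simp add: walk_step_def sum.distrib sum_distrib_left[symmetric] add_divide_distrib)
qed simp

lemma walk_op_diff: "walk_op P \<Longrightarrow> P (\<lambda>y. g y - h y) x = P g x - P h x"
  using walk_op_linear[of P 1 g "-1" h x] by simp

lemma walk_op_bound:
  fixes P :: "(real^'n::finite \<Rightarrow> real) \<Rightarrow> real^'n \<Rightarrow> real"
  shows "walk_op P \<Longrightarrow> (\<And>y. \<bar>g y\<bar> \<le> c) \<Longrightarrow> \<bar>P g x\<bar> \<le> c"
proof (induction arbitrary: x rule: walk_op.induct)
  case (walk_op_step P Q)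
  have "\<bar>\<Sum>i\<in>UNIV. P g (x + walk_shift Q i)\<bar> \<le> (\<Sum>i\<in>(UNIV :: ('n \<times> bool) set). c)"
    by (intro order_trans[OF sum_abs] sum_mono walk_op_step.IH walk_op_step.prems)
  then have "\<bar>\<Sum>i\<in>UNIV. P g (x + walk_shift Q i)\<bar> / (2 * real CARD('n)) \<le> (\<Sum>i\<in>(UNIV :: ('n \<times> bool) set). c) / (2 * real CARD('n))"
    by (rule divide_right_mono) simp
  then have "\<bar>walk_step Q (P g) x\<bar> \<le> (\<Sum>i\<in>(UNIV :: ('n \<times> bool) set). c) / (2 * real CARD('n))"
    by (simp only: walk_step_def abs_divide abs_mult abs_numeral abs_of_nat)
  also have "\<dots> = c" by (simp add: card_cartesian_product UNIV_Times_UNIV[symmetric] del: UNIV_Times_UNIV)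
  finally show ?case .
qed simp

lemma walk_op_translate: "walk_op P \<Longrightarrow> P (\<lambda>u. g (u + y)) x = P g (x + y)"
proof (induction arbitrary: x rule: walk_op.induct)
  case (walk_op_step P Q)
  then show ?case by (simp add: walk_step_def add_ac)
qed simp

lemma walk_op_measurable: "walk_op P \<Longrightarrow> (\<And>y. (\<lambda>s. g s y) \<in> borel_measurable M) \<Longrightarrow> (\<lambda>s. P (g s) x) \<in> borel_measurable M"
proof (induction arbitrary: x rule: walk_op.induct)
  case (walk_op_step P Q)
  then show ?case unfolding walk_step_def by (intro borel_measurable_divide borel_measurable_sum) auto
qed simp

text \<open>Each inequality in \<open>jet\<close> bounds a linear combination of translates, with
  which P commutes; contraction then keeps the bound together with its constant.\<close>

lemma jet_walk:
  assumes P: "walk_op P" and G: "jet M G"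
  shows "jet M (\<lambda>vs. P (G vs))"
proof (rule jetI)
  fix us vs :: "(real^'a) list" and x v v' :: "real^'a" and c :: real
  show "\<bar>P (G vs) x\<bar> \<le> M (length vs) * norm_prod vs"
    by (rule walk_op_bound[OF P jet_bound[OF G]])
  have "P (G vs) (x + v) - P (G vs) x - P (G (v # vs)) x = P (\<lambda>y. G vs (y + v) - G vs y - G (v # vs) y) x"
    by (simp add: walk_op_diff[OF P] walk_op_translate[OF P])
  then show "\<bar>P (G vs) (x + v) - P (G vs) x - P (G (v # vs)) x\<bar> \<le> M (length vs + 2) * norm_prod vs * (norm v)\<^sup>2"
    using walk_op_bound[OF P jet_taylor1[OF G]] by simp
  have "G (us @ (v + v') # vs) = (\<lambda>y. 1 * G (us @ v # vs) y + 1 * G (us @ v' # vs) y)"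
    by (simp add: jet_add[OF G] fun_eq_iff)
  then show "P (G (us @ (v + v') # vs)) x = P (G (us @ v # vs)) x + P (G (us @ v' # vs)) x"
    by (simp only: walk_op_linear[OF P])
  have "G (us @ (c *\<^sub>R v) # vs) = (\<lambda>y. c * G (us @ v # vs) y + 0 * G [] y)"
    by (simp add: jet_scale[OF G] fun_eq_iff)
  then show "P (G (us @ (c *\<^sub>R v) # vs)) x = c * P (G (us @ v # vs)) x"
    by (simp only: walk_op_linear[OF P])
qed

lemma walk_step_commute: "walk_step Q (walk_step Q' g) = walk_step Q' (walk_step Q g)"
  unfolding walk_step_def
  by (rule ext, simp add: sum_divide_distrib[symmetric] add_ac, subst sum.swap, simp add: add_ac)

lemma walk_step_pairs:
  "walk_step Q g x = (\<Sum>p\<in>UNIV. g (x + sqrt (2 * real CARD('n)) *\<^sub>R matrix_factor Q p)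
      + g (x - sqrt (2 * real CARD('n)) *\<^sub>R matrix_factor Q p)) / (2 * real CARD('n))"
  for Q :: "real^'n^'n::finite"
proof -
  have "(\<Sum>i\<in>UNIV. g (x + walk_shift Q i)) = (\<Sum>p\<in>UNIV. \<Sum>b\<in>UNIV. g (x + walk_shift Q (p, b)))"
    unfolding sum.cartesian_product by (simp add: case_prod_beta)
  then show ?thesis by (simp add: walk_step_def walk_shift_def UNIV_bool add.commute)
qed

text \<open>Tr(Q D^2) applied to the derivative in the directions \<open>vs\<close>.\<close>

definition diffusion :: "real^'n^'n::finite \<Rightarrow> ((real^'n) list \<Rightarrow> real^'n \<Rightarrow> real) \<Rightarrow> (real^'n) list \<Rightarrow> real^'n \<Rightarrow> real" where
  "diffusion Q G vs x = (\<Sum>i\<in>UNIV. \<Sum>j\<in>UNIV. Q $ i $ j * G (axis i 1 # axis j 1 # vs) x)"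

lemma jet_expand:
  assumes G: "jet M (G :: (real^'n::finite) list \<Rightarrow> real^'n \<Rightarrow> real)"
  shows "G (us @ v # vs) x = (\<Sum>i\<in>UNIV. v $ i * G (us @ axis i 1 # vs) x)"
proof -
  have "G (us @ v # vs) x = G (us @ (\<Sum>i\<in>UNIV. v $ i *\<^sub>R axis i 1) # vs) x"
    using basis_expansion[of v] by (simp add: scalar_mult_eq_scaleR)
  also have "\<dots> = (\<Sum>i\<in>UNIV. v $ i * G (us @ axis i 1 # vs) x)"
    using linear_sum[OF jet_linear[OF G, of us vs x], of "\<lambda>i. v $ i *\<^sub>R axis i 1" UNIV]
    by (simp add: jet_scale[OF G])
  finally show ?thesis .
qed

lemma jet_expand2:
  assumes G: "jet M (G :: (real^'n::finite) list \<Rightarrow> real^'n \<Rightarrow> real)"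
  shows "G (u # v # vs) x = (\<Sum>i\<in>UNIV. \<Sum>j\<in>UNIV. u $ i * v $ j * G (axis i 1 # axis j 1 # vs) x)"
  using jet_expand[OF G, of "[]" u "v # vs" x] jet_expand[OF G, of "[axis _ 1]" v vs x]
  by (simp add: sum_distrib_left mult.assoc)

lemma diffusion_factor:
  assumes G: "jet M G" and Q: "sym_nonneg_matrix Q"
  shows "diffusion Q G vs x = (\<Sum>p\<in>UNIV. G (matrix_factor Q p # matrix_factor Q p # vs) x)"
proof -
  have "(\<Sum>p\<in>UNIV. G (matrix_factor Q p # matrix_factor Q p # vs) x)
     = (\<Sum>p\<in>UNIV. \<Sum>i\<in>UNIV. \<Sum>j\<in>UNIV. matrix_factor Q p $ i * matrix_factor Q p $ j * G (axis i 1 # axis j 1 # vs) x)"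
    by (simp add: jet_expand2[OF G, of "matrix_factor Q _" "matrix_factor Q _"])
  also have "\<dots> = (\<Sum>i\<in>UNIV. \<Sum>p\<in>UNIV. \<Sum>j\<in>UNIV. matrix_factor Q p $ i * matrix_factor Q p $ j * G (axis i 1 # axis j 1 # vs) x)"
    by (rule sum.swap)
  also have "\<dots> = (\<Sum>i\<in>UNIV. \<Sum>j\<in>UNIV. \<Sum>p\<in>UNIV. matrix_factor Q p $ i * matrix_factor Q p $ j * G (axis i 1 # axis j 1 # vs) x)"
    by (intro sum.cong refl sum.swap)
  also have "\<dots> = diffusion Q G vs x"
    by (simp add: diffusion_def matrix_factor[OF Q] sum_distrib_right)
  finally show ?thesis by simp
qed

lemma diffusion_add: "diffusion (P + Q) G vs x = diffusion P G vs x + diffusion Q G vs x"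
  by (simp add: diffusion_def sum.distrib algebra_simps)

text \<open>Turns the fourth moment of a step into the square of its second moment, so that local
  errors become quadratic in the trace.\<close>

lemma sum_fourth_powers_le:
  "(\<Sum>p\<in>UNIV. norm (matrix_factor Q p) ^ 4) \<le> (trace Q)\<^sup>2" if "sym_nonneg_matrix Q" for Q :: "real^'n^'n::finite"
proof -
  have "(\<Sum>p\<in>UNIV. (norm (matrix_factor Q p))\<^sup>2 * (norm (matrix_factor Q p))\<^sup>2)
      \<le> (\<Sum>p\<in>UNIV. (norm (matrix_factor Q p))\<^sup>2 * trace Q)"
    unfolding trace_matrix_factor[OF that]
    by (intro sum_mono mult_left_mono member_le_sum) auto
  then show ?thesis
    by (simp add: trace_matrix_factor[OF that] sum_distrib_right[symmetric] power2_eq_square[symmetric] power_mult[symmetric])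
qed

lemma walk_step_first_order:
  fixes Q :: "real^'n^'n::finite"
  assumes G: "jet M G" and Q: "sym_nonneg_matrix Q"
  shows "\<bar>walk_step Q (G vs) x - G vs x\<bar> \<le> 2 * M (length vs + 2) * norm_prod vs * trace Q"
proof -
  let ?c = "sqrt (2 * real CARD('n))"
  let ?s = "\<lambda>p. ?c *\<^sub>R matrix_factor Q p"
  have bd: "\<bar>G vs (x + ?s p) + G vs (x - ?s p) - 2 * G vs x\<bar> \<le> 2 * M (length vs + 2) * norm_prod vs * (norm (?s p))\<^sup>2" for p
    by (rule jet_second_difference[OF G])
  have "walk_step Q (G vs) x - G vs x = (\<Sum>p\<in>UNIV. G vs (x + ?s p) + G vs (x - ?s p) - 2 * G vs x) / (2 * real CARD('n))"
    unfolding walk_step_pairs by (simp add: sum_subtractf diff_divide_distrib)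
  also have "\<bar>\<dots>\<bar> \<le> (\<Sum>p\<in>UNIV. 2 * M (length vs + 2) * norm_prod vs * (norm (?s p))\<^sup>2) / (2 * real CARD('n))"
    by (simp only: abs_divide abs_mult abs_numeral abs_of_nat)
       (intro divide_right_mono order_trans[OF sum_abs] sum_mono bd, simp)
  also have "\<dots> = 2 * M (length vs + 2) * norm_prod vs * trace Q"
    by (simp add: trace_matrix_factor[OF Q] power_mult_distrib sum_distrib_left sum_divide_distrib field_simps)
  finally show ?thesis .
qed

text \<open>Symmetric Taylor expansion of order four in each column. With n steps of trace of order
  1/n such quadratic errors add up to order 1/n. The factor 2 CARD('n) is the fourth power of the
  scaling of the columns divided by the number of possible steps.\<close>

lemma walk_step_second_order:
  fixes Q :: "real^'n^'n::finite"
  assumes G: "jet M G" and Q: "sym_nonneg_matrix Q"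
  shows "\<bar>walk_step Q (G vs) x - G vs x - diffusion Q G vs x\<bar>
     \<le> 2 * real CARD('n) * M (length vs + 4) * norm_prod vs * (trace Q)\<^sup>2"
proof -
  let ?c = "sqrt (2 * real CARD('n))"
  let ?s = "\<lambda>p. ?c *\<^sub>R matrix_factor Q p"
  define m where "m = M (length vs + 4) * norm_prod vs"
  have m: "m \<ge> 0" unfolding m_def by (intro mult_nonneg_nonneg jet_nonneg[OF G] norm_prod_nonneg)
  have sc: "G (?s p # ?s p # vs) x = 2 * real CARD('n) * G (matrix_factor Q p # matrix_factor Q p # vs) x" for p
    using jet_scale[OF G, of "[]" ?c] jet_scale[OF G, of "[matrix_factor Q p]" ?c]
    by (simp add: mult.assoc[symmetric])
  have bd: "\<bar>G vs (x + ?s p) + G vs (x - ?s p) - 2 * G vs x - G (?s p # ?s p # vs) x\<bar> \<le> m * norm (?s p) ^ 4" for p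
    unfolding m_def by (rule jet_taylor4[OF G])
  have "walk_step Q (G vs) x - G vs x - diffusion Q G vs x
      = (\<Sum>p\<in>UNIV. G vs (x + ?s p) + G vs (x - ?s p) - 2 * G vs x - G (?s p # ?s p # vs) x) / (2 * real CARD('n))"
    unfolding walk_step_pairs diffusion_factor[OF G Q] sc
    by (simp add: sum_subtractf diff_divide_distrib sum_distrib_left[symmetric])
  also have "\<bar>\<dots>\<bar> \<le> (\<Sum>p\<in>UNIV. m * norm (?s p) ^ 4) / (2 * real CARD('n))"
    by (simp only: abs_divide abs_mult abs_numeral abs_of_nat)
       (intro divide_right_mono order_trans[OF sum_abs] sum_mono bd, simp)
  also have "\<dots> = 2 * real CARD('n) * m * (\<Sum>p\<in>UNIV. norm (matrix_factor Q p) ^ 4)"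
  proof -
    have "?c ^ 4 = (2 * real CARD('n))\<^sup>2" by (simp add: power4_eq_xxxx power2_eq_square)
    then show ?thesis
      by (simp add: power_mult_distrib sum_distrib_left sum_divide_distrib power2_eq_square field_simps)
  qed
  also have "\<dots> \<le> 2 * real CARD('n) * m * (trace Q)\<^sup>2"
    using m sum_fourth_powers_le[OF Q] by (intro mult_left_mono) auto
  finally show ?thesis by (simp add: m_def mult_ac)
qed

text \<open>The cross term for \<open>walk_step_split\<close>. Writing \<open>diffusion P\<close>
  through the columns of a square root of P makes the trace of P appear as a factor.\<close>

lemma walk_step_diffusion_first_order:
  fixes Q :: "real^'n^'n::finite"
  assumes G: "jet M G" and Q: "sym_nonneg_matrix Q" "sym_nonneg_matrix P"
  shows "\<bar>walk_step Q (diffusion P G vs) x - diffusion P G vs x\<bar>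
     \<le> 2 * M (length vs + 4) * norm_prod vs * trace Q * trace P"
proof -
  have "diffusion P G vs = (\<lambda>y. \<Sum>p\<in>UNIV. G (matrix_factor P p # matrix_factor P p # vs) y)"
    by (simp add: fun_eq_iff diffusion_factor[OF G Q(2)])
  then have "walk_step Q (diffusion P G vs) x - diffusion P G vs x
     = (\<Sum>p\<in>UNIV. walk_step Q (G (matrix_factor P p # matrix_factor P p # vs)) x - G (matrix_factor P p # matrix_factor P p # vs) x)"
    unfolding walk_step_def by (simp add: sum_subtractf sum_divide_distrib) (subst sum.swap, simp)
  also have "\<bar>\<dots>\<bar> \<le> (\<Sum>p\<in>UNIV. 2 * M (length vs + 4) * norm_prod vs * trace Q * (norm (matrix_factor P p))\<^sup>2)"
  proof (intro order_trans[OF sum_abs] sum_mono)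
    fix p :: 'n
    have "length vs + 4 = length (matrix_factor P p # matrix_factor P p # vs) + 2" by simp
    then show "\<bar>walk_step Q (G (matrix_factor P p # matrix_factor P p # vs)) x - G (matrix_factor P p # matrix_factor P p # vs) x\<bar>
       \<le> 2 * M (length vs + 4) * norm_prod vs * trace Q * (norm (matrix_factor P p))\<^sup>2"
      using walk_step_first_order[OF G Q(1), of "matrix_factor P p # matrix_factor P p # vs" x]
      unfolding \<open>length vs + 4 = _\<close> by (simp add: power2_eq_square mult_ac)
  qed
  also have "\<dots> = 2 * M (length vs + 4) * norm_prod vs * trace Q * trace P"
    by (simp add: trace_matrix_factor[OF Q(2)] sum_distrib_left)
  finally show ?thesis .
qed

text \<open>Both sides are the identity plus \<open>diffusion (Q + P)\<close> up to second order.
  Expanding the inner step under the outer one also produces the change of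
  \<open>diffusion P G\<close> under \<open>walk_step Q\<close>, of size trace Q times trace
  P.\<close>

lemma walk_step_split:
  fixes Q :: "real^'n^'n::finite"
  assumes G: "jet M G" and Q: "sym_nonneg_matrix Q" "sym_nonneg_matrix P"
  shows "\<bar>walk_step (Q + P) (G vs) x - walk_step Q (walk_step P (G vs)) x\<bar>
     \<le> 6 * real CARD('n) * M (length vs + 4) * norm_prod vs * (trace Q + trace P)\<^sup>2"
proof -
  define m where "m = M (length vs + 4) * norm_prod vs"
  have m: "m \<ge> 0" unfolding m_def by (intro mult_nonneg_nonneg jet_nonneg[OF G] norm_prod_nonneg)
  have tr: "trace Q \<ge> 0" "trace P \<ge> 0" using Q trace_nonneg by auto
  have trs: "trace (Q + P) = trace Q + trace P" by (simp add: trace_def sum.distrib)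
  have K: "walk_op (walk_step Q)" by (rule walk_op_walk_step)
  have "\<bar>walk_step (Q + P) (G vs) x - G vs x - diffusion (Q + P) G vs x\<bar> \<le> 2 * real CARD('n) * m * (trace Q + trace P)\<^sup>2"
    using walk_step_second_order[OF G sym_nonneg_add[OF Q], of vs x] trs by (simp add: m_def mult_ac)
  moreover have "\<bar>walk_step Q (\<lambda>y. walk_step P (G vs) y - G vs y - diffusion P G vs y) x\<bar> \<le> 2 * real CARD('n) * m * (trace P)\<^sup>2"
    using walk_op_bound[OF K walk_step_second_order[OF G Q(2), of vs]] by (simp add: m_def mult_ac)
  moreover have "walk_step Q (\<lambda>y. walk_step P (G vs) y - G vs y - diffusion P G vs y) x
    = walk_step Q (walk_step P (G vs)) x - walk_step Q (G vs) x - walk_step Q (diffusion P G vs) x"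
    by (simp add: walk_op_diff[OF K])
  moreover have "\<bar>walk_step Q (diffusion P G vs) x - diffusion P G vs x\<bar> \<le> 2 * m * (trace Q * trace P)"
    using walk_step_diffusion_first_order[OF G Q] by (simp add: m_def mult_ac)
  moreover have "\<bar>walk_step Q (G vs) x - G vs x - diffusion Q G vs x\<bar> \<le> 2 * real CARD('n) * m * (trace Q)\<^sup>2"
    using walk_step_second_order[OF G Q(1), of vs x] by (simp add: m_def mult_ac)
  ultimately have "\<bar>walk_step (Q + P) (G vs) x - walk_step Q (walk_step P (G vs)) x\<bar>
     \<le> 2 * real CARD('n) * m * (trace Q + trace P)\<^sup>2 + 2 * real CARD('n) * m * (trace P)\<^sup>2
        + 2 * m * (trace Q * trace P) + 2 * real CARD('n) * m * (trace Q)\<^sup>2"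
    unfolding diffusion_add by linarith
  also have "\<dots> \<le> 6 * real CARD('n) * m * (trace Q + trace P)\<^sup>2"
  proof -
    have n: "1 \<le> real CARD('n)" by simp
    have "2 * m * (trace Q * trace P) \<le> 2 * real CARD('n) * m * (trace Q * trace P)"
      using n m tr by (intro mult_right_mono) (auto simp: mult_le_cancel_right1)
    moreover have "2 * real CARD('n) * m * (trace Q * trace P) \<le> 8 * real CARD('n) * m * (trace Q * trace P)"
      using n m tr by (intro mult_right_mono) auto
    moreover have "0 \<le> real CARD('n) * m * (trace P)\<^sup>2" "0 \<le> real CARD('n) * m * (trace Q)\<^sup>2" using m by auto
    ultimately show ?thesis by (simp add: power2_sum algebra_simps)
  qed
  finally show ?thesis by (simp add: m_def mult_ac)
qed

text \<open>Telescoping of A^n - B^n with the contraction A on the left. The one-step error is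
  required along the orbit of B, where jet bounds of the iterates are available.\<close>

lemma telescope_powers:
  assumes A: "walk_op A" and e: "\<And>j x. \<bar>A ((B ^^ j) g) x - B ((B ^^ j) g) x\<bar> \<le> e"
  shows "\<bar>(A ^^ n) g x - (B ^^ n) g x\<bar> \<le> real n * e"
proof (induction n arbitrary: x)
  case (Suc n)
  have "\<bar>A (\<lambda>y. (A ^^ n) g y - (B ^^ n) g y) x\<bar> \<le> real n * e"
    by (rule walk_op_bound[OF A Suc])
  then show ?case using e[of n x] by (simp add: walk_op_diff[OF A] algebra_simps)
qed simp

section \<open>The Gaussian semigroup as a limit of walks\<close>

text \<open>Dyadic numbers of steps, so that passing from n to n + 1 replaces each step by two of
  half the covariance, which is what \<open>walk_step_split\<close> compares.\<close>

definition heat_approx :: "real^'n^'n::finite \<Rightarrow> nat \<Rightarrow> (real^'n \<Rightarrow> real) \<Rightarrow> real^'n \<Rightarrow> real" where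
  "heat_approx Q n = walk_step ((1 / 2 ^ n) *\<^sub>R Q) ^^ (2 ^ n)"

text \<open>\<open>heat Q\<close> is convolution with the centred Gaussian of covariance \<open>2Q\<close>, that is \<open>exp (Tr (Q D\<^sup>2))\<close>,
  obtained as a limit of random walks.\<close>

definition heat :: "real^'n^'n::finite \<Rightarrow> ((real^'n) list \<Rightarrow> real^'n \<Rightarrow> real) \<Rightarrow> (real^'n) list \<Rightarrow> real^'n \<Rightarrow> real" where
  "heat Q G vs x = lim (\<lambda>n. heat_approx Q n (G vs) x)"

lemma walk_op_heat_approx: "walk_op (heat_approx Q n)"
  unfolding heat_approx_def by (intro walk_op_funpow walk_op_walk_step)

text \<open>There are 2^n local errors of size 4^(-n), which add up to 2^(-n).\<close>

lemma heat_approx_step: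
  fixes Q :: "real^'n^'n::finite"
  assumes G: "jet M G" and Q: "sym_nonneg_matrix Q"
  shows "\<bar>heat_approx Q n (G vs) x - heat_approx Q (Suc n) (G vs) x\<bar>
     \<le> 6 * real CARD('n) * M (length vs + 4) * norm_prod vs * (trace Q)\<^sup>2 * (1 / 2 ^ n)"
proof -
  define P where "P = (1 / 2 ^ Suc n) *\<^sub>R Q"
  have P: "sym_nonneg_matrix P" unfolding P_def by (intro sym_nonneg_scale Q) simp
  have PP: "(1 / 2 ^ n) *\<^sub>R Q = P + P" unfolding P_def by (simp add: scaleR_add_left[symmetric])
  define B where "B = (\<lambda>g. walk_step P (walk_step P g))"
  have B: "walk_op B" unfolding B_def by (rule walk_op_compose[OF walk_op_walk_step walk_op_walk_step])
  have "B = walk_step P ^^ 2" by (simp add: B_def fun_eq_iff numeral_2_eq_2)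
  moreover have "heat_approx Q (Suc n) = walk_step P ^^ (2 ^ Suc n)" unfolding heat_approx_def P_def ..
  ultimately have "heat_approx Q (Suc n) = B ^^ (2 ^ n)" by (simp only: funpow_mult power_Suc)
  moreover have "\<bar>(walk_step (P + P) ^^ (2 ^ n)) (G vs) x - (B ^^ (2 ^ n)) (G vs) x\<bar>
     \<le> real (2 ^ n) * (6 * real CARD('n) * M (length vs + 4) * norm_prod vs * (trace P + trace P)\<^sup>2)"
  proof (rule telescope_powers[OF walk_op_walk_step])
    fix j y
    show "\<bar>walk_step (P + P) ((B ^^ j) (G vs)) y - B ((B ^^ j) (G vs)) y\<bar>
        \<le> 6 * real CARD('n) * M (length vs + 4) * norm_prod vs * (trace P + trace P)\<^sup>2"
      using walk_step_split[OF jet_walk[OF walk_op_funpow[OF B, of j] G] P P, of vs y] by (simp add: B_def)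
  qed
  moreover have "trace P + trace P = trace Q / 2 ^ n" by (simp add: P_def trace_scale)
  ultimately show ?thesis
    by (simp add: heat_approx_def[of Q n] PP power_divide power2_eq_square)
qed

text \<open>The errors of successive refinements form a geometric series of ratio 1/2; its sum
  doubles the constant 6 to 12.\<close>

lemma heat_converges:
  fixes Q :: "real^'n^'n::finite"
  assumes G: "jet M G" and Q: "sym_nonneg_matrix Q"
  shows "(\<lambda>n. heat_approx Q n (G vs) x) \<longlonglongrightarrow> heat Q G vs x"
    and "\<bar>heat_approx Q n (G vs) x - heat Q G vs x\<bar>
     \<le> 12 * real CARD('n) * M (length vs + 4) * norm_prod vs * (trace Q)\<^sup>2 * (1 / 2 ^ n)"
proof -
  define h where "h n = heat_approx Q n (G vs) x" for n
  define c where "c = 6 * real CARD('n) * M (length vs + 4) * norm_prod vs * (trace Q)\<^sup>2"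
  have c: "c \<ge> 0" unfolding c_def by (intro mult_nonneg_nonneg jet_nonneg[OF G] norm_prod_nonneg) auto
  have step: "\<bar>h n - h (Suc n)\<bar> \<le> c * (1 / 2) ^ n" for n
    using heat_approx_step[OF G Q] by (simp add: h_def c_def power_divide)
  \<comment> \<open>The subtracted geometric remainder is what lets the induction close.\<close>
  have add: "\<bar>h n - h (n + m)\<bar> \<le> 2 * c * (1 / 2) ^ n - 2 * c * (1 / 2) ^ (n + m)" for n m
  proof (induction m)
    case (Suc m)
    have "\<bar>h n - h (n + Suc m)\<bar> \<le> \<bar>h n - h (n + m)\<bar> + \<bar>h (n + m) - h (Suc (n + m))\<bar>" by simp
    also have "\<dots> \<le> 2 * c * (1 / 2) ^ n - 2 * c * (1 / 2) ^ (n + m) + c * (1 / 2) ^ (n + m)"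
      by (intro add_mono Suc step)
    also have "\<dots> = 2 * c * (1 / 2) ^ n - 2 * c * (1 / 2) ^ (n + Suc m)" by simp
    finally show ?case .
  qed simp
  have le: "\<bar>h n - h k\<bar> \<le> 2 * c * (1 / 2) ^ n" if "n \<le> k" for n k
  proof -
    have "\<bar>h n - h k\<bar> \<le> 2 * c * (1 / 2) ^ n - 2 * c * (1 / 2) ^ k" using add[of n "k - n"] that by simp
    also have "\<dots> \<le> 2 * c * (1 / 2) ^ n" using c by simp
    finally show ?thesis .
  qed
  have lim0: "(\<lambda>n. 2 * c * (1 / 2) ^ n) \<longlonglongrightarrow> 0"
    by (intro tendsto_mult_right_zero LIMSEQ_realpow_zero) auto
  have "Cauchy h"
    unfolding Cauchy_altdef2
  proof (intro allI impI)
    fix e :: real assume "e > 0"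
    then obtain N where "2 * c * (1 / 2) ^ N < e"
      using order_tendstoD(2)[OF lim0] by (auto simp: eventually_sequentially)
    then have "dist (h n) (h N) < e" if "n \<ge> N" for n using le[OF that] by (simp add: dist_real_def)
    then show "\<exists>N. \<forall>n\<ge>N. dist (h n) (h N) < e" by blast
  qed
  then show lim: "(\<lambda>n. heat_approx Q n (G vs) x) \<longlonglongrightarrow> heat Q G vs x"
    unfolding heat_def h_def[symmetric] by (simp add: Cauchy_convergent_iff convergent_LIMSEQ_iff)
  have "\<bar>h n - heat Q G vs x\<bar> \<le> 2 * c * (1 / 2) ^ n"
    by (rule LIMSEQ_le_const2[OF tendsto_rabs[OF tendsto_diff[OF tendsto_const lim]]])
       (use le h_def in auto)
  then show "\<bar>heat_approx Q n (G vs) x - heat Q G vs x\<bar>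
     \<le> 12 * real CARD('n) * M (length vs + 4) * norm_prod vs * (trace Q)\<^sup>2 * (1 / 2 ^ n)"
    by (simp add: h_def c_def power_divide)
qed

lemma jet_heat:
  assumes G: "jet M G" and Q: "sym_nonneg_matrix Q"
  shows "jet M (heat Q G)"
  by (rule jet_limit[where G = "\<lambda>n vs. heat_approx Q n (G vs)" and F = sequentially])
     (auto intro: heat_converges[OF G Q] jet_walk[OF walk_op_heat_approx G])

lemma heat_first_order:
  fixes Q :: "real^'n^'n::finite"
  assumes G: "jet M G" and Q: "sym_nonneg_matrix Q"
  shows "\<bar>heat Q G vs x - G vs x\<bar> \<le> 2 * M (length vs + 2) * norm_prod vs * trace Q"
proof (rule LIMSEQ_le_const2[OF tendsto_rabs[OF tendsto_diff[OF heat_converges(1)[OF G Q] tendsto_const]]])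
  have "\<bar>heat_approx Q n (G vs) x - G vs x\<bar> \<le> 2 * M (length vs + 2) * norm_prod vs * trace Q" for n
  proof -
    have P: "sym_nonneg_matrix ((1 / 2 ^ n) *\<^sub>R Q)" by (intro sym_nonneg_scale Q) simp
    have id: "((\<lambda>g. g) ^^ j) g = g" for j and g :: "real^'n \<Rightarrow> real" by (induction j) auto
    have "\<bar>(walk_step ((1 / 2 ^ n) *\<^sub>R Q) ^^ (2 ^ n)) (G vs) x - ((\<lambda>g. g) ^^ (2 ^ n)) (G vs) x\<bar>
       \<le> real (2 ^ n) * (2 * M (length vs + 2) * norm_prod vs * trace ((1 / 2 ^ n) *\<^sub>R Q))"
      by (rule telescope_powers[OF walk_op_walk_step]) (simp only: id walk_step_first_order[OF G P])
    then show ?thesis by (simp add: id heat_approx_def trace_scale)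
  qed
  then show "\<exists>N. \<forall>n\<ge>N. \<bar>heat_approx Q n (G vs) x - G vs x\<bar> \<le> 2 * M (length vs + 2) * norm_prod vs * trace Q"
    by blast
qed

text \<open>The rate of convergence at n = 0, where the approximation is a single step.\<close>

lemma walk_step_heat:
  fixes Q :: "real^'n^'n::finite"
  assumes G: "jet M G" and Q: "sym_nonneg_matrix Q"
  shows "\<bar>walk_step Q (G vs) x - heat Q G vs x\<bar> \<le> 12 * real CARD('n) * M (length vs + 4) * norm_prod vs * (trace Q)\<^sup>2"
  using heat_converges(2)[OF G Q, of 0 vs x] by (simp add: heat_approx_def)

lemma heat_second_order:
  fixes Q :: "real^'n^'n::finite"
  assumes G: "jet M G" and Q: "sym_nonneg_matrix Q"
  shows "\<bar>heat Q G vs x - G vs x - diffusion Q G vs x\<bar>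
     \<le> 14 * real CARD('n) * M (length vs + 4) * norm_prod vs * (trace Q)\<^sup>2"
  using walk_step_heat[OF G Q, of vs x] walk_step_second_order[OF G Q, of vs x] by (simp add: algebra_simps)

lemma funpow_commute_compose:
  assumes "\<And>x. f (g x) = g (f x)"
  shows "((\<lambda>x. f (g x)) ^^ n) x = (f ^^ n) ((g ^^ n) x)"
proof -
  have c: "f ((g ^^ n) x) = (g ^^ n) (f x)" for n x by (induction n) (simp_all add: assms)
  have "(f ^^ n) (g x) = g ((f ^^ n) x)" for n x by (induction n) (simp_all add: assms)
  then show ?thesis by (induction n) (simp_all add: c)
qed

text \<open>On the level of walks, each step of covariance Q + P is split into one for Q and one for
  P. Steps commute, so all those for Q can be collected on the left.\<close>

lemma heat_semigroup:
  fixes Q :: "real^'n^'n::finite"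
  assumes G: "jet M G" and Q: "sym_nonneg_matrix Q" and P: "sym_nonneg_matrix P"
  shows "heat (Q + P) G vs x = heat Q (heat P G) vs x"
proof -
  have QP: "sym_nonneg_matrix (Q + P)" by (rule sym_nonneg_add[OF Q P])
  have JP: "jet M (heat P G)" by (rule jet_heat[OF G P])
  define c where "c = 6 * real CARD('n) * M (length vs + 4) * norm_prod vs * (trace Q + trace P)\<^sup>2"
  define d where "d = 12 * real CARD('n) * M (length vs + 4) * norm_prod vs * (trace P)\<^sup>2"
  have 1: "\<bar>heat_approx (Q + P) n (G vs) x - heat_approx Q n (heat_approx P n (G vs)) x\<bar> \<le> c * (1 / 2) ^ n" for n
  proof -
    define Q' where "Q' = (1 / 2 ^ n) *\<^sub>R Q"
    define P' where "P' = (1 / 2 ^ n) *\<^sub>R P"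
    have Q': "sym_nonneg_matrix Q'" "sym_nonneg_matrix P'" unfolding Q'_def P'_def by (intro sym_nonneg_scale Q P; simp)+
    define B where "B = (\<lambda>g. walk_step Q' (walk_step P' g))"
    have B: "walk_op B" unfolding B_def by (rule walk_op_compose[OF walk_op_walk_step walk_op_walk_step])
    have "\<bar>(walk_step (Q' + P') ^^ (2 ^ n)) (G vs) x - (B ^^ (2 ^ n)) (G vs) x\<bar>
       \<le> real (2 ^ n) * (6 * real CARD('n) * M (length vs + 4) * norm_prod vs * (trace Q' + trace P')\<^sup>2)"
    proof (rule telescope_powers[OF walk_op_walk_step])
      fix j y
      have "jet M (\<lambda>vs. (B ^^ j) (G vs))" by (rule jet_walk[OF walk_op_funpow[OF B] G])
      from walk_step_split[OF this Q', of vs y]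
      show "\<bar>walk_step (Q' + P') ((B ^^ j) (G vs)) y - B ((B ^^ j) (G vs)) y\<bar>
        \<le> 6 * real CARD('n) * M (length vs + 4) * norm_prod vs * (trace Q' + trace P')\<^sup>2"
        by (simp add: B_def)
    qed
    moreover have "(B ^^ (2 ^ n)) (G vs) = heat_approx Q n (heat_approx P n (G vs))"
      unfolding B_def heat_approx_def Q'_def P'_def by (rule funpow_commute_compose) (rule walk_step_commute)
    moreover have "walk_step (Q' + P') ^^ (2 ^ n) = heat_approx (Q + P) n"
      by (simp add: heat_approx_def Q'_def P'_def scaleR_add_right)
    moreover have "trace Q' + trace P' = (trace Q + trace P) / 2 ^ n"
      by (simp add: Q'_def P'_def trace_scale add_divide_distrib)
    ultimately show ?thesis by (simp add: c_def power_divide power2_eq_square)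
  qed
  \<comment> \<open>The inner approximation is uniform in space, and the outer walk is a
    contraction, so the error survives unchanged.\<close>
  have 2: "\<bar>heat_approx Q n (heat_approx P n (G vs)) x - heat_approx Q n (heat P G vs) x\<bar> \<le> d * (1 / 2) ^ n" for n
  proof -
    have "\<bar>heat_approx P n (G vs) y - heat P G vs y\<bar> \<le> d * (1 / 2) ^ n" for y
      using heat_converges(2)[OF G P, of n vs y] by (simp add: d_def power_divide)
    from walk_op_bound[OF walk_op_heat_approx[of Q n] this, where x = x] show ?thesis
      by (simp add: walk_op_diff[OF walk_op_heat_approx])
  qed
  have "(\<lambda>n. heat_approx (Q + P) n (G vs) x - heat_approx Q n (heat P G vs) x) \<longlonglongrightarrow> 0"
  proof (rule tendsto_rabs_zero_cancel, rule tendsto_sandwich[OF _ _ tendsto_const])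
    show "(\<lambda>n. (c + d) * (1 / 2) ^ n) \<longlonglongrightarrow> 0" by (intro tendsto_mult_right_zero LIMSEQ_realpow_zero) auto
    show "\<forall>\<^sub>F n in sequentially. \<bar>heat_approx (Q + P) n (G vs) x - heat_approx Q n (heat P G vs) x\<bar> \<le> (c + d) * (1 / 2) ^ n"
    proof (intro always_eventually allI)
      fix n
      show "\<bar>heat_approx (Q + P) n (G vs) x - heat_approx Q n (heat P G vs) x\<bar> \<le> (c + d) * (1 / 2) ^ n"
        unfolding distrib_right using 1[of n] 2[of n] by linarith
    qed
  qed simp
  moreover have "(\<lambda>n. heat_approx (Q + P) n (G vs) x - heat_approx Q n (heat P G vs) x) \<longlonglongrightarrow> heat (Q + P) G vs x - heat Q (heat P G) vs x"
    by (intro tendsto_diff heat_converges(1)[OF G QP] heat_converges(1)[OF JP Q])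
  ultimately show ?thesis using LIMSEQ_unique by fastforce
qed

lemma heat_translate:
  assumes G: "jet M G" and Q: "sym_nonneg_matrix Q"
  shows "heat Q (\<lambda>vs x. G vs (x + y)) vs x = heat Q G vs (x + y)"
  by (simp add: heat_def walk_op_translate[OF walk_op_heat_approx])

lemma heat_measurable:
  assumes G: "\<And>s. s \<in> space N \<Longrightarrow> jet M (G s)" and Q: "sym_nonneg_matrix Q"
    and m: "\<And>y. (\<lambda>s. G s vs y) \<in> borel_measurable N"
  shows "(\<lambda>s. heat Q (G s) vs x) \<in> borel_measurable N"
  by (rule borel_measurable_LIMSEQ_real[where u = "\<lambda>n s. heat_approx Q n (G s vs) x"])
     (auto intro: heat_converges(1)[OF G Q] walk_op_measurable[OF walk_op_heat_approx m])

section \<open>Walks with unequal steps\<close>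

primrec walk_steps :: "(real^'n^'n::finite) list \<Rightarrow> (real^'n \<Rightarrow> real) \<Rightarrow> real^'n \<Rightarrow> real" where
  "walk_steps [] g = g"
| "walk_steps (Q # Qs) g = walk_step Q (walk_steps Qs g)"

lemma sym_nonneg_zero: "sym_nonneg_matrix (0 :: real^'n^'n::finite)"
  by (simp add: sym_nonneg_matrix_def transpose_def vec_eq_iff)

lemma sym_nonneg_sum_list:
  "(\<And>Q. Q \<in> set Qs \<Longrightarrow> sym_nonneg_matrix Q) \<Longrightarrow> sym_nonneg_matrix (sum_list Qs :: real^'n^'n::finite)"
  by (induction Qs) (auto intro: sym_nonneg_add sym_nonneg_zero)

lemma heat_zero:
  fixes G :: "(real^'n::finite) list \<Rightarrow> real^'n \<Rightarrow> real"
  assumes "jet M G" shows "heat 0 G vs x = G vs x"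
  using heat_first_order[OF assms sym_nonneg_zero, of vs x] by (simp add: trace_def)

text \<open>One step at a time is replaced by the Gaussian of the same covariance. The local errors
  just add, since the operators applied to earlier errors are contractions.\<close>

lemma walk_steps_heat:
  fixes Qs :: "(real^'n^'n::finite) list"
  assumes G: "jet M G" and "\<And>Q. Q \<in> set Qs \<Longrightarrow> sym_nonneg_matrix Q"
  shows "\<bar>walk_steps Qs (G vs) x - heat (sum_list Qs) G vs x\<bar>
     \<le> 12 * real CARD('n) * M (length vs + 4) * norm_prod vs * (\<Sum>Q\<leftarrow>Qs. (trace Q)\<^sup>2)"
  using assms(2)
proof (induction Qs arbitrary: x)
  case Nil
  then show ?case using heat_zero[OF G] by simp
next
  case (Cons Q Qs)
  let ?c = "12 * real CARD('n) * M (length vs + 4) * norm_prod vs"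
  have Q: "sym_nonneg_matrix Q" and S: "sym_nonneg_matrix (sum_list Qs)" using Cons.prems by (auto intro: sym_nonneg_sum_list)
  have "\<bar>walk_step Q (\<lambda>y. walk_steps Qs (G vs) y - heat (sum_list Qs) G vs y) x\<bar> \<le> ?c * (\<Sum>Q\<leftarrow>Qs. (trace Q)\<^sup>2)"
    by (intro walk_op_bound[OF walk_op_walk_step] Cons.IH Cons.prems) simp
  moreover have "\<bar>walk_step Q (heat (sum_list Qs) G vs) x - heat Q (heat (sum_list Qs) G) vs x\<bar> \<le> ?c * (trace Q)\<^sup>2"
    by (rule walk_step_heat[OF jet_heat[OF G S] Q])
  ultimately show ?case
    by (simp add: heat_semigroup[OF G Q S] walk_op_diff[OF walk_op_walk_step] distrib_left)
qed

section \<open>The matrix exponential\<close>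

definition matrix_power :: "real^'n^'n::finite \<Rightarrow> nat \<Rightarrow> real^'n^'n" where
  "matrix_power A k = (((**) A) ^^ k) (mat 1)"

text \<open>Taken entrywise, so that termwise differentiation of real power series applies.\<close>

definition matrix_exp :: "real^'n^'n::finite \<Rightarrow> real \<Rightarrow> real^'n^'n" where
  "matrix_exp A t = (\<chi> i j. \<Sum>k. matrix_power A k $ i $ j / fact k * t ^ k)"

lemma matrix_power_Suc: "matrix_power A (Suc k) = A ** matrix_power A k"
  by (simp add: matrix_power_def)

lemma matrix_power_Suc_right: "matrix_power A (Suc k) = matrix_power A k ** A"
proof (induction k)
  case (Suc k)
  then show ?case by (metis matrix_power_Suc matrix_mul_assoc)
qed (simp add: matrix_power_def)

lemma matrix_power_entry_le:
  fixes A :: "real^'n^'n::finite"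
  defines "c \<equiv> \<Sum>i\<in>UNIV. \<Sum>j\<in>UNIV. \<bar>A $ i $ j\<bar>"
  shows "\<bar>matrix_power A k $ i $ j\<bar> \<le> c ^ k"
proof (induction k arbitrary: i j)
  case 0
  then show ?case by (simp add: matrix_power_def mat_def)
next
  case (Suc k)
  have c: "0 \<le> c" unfolding c_def by (intro sum_nonneg) auto
  have "\<bar>matrix_power A (Suc k) $ i $ j\<bar> \<le> (\<Sum>l\<in>UNIV. \<bar>A $ i $ l\<bar> * c ^ k)"
    unfolding matrix_power_Suc matrix_matrix_mult_def
    by (simp, intro order_trans[OF sum_abs] sum_mono, simp add: abs_mult mult_left_mono Suc)
  also have "\<dots> = (\<Sum>l\<in>UNIV. \<bar>A $ i $ l\<bar>) * c ^ k" by (simp add: sum_distrib_right)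
  also have "\<dots> \<le> c * c ^ k"
    unfolding c_def using member_le_sum[of i UNIV "\<lambda>i. \<Sum>l\<in>UNIV. \<bar>A $ i $ l\<bar>"] c
    by (intro mult_right_mono) (auto simp: sum_nonneg c_def)
  finally show ?case by simp
qed

lemma matrix_exp_summable:
  fixes A :: "real^'n^'n::finite"
  shows "summable (\<lambda>k. matrix_power A k $ i $ j / fact k * t ^ k)"
proof (rule summable_comparison_test'[where N = 0])
  let ?c = "\<Sum>i\<in>UNIV. \<Sum>j\<in>UNIV. \<bar>A $ i $ j\<bar>"
  show "summable (\<lambda>k. inverse (fact k) * (?c * \<bar>t\<bar>) ^ k)"
    by (rule summable_exp)
  show "norm (matrix_power A k $ i $ j / fact k * t ^ k) \<le> inverse (fact k) * (?c * \<bar>t\<bar>) ^ k" for k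
    using mult_right_mono[OF matrix_power_entry_le[of A k i j], of "\<bar>t\<bar> ^ k"]
    by (simp add: abs_mult power_abs power_mult_distrib divide_simps)
qed

lemma matrix_exp_zero [simp]: "matrix_exp A 0 = mat 1"
  unfolding matrix_exp_def vec_eq_iff
  by (simp only: vec_lambda_beta powser_zero) (simp add: matrix_power_def)

text \<open>Multiplication by A from either side shifts the coefficients in the same way, so both
  products equal the termwise derivative.\<close>

lemma matrix_exp_derivative:
  fixes A :: "real^'n^'n::finite"
  shows "((\<lambda>t. matrix_exp A t $ i $ j) has_real_derivative (A ** matrix_exp A t) $ i $ j) (at t)"
    and "(A ** matrix_exp A t) $ i $ j = (matrix_exp A t ** A) $ i $ j"
proof -
  define c where "c k = matrix_power A k $ i $ j / fact k" for k
  have dc: "diffs c k = matrix_power A (Suc k) $ i $ j / fact k" for k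
    by (simp add: diffs_def c_def field_simps del: of_nat_Suc)
  have "((\<lambda>t. \<Sum>k. c k * t ^ k) has_real_derivative (\<Sum>k. diffs c k * t ^ k)) (at t)"
    by (rule termdiffs_strong_converges_everywhere) (unfold c_def, rule matrix_exp_summable)
  moreover have L: "(\<Sum>k. diffs c k * t ^ k) = (A ** matrix_exp A t) $ i $ j"
  proof -
    have "(A ** matrix_exp A t) $ i $ j = (\<Sum>l\<in>UNIV. A $ i $ l * (\<Sum>k. matrix_power A k $ l $ j / fact k * t ^ k))"
      by (simp add: matrix_matrix_mult_def matrix_exp_def)
    also have "\<dots> = (\<Sum>l\<in>UNIV. \<Sum>k. A $ i $ l * (matrix_power A k $ l $ j / fact k * t ^ k))"
      by (intro sum.cong refl suminf_mult[symmetric] matrix_exp_summable)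
    also have "\<dots> = (\<Sum>k. \<Sum>l\<in>UNIV. A $ i $ l * (matrix_power A k $ l $ j / fact k * t ^ k))"
      by (rule suminf_sum[symmetric]) (intro summable_mult matrix_exp_summable)
    also have "\<dots> = (\<Sum>k. diffs c k * t ^ k)"
      by (simp add: dc matrix_power_Suc matrix_matrix_mult_def sum_divide_distrib sum_distrib_left mult_ac)
    finally show ?thesis by simp
  qed
  moreover have "(\<Sum>k. diffs c k * t ^ k) = (matrix_exp A t ** A) $ i $ j"
  proof -
    have "(matrix_exp A t ** A) $ i $ j = (\<Sum>l\<in>UNIV. A $ l $ j * (\<Sum>k. matrix_power A k $ i $ l / fact k * t ^ k))"
      by (simp add: matrix_matrix_mult_def matrix_exp_def mult.commute)
    also have "\<dots> = (\<Sum>l\<in>UNIV. \<Sum>k. A $ l $ j * (matrix_power A k $ i $ l / fact k * t ^ k))"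
      by (intro sum.cong refl suminf_mult[symmetric] matrix_exp_summable)
    also have "\<dots> = (\<Sum>k. \<Sum>l\<in>UNIV. A $ l $ j * (matrix_power A k $ i $ l / fact k * t ^ k))"
      by (rule suminf_sum[symmetric]) (intro summable_mult matrix_exp_summable)
    also have "\<dots> = (\<Sum>k. diffs c k * t ^ k)"
      by (simp add: dc matrix_power_Suc_right matrix_matrix_mult_def sum_divide_distrib sum_distrib_left mult_ac)
    finally show ?thesis by simp
  qed
  ultimately show "((\<lambda>t. matrix_exp A t $ i $ j) has_real_derivative (A ** matrix_exp A t) $ i $ j) (at t)"
    "(A ** matrix_exp A t) $ i $ j = (matrix_exp A t ** A) $ i $ j"
    by (simp_all add: matrix_exp_def c_def)
qed

lemma matrix_exp_commute: "A ** matrix_exp A t = matrix_exp A t ** A"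
  by (simp add: vec_eq_iff matrix_exp_derivative(2))

text \<open>The two terms in the derivative of e^{-tA} e^{tA} cancel, so the product keeps its value
  at t = 0.\<close>

lemma matrix_exp_inverse: "matrix_exp A (- t) ** matrix_exp A t = mat 1"
  for A :: "real^'n^'n::finite"
proof -
  have "(matrix_exp A (- t) ** matrix_exp A t) $ i $ j = (mat 1 :: real^'n^'n) $ i $ j" for i j
  proof -
    define f where "f t = (matrix_exp A (- t) ** matrix_exp A t) $ i $ j" for t
    have d1: "((\<lambda>t. matrix_exp A (- t) $ i $ l) has_real_derivative - (matrix_exp A (- t) ** A) $ i $ l) (at t)" for l t
    proof -
      have "((\<lambda>t. matrix_exp A (- t) $ i $ l) has_real_derivative (A ** matrix_exp A (- t)) $ i $ l * (- 1)) (at t)"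
        by (rule DERIV_chain2[OF matrix_exp_derivative(1)]) (auto intro!: derivative_eq_intros)
      then show ?thesis by (simp add: matrix_exp_commute)
    qed
    have "(f has_real_derivative 0) (at t)" for t
    proof -
      have "(f has_real_derivative (\<Sum>l\<in>UNIV. matrix_exp A (- t) $ i $ l * (A ** matrix_exp A t) $ l $ j
            + - (matrix_exp A (- t) ** A) $ i $ l * matrix_exp A t $ l $ j)) (at t)"
        unfolding f_def matrix_matrix_mult_def[of "matrix_exp A (- _)" "matrix_exp A _"]
        by (simp only: vec_lambda_beta, intro DERIV_sum DERIV_mult' d1 matrix_exp_derivative(1))
      also have "(\<Sum>l\<in>UNIV. matrix_exp A (- t) $ i $ l * (A ** matrix_exp A t) $ l $ j
            + - (matrix_exp A (- t) ** A) $ i $ l * matrix_exp A t $ l $ j)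
        = (matrix_exp A (- t) ** (A ** matrix_exp A t)) $ i $ j - ((matrix_exp A (- t) ** A) ** matrix_exp A t) $ i $ j"
        by (simp add: matrix_matrix_mult_def[of "matrix_exp A (- t)" "A ** matrix_exp A t"]
            matrix_matrix_mult_def[of "matrix_exp A (- t) ** A" "matrix_exp A t"] sum_subtractf)
      also have "\<dots> = 0" by (simp add: matrix_mul_assoc)
      finally show ?thesis .
    qed
    then have "f t = f 0" using DERIV_isconst_all[of f t 0] by blast
    then show ?thesis by (simp add: f_def)
  qed
  then show ?thesis by (simp add: vec_eq_iff)
qed

lemma matrix_exp_inverse_vec:
  "matrix_exp A (- t) *v (matrix_exp A t *v x) = x" "matrix_exp A t *v (matrix_exp A (- t) *v x) = x"
  using matrix_exp_inverse[of A t] matrix_exp_inverse[of A "- t"] by (simp_all add: matrix_vector_mul_assoc)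

lemma matrix_exp_continuous: "continuous_on S (matrix_exp A)"
proof -
  have "continuous_on S (\<lambda>t. matrix_exp A t $ i $ j)" for i j
    by (rule DERIV_continuous_on[OF has_field_derivative_at_within[OF matrix_exp_derivative(1)]])
  then have "continuous_on S (\<lambda>t. \<chi> i j. matrix_exp A t $ i $ j)"
    by (intro continuous_on_vec_lambda)
  then show ?thesis by simp
qed

lemma matrix_exp_vec_derivative:
  "((\<lambda>t. matrix_exp A t *v x) has_vector_derivative matrix_exp A t *v (A *v x)) (at t)"
proof -
  have "((\<lambda>t. (matrix_exp A t *v x) $ i) has_vector_derivative (matrix_exp A t *v (A *v x)) $ i) (at t)" for i
  proof -
    have "((\<lambda>t. \<Sum>j\<in>UNIV. matrix_exp A t $ i $ j * x $ j) has_real_derivative (\<Sum>j\<in>UNIV. (A ** matrix_exp A t) $ i $ j * x $ j)) (at t)"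
      by (intro DERIV_sum DERIV_cmult_right matrix_exp_derivative(1))
    moreover have "(\<Sum>j\<in>UNIV. (A ** matrix_exp A t) $ i $ j * x $ j) = (matrix_exp A t *v (A *v x)) $ i"
      unfolding matrix_exp_commute matrix_vector_mul_assoc by (simp add: matrix_vector_mult_def)
    ultimately show ?thesis
      by (simp add: has_real_derivative_iff_has_vector_derivative matrix_vector_mult_def)
  qed
  then show ?thesis unfolding has_vector_derivative_def
    by (subst has_derivative_componentwise_within) (auto simp: Basis_vec_def inner_axis)
qed

lemma matrix_exp_bounds:
  fixes A :: "real^'n^'n::finite"
  obtains c where "c \<ge> 1" "\<And>t x. \<bar>t\<bar> \<le> T \<Longrightarrow> norm (matrix_exp A t *v x) \<le> c * norm x"
    "\<And>s t x. \<bar>s\<bar> \<le> T \<Longrightarrow> \<bar>t\<bar> \<le> T \<Longrightarrow> norm (matrix_exp A t *v x - matrix_exp A s *v x) \<le> c * \<bar>t - s\<bar> * norm x"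
proof -
  have "compact (matrix_exp A ` {- T..T})" by (intro compact_continuous_image matrix_exp_continuous compact_Icc)
  from compact_imp_bounded[OF this] obtain b where "\<forall>y\<in>matrix_exp A ` {- T..T}. norm y \<le> b"
    unfolding bounded_iff by blast
  then have b: "norm (matrix_exp A t) \<le> b" if "\<bar>t\<bar> \<le> T" for t using that by (auto simp: abs_le_iff)
  define d where "d = real CARD('n) * real CARD('n) * \<bar>b\<bar>"
  have bd: "norm (matrix_exp A t *v x) \<le> d * norm x" if "\<bar>t\<bar> \<le> T" for t x
  proof -
    have e: "\<bar>matrix_exp A t $ i $ j\<bar> \<le> \<bar>b\<bar>" for i j
      using b[OF that] component_le_norm_cart[of "matrix_exp A t $ i" j] Finite_Cartesian_Product.norm_nth_le[of "matrix_exp A t" i] by linarith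
    have "norm (matrix_exp A t *v x) \<le> (\<Sum>i\<in>UNIV. \<bar>(matrix_exp A t *v x) $ i\<bar>)" by (rule norm_le_l1_cart)
    also have "\<dots> \<le> (\<Sum>i\<in>(UNIV::'n set). \<Sum>j\<in>(UNIV::'n set). \<bar>b\<bar> * norm x)"
      unfolding matrix_vector_mult_def
      by (intro sum_mono, simp, intro order_trans[OF sum_abs] sum_bounded_above, unfold abs_mult, intro mult_mono e component_le_norm_cart) auto
    also have "\<dots> = d * norm x" by (simp add: d_def)
    finally show ?thesis .
  qed
  obtain a where a: "\<And>x. norm (A *v x) \<le> a * norm x" "a > 0"
    using bounded_linear.pos_bounded[OF matrix_vector_mul_bounded_linear[of A]] by (metis mult.commute)
  have d0: "d \<ge> 0" by (simp add: d_def)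
  define c where "c = max 1 (max d (d * a))"
  show thesis
  proof (rule that)
    show "c \<ge> 1" by (simp add: c_def)
    show "norm (matrix_exp A t *v x) \<le> c * norm x" if "\<bar>t\<bar> \<le> T" for t x
    proof -
      have "d \<le> c" by (simp add: c_def)
      then show ?thesis using bd[OF that, of x] mult_right_mono[of d c "norm x"] by simp
    qed
    fix s t x assume st: "\<bar>s\<bar> \<le> T" "\<bar>t\<bar> \<le> T"
    have "norm (matrix_exp A t *v x - matrix_exp A s *v x) \<le> (d * a * norm x) * norm (t - s)"
    proof (rule differentiable_bound[of "{- T..T}" "\<lambda>t. matrix_exp A t *v x" "\<lambda>t h. h *\<^sub>R (matrix_exp A t *v (A *v x))"])
      show "((\<lambda>t. matrix_exp A t *v x) has_derivative (\<lambda>h. h *\<^sub>R (matrix_exp A r *v (A *v x)))) (at r within {- T..T})" for r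
        using matrix_exp_vec_derivative[of A x r] unfolding has_vector_derivative_def by (rule has_derivative_at_withinI)
      show "onorm (\<lambda>h. h *\<^sub>R (matrix_exp A r *v (A *v x))) \<le> d * a * norm x" if "r \<in> {- T..T}" for r
      proof (rule onorm_le)
        fix h :: real
        have "norm (matrix_exp A r *v (A *v x)) \<le> d * (a * norm x)"
          using bd[of r "A *v x"] that mult_left_mono[OF a(1)[of x] d0] by (auto simp: abs_le_iff)
        from mult_right_mono[OF this, of "\<bar>h\<bar>"]
        show "norm (h *\<^sub>R (matrix_exp A r *v (A *v x))) \<le> d * a * norm x * norm h"
          by (simp add: mult_ac)
      qed
    qed (use st in auto)
    also have "\<dots> \<le> (c * norm x) * \<bar>t - s\<bar>"
      unfolding real_norm_def by (intro mult_right_mono) (auto simp: c_def)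
    finally show "norm (matrix_exp A t *v x - matrix_exp A s *v x) \<le> c * \<bar>t - s\<bar> * norm x" by (simp add: mult_ac)
  qed
qed

section \<open>Integrated covariances\<close>

definition cov_int :: "(real \<Rightarrow> real^'n^'n::finite) \<Rightarrow> real \<Rightarrow> real \<Rightarrow> real^'n^'n" where
  "cov_int b s t = (\<chi> i j. integral {s..t} (\<lambda>\<sigma>. b \<sigma> $ i $ j))"

locale covariance_path =
  fixes T :: real and b :: "real \<Rightarrow> real^'n^'n::finite"
  assumes T: "T > 0" and b_cont: "continuous_on {0..T} b"
    and b_psd: "\<And>t. t \<in> {0..T} \<Longrightarrow> sym_nonneg_matrix (b t)"
begin

lemma entry_integrable: "0 \<le> s \<Longrightarrow> t \<le> T \<Longrightarrow> (\<lambda>\<sigma>. b \<sigma> $ i $ j) integrable_on {s..t}"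
  by (intro integrable_continuous_interval continuous_intros continuous_on_subset[OF b_cont]) auto

lemma cov_int_add:
  "0 \<le> s \<Longrightarrow> s \<le> t \<Longrightarrow> t \<le> r \<Longrightarrow> r \<le> T \<Longrightarrow> cov_int b s r = cov_int b s t + cov_int b t r"
  by (simp add: cov_int_def vec_eq_iff Henstock_Kurzweil_Integration.integral_combine entry_integrable)

lemma cov_int_linear:
  assumes "0 \<le> s" "t \<le> T"
  shows "(\<Sum>i\<in>UNIV. \<Sum>j\<in>UNIV. c i j * cov_int b s t $ i $ j) = integral {s..t} (\<lambda>\<sigma>. \<Sum>i\<in>UNIV. \<Sum>j\<in>UNIV. c i j * b \<sigma> $ i $ j)"
  using assms by (simp add: cov_int_def integral_sum integrable_sum integrable_on_mult_right entry_integrable)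

lemma cov_int_psd:
  assumes "0 \<le> s" "t \<le> T"
  shows "sym_nonneg_matrix (cov_int b s t)"
proof -
  have sym: "b \<sigma> $ i $ j = b \<sigma> $ j $ i" if "\<sigma> \<in> {s..t}" for \<sigma> i j
    using b_psd[of \<sigma>] that assms unfolding sym_nonneg_matrix_def by (auto simp: transpose_def vec_eq_iff)
  have "transpose (cov_int b s t) = cov_int b s t"
    unfolding cov_int_def transpose_def by (simp add: vec_eq_iff) (intro allI integral_cong sym)
  moreover have "0 \<le> (cov_int b s t *v \<xi>) \<bullet> \<xi>" for \<xi>
  proof -
    have "(cov_int b s t *v \<xi>) \<bullet> \<xi> = (\<Sum>i\<in>UNIV. \<Sum>j\<in>UNIV. (\<xi> $ j * \<xi> $ i) * cov_int b s t $ i $ j)"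
      unfolding quadratic_form_sum by (simp add: mult_ac)
    also have "\<dots> = integral {s..t} (\<lambda>\<sigma>. (b \<sigma> *v \<xi>) \<bullet> \<xi>)"
      unfolding cov_int_linear[OF assms] quadratic_form_sum by (simp add: mult_ac)
    also have "\<dots> \<ge> 0"
    proof (rule integral_nonneg)
      show "(\<lambda>\<sigma>. (b \<sigma> *v \<xi>) \<bullet> \<xi>) integrable_on {s..t}"
        unfolding quadratic_form_sum using assms
        by (intro integrable_sum) (auto intro!: integrable_on_mult_left entry_integrable)
      show "0 \<le> (b \<sigma> *v \<xi>) \<bullet> \<xi>" if "\<sigma> \<in> {s..t}" for \<sigma>
        using b_psd[of \<sigma>] that assms unfolding sym_nonneg_matrix_def by auto
    qed
    finally show ?thesis .
  qed
  ultimately show ?thesis unfolding sym_nonneg_matrix_def by blast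
qed

lemma cov_int_trace_le:
  obtains c where "c \<ge> 0" "\<And>s t. 0 \<le> s \<Longrightarrow> s \<le> t \<Longrightarrow> t \<le> T \<Longrightarrow> trace (cov_int b s t) \<le> c * (t - s)"
proof -
  have "compact ((\<lambda>t. trace (b t)) ` {0..T})"
    unfolding trace_def by (intro compact_continuous_image continuous_intros b_cont compact_Icc)
  from compact_imp_bounded[OF this] obtain c where c: "\<forall>y\<in>(\<lambda>t. trace (b t)) ` {0..T}. norm y \<le> c"
    unfolding bounded_iff by blast
  show thesis
  proof (rule that)
    show "\<bar>c\<bar> \<ge> 0" by simp
    fix s t assume st: "0 \<le> s" "s \<le> t" "t \<le> T"
    have "trace (cov_int b s t) = integral {s..t} (\<lambda>\<sigma>. trace (b \<sigma>))"
      unfolding trace_def cov_int_def using st by (simp add: integral_sum entry_integrable)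
    also have "\<dots> \<le> integral {s..t} (\<lambda>\<sigma>. \<bar>c\<bar>)"
    proof (rule integral_le)
      show "(\<lambda>\<sigma>. trace (b \<sigma>)) integrable_on {s..t}"
        unfolding trace_def using st by (intro integrable_sum entry_integrable) auto
      show "trace (b \<sigma>) \<le> \<bar>c\<bar>" if "\<sigma> \<in> {s..t}" for \<sigma>
      proof -
        have "norm (trace (b \<sigma>)) \<le> c" using c that st by auto
        then show ?thesis by simp
      qed
    qed auto
    also have "\<dots> = \<bar>c\<bar> * (t - s)" using st by simp
    finally show "trace (cov_int b s t) \<le> \<bar>c\<bar> * (t - s)" .
  qed
qed

lemma cov_int_right_derivative:
  assumes "0 \<le> t" "t < T"
  shows "((\<lambda>h. cov_int b t (t + h) $ i $ j / h) \<longlongrightarrow> b t $ i $ j) (at_right 0)"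
proof -
  define g where "g u = integral {t..u} (\<lambda>\<sigma>. b \<sigma> $ i $ j)" for u
  have "(g has_vector_derivative b t $ i $ j) (at t within {t..T})"
    unfolding g_def using assms
    by (intro integral_has_vector_derivative continuous_intros continuous_on_subset[OF b_cont]) auto
  then have "(g has_real_derivative b t $ i $ j) (at t within {t..T})"
    by (simp add: has_real_derivative_iff_has_vector_derivative)
  then have "((\<lambda>y. (g y - g t) / (y - t)) \<longlongrightarrow> b t $ i $ j) (at_right t)"
    using assms by (simp add: has_field_derivative_iff at_within_Icc_at_right)
  then have "((\<lambda>h. (g (h + t) - g t) / h) \<longlongrightarrow> b t $ i $ j) (at_right 0)"
    by (subst (asm) at_right_to_0) (simp add: filterlim_filtermap)
  then show ?thesis by (simp add: g_def cov_int_def add.commute)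
qed

end

section \<open>The heat evolution\<close>

text \<open>A Lipschitz function cannot move on a null set. The functions g and -g are tilted by a
  small slope: at points outside N the tilt makes the growth nonpositive, and at a point s of N the
  growth is at most C (t - s), which is C times the measure of [s, t] without N.\<close>

lemma constant_of_right_derivative_zero:
  fixes g :: "real \<Rightarrow> real"
  assumes ab: "a \<le> b" and N: "countable N"
    and lip: "\<And>s t. a \<le> s \<Longrightarrow> s \<le> t \<Longrightarrow> t \<le> b \<Longrightarrow> \<bar>g t - g s\<bar> \<le> C * (t - s)"
    and der: "\<And>s. a \<le> s \<Longrightarrow> s < b \<Longrightarrow> s \<notin> N \<Longrightarrow> ((\<lambda>h. (g (s + h) - g s) / h) \<longlongrightarrow> 0) (at_right 0)"
  shows "g b = g a"
proof -
  have Nn: "N \<in> null_sets lebesgue"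
    using countable_imp_null_set_lborel[OF N] by (simp add: null_sets_completionI)
  have main: "f b - f a \<le> \<eta> * (b - a)"
    if \<eta>: "\<eta> > 0" and lip: "\<And>s t. a \<le> s \<Longrightarrow> s \<le> t \<Longrightarrow> t \<le> b \<Longrightarrow> \<bar>f t - f s\<bar> \<le> C * (t - s)"
      and der: "\<And>s. a \<le> s \<Longrightarrow> s < b \<Longrightarrow> s \<notin> N \<Longrightarrow> ((\<lambda>h. (f (s + h) - f s) / h) \<longlongrightarrow> 0) (at_right 0)"
    for f :: "real \<Rightarrow> real" and \<eta>
  proof -
    \<comment> \<open>Index 0 serves the points where the right derivative vanishes; there the cost
      is 0, since nothing lies outside UNIV. The other indices serve the exceptional points.\<close>
    define E where "E k = (if k = 0 then UNIV else N)" for k :: nat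
    have "f b - \<eta> * b \<le> f a - \<eta> * a"
    proof (rule nonincreasing_up_to_small_sets[where E = E and C = "\<bar>C\<bar>" and M = "\<lambda>t. f t - \<eta> * t"])
      have "\<bar>C\<bar>-lipschitz_on {a..b} f"
      proof (rule lipschitz_onI)
        fix x y assume xy: "x \<in> {a..b}" "y \<in> {a..b}"
        have "C * \<bar>x - y\<bar> \<le> \<bar>C\<bar> * \<bar>x - y\<bar>" by (intro mult_right_mono) auto
        moreover have "\<bar>f x - f y\<bar> \<le> C * \<bar>x - y\<bar>"
          using lip[of x y] lip[of y x] xy by (cases "x \<le> y") (auto simp: abs_minus_commute)
        ultimately show "dist (f x) (f y) \<le> \<bar>C\<bar> * dist x y" by (simp add: dist_real_def)
      qed simp
      then show "continuous_on {a..b} (\<lambda>t. f t - \<eta> * t)"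
        by (intro continuous_intros lipschitz_on_continuous_on)
      show "E k \<in> sets lebesgue" for k using Nn by (auto simp: E_def null_setsD2)
      fix s assume s: "a \<le> s" "s < b"
      show "\<exists>k \<gamma>. s \<in> E k \<and> 0 < \<gamma> \<and> (\<forall>t. s < t \<and> t < s + \<gamma> \<and> t \<le> b \<longrightarrow>
           f t - \<eta> * t - (f s - \<eta> * s) \<le> \<bar>C\<bar> * measure lebesgue ({s..t} - E k))"
      proof (cases "s \<in> N")
        case True
        have "f t - \<eta> * t - (f s - \<eta> * s) \<le> \<bar>C\<bar> * measure lebesgue ({s..t} - N)" if t: "s < t" "t \<le> b" for t
        proof -
          have me: "measure lebesgue ({s..t} - N) = t - s"
            using t Nn by (simp add: measure_Diff_null_set)
          have "f t - f s \<le> C * (t - s)" using lip[of s t] s t by auto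
          moreover have "C * (t - s) \<le> \<bar>C\<bar> * (t - s)" using t by (intro mult_right_mono) auto
          moreover have "0 \<le> \<eta> * t - \<eta> * s" using \<eta> t by simp
          ultimately show ?thesis unfolding me by linarith
        qed
        then show ?thesis using True by (intro exI[of _ "1::nat"] exI[of _ "1::real"]) (auto simp: E_def)
      next
        case False
        have "eventually (\<lambda>h. (f (s + h) - f s) / h < \<eta>) (at_right 0)"
          by (rule order_tendstoD(2)[OF der[OF s False] \<eta>])
        then obtain \<gamma> where \<gamma>: "\<gamma> > 0" "\<And>h. 0 < h \<Longrightarrow> h < \<gamma> \<Longrightarrow> (f (s + h) - f s) / h < \<eta>"
          by (auto simp: eventually_at_right_field)
        have "f t - \<eta> * t - (f s - \<eta> * s) \<le> 0" if "s < t" "t < s + \<gamma>" for t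
          using \<gamma>(2)[of "t - s"] that by (simp add: field_simps)
        then show ?thesis using \<gamma>(1) by (intro exI[of _ "0::nat"] exI[of _ \<gamma>]) (auto simp: E_def)
      qed
    qed (use ab in auto)
    then show ?thesis by (simp add: algebra_simps)
  qed
  have abs: "\<bar>g b - g a\<bar> \<le> \<eta> * (b - a)" if "\<eta> > 0" for \<eta>
  proof -
    have "((\<lambda>h. (- g (s + h) - - g s) / h) \<longlongrightarrow> 0) (at_right 0)" if "a \<le> s" "s < b" "s \<notin> N" for s
      using tendsto_minus[OF der[OF that]] by (simp add: diff_divide_distrib add_divide_distrib)
    then have "- g b - - g a \<le> \<eta> * (b - a)" using lip by (intro main[OF that]) (auto simp: abs_minus_commute)
    moreover have "g b - g a \<le> \<eta> * (b - a)" by (rule main[OF that lip der])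
    ultimately show ?thesis by linarith
  qed
  have "\<bar>g b - g a\<bar> \<le> 0"
  proof (rule field_le_epsilon)
    fix e :: real assume "e > 0"
    then have "\<bar>g b - g a\<bar> \<le> e / (b - a + 1) * (b - a)" using ab by (intro abs) simp
    also have "\<dots> \<le> e" using \<open>e > 0\<close> ab by (simp add: field_simps)
    finally show "\<bar>g b - g a\<bar> \<le> 0 + e" by simp
  qed
  then show ?thesis by simp
qed

text \<open>The second argument is frozen on a mesh of width 1/(n + 1), which leaves countably many
  measurable pieces; continuity in that argument gives the limit on the diagonal.\<close>

lemma caratheodory_measurable:
  fixes \<Phi> :: "real \<Rightarrow> real \<Rightarrow> real"
  assumes t: "0 \<le> t" and m: "\<And>r. r \<in> {0..t} \<Longrightarrow> (\<lambda>s. \<Phi> s r) \<in> borel_measurable borel"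
    and c: "\<And>s. continuous_on {0..t} (\<Phi> s)"
  shows "(\<lambda>s. indicator {0..t} s * \<Phi> s s) \<in> borel_measurable borel"
proof -
  \<comment> \<open>The truncation to [0, t] keeps the mesh points where measurability and
    continuity are assumed.\<close>
  define \<theta> where "\<theta> n s = max 0 (min t (real_of_int \<lfloor>real (Suc n) * s\<rfloor> / real (Suc n)))" for n s
  have \<theta>: "\<theta> n s \<in> {0..t}" for n s using t by (auto simp: \<theta>_def)
  have near: "\<bar>\<theta> n s - s\<bar> \<le> 1 / real (Suc n)" if "s \<in> {0..t}" for n s
  proof -
    have "real_of_int \<lfloor>real (Suc n) * s\<rfloor> / real (Suc n) \<le> s"
      by (simp add: pos_divide_le_eq mult.commute del: of_nat_Suc)
    moreover have "real (Suc n) * s < real_of_int \<lfloor>real (Suc n) * s\<rfloor> + 1" by linarith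
    then have "s < real_of_int \<lfloor>real (Suc n) * s\<rfloor> / real (Suc n) + 1 / real (Suc n)"
      by (simp add: add_divide_distrib[symmetric] pos_less_divide_eq mult.commute del: of_nat_Suc)
    ultimately show ?thesis using that unfolding \<theta>_def by (auto simp: max_def min_def abs_if)
  qed
  show ?thesis
  proof (rule borel_measurable_LIMSEQ_real)
    show "(\<lambda>s. indicator {0..t} s * \<Phi> s (\<theta> n s)) \<in> borel_measurable borel" for n
    proof -
      have "(\<lambda>s. indicator {0..t} s * \<Phi> s (max 0 (min t (real_of_int \<lfloor>real (Suc n) * s\<rfloor> / real (Suc n))))) \<in> borel_measurable borel"
      proof (rule measurable_compose_countable[where g = "\<lambda>s. \<lfloor>real (Suc n) * s\<rfloor>"
            and f = "\<lambda>k s. indicator {0..t} s * \<Phi> s (max 0 (min t (real_of_int k / real (Suc n))))"])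
        show "(\<lambda>s. indicator {0..t} s * \<Phi> s (max 0 (min t (real_of_int k / real (Suc n))))) \<in> borel_measurable borel" for k
          using t by (intro borel_measurable_times m) auto
        show "(\<lambda>s. \<lfloor>real (Suc n) * s\<rfloor>) \<in> borel \<rightarrow>\<^sub>M count_space UNIV"
          by measurable
      qed
      then show ?thesis by (simp add: \<theta>_def)
    qed
    show "(\<lambda>n. indicator {0..t} s * \<Phi> s (\<theta> n s)) \<longlonglongrightarrow> indicator {0..t} s * \<Phi> s s" for s
    proof (cases "s \<in> {0..t}")
      case True
      have "(\<lambda>n. \<theta> n s - s) \<longlonglongrightarrow> 0"
        by (rule Lim_null_comparison[OF _ LIMSEQ_inverse_real_of_nat])
           (use near[OF True] in \<open>auto simp: inverse_eq_divide\<close>)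
      then have "(\<lambda>n. \<theta> n s) \<longlonglongrightarrow> s" by (simp add: LIM_zero_iff)
      then have "(\<lambda>n. \<Phi> s (\<theta> n s)) \<longlonglongrightarrow> \<Phi> s s"
        using c[of s] True \<theta> unfolding continuous_on_sequentially by (auto simp: o_def)
      then show ?thesis by (intro tendsto_mult_left)
    qed simp
  qed
qed

section \<open>Sources and Duhamel's integral\<close>

text \<open>A single countable exceptional set \<open>N\<close> serves all points and all
  derivatives, whereas a source in \<open>Bb_Cc_infty\<close> comes with one finite set per
  point.\<close>

locale jet_source =
  fixes T :: real and M :: "nat \<Rightarrow> real" and F :: "real \<Rightarrow> (real^'n::finite) list \<Rightarrow> real^'n \<Rightarrow> real" and N :: "real set"
  assumes F_jet: "\<And>s. jet M (F s)"
    and F_meas: "\<And>vs x. (\<lambda>s. F s vs x) \<in> borel_measurable borel"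
    and N: "countable N"
    and F_right: "\<And>s vs x. 0 \<le> s \<Longrightarrow> s < T \<Longrightarrow> s \<notin> N \<Longrightarrow> ((\<lambda>h. F (s + h) vs x) \<longlongrightarrow> F s vs x) (at_right 0)"

definition heat_flow :: "(real \<Rightarrow> real^'n^'n::finite) \<Rightarrow> (real \<Rightarrow> (real^'n) list \<Rightarrow> real^'n \<Rightarrow> real) \<Rightarrow> real \<Rightarrow> (real^'n) list \<Rightarrow> real^'n \<Rightarrow> real" where
  "heat_flow b F t vs x = (LBINT s:{0..t}. heat (cov_int b s t) (F s) vs x)"

lemma set_integral_bound_Icc:
  fixes g :: "real \<Rightarrow> real"
  assumes "a \<le> b" "set_integrable lborel {a..b} g" "\<And>s. s \<in> {a..b} \<Longrightarrow> \<bar>g s - d\<bar> \<le> C"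
  shows "\<bar>(LBINT s:{a..b}. g s) - (b - a) * d\<bar> \<le> (b - a) * C"
proof -
  have ci: "set_integrable lborel {a..b} (\<lambda>_. c)" for c :: real by (rule borel_integrable_atLeastAtMost') simp
  have const: "(LBINT s:{a..b}. c) = (b - a) * c" for c :: real using assms(1) by (simp add: set_lebesgue_integral_def)
  have "(LBINT s:{a..b}. g s) - (b - a) * d = (LBINT s:{a..b}. g s - d)"
    using assms(2) ci by (simp add: set_integral_diff const)
  also have "\<bar>\<dots>\<bar> \<le> (LBINT s:{a..b}. \<bar>g s - d\<bar>)"
    using set_integral_norm_bound[of lborel "{a..b}" "\<lambda>s. g s - d"] assms(2) ci by simp
  also have "\<dots> \<le> (LBINT s:{a..b}. C)"
    by (intro set_integral_mono set_integrable_abs set_integral_diff assms ci)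
  finally show ?thesis by (simp add: const)
qed

lemma set_integrable_finite_sum:
  fixes f :: "'i \<Rightarrow> 'a \<Rightarrow> real"
  shows "(\<And>i. i \<in> I \<Longrightarrow> set_integrable N A (f i)) \<Longrightarrow> set_integrable N A (\<lambda>x. \<Sum>i\<in>I. f i x)"
  unfolding set_integrable_def by (simp add: sum_distrib_left)

lemma set_integral_finite_sum:
  fixes f :: "'i \<Rightarrow> 'a \<Rightarrow> real"
  shows "(\<And>i. i \<in> I \<Longrightarrow> set_integrable N A (f i)) \<Longrightarrow> (LINT x:A|N. \<Sum>i\<in>I. f i x) = (\<Sum>i\<in>I. LINT x:A|N. f i x)"
  unfolding set_integrable_def set_lebesgue_integral_def by (simp add: sum_distrib_left)

lemma set_integrable_bounded_Icc:
  fixes g :: "real \<Rightarrow> real"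
  assumes "(\<lambda>s. indicator {a..b} s * g s) \<in> borel_measurable borel" "\<And>s. s \<in> {a..b} \<Longrightarrow> \<bar>g s\<bar> \<le> C"
  shows "set_integrable lborel {a..b} g"
  unfolding set_integrable_def
proof (rule Bochner_Integration.integrable_bound)
  show "integrable lborel (\<lambda>s. indicator {a..b} s *\<^sub>R C)"
    using borel_integrable_atLeastAtMost'[of a b "\<lambda>_. C"] by (simp add: set_integrable_def)
  show "AE s in lborel. norm (indicator {a..b} s *\<^sub>R g s) \<le> norm (indicator {a..b} s *\<^sub>R C)"
    using assms(2) by (intro AE_I2) (auto simp: indicator_def intro: order_trans[OF _ abs_ge_self])
qed (use assms(1) in simp)

locale heat_evolution = covariance_path T b + jet_source T M F N
  for T :: real and b :: "real \<Rightarrow> real^'n^'n::finite" and M and F :: "real \<Rightarrow> (real^'n) list \<Rightarrow> real^'n \<Rightarrow> real" and N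
begin

abbreviation "V \<equiv> heat_flow b F"

lemma heat_jet: "0 \<le> s \<Longrightarrow> t \<le> T \<Longrightarrow> jet M (heat (cov_int b s t) (F s'))"
  by (intro jet_heat F_jet cov_int_psd)

lemma heat_split:
  assumes "0 \<le> s" "s \<le> t" "t \<le> r" "r \<le> T"
  shows "heat (cov_int b s r) (F s') vs x = heat (cov_int b t r) (heat (cov_int b s t) (F s')) vs x"
proof -
  have "cov_int b s r = cov_int b t r + cov_int b s t" using cov_int_add[OF assms] by (simp add: add.commute)
  then show ?thesis using assms by (simp add: heat_semigroup[OF F_jet] cov_int_psd)
qed

lemma heat_split':
  assumes "0 \<le> s" "s \<le> t" "t \<le> r" "r \<le> T"
  shows "heat (cov_int b s r) (F s') vs x = heat (cov_int b s t) (heat (cov_int b t r) (F s')) vs x"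
  using assms by (simp add: cov_int_add[OF assms] heat_semigroup[OF F_jet] cov_int_psd)

text \<open>The time s occurs both as the time of the source and as the start of the covariance. For
  a fixed start the dependence is measurable, and in the start it is Lipschitz by the first-order
  bound, so \<open>caratheodory_measurable\<close> applies to the diagonal.\<close>

lemma integrand_measurable:
  assumes t: "0 \<le> t" "t \<le> T"
  shows "(\<lambda>s. indicator {0..t} s * heat (cov_int b s t) (F s) vs x) \<in> borel_measurable borel"
proof (rule caratheodory_measurable[OF t(1), of "\<lambda>s r. heat (cov_int b r t) (F s) vs x"])
  show "(\<lambda>s. heat (cov_int b r t) (F s) vs x) \<in> borel_measurable borel" if "r \<in> {0..t}" for r
    using that t by (intro heat_measurable[OF F_jet cov_int_psd F_meas]) auto
  fix s
  obtain c where c: "c \<ge> 0" "\<And>s t. 0 \<le> s \<Longrightarrow> s \<le> t \<Longrightarrow> t \<le> T \<Longrightarrow> trace (cov_int b s t) \<le> c * (t - s)"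
    using cov_int_trace_le by blast
  define m where "m = 2 * M (length vs + 2) * norm_prod vs"
  have m: "m \<ge> 0" unfolding m_def using jet_nonneg[OF F_jet] norm_prod_nonneg by (intro mult_nonneg_nonneg) auto
  have le: "\<bar>heat (cov_int b r t) (F s) vs x - heat (cov_int b r' t) (F s) vs x\<bar> \<le> m * c * (r' - r)"
    if "0 \<le> r" "r \<le> r'" "r' \<le> t" for r r'
  proof -
    have "\<bar>heat (cov_int b r r') (heat (cov_int b r' t) (F s)) vs x - heat (cov_int b r' t) (F s) vs x\<bar> \<le> m * trace (cov_int b r r')"
      unfolding m_def using that t by (intro heat_first_order heat_jet cov_int_psd) auto
    also have "\<dots> \<le> m * (c * (r' - r))" using c(2)[of r r'] that t m by (intro mult_left_mono) auto
    finally show ?thesis using that t by (simp add: heat_split' mult.assoc)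
  qed
  have "(m * c)-lipschitz_on {0..t} (\<lambda>r. heat (cov_int b r t) (F s) vs x)"
  proof (rule lipschitz_onI)
    fix r r' assume "r \<in> {0..t}" "r' \<in> {0..t}"
    then show "dist (heat (cov_int b r t) (F s) vs x) (heat (cov_int b r' t) (F s) vs x) \<le> m * c * dist r r'"
      using le[of r r'] le[of r' r] by (cases "r \<le> r'") (auto simp: dist_real_def abs_minus_commute)
  qed (use m c in auto)
  then show "continuous_on {0..t} (\<lambda>r. heat (cov_int b r t) (F s) vs x)" by (rule lipschitz_on_continuous_on)
qed

lemma integrand_integrable:
  assumes t: "0 \<le> t" "t \<le> T"
  shows "set_integrable lborel {0..t} (\<lambda>s. heat (cov_int b s t) (F s) vs x)"
  by (rule set_integrable_bounded_Icc[OF integrand_measurable[OF t]])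
     (use t in \<open>auto intro: jet_bound[OF heat_jet]\<close>)

lemma flow_jet:
  assumes t: "0 \<le> t" "t \<le> T"
  shows "jet (\<lambda>k. T * M k) (V t)"
proof (rule jet_mono)
  show "jet (\<lambda>k. (t - 0) * M k) (V t)"
    unfolding heat_flow_def[abs_def] using t
    by (intro jet_set_integral heat_jet integrand_integrable) auto
  show "(t - 0) * M k \<le> T * M k" for k using t jet_nonneg[OF F_jet] by (intro mult_right_mono) auto
qed

text \<open>By the semigroup law the increment consists of the sources in [t, t + h] and of the
  further smoothing of what was present at time t.\<close>

lemma flow_increment:
  assumes t: "0 \<le> t" "0 \<le> h" "t + h \<le> T"
  shows "V (t + h) vs y - V t vs y = (LBINT s:{t..t+h}. heat (cov_int b s (t + h)) (F s) vs y)
     + (LBINT s:{0..t}. heat (cov_int b t (t + h)) (heat (cov_int b s t) (F s)) vs y - heat (cov_int b s t) (F s) vs y)"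
proof -
  let ?g = "\<lambda>s. heat (cov_int b s (t + h)) (F s) vs y"
  have th: "0 \<le> t + h" using t by simp
  have i: "set_integrable lborel X ?g" if "X \<subseteq> {0..t+h}" "X \<in> sets borel" for X
    by (rule set_integrable_subset[OF integrand_integrable[OF th t(3)]]) (use that in auto)
  have "(LBINT s:{0..t+h}. ?g s) = (LBINT s:{0..t}. ?g s) + (LBINT s:{t..t+h}. ?g s)"
  proof -
    have e: "{0..t} \<union> {t..t+h} = {0..t+h}" using t by auto
    have "(LBINT s:{0..t} \<union> {t..t+h}. ?g s) = (LBINT s:{0..t}. ?g s) + (LBINT s:{t..t+h}. ?g s)"
    proof (rule set_integral_Un_AE)
      show "AE x in lborel. \<not> (x \<in> {0..t} \<and> x \<in> {t..t+h})"
        by (rule AE_mp[OF AE_lborel_singleton[of t]], rule AE_I2) auto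
    qed (use t i in auto)
    then show ?thesis by (simp add: e)
  qed
  moreover have "(LBINT s:{0..t}. ?g s) = (LBINT s:{0..t}. heat (cov_int b t (t + h)) (heat (cov_int b s t) (F s)) vs y)"
    using t by (intro set_lebesgue_integral_cong) (auto simp: heat_split[of _ t "t + h"])
  moreover have "set_integrable lborel {0..t} (\<lambda>s. heat (cov_int b t (t + h)) (heat (cov_int b s t) (F s)) vs y)"
  proof -
    have "set_integrable lborel {0..t} ?g" using i t by auto
    then show ?thesis
      by (rule set_integrable_cong[THEN iffD1, rotated -1]) (use t in \<open>auto simp: heat_split[of _ t "t + h"]\<close>)
  qed
  ultimately show ?thesis
    unfolding heat_flow_def using integrand_integrable[of t vs y] t by (simp add: set_integral_diff)
qed

lemma flow_time_lipschitz:
  obtains C where "C \<ge> 0" "\<And>s t y. 0 \<le> s \<Longrightarrow> s \<le> t \<Longrightarrow> t \<le> T \<Longrightarrow> \<bar>V t vs y - V s vs y\<bar> \<le> C * (t - s)"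
proof -
  obtain c where c: "c \<ge> 0" "\<And>s t. 0 \<le> s \<Longrightarrow> s \<le> t \<Longrightarrow> t \<le> T \<Longrightarrow> trace (cov_int b s t) \<le> c * (t - s)"
    using cov_int_trace_le by blast
  define m0 where "m0 = M (length vs) * norm_prod vs"
  define m2 where "m2 = 2 * M (length vs + 2) * norm_prod vs"
  have m: "m0 \<ge> 0" "m2 \<ge> 0" unfolding m0_def m2_def
    by (intro mult_nonneg_nonneg jet_nonneg[OF F_jet] norm_prod_nonneg; simp)+
  show thesis
  proof (rule that)
    \<comment> \<open>The rate of the new sources plus the rate of smoothing, the latter integrated
      over source times of total length at most T.\<close>
    show "m0 + T * (m2 * c) \<ge> 0" using m c T by simp
    fix s t y assume st: "0 \<le> s" "s \<le> t" "t \<le> T"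
    let ?g = "\<lambda>\<sigma>. heat (cov_int b \<sigma> t) (F \<sigma>) vs y"
    let ?k = "\<lambda>\<sigma>. heat (cov_int b s t) (heat (cov_int b \<sigma> s) (F \<sigma>)) vs y - heat (cov_int b \<sigma> s) (F \<sigma>) vs y"
    have "set_integrable lborel {s..t} ?g"
      by (rule set_integrable_subset[OF integrand_integrable[of t]]) (use st in auto)
    then have "\<bar>(LBINT \<sigma>:{s..t}. ?g \<sigma>) - (t - s) * 0\<bar> \<le> (t - s) * m0"
      unfolding m0_def using st by (intro set_integral_bound_Icc) (auto intro!: jet_bound[OF heat_jet])
    moreover have "set_integrable lborel {0..s} ?k"
    proof -
      have "set_integrable lborel {0..s} ?g"
        by (rule set_integrable_subset[OF integrand_integrable[of t]]) (use st in auto)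
      then have "set_integrable lborel {0..s} (\<lambda>\<sigma>. ?g \<sigma> - heat (cov_int b \<sigma> s) (F \<sigma>) vs y)"
        using st by (intro set_integral_diff(1) integrand_integrable) auto
      then show ?thesis
        by (rule set_integrable_cong[THEN iffD1, rotated -1]) (use st in \<open>auto simp: heat_split[of _ s t]\<close>)
    qed
    then have "\<bar>(LBINT \<sigma>:{0..s}. ?k \<sigma>) - (s - 0) * 0\<bar> \<le> (s - 0) * (m2 * (c * (t - s)))"
    proof (rule set_integral_bound_Icc[OF st(1)])
      fix \<sigma> assume \<sigma>: "\<sigma> \<in> {0..s}"
      have "\<bar>?k \<sigma>\<bar> \<le> m2 * trace (cov_int b s t)"
        unfolding m2_def using \<sigma> st by (intro heat_first_order heat_jet cov_int_psd) auto
      also have "\<dots> \<le> m2 * (c * (t - s))" using c(2)[OF st] m by (intro mult_left_mono) auto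
      finally show "\<bar>?k \<sigma> - 0\<bar> \<le> m2 * (c * (t - s))" by simp
    qed
    moreover have "s * (m2 * (c * (t - s))) \<le> T * (m2 * (c * (t - s)))" using st m c by (intro mult_right_mono) auto
    moreover have "V t vs y - V s vs y = (LBINT \<sigma>:{s..t}. ?g \<sigma>) + (LBINT \<sigma>:{0..s}. ?k \<sigma>)"
      using flow_increment[of s "t - s" vs y] st by simp
    ultimately show "\<bar>V t vs y - V s vs y\<bar> \<le> (m0 + T * (m2 * c)) * (t - s)"
      by (simp add: algebra_simps)
  qed
qed

lemma flow_tendsto_space:
  assumes "0 \<le> t" "t \<le> T" "(y \<longlongrightarrow> x) \<F>"
  shows "((\<lambda>h. V t vs (y h)) \<longlongrightarrow> V t vs x) \<F>"
  using continuous_on_tendsto_compose[OF jet_continuous[OF flow_jet[OF assms(1,2)], of UNIV] assms(3)] by simp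

text \<open>The point may move with h, because a fixed z in the original coordinates is the moving
  point e^{(t+h)A} z of the frame. New sources give \<open>F t\<close>, and the further smoothing
  gives the generator applied to \<open>V t\<close>.\<close>

lemma flow_right_derivative:
  assumes t: "0 \<le> t" "t < T" "t \<notin> N" and y: "(y \<longlongrightarrow> x) (at_right 0)"
  shows "((\<lambda>h. (V (t + h) vs (y h) - V t vs (y h)) / h) \<longlongrightarrow> F t vs x + diffusion (b t) (V t) vs x) (at_right 0)"
proof -
  obtain c where c: "c \<ge> 0" "\<And>s t. 0 \<le> s \<Longrightarrow> s \<le> t \<Longrightarrow> t \<le> T \<Longrightarrow> trace (cov_int b s t) \<le> c * (t - s)"
    using cov_int_trace_le by blast
  define m1 where "m1 = M (length vs + 1) * norm_prod vs"
  define m2 where "m2 = 2 * M (length vs + 2) * norm_prod vs"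
  define m4 where "m4 = 14 * real CARD('n) * M (length vs + 4) * norm_prod vs"
  have m: "m1 \<ge> 0" "m2 \<ge> 0" "m4 \<ge> 0" unfolding m1_def m2_def m4_def
    by (intro mult_nonneg_nonneg jet_nonneg[OF F_jet] norm_prod_nonneg; simp)+
  define A where "A h = (LBINT s:{t..t+h}. heat (cov_int b s (t + h)) (F s) vs (y h))" for h
  define D where "D h = (LBINT s:{0..t}. heat (cov_int b t (t + h)) (heat (cov_int b s t) (F s)) vs (y h) - heat (cov_int b s t) (F s) vs (y h))" for h
  have small: "eventually (\<lambda>h. 0 < h \<and> h < T - t) (at_right 0)"
    using t by (auto simp: eventually_at_right_field intro!: exI[of _ "T - t"])
  have h0: "((\<lambda>h::real. h) \<longlongrightarrow> 0) (at_right 0)" by (rule tendsto_ident_at)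
  have yn: "((\<lambda>h. norm (y h - x)) \<longlongrightarrow> 0) (at_right 0)" using y by (simp add: tendsto_norm_zero_iff LIM_zero_iff)
  have Alim: "((\<lambda>h. A h / h) \<longlongrightarrow> F t vs x) (at_right 0)"
  proof (rule tendstoI)
    fix e :: real assume e: "e > 0"
    obtain \<gamma> where \<gamma>: "\<gamma> > 0" "\<And>h. 0 < h \<Longrightarrow> h < \<gamma> \<Longrightarrow> \<bar>F (t + h) vs x - F t vs x\<bar> < e / 3"
      using tendstoD[OF F_right[OF t, of vs x], of "e / 3"] e by (auto simp: eventually_at_right_field dist_real_def)
    have l1: "((\<lambda>h. m2 * (c * h) + m1 * norm (y h - x)) \<longlongrightarrow> m2 * (c * 0) + m1 * 0) (at_right 0)"
      by (intro tendsto_intros h0 yn)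
    have ev: "eventually (\<lambda>h. m2 * (c * h) + m1 * norm (y h - x) < e / 3) (at_right 0)"
      by (rule order_tendstoD(2)[OF l1]) (use e in simp)
    have ev\<gamma>: "eventually (\<lambda>h. h < \<gamma>) (at_right 0)" using \<gamma>(1) by (auto simp: eventually_at_right_field)
    show "eventually (\<lambda>h. dist (A h / h) (F t vs x) < e) (at_right 0)"
      using small ev ev\<gamma>
    proof eventually_elim
      case (elim h)
      have "\<bar>A h - (t + h - t) * F t vs x\<bar> \<le> (t + h - t) * (e / 3 + (m2 * (c * h) + m1 * norm (y h - x)))"
        unfolding A_def
      proof (rule set_integral_bound_Icc)
        show "set_integrable lborel {t..t+h} (\<lambda>s. heat (cov_int b s (t + h)) (F s) vs (y h))"
          by (rule set_integrable_subset[OF integrand_integrable[of "t + h"]]) (use elim t in auto)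
        fix s assume s: "s \<in> {t..t+h}"
        have "\<bar>heat (cov_int b s (t + h)) (F s) vs (y h) - F s vs (y h)\<bar> \<le> m2 * trace (cov_int b s (t + h))"
          unfolding m2_def using s t elim by (intro heat_first_order F_jet cov_int_psd) auto
        moreover have "m2 * trace (cov_int b s (t + h)) \<le> m2 * (c * h)"
        proof (intro mult_left_mono m)
          have "trace (cov_int b s (t + h)) \<le> c * (t + h - s)" by (rule c(2)) (use s t elim in auto)
          also have "\<dots> \<le> c * h" using s c by (intro mult_left_mono) auto
          finally show "trace (cov_int b s (t + h)) \<le> c * h" .
        qed
        moreover have "\<bar>F s vs (y h) - F s vs x\<bar> \<le> m1 * norm (y h - x)"
          unfolding m1_def by (rule jet_lipschitz[OF F_jet])
        moreover have "\<bar>F s vs x - F t vs x\<bar> \<le> e / 3"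
        proof (cases "s = t")
          case False
          then show ?thesis using \<gamma>(2)[of "s - t"] s elim by simp
        qed (use e in simp)
        ultimately show "\<bar>heat (cov_int b s (t + h)) (F s) vs (y h) - F t vs x\<bar> \<le> e / 3 + (m2 * (c * h) + m1 * norm (y h - x))"
          by linarith
      qed (use elim in simp)
      then have "\<bar>A h - h * F t vs x\<bar> \<le> h * (e / 3 + (m2 * (c * h) + m1 * norm (y h - x)))" by simp
      also have "\<dots> < h * e" using elim e by (intro mult_strict_left_mono) auto
      finally have "\<bar>A h - h * F t vs x\<bar> / h < e" using elim by (simp add: pos_divide_less_eq mult.commute)
      moreover have "\<bar>A h / h - F t vs x\<bar> = \<bar>A h - h * F t vs x\<bar> / h"
      proof -
        have "A h / h - F t vs x = (A h - h * F t vs x) / h" using elim by (simp add: field_simps)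
        then show ?thesis using elim by (simp add: abs_divide)
      qed
      ultimately show ?case by (simp add: dist_real_def)
    qed
  qed
  define \<Delta> where "\<Delta> h = cov_int b t (t + h)" for h
  have int: "set_integrable lborel {0..t} (\<lambda>s. heat (cov_int b s t) (F s) us z)" for us z
    using t by (intro integrand_integrable) auto
  \<comment> \<open>\<open>diffusion\<close> is a finite combination of derivatives, so it passes
    under the time integral.\<close>
  have dint: "(LBINT s:{0..t}. diffusion Q (heat (cov_int b s t) (F s)) vs z) = diffusion Q (V t) vs z"
    "set_integrable lborel {0..t} (\<lambda>s. diffusion Q (heat (cov_int b s t) (F s)) vs z)" for Q z
    unfolding diffusion_def heat_flow_def
    by (simp_all add: set_integral_finite_sum set_integrable_finite_sum int)
  \<comment> \<open>The remainder in the expansion of the semigroup is quadratic in h, uniformly in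
    the source time, and so vanishes after division by h.\<close>
  have Dlim: "((\<lambda>h. (D h - diffusion (\<Delta> h) (V t) vs (y h)) / h) \<longlongrightarrow> 0) (at_right 0)"
  proof (rule Lim_null_comparison)
    show "((\<lambda>h. t * (m4 * c\<^sup>2) * h) \<longlongrightarrow> 0) (at_right 0)"
      using tendsto_mult_left[OF h0, of "t * (m4 * c\<^sup>2)"] by simp
    show "eventually (\<lambda>h. norm ((D h - diffusion (\<Delta> h) (V t) vs (y h)) / h) \<le> t * (m4 * c\<^sup>2) * h) (at_right 0)"
      using small
    proof eventually_elim
      case (elim h)
      have psd: "sym_nonneg_matrix (\<Delta> h)" unfolding \<Delta>_def using elim t by (intro cov_int_psd) auto
      let ?G = "\<lambda>s. heat (cov_int b s t) (F s)"
      have ih: "set_integrable lborel {0..t} (\<lambda>s. heat (\<Delta> h) (?G s) vs (y h))"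
      proof -
        have "set_integrable lborel {0..t} (\<lambda>s. heat (cov_int b s (t + h)) (F s) vs (y h))"
          by (rule set_integrable_subset[OF integrand_integrable[of "t + h"]]) (use elim t in auto)
        then show ?thesis unfolding \<Delta>_def
          by (rule set_integrable_cong[THEN iffD1, rotated -1]) (use elim t in \<open>auto simp: heat_split[of _ t "t + h"]\<close>)
      qed
      have "D h - diffusion (\<Delta> h) (V t) vs (y h) = (LBINT s:{0..t}. heat (\<Delta> h) (?G s) vs (y h) - ?G s vs (y h) - diffusion (\<Delta> h) (?G s) vs (y h))"
        unfolding D_def \<Delta>_def[symmetric] dint(1)[symmetric]
        by (intro set_integral_diff(2)[symmetric] set_integral_diff(1) ih int dint(2))
      moreover have "\<bar>(LBINT s:{0..t}. heat (\<Delta> h) (?G s) vs (y h) - ?G s vs (y h) - diffusion (\<Delta> h) (?G s) vs (y h)) - (t - 0) * 0\<bar> \<le> (t - 0) * (m4 * (c * h)\<^sup>2)"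
      proof (rule set_integral_bound_Icc[OF t(1)])
        show "set_integrable lborel {0..t} (\<lambda>s. heat (\<Delta> h) (?G s) vs (y h) - ?G s vs (y h) - diffusion (\<Delta> h) (?G s) vs (y h))"
          by (intro set_integral_diff(1) ih int dint(2))
        fix s assume s: "s \<in> {0..t}"
        have "\<bar>heat (\<Delta> h) (?G s) vs (y h) - ?G s vs (y h) - diffusion (\<Delta> h) (?G s) vs (y h)\<bar> \<le> m4 * (trace (\<Delta> h))\<^sup>2"
          unfolding m4_def using s t by (intro heat_second_order heat_jet psd) auto
        also have "\<dots> \<le> m4 * (c * h)\<^sup>2"
        proof (intro mult_left_mono power_mono m)
          show "trace (\<Delta> h) \<le> c * h" unfolding \<Delta>_def using c(2)[of t "t + h"] elim t by simp
        qed (use trace_nonneg[OF psd] in auto)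
        finally show "\<bar>heat (\<Delta> h) (?G s) vs (y h) - ?G s vs (y h) - diffusion (\<Delta> h) (?G s) vs (y h) - 0\<bar> \<le> m4 * (c * h)\<^sup>2" by simp
      qed
      ultimately have "\<bar>D h - diffusion (\<Delta> h) (V t) vs (y h)\<bar> \<le> (t * (m4 * c\<^sup>2) * h) * h"
        by (simp add: power_mult_distrib power2_eq_square mult_ac)
      then show ?case using elim by (simp add: abs_divide pos_divide_le_eq)
    qed
  qed
  have dlim: "((\<lambda>h. diffusion (\<Delta> h) (V t) vs (y h) / h) \<longlongrightarrow> diffusion (b t) (V t) vs x) (at_right 0)"
  proof -
    have "((\<lambda>h. \<Sum>i\<in>UNIV. \<Sum>j\<in>UNIV. (\<Delta> h $ i $ j / h) * V t (axis i 1 # axis j 1 # vs) (y h))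
      \<longlongrightarrow> (\<Sum>i\<in>UNIV. \<Sum>j\<in>UNIV. b t $ i $ j * V t (axis i 1 # axis j 1 # vs) x)) (at_right 0)"
      unfolding \<Delta>_def using t
      by (intro tendsto_sum tendsto_mult cov_int_right_derivative flow_tendsto_space y) auto
    then show ?thesis by (simp add: diffusion_def sum_divide_distrib)
  qed
  have "((\<lambda>h. A h / h + ((D h - diffusion (\<Delta> h) (V t) vs (y h)) / h + diffusion (\<Delta> h) (V t) vs (y h) / h))
     \<longlongrightarrow> F t vs x + (0 + diffusion (b t) (V t) vs x)) (at_right 0)"
    by (intro tendsto_add Alim Dlim dlim)
  then have "((\<lambda>h. A h / h + ((D h - diffusion (\<Delta> h) (V t) vs (y h)) / h + diffusion (\<Delta> h) (V t) vs (y h) / h))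
     \<longlongrightarrow> F t vs x + diffusion (b t) (V t) vs x) (at_right 0)" by simp
  then show ?thesis
  proof (rule Lim_transform_eventually)
    show "eventually (\<lambda>h. A h / h + ((D h - diffusion (\<Delta> h) (V t) vs (y h)) / h + diffusion (\<Delta> h) (V t) vs (y h) / h)
       = (V (t + h) vs (y h) - V t vs (y h)) / h) (at_right 0)"
      using small
    proof eventually_elim
      case (elim h)
      then have "V (t + h) vs (y h) - V t vs (y h) = A h + D h"
        unfolding A_def D_def using t by (intro flow_increment) auto
      then show ?case by (simp add: add_divide_distrib diff_divide_distrib)
    qed
  qed
qed

end

section \<open>Jets and partial derivatives\<close>

lemma jet_partial:
  fixes G :: "(real^'n::finite) list \<Rightarrow> real^'n \<Rightarrow> real"
  assumes "jet M G"
  shows "((\<lambda>h. G vs (x + h *\<^sub>R axis p 1)) has_real_derivative G (axis p 1 # vs) x) (at 0)"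
  using jet_derivative[OF assms, of vs x "axis p 1" 0] by simp

lemma jet_pdiffs:
  fixes G :: "(real^'n::finite) list \<Rightarrow> real^'n \<Rightarrow> real"
  assumes "jet M G"
  shows "pdiffs ps (G []) = G (map (\<lambda>p. axis p 1) ps)"
proof (induction ps)
  case Nil then show ?case by (simp add: pdiffs_def)
next
  case (Cons p ps)
  have "pdiffs (p # ps) (G []) = pdiff p (G (map (\<lambda>p. axis p 1) ps))"
    using Cons by (simp add: pdiffs_def)
  also have "\<dots> = G (map (\<lambda>p. axis p 1) (p # ps))"
    by (rule ext) (simp add: pdiff_def DERIV_imp_deriv[OF jet_partial[OF assms]])
  finally show ?case .
qed

lemma jet_Cn_on:
  fixes G :: "(real^'n::finite) list \<Rightarrow> real^'n \<Rightarrow> real"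
  assumes "jet M G"
  shows "Cn_on I n (G [])"
  unfolding Cn_on_def jet_pdiffs[OF assms]
  by (auto intro: jet_continuous[OF assms] simp: field_differentiable_def intro!: exI jet_partial[OF assms])

section \<open>Jets built from bounded partial derivatives\<close>

text \<open>The sum over all coordinate tuples qs of \<open>P qs\<close> times the product of the
  matching coordinates of \<open>vs\<close>; it is the derivative in the directions
  \<open>vs\<close> when P lists the partial derivatives.\<close>

primrec contract :: "(real^'n::finite) list \<Rightarrow> ('n list \<Rightarrow> real) \<Rightarrow> real" where
  "contract [] P = P []"
| "contract (v # vs) P = (\<Sum>p\<in>UNIV. v $ p * contract vs (\<lambda>qs. P (p # qs)))"

lemma contract_add: "contract vs (\<lambda>qs. P qs + Q qs) = contract vs P + contract vs Q"
  by (induction vs arbitrary: P Q) (simp_all add: sum.distrib algebra_simps)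

lemma contract_scale: "contract vs (\<lambda>qs. c * P qs) = c * contract vs P"
  by (induction vs arbitrary: P) (simp_all add: sum_distrib_left mult_ac)

lemma contract_diff: "contract vs (\<lambda>qs. P qs - Q qs) = contract vs P - contract vs Q"
  using contract_add[of vs P "\<lambda>qs. - 1 * Q qs"] contract_scale[of vs "-1" Q] by simp

lemma contract_sum: "finite I \<Longrightarrow> contract vs (\<lambda>qs. \<Sum>i\<in>I. P i qs) = (\<Sum>i\<in>I. contract vs (P i))"
proof (induction I rule: finite_induct)
  case empty
  then show ?case using contract_scale[of vs 0 "\<lambda>_. 0"] by simp
qed (simp add: contract_add)

lemma contract_bound:
  fixes vs :: "(real^'n::finite) list"
  assumes "\<And>qs. length qs = length vs \<Longrightarrow> \<bar>P qs\<bar> \<le> c" "c \<ge> 0"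
  shows "\<bar>contract vs P\<bar> \<le> c * (real CARD('n) ^ length vs * norm_prod vs)"
  using assms(1)
proof (induction vs arbitrary: P)
  case Nil then show ?case by simp
next
  case (Cons v vs)
  define k where "k = c * (real CARD('n) ^ length vs * norm_prod vs)"
  have k: "k \<ge> 0" unfolding k_def using assms(2) norm_prod_nonneg[of vs] by simp
  have "\<bar>contract (v # vs) P\<bar> \<le> (\<Sum>p\<in>UNIV. \<bar>v $ p\<bar> * k)"
    unfolding contract.simps
  proof (intro order_trans[OF sum_abs] sum_mono)
    fix p
    have "\<bar>contract vs (\<lambda>qs. P (p # qs))\<bar> \<le> k" unfolding k_def by (rule Cons.IH) (use Cons.prems in simp)
    then show "\<bar>v $ p * contract vs (\<lambda>qs. P (p # qs))\<bar> \<le> \<bar>v $ p\<bar> * k" by (simp add: abs_mult mult_left_mono)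
  qed
  also have "\<dots> \<le> (real CARD('n) * norm v) * k"
    unfolding sum_distrib_right[symmetric] using k sum_abs_le_norm[of v] by (intro mult_right_mono) auto
  finally show ?case by (simp add: k_def mult_ac)
qed

lemma contract_linear_slot:
  "contract (us @ (v + v') # vs) P = contract (us @ v # vs) P + contract (us @ v' # vs) P"
  "contract (us @ (c *\<^sub>R v) # vs) P = c * contract (us @ v # vs) P"
  by (induction us arbitrary: P) (simp_all add: sum.distrib sum_distrib_left algebra_simps)

text \<open>CARD('n)^k counts the coordinate tuples. The factor 3 comes from the Lipschitz bound
  \<open>lip\<close>: 2 for the oscillation of the next derivatives in the Taylor remainder and 1
  for the linear term.\<close>

lemma jet_of_partials:
  fixes f :: "real^'n::finite \<Rightarrow> real"
  assumes smooth: "\<And>n. Cn_on UNIV n f" and bd: "\<And>ps x. \<bar>pdiffs ps f x\<bar> \<le> m (length ps)"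
  shows "jet (\<lambda>k. 3 * m k * real CARD('n) ^ k) (\<lambda>vs x. contract vs (\<lambda>qs. pdiffs qs f x))"
proof (rule jetI)
  have UNIV_space: "coord_space UNIV = (UNIV :: (real^'n) set)" by (simp add: coord_space_def)
  have d: "((\<lambda>h. pdiffs ps f (x + h *\<^sub>R axis p 1)) has_real_derivative pdiffs (p # ps) f x) (at 0)" for ps x p
  proof -
    have "(\<lambda>h. pdiffs ps f (x + h *\<^sub>R axis p 1)) field_differentiable (at 0)"
      using smooth[of "Suc (length ps)"] unfolding Cn_on_def UNIV_space by (auto simp: multi_indices_def)
    then have "((\<lambda>h. pdiffs ps f (x + h *\<^sub>R axis p 1)) has_real_derivative deriv (\<lambda>h. pdiffs ps f (x + h *\<^sub>R axis p 1)) 0) (at 0)"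
      by (simp add: DERIV_deriv_iff_field_differentiable)
    then show ?thesis by (simp add: pdiffs_def pdiff_def)
  qed
  have m0: "m k \<ge> 0" for k
    using bd[of "replicate k undefined" 0] by (auto intro: order_trans[OF abs_ge_zero])
  define c where "c = real CARD('n)"
  have c: "c \<ge> 1" by (simp add: c_def)
  fix us vs :: "(real^'n) list" and x v v' :: "real^'n" and r :: real
  have "\<bar>contract vs (\<lambda>qs. pdiffs qs f x)\<bar> \<le> m (length vs) * (c ^ length vs * norm_prod vs)"
    unfolding c_def using bd[of _ x] by (intro contract_bound m0) metis
  also have "\<dots> \<le> 3 * (m (length vs) * (c ^ length vs * norm_prod vs))"
    using m0 c norm_prod_nonneg[of vs] by simp
  finally show "\<bar>contract vs (\<lambda>qs. pdiffs qs f x)\<bar> \<le> 3 * m (length vs) * real CARD('n) ^ length vs * norm_prod vs"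
    by (simp add: c_def mult_ac)
  have lip: "\<bar>pdiffs ps f y - pdiffs ps f z\<bar> \<le> 3 * m (Suc (length ps)) * c * norm (y - z)" for ps y z
  proof -
    let ?m = "m (Suc (length ps))"
    have "\<bar>pdiffs ps f (z + (y - z)) - pdiffs ps f z - (\<Sum>p\<in>UNIV. (y - z) $ p * pdiffs (p # ps) f z)\<bar> \<le> (2 * ?m) * (\<Sum>p\<in>UNIV. \<bar>(y - z) $ p\<bar>)"
    proof (rule partial_derivatives_taylor1[OF d])
      fix y' p
      show "\<bar>pdiffs (p # ps) f y' - pdiffs (p # ps) f z\<bar> \<le> 2 * ?m"
        using bd[of "p # ps" y'] bd[of "p # ps" z] by simp
    qed
    moreover have "\<bar>\<Sum>p\<in>UNIV. (y - z) $ p * pdiffs (p # ps) f z\<bar> \<le> ?m * (\<Sum>p\<in>UNIV. \<bar>(y - z) $ p\<bar>)"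
      unfolding sum_distrib_left
    proof (intro order_trans[OF sum_abs] sum_mono)
      fix p
      show "\<bar>(y - z) $ p * pdiffs (p # ps) f z\<bar> \<le> ?m * \<bar>(y - z) $ p\<bar>"
        using mult_left_mono[OF bd[of "p # ps" z], of "\<bar>(y - z) $ p\<bar>"] by (simp add: abs_mult mult.commute)
    qed
    moreover have "z + (y - z) = y" by simp
    ultimately have "\<bar>pdiffs ps f y - pdiffs ps f z\<bar> \<le> 3 * (?m * (\<Sum>p\<in>UNIV. \<bar>(y - z) $ p\<bar>))" by (simp add: algebra_simps)
    also have "\<dots> \<le> 3 * (?m * (c * norm (y - z)))"
      using sum_abs_le_norm[of "y - z"] m0 unfolding c_def by (intro mult_left_mono) auto
    finally show ?thesis by (simp add: mult_ac)
  qed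
  let ?R = "\<lambda>qs. pdiffs qs f (x + v) - pdiffs qs f x - (\<Sum>p\<in>UNIV. v $ p * pdiffs (p # qs) f x)"
  have "contract vs (\<lambda>qs. pdiffs qs f (x + v)) - contract vs (\<lambda>qs. pdiffs qs f x) - contract (v # vs) (\<lambda>qs. pdiffs qs f x)
      = contract vs ?R"
    by (simp add: contract_diff contract_sum contract_scale)
  also have "\<bar>\<dots>\<bar> \<le> (3 * m (length vs + 2) * c * norm v * (c * norm v)) * (c ^ length vs * norm_prod vs)"
    unfolding c_def
  proof (rule contract_bound)
    fix qs :: "'n list" assume l: "length qs = length vs"
    have "\<bar>?R qs\<bar> \<le> (3 * m (length vs + 2) * c * norm v) * (\<Sum>p\<in>UNIV. \<bar>v $ p\<bar>)"
    proof (rule partial_derivatives_taylor1[OF d])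
      fix y p assume y: "norm (y - x) \<le> norm v"
      have "\<bar>pdiffs (p # qs) f y - pdiffs (p # qs) f x\<bar> \<le> 3 * m (length vs + 2) * c * norm (y - x)"
        using lip[of "p # qs" y x] l by simp
      also have "\<dots> \<le> 3 * m (length vs + 2) * c * norm v"
        using y m0 c by (intro mult_left_mono) auto
      finally show "\<bar>pdiffs (p # qs) f y - pdiffs (p # qs) f x\<bar> \<le> 3 * m (length vs + 2) * c * norm v" .
    qed
    also have "\<dots> \<le> (3 * m (length vs + 2) * c * norm v) * (c * norm v)"
      using sum_abs_le_norm[of v] m0 c unfolding c_def[symmetric] by (intro mult_left_mono) auto
    finally show "\<bar>?R qs\<bar> \<le> 3 * m (length vs + 2) * real CARD('n) * norm v * (real CARD('n) * norm v)" by (simp add: c_def)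
  qed (use m0 c in auto)
  finally show "\<bar>contract vs (\<lambda>qs. pdiffs qs f (x + v)) - contract vs (\<lambda>qs. pdiffs qs f x) - contract (v # vs) (\<lambda>qs. pdiffs qs f x)\<bar>
      \<le> 3 * m (length vs + 2) * real CARD('n) ^ (length vs + 2) * norm_prod vs * (norm v)\<^sup>2"
    by (simp add: c_def power2_eq_square mult_ac)
qed (simp_all add: contract_linear_slot)

text \<open>With the second-order bound, convergence of the values forces convergence of all derivatives.\<close>

lemma jet_tendsto_of_values:
  fixes G :: "'i \<Rightarrow> 'a::euclidean_space list \<Rightarrow> 'a \<Rightarrow> real"
  assumes G: "\<And>n. jet M (G n)" "jet M H" and lim: "\<And>x. ((\<lambda>n. G n [] x) \<longlongrightarrow> H [] x) \<F>"
  shows "((\<lambda>n. G n vs x) \<longlongrightarrow> H vs x) \<F>"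
proof (induction vs arbitrary: x)
  case Nil show ?case by (rule lim)
next
  case (Cons v vs)
  show ?case
  proof (rule tendstoI)
    fix e :: real assume e: "e > 0"
    define K where "K = M (length vs + 2) * norm_prod vs * (norm v)\<^sup>2"
    have K: "K \<ge> 0" unfolding K_def by (intro mult_nonneg_nonneg jet_nonneg[OF G(2)] norm_prod_nonneg) auto
    \<comment> \<open>With this h the difference quotient is within e/3 of the derivative for every
      jet with constants M, so one h serves all n and the limit.\<close>
    define h where "h = e / 3 / (K + 1)"
    have h: "h > 0" using e K by (simp add: h_def)
    have Kh: "K * h < e / 3"
    proof -
      have "K * h < (K + 1) * h" using h by (simp add: distrib_right)
      also have "\<dots> = e / 3"
      proof -
        have "K + 1 \<noteq> 0" using K by simp
        from nonzero_eq_divide_eq[OF this, THEN iffD1, OF h_def] show ?thesis by (simp add: mult.commute)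
      qed
      finally show ?thesis .
    qed
    have q: "\<bar>(J vs (x + h *\<^sub>R v) - J vs x) / h - J (v # vs) x\<bar> \<le> K * h" if J: "jet M J" for J
    proof -
      have "\<bar>J vs (x + h *\<^sub>R v) - J vs x - h * J (v # vs) x\<bar> \<le> K * h\<^sup>2"
        using jet_taylor1[OF J, of vs x "h *\<^sub>R v"]
        by (simp add: K_def jet_scale_head[OF J] power_mult_distrib mult_ac)
      then have "\<bar>J vs (x + h *\<^sub>R v) - J vs x - h * J (v # vs) x\<bar> / h \<le> K * h"
        using h by (simp add: pos_divide_le_eq power2_eq_square mult_ac)
      moreover have "(J vs (x + h *\<^sub>R v) - J vs x) / h - J (v # vs) x = (J vs (x + h *\<^sub>R v) - J vs x - h * J (v # vs) x) / h"
        using h by (simp add: field_simps)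
      ultimately show ?thesis using h by (simp add: abs_divide)
    qed
    have "((\<lambda>n. (G n vs (x + h *\<^sub>R v) - G n vs x) / h) \<longlongrightarrow> (H vs (x + h *\<^sub>R v) - H vs x) / h) \<F>"
      using h by (intro tendsto_intros Cons) auto
    then have "eventually (\<lambda>n. dist ((G n vs (x + h *\<^sub>R v) - G n vs x) / h) ((H vs (x + h *\<^sub>R v) - H vs x) / h) < e / 3) \<F>"
      using e by (intro tendstoD) auto
    then show "eventually (\<lambda>n. dist (G n (v # vs) x) (H (v # vs) x) < e) \<F>"
    proof eventually_elim
      case (elim n)
      then show ?case using q[OF G(1)[of n]] q[OF G(2)] Kh unfolding dist_real_def by linarith
    qed
  qed
qed

text \<open>Inductively, each derivative is a pointwise limit of difference quotients with h = 1/(n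
  + 1).\<close>

lemma jet_measurable_of_values:
  fixes G :: "real \<Rightarrow> 'a::euclidean_space list \<Rightarrow> 'a \<Rightarrow> real"
  assumes G: "\<And>s. jet M (G s)" and m: "\<And>x. (\<lambda>s. G s [] x) \<in> borel_measurable borel"
  shows "(\<lambda>s. G s vs x) \<in> borel_measurable borel"
proof (induction vs arbitrary: x)
  case Nil show ?case by (rule m)
next
  case (Cons v vs)
  show ?case
  proof (rule borel_measurable_LIMSEQ_real)
    show "(\<lambda>s. real (Suc n) * (G s vs (x + (1 / real (Suc n)) *\<^sub>R v) - G s vs x)) \<in> borel_measurable borel" for n
      by (intro borel_measurable_times borel_measurable_diff Cons) auto
    fix s
    have "((\<lambda>h. (G s vs (x + h *\<^sub>R v) - G s vs x) / h) \<longlongrightarrow> G s (v # vs) x) (at 0)"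
      using jet_derivative[OF G, of s vs x v 0] by (simp add: DERIV_def)
    moreover have "filterlim (\<lambda>n. 1 / real (Suc n)) (at 0) sequentially"
      using LIMSEQ_inverse_real_of_nat by (auto simp: filterlim_at inverse_eq_divide)
    ultimately have "(\<lambda>n. (G s vs (x + (1 / real (Suc n)) *\<^sub>R v) - G s vs x) / (1 / real (Suc n))) \<longlonglongrightarrow> G s (v # vs) x"
      by (rule filterlim_compose)
    then show "(\<lambda>n. real (Suc n) * (G s vs (x + (1 / real (Suc n)) *\<^sub>R v) - G s vs x)) \<longlonglongrightarrow> G s (v # vs) x"
      by (simp add: mult.commute)
  qed
qed

section \<open>Existence\<close>

text \<open>The diffusion matrix seen in the frame e^{tA} z: a derivative in z in direction v
  becomes one in direction e^{tA} v.\<close>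

definition conj_cov :: "real^'n^'n::finite \<Rightarrow> (real \<Rightarrow> real^'n^'n) \<Rightarrow> real \<Rightarrow> real^'n^'n" where
  "conj_cov A a t = matrix_exp A t ** a t ** transpose (matrix_exp A t)"

lemma conj_cov_psd:
  assumes "sym_nonneg_matrix (a t)"
  shows "sym_nonneg_matrix (conj_cov A a t)"
proof -
  let ?E = "matrix_exp A t"
  have "transpose (conj_cov A a t) = conj_cov A a t"
    using assms unfolding sym_nonneg_matrix_def conj_cov_def by (simp add: matrix_transpose_mul matrix_mul_assoc)
  moreover have "(conj_cov A a t *v \<xi>) \<bullet> \<xi> = (a t *v (transpose ?E *v \<xi>)) \<bullet> (transpose ?E *v \<xi>)" for \<xi>
    unfolding conj_cov_def
    by (simp add: matrix_vector_mul_assoc[symmetric] inner_commute dot_lmul_matrix[symmetric])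
  ultimately show ?thesis using assms unfolding sym_nonneg_matrix_def by simp
qed

lemma continuous_on_matrix_mult:
  fixes f g :: "real \<Rightarrow> real^'n^'n::finite"
  assumes "continuous_on S f" "continuous_on S g"
  shows "continuous_on S (\<lambda>t. f t ** g t)"
  unfolding matrix_matrix_mult_def by (intro continuous_on_vec_lambda continuous_intros assms)

lemma conj_cov_continuous:
  assumes "continuous_on S a"
  shows "continuous_on S (conj_cov A a)"
proof -
  have "continuous_on S (\<lambda>t. transpose (matrix_exp A t))"
    unfolding transpose_def by (intro continuous_on_vec_lambda continuous_intros matrix_exp_continuous)
  then show ?thesis unfolding conj_cov_def[abs_def]
    by (intro continuous_on_matrix_mult matrix_exp_continuous assms)
qed

lemma conj_cov_add: "conj_cov A (\<lambda>t. a t + a' t) t = conj_cov A a t + conj_cov A a' t"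
  by (simp add: conj_cov_def matrix_matrix_mult_def vec_eq_iff sum.distrib algebra_simps)

lemma diffusion_conj_cov:
  fixes A :: "real^'n^'n::finite"
  assumes G: "jet M G"
  shows "diffusion (conj_cov A a t) G [] x = (\<Sum>i\<in>UNIV. \<Sum>j\<in>UNIV. a t $ i $ j * G [matrix_exp A t *v axis i 1, matrix_exp A t *v axis j 1] x)"
proof -
  define E where "E = matrix_exp A t"
  define g where "g k l = G [axis k 1, axis l 1] x" for k l
  have col: "(E *v axis i 1) $ k = E $ k $ i" for i k
    by (simp add: matrix_vector_mul_component inner_axis)
  have "(\<Sum>i\<in>UNIV. \<Sum>j\<in>UNIV. a t $ i $ j * G [E *v axis i 1, E *v axis j 1] x)
     = (\<Sum>i\<in>UNIV. \<Sum>j\<in>UNIV. \<Sum>k\<in>UNIV. \<Sum>l\<in>UNIV. a t $ i $ j * (E $ k $ i * E $ l $ j * g k l))"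
    by (simp add: jet_expand2[OF G, of "E *v _" "E *v _"] col g_def sum_distrib_left)
  also have "\<dots> = (\<Sum>k\<in>UNIV. \<Sum>l\<in>UNIV. \<Sum>i\<in>UNIV. \<Sum>j\<in>UNIV. a t $ i $ j * (E $ k $ i * E $ l $ j * g k l))"
  proof -
    have "(\<Sum>i\<in>UNIV. \<Sum>j\<in>UNIV. \<Sum>k\<in>UNIV. \<Sum>l\<in>UNIV. w i j k l) = (\<Sum>k\<in>UNIV. \<Sum>l\<in>UNIV. \<Sum>i\<in>UNIV. \<Sum>j\<in>UNIV. w i j k l)"
      for w :: "'n \<Rightarrow> 'n \<Rightarrow> 'n \<Rightarrow> 'n \<Rightarrow> real"
    proof -
      have "(\<Sum>i\<in>UNIV. \<Sum>j\<in>UNIV. \<Sum>k\<in>UNIV. \<Sum>l\<in>UNIV. w i j k l) = (\<Sum>i\<in>UNIV. \<Sum>k\<in>UNIV. \<Sum>j\<in>UNIV. \<Sum>l\<in>UNIV. w i j k l)"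
        by (intro sum.cong refl sum.swap)
      also have "\<dots> = (\<Sum>k\<in>UNIV. \<Sum>i\<in>UNIV. \<Sum>j\<in>UNIV. \<Sum>l\<in>UNIV. w i j k l)" by (rule sum.swap)
      also have "\<dots> = (\<Sum>k\<in>UNIV. \<Sum>i\<in>UNIV. \<Sum>l\<in>UNIV. \<Sum>j\<in>UNIV. w i j k l)" by (intro sum.cong refl sum.swap)
      also have "\<dots> = (\<Sum>k\<in>UNIV. \<Sum>l\<in>UNIV. \<Sum>i\<in>UNIV. \<Sum>j\<in>UNIV. w i j k l)" by (intro sum.cong refl sum.swap)
      finally show ?thesis .
    qed
    then show ?thesis .
  qed
  also have "\<dots> = (\<Sum>k\<in>UNIV. \<Sum>l\<in>UNIV. conj_cov A a t $ k $ l * g k l)"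
  proof (intro sum.cong refl)
    fix k l
    have "conj_cov A a t $ k $ l = (\<Sum>j\<in>UNIV. (\<Sum>i\<in>UNIV. E $ k $ i * a t $ i $ j) * E $ l $ j)"
      by (simp add: conj_cov_def E_def[symmetric] matrix_matrix_mult_def transpose_def)
    also have "\<dots> = (\<Sum>i\<in>UNIV. \<Sum>j\<in>UNIV. E $ k $ i * a t $ i $ j * E $ l $ j)"
      unfolding sum_distrib_right by (rule sum.swap)
    finally show "(\<Sum>i\<in>UNIV. \<Sum>j\<in>UNIV. a t $ i $ j * (E $ k $ i * E $ l $ j * g k l)) = conj_cov A a t $ k $ l * g k l"
      by (simp add: sum_distrib_left mult_ac)
  qed
  finally show ?thesis by (simp add: diffusion_def E_def g_def)
qed

lemma set_integral_right_derivative: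
  fixes k :: "real \<Rightarrow> real"
  assumes t: "0 \<le> t" "t < T" and i: "set_integrable lborel {0..T} k"
    and c: "((\<lambda>h. k (t + h)) \<longlongrightarrow> k t) (at_right 0)"
  shows "((\<lambda>h. ((LBINT s:{0..t+h}. k s) - (LBINT s:{0..t}. k s)) / h) \<longlongrightarrow> k t) (at_right 0)"
proof (rule tendstoI)
  fix e :: real assume e: "e > 0"
  obtain \<gamma> where \<gamma>: "\<gamma> > 0" "\<And>h. 0 < h \<Longrightarrow> h < \<gamma> \<Longrightarrow> \<bar>k (t + h) - k t\<bar> < e / 2"
    using tendstoD[OF c, of "e / 2"] e by (auto simp: eventually_at_right_field dist_real_def)
  have "eventually (\<lambda>h. 0 < h \<and> h < min \<gamma> (T - t)) (at_right 0)"
    using t \<gamma> by (auto simp: eventually_at_right_field intro!: exI[of _ "min \<gamma> (T - t)"])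
  then show "eventually (\<lambda>h. dist (((LBINT s:{0..t+h}. k s) - (LBINT s:{0..t}. k s)) / h) (k t) < e) (at_right 0)"
  proof eventually_elim
    case (elim h)
    have sub: "set_integrable lborel X k" if "X \<subseteq> {0..T}" "X \<in> sets borel" for X
      by (rule set_integrable_subset[OF i]) (use that in auto)
    have "{0..t+h} = {0..t} \<union> {t..t+h}" using elim t by auto
    then have "(LBINT s:{0..t+h}. k s) = (LBINT s:{0..t} \<union> {t..t+h}. k s)" by simp
    also have "\<dots> = (LBINT s:{0..t}. k s) + (LBINT s:{t..t+h}. k s)"
    proof (rule set_integral_Un_AE)
      show "AE x in lborel. \<not> (x \<in> {0..t} \<and> x \<in> {t..t+h})"
        by (rule AE_mp[OF AE_lborel_singleton[of t]], rule AE_I2) auto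
    qed (use elim t sub in auto)
    finally have eq: "(LBINT s:{0..t+h}. k s) - (LBINT s:{0..t}. k s) = (LBINT s:{t..t+h}. k s)" by simp
    have "\<bar>(LBINT s:{t..t+h}. k s) - (t + h - t) * k t\<bar> \<le> (t + h - t) * (e / 2)"
    proof (rule set_integral_bound_Icc)
      show "\<bar>k s - k t\<bar> \<le> e / 2" if "s \<in> {t..t+h}" for s
        using \<gamma>(2)[of "s - t"] that elim e by (cases "s = t") auto
    qed (use elim t sub in auto)
    then have "\<bar>(LBINT s:{t..t+h}. k s) - h * k t\<bar> \<le> h * (e / 2)" by simp
    also have "\<dots> < h * e" using elim e by simp
    finally have "\<bar>(LBINT s:{t..t+h}. k s) - h * k t\<bar> / h < e" using elim by (simp add: pos_divide_less_eq mult.commute)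
    moreover have "(LBINT s:{t..t+h}. k s) / h - k t = ((LBINT s:{t..t+h}. k s) - h * k t) / h" using elim by (simp add: field_simps)
    ultimately show ?case unfolding eq dist_real_def using elim by (simp add: abs_divide)
  qed
qed

text \<open>In the moving frame \<open>w = e\<^sup>t\<^sup>A z\<close> the drift disappears: \<open>F\<close> is the source read in this frame.\<close>

locale ou_evolution = heat_evolution T "conj_cov A a" M F N
  for T :: real and A :: "real^'n^'n::finite" and a :: "real \<Rightarrow> real^'n^'n"
    and M and F :: "real \<Rightarrow> (real^'n) list \<Rightarrow> real^'n \<Rightarrow> real" and N +
  fixes f :: "real \<Rightarrow> real^'n \<Rightarrow> real"
  assumes a_cont: "continuous_on {0..T} a"
    and F_f: "\<And>s x. s \<in> {0..T} \<Longrightarrow> F s [] x = f s (matrix_exp A (- s) *v x)"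
begin

abbreviation "E \<equiv> matrix_exp A"

text \<open>Back from the moving frame; by the chain rule each direction is transported by
  e^{tA}.\<close>

definition sol_jet :: "real \<Rightarrow> (real^'n) list \<Rightarrow> real^'n \<Rightarrow> real" where
  "sol_jet t vs z = V t (map ((*v) (E t)) vs) (E t *v z)"

lemma sol_jet_bounds:
  obtains M' where "\<And>t. t \<in> {0..T} \<Longrightarrow> jet M' (sol_jet t)"
proof -
  obtain c where c: "c \<ge> 1" "\<And>t x. \<bar>t\<bar> \<le> T \<Longrightarrow> norm (E t *v x) \<le> c * norm x"
    using matrix_exp_bounds[of T A] by metis
  show thesis
  proof (rule that)
    fix t assume t: "t \<in> {0..T}"
    show "jet (\<lambda>k. c ^ k * (T * M k)) (sol_jet t)"
      unfolding sol_jet_def[abs_def] using t c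
      by (intro jet_compose_linear[OF flow_jet]) auto
  qed
qed

lemma flow_exp_continuous:
  assumes "continuous_on {0..T} y"
  shows "continuous_on {0..T} (\<lambda>s. V s vs (y s))"
  unfolding continuous_on_def
proof
  fix t assume t: "t \<in> {0..T}"
  obtain C where C: "C \<ge> 0" "\<And>s t y. 0 \<le> s \<Longrightarrow> s \<le> t \<Longrightarrow> t \<le> T \<Longrightarrow> \<bar>V t vs y - V s vs y\<bar> \<le> C * (t - s)"
    using flow_time_lipschitz by blast
  have 1: "((\<lambda>s. V s vs (y s) - V t vs (y s)) \<longlongrightarrow> 0) (at t within {0..T})"
  proof (rule Lim_null_comparison)
    show "eventually (\<lambda>s. norm (V s vs (y s) - V t vs (y s)) \<le> C * \<bar>s - t\<bar>) (at t within {0..T})"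
      unfolding eventually_at_filter
    proof (intro always_eventually allI impI)
      fix s assume "s \<in> {0..T}"
      then show "norm (V s vs (y s) - V t vs (y s)) \<le> C * \<bar>s - t\<bar>"
        using C(2)[of s t "y s"] C(2)[of t s "y s"] t by (cases "s \<le> t") (auto simp: abs_minus_commute)
    qed
    show "((\<lambda>s. C * \<bar>s - t\<bar>) \<longlongrightarrow> 0) (at t within {0..T})"
      by (auto intro!: tendsto_eq_intros)
  qed
  have "((\<lambda>s. V t vs (y s)) \<longlongrightarrow> V t vs (y t)) (at t within {0..T})"
    using assms t unfolding continuous_on_def by (intro flow_tendsto_space) auto
  from tendsto_add[OF 1 this] show "((\<lambda>s. V s vs (y s)) \<longlongrightarrow> V t vs (y t)) (at t within {0..T})" by simp
qed

lemma exp_vec_continuous: "continuous_on S (\<lambda>s. E s *v z)"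
  by (intro continuous_at_imp_continuous_on ballI has_vector_derivative_continuous[OF matrix_exp_vec_derivative])

text \<open>The operator applied to the solution, computed in the moving frame. The drift is the
  derivative along the velocity e^{sA} A z of the moving point.\<close>

definition rhs :: "real \<Rightarrow> real^'n \<Rightarrow> real" where
  "rhs s z = diffusion (conj_cov A a s) (V s) [] (E s *v z) + V s [E s *v (A *v z)] (E s *v z)"

lemma rhs_continuous: "continuous_on {0..T} (\<lambda>s. rhs s z)"
proof -
  have "V s [E s *v (A *v z)] (E s *v z) = (\<Sum>i\<in>UNIV. (E s *v (A *v z)) $ i * V s [axis i 1] (E s *v z))" if "s \<in> {0..T}" for s
    using jet_expand[OF flow_jet, of s "[]" "E s *v (A *v z)" "[]" "E s *v z"] that by simp
  then have eq: "rhs s z = (\<Sum>i\<in>UNIV. \<Sum>j\<in>UNIV. conj_cov A a s $ i $ j * V s [axis i 1, axis j 1] (E s *v z))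
      + (\<Sum>i\<in>UNIV. (E s *v (A *v z)) $ i * V s [axis i 1] (E s *v z))" if "s \<in> {0..T}" for s
    using that by (simp add: rhs_def diffusion_def)
  have "continuous_on {0..T} (\<lambda>s. (\<Sum>i\<in>UNIV. \<Sum>j\<in>UNIV. conj_cov A a s $ i $ j * V s [axis i 1, axis j 1] (E s *v z))
      + (\<Sum>i\<in>UNIV. (E s *v (A *v z)) $ i * V s [axis i 1] (E s *v z)))"
    by (intro continuous_intros flow_exp_continuous exp_vec_continuous conj_cov_continuous a_cont)
  then show ?thesis by (rule continuous_on_eq) (simp add: eq)
qed

lemma source_integrable: "set_integrable lborel {0..T} (\<lambda>s. f s z)"
proof (rule set_integrable_bounded_Icc)
  \<comment> \<open>Measurability is known for \<open>F\<close> at fixed points of the frame, while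
    a fixed z moves there with s.\<close>
  have "(\<lambda>s. indicator {0..T} s * F s [] (E s *v z)) \<in> borel_measurable borel"
  proof (rule caratheodory_measurable[where \<Phi> = "\<lambda>s r. F s [] (E r *v z)"])
    show "continuous_on {0..T} (\<lambda>r. F s [] (E r *v z))" for s
      by (rule continuous_on_compose2[OF jet_continuous[OF F_jet, of UNIV] exp_vec_continuous]) auto
  qed (use T F_meas in auto)
  moreover have "indicator {0..T} s * F s [] (E s *v z) = indicator {0..T} s * f s z" for s
    using F_f[of s "E s *v z"] by (auto simp: indicator_def matrix_exp_inverse_vec)
  ultimately show "(\<lambda>s. indicator {0..T} s * f s z) \<in> borel_measurable borel" by simp
  show "\<bar>f s z\<bar> \<le> M 0" if "s \<in> {0..T}" for s
    using F_f[of s "E s *v z"] jet_bound[OF F_jet, of s "[]" "E s *v z"] that by (simp add: matrix_exp_inverse_vec)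
qed

text \<open>The increment is split into the time increment at the moved point \<open>y h\<close> and
  the space increment at time t along the curve y, whose velocity produces the drift.\<close>

lemma solution_right_derivative:
  assumes t: "0 \<le> t" "t < T" "t \<notin> N"
  shows "((\<lambda>h. (sol_jet (t + h) [] z - sol_jet t [] z) / h) \<longlongrightarrow> f t z + rhs t z) (at_right 0)"
proof -
  define y where "y h = E (t + h) *v z" for h
  have der: "((\<lambda>h. (y h - y 0) /\<^sub>R h) \<longlongrightarrow> E t *v (A *v z)) (at_right 0)"
  proof -
    have "((\<lambda>h. (y h - y 0) /\<^sub>R h) \<longlongrightarrow> E t *v (A *v z)) (at 0)"
    proof (rule Lim_null[THEN iffD2], rule tendsto_norm_zero_cancel)
      have "((\<lambda>h. norm (E (t + h) *v z - E t *v z - h *\<^sub>R (E t *v (A *v z))) / norm h) \<longlongrightarrow> 0) (at 0)"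
        using matrix_exp_vec_derivative[of A z t] unfolding has_vector_derivative_def has_derivative_at by blast
      then show "((\<lambda>h. norm ((y h - y 0) /\<^sub>R h - E t *v (A *v z))) \<longlongrightarrow> 0) (at 0)"
      proof (rule Lim_transform_eventually)
        show "\<forall>\<^sub>F h in at 0. norm (E (t + h) *v z - E t *v z - h *\<^sub>R (E t *v (A *v z))) / norm h
            = norm ((y h - y 0) /\<^sub>R h - E t *v (A *v z))"
          unfolding eventually_at_filter
        proof (intro always_eventually allI impI)
          fix h :: real assume h: "h \<noteq> 0"
          then have "(y h - y 0) /\<^sub>R h - E t *v (A *v z) = (y h - y 0 - h *\<^sub>R (E t *v (A *v z))) /\<^sub>R h"
            by (simp add: scaleR_diff_right)
          then show "norm (E (t + h) *v z - E t *v z - h *\<^sub>R (E t *v (A *v z))) / norm h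
            = norm ((y h - y 0) /\<^sub>R h - E t *v (A *v z))"
            by (simp add: y_def divide_inverse mult.commute)
        qed
      qed
    qed
    then show ?thesis by (rule tendsto_within_subset) simp
  qed
  have yc: "(y \<longlongrightarrow> y 0) (at_right 0)"
  proof -
    have "continuous_on UNIV y" unfolding y_def[abs_def]
      by (rule continuous_on_compose2[OF exp_vec_continuous[of UNIV]]) (auto intro!: continuous_intros)
    then have "(y \<longlongrightarrow> y 0) (at 0)" by (simp add: continuous_on_def)
    then show ?thesis by (rule tendsto_within_subset) simp
  qed
  have 1: "((\<lambda>h. (V (t + h) [] (y h) - V t [] (y h)) / h) \<longlongrightarrow> F t [] (y 0) + diffusion (conj_cov A a t) (V t) [] (y 0)) (at_right 0)"
    by (rule flow_right_derivative[OF t yc])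
  have J: "jet (\<lambda>k. T * M k) (V t)" using t by (intro flow_jet) auto
  have 2: "((\<lambda>h. (V t [] (y h) - V t [] (y 0)) / h) \<longlongrightarrow> V t [E t *v (A *v z)] (y 0)) (at_right 0)"
  proof -
    have lin: "linear (\<lambda>v. V t [v] (y 0))" using jet_linear[OF J, of "[]" "[]"] by simp
    then have "((\<lambda>h. V t [(y h - y 0) /\<^sub>R h] (y 0)) \<longlongrightarrow> V t [E t *v (A *v z)] (y 0)) (at_right 0)"
      by (intro bounded_linear.tendsto[OF _ der]) (simp add: linear_conv_bounded_linear)
    then have a: "((\<lambda>h. V t [y h - y 0] (y 0) / h) \<longlongrightarrow> V t [E t *v (A *v z)] (y 0)) (at_right 0)"
      by (simp add: linear_scale[OF lin] divide_inverse mult.commute)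
    have b: "((\<lambda>h. (V t [] (y h) - V t [] (y 0) - V t [y h - y 0] (y 0)) / h) \<longlongrightarrow> 0) (at_right 0)"
    proof (rule Lim_null_comparison)
      show "((\<lambda>h. T * M 2 * (norm ((y h - y 0) /\<^sub>R h) * norm (y h - y 0))) \<longlongrightarrow> 0) (at_right 0)"
      proof -
        have "((\<lambda>h. norm (y h - y 0)) \<longlongrightarrow> 0) (at_right 0)" using yc by (simp add: tendsto_norm_zero_iff LIM_zero_iff)
        from tendsto_mult_left[OF tendsto_mult[OF tendsto_norm[OF der] this], of "T * M 2"] show ?thesis by simp
      qed
      show "eventually (\<lambda>h. norm ((V t [] (y h) - V t [] (y 0) - V t [y h - y 0] (y 0)) / h) \<le> T * M 2 * (norm ((y h - y 0) /\<^sub>R h) * norm (y h - y 0))) (at_right 0)"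
        unfolding eventually_at_filter
      proof (intro always_eventually allI impI)
        fix h :: real assume h: "h \<in> {0<..}"
        have "\<bar>V t [] (y h) - V t [] (y 0) - V t [y h - y 0] (y 0)\<bar> \<le> T * M 2 * (norm (y h - y 0))\<^sup>2"
          using jet_taylor1[OF J, of "[]" "y 0" "y h - y 0"] by (simp add: numeral_2_eq_2)
        then have "\<bar>V t [] (y h) - V t [] (y 0) - V t [y h - y 0] (y 0)\<bar> / h \<le> T * M 2 * (norm (y h - y 0))\<^sup>2 / h"
          using h by (intro divide_right_mono) auto
        then show "norm ((V t [] (y h) - V t [] (y 0) - V t [y h - y 0] (y 0)) / h) \<le> T * M 2 * (norm ((y h - y 0) /\<^sub>R h) * norm (y h - y 0))"
          using h by (simp add: abs_mult power2_eq_square divide_inverse mult_ac)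
      qed
    qed
    from tendsto_add[OF b a] show ?thesis by (simp add: add_divide_distrib[symmetric])
  qed
  have "F t [] (y 0) = f t z" using F_f[of t "y 0"] t by (simp add: y_def matrix_exp_inverse_vec)
  then show ?thesis
    using tendsto_add[OF 1 2] by (simp add: sol_jet_def y_def rhs_def add_divide_distrib[symmetric] add.assoc)
qed

lemma right_shift_tendsto:
  fixes g :: "real \<Rightarrow> 'b::topological_space"
  assumes "continuous_on {0..T} g" "0 \<le> t" "t < T"
  shows "((\<lambda>h. g (t + h)) \<longlongrightarrow> g t) (at_right 0)"
proof -
  have "continuous_on {t..T} g" using assms by (auto elim: continuous_on_subset)
  then have "(g \<longlongrightarrow> g t) (at_right t)"
    using assms by (simp add: continuous_on_def at_within_Icc_at_right[symmetric])
  then show ?thesis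
    by (subst (asm) at_right_to_0) (simp add: filterlim_filtermap add.commute)
qed

lemma source_right:
  assumes t: "0 \<le> t" "t < T" "t \<notin> N"
  shows "((\<lambda>h. f (t + h) z) \<longlongrightarrow> f t z) (at_right 0)"
proof -
  have fF: "f s z = F s [] (E s *v z)" if "s \<in> {0..T}" for s
    using F_f[OF that, of "E s *v z"] by (simp add: matrix_exp_inverse_vec)
  have "((\<lambda>h. F (t + h) [] (E (t + h) *v z) - F (t + h) [] (E t *v z)) \<longlongrightarrow> 0) (at_right 0)"
  proof (rule Lim_null_comparison)
    show "eventually (\<lambda>h. norm (F (t + h) [] (E (t + h) *v z) - F (t + h) [] (E t *v z)) \<le> M 1 * norm (E (t + h) *v z - E t *v z)) (at_right 0)"
      using jet_lipschitz[OF F_jet, of _ "[]"] by (intro always_eventually) simp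
    have "((\<lambda>h. E (t + h) *v z) \<longlongrightarrow> E t *v z) (at_right 0)"
      by (rule right_shift_tendsto[OF exp_vec_continuous t(1,2)])
    then have "((\<lambda>h. norm (E (t + h) *v z - E t *v z)) \<longlongrightarrow> 0) (at_right 0)"
      by (simp add: tendsto_norm_zero_iff LIM_zero_iff)
    then show "((\<lambda>h. M 1 * norm (E (t + h) *v z - E t *v z)) \<longlongrightarrow> 0) (at_right 0)"
      using tendsto_mult_left[of _ 0 _ "M 1"] by simp
  qed
  from tendsto_add[OF this F_right[OF t, of "[]" "E t *v z"]]
  have "((\<lambda>h. F (t + h) [] (E (t + h) *v z)) \<longlongrightarrow> f t z) (at_right 0)" using fF[of t] t by simp
  moreover have "eventually (\<lambda>h. F (t + h) [] (E (t + h) *v z) = f (t + h) z) (at_right 0)"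
  proof -
    have "eventually (\<lambda>h. 0 < h \<and> h < T - t) (at_right 0)"
      using t by (auto simp: eventually_at_right_field intro!: exI[of _ "T - t"])
    then show ?thesis using fF t by (auto elim!: eventually_mono)
  qed
  ultimately show ?thesis by (rule Lim_transform_eventually)
qed

lemma total_integrable: "set_integrable lborel {0..T} (\<lambda>s. f s z + rhs s z)"
  by (intro set_integral_add(1) source_integrable borel_integrable_atLeastAtMost' rhs_continuous)

text \<open>The difference \<open>g\<close> of the two sides is Lipschitz in time, has right
  derivative 0 outside the countable set \<open>N\<close>, and vanishes at time 0.\<close>

lemma solution_equation:
  assumes t: "t \<in> {0..T}"
  shows "sol_jet t [] z = (LBINT s:{0..t}. f s z + rhs s z)"
proof -
  define k where "k s = f s z + rhs s z" for s
  define g where "g r = sol_jet r [] z - (LBINT s:{0..r}. k s)" for r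
  have ki: "set_integrable lborel {0..T} k" unfolding k_def[abs_def] by (rule total_integrable)
  have ks: "set_integrable lborel X k" if "X \<subseteq> {0..T}" "X \<in> sets borel" for X
    by (rule set_integrable_subset[OF ki]) (use that in auto)
  obtain c where c: "c \<ge> 1" "\<And>t x. \<bar>t\<bar> \<le> T \<Longrightarrow> norm (E t *v x) \<le> c * norm x"
     "\<And>s t x. \<bar>s\<bar> \<le> T \<Longrightarrow> \<bar>t\<bar> \<le> T \<Longrightarrow> norm (E t *v x - E s *v x) \<le> c * \<bar>t - s\<bar> * norm x"
    using matrix_exp_bounds[of T A] by metis
  obtain C where C: "C \<ge> 0" "\<And>s t y. 0 \<le> s \<Longrightarrow> s \<le> t \<Longrightarrow> t \<le> T \<Longrightarrow> \<bar>V t [] y - V s [] y\<bar> \<le> C * (t - s)"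
    using flow_time_lipschitz by blast
  have "compact ((\<lambda>s. rhs s z) ` {0..T})" by (intro compact_continuous_image rhs_continuous compact_Icc)
  from compact_imp_bounded[OF this] obtain R where R: "\<forall>v\<in>(\<lambda>s. rhs s z) ` {0..T}. norm v \<le> R"
    unfolding bounded_iff by blast
  have kb: "\<bar>k s\<bar> \<le> M 0 + R" if "s \<in> {0..T}" for s
  proof -
    have "\<bar>f s z\<bar> \<le> M 0"
      using F_f[of s "E s *v z"] jet_bound[OF F_jet, of s "[]" "E s *v z"] that by (simp add: matrix_exp_inverse_vec)
    moreover have "\<bar>rhs s z\<bar> \<le> R" using R that by auto
    ultimately show ?thesis unfolding k_def by linarith
  qed
  have "g t = g 0"
  proof (rule constant_of_right_derivative_zero[where g = g and a = 0 and b = t and N = "N" and C = "C + T * M 1 * (c * norm z) + (M 0 + R)"])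
    show "countable N" by (rule N)
    show "\<bar>g y - g x\<bar> \<le> (C + T * M 1 * (c * norm z) + (M 0 + R)) * (y - x)" if xy: "0 \<le> x" "x \<le> y" "y \<le> t" for x y
    proof -
      have xyT: "x \<le> T" "y \<le> T" using xy t by auto
      have "\<bar>V y [] (E y *v z) - V x [] (E y *v z)\<bar> \<le> C * (y - x)" using C(2)[of x y] xy xyT by simp
      moreover have "\<bar>V x [] (E y *v z) - V x [] (E x *v z)\<bar> \<le> T * M 1 * (c * norm z) * (y - x)"
      proof -
        have "\<bar>V x [] (E y *v z) - V x [] (E x *v z)\<bar> \<le> T * M 1 * norm (E y *v z - E x *v z)"
          using jet_lipschitz[OF flow_jet[OF xy(1) xyT(1)], of "[]" "E y *v z" "E x *v z"] by simp
        also have "\<dots> \<le> T * M 1 * (c * \<bar>y - x\<bar> * norm z)"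
          using c(3)[of x y z] xy xyT T jet_nonneg[OF F_jet, of 1] by (intro mult_left_mono) auto
        finally show ?thesis using xy by (simp add: mult_ac)
      qed
      moreover have "\<bar>(LBINT s:{0..y}. k s) - (LBINT s:{0..x}. k s)\<bar> \<le> (M 0 + R) * (y - x)"
      proof -
        have "{0..y} = {0..x} \<union> {x..y}" using xy by auto
        then have "(LBINT s:{0..y}. k s) = (LBINT s:{0..x} \<union> {x..y}. k s)" by simp
        also have "\<dots> = (LBINT s:{0..x}. k s) + (LBINT s:{x..y}. k s)"
        proof (rule set_integral_Un_AE)
          show "AE s in lborel. \<not> (s \<in> {0..x} \<and> s \<in> {x..y})"
            by (rule AE_mp[OF AE_lborel_singleton[of x]], rule AE_I2) auto
        qed (use xy xyT ks in auto)
        finally have "(LBINT s:{0..y}. k s) - (LBINT s:{0..x}. k s) = (LBINT s:{x..y}. k s)" by simp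
        moreover have "\<bar>(LBINT s:{x..y}. k s) - (y - x) * 0\<bar> \<le> (y - x) * (M 0 + R)"
          using xy xyT kb ks by (intro set_integral_bound_Icc) auto
        ultimately show ?thesis by (simp add: mult.commute)
      qed
      ultimately show ?thesis unfolding g_def sol_jet_def by (simp add: distrib_right)
    qed
    show "((\<lambda>h. (g (x + h) - g x) / h) \<longlongrightarrow> 0) (at_right 0)" if x: "0 \<le> x" "x < t" "x \<notin> N" for x
    proof -
      have xT: "x < T" using x t by auto
      have "((\<lambda>h. k (x + h)) \<longlongrightarrow> k x) (at_right 0)"
        unfolding k_def by (intro tendsto_add source_right right_shift_tendsto[OF rhs_continuous] x(1,3) xT)
      from tendsto_diff[OF solution_right_derivative[OF x(1) xT x(3), of z] set_integral_right_derivative[OF x(1) xT ki this]]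
      show ?thesis by (simp add: g_def k_def diff_divide_distrib add_divide_distrib algebra_simps)
    qed
  qed (use t in auto)
  moreover have "g 0 = 0"
  proof -
    have "(LBINT s:{0..0}. u s) = 0" for u :: "real \<Rightarrow> real"
      unfolding set_lebesgue_integral_def
      by (rule integral_eq_zero_AE, rule AE_mp[OF AE_lborel_singleton[of 0]], rule AE_I2) (auto simp: indicator_def)
    then show ?thesis by (simp add: g_def sol_jet_def heat_flow_def)
  qed
  ultimately show ?thesis by (simp add: g_def k_def)
qed

lemma sol_jet_continuous: "continuous_on ({0..T} \<times> UNIV) (\<lambda>(t, z). sol_jet t [] z)"
  unfolding continuous_on_def
proof (clarify)
  fix t and z :: "real^'n" assume t: "t \<in> {0..T}"
  let ?\<F> = "at (t, z) within {0..T} \<times> UNIV"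
  obtain C where C: "C \<ge> 0" "\<And>s t y. 0 \<le> s \<Longrightarrow> s \<le> t \<Longrightarrow> t \<le> T \<Longrightarrow> \<bar>V t [] y - V s [] y\<bar> \<le> C * (t - s)"
    using flow_time_lipschitz by blast
  have f1: "((\<lambda>x. fst x) \<longlongrightarrow> t) ?\<F>" using tendsto_fst[OF tendsto_ident_at] by fastforce
  have "continuous_on UNIV (\<lambda>x::real \<times> (real^'n). E (fst x) *v snd x)"
    unfolding matrix_vector_mult_def
    by (intro continuous_on_vec_lambda continuous_intros continuous_on_compose2[OF matrix_exp_continuous[of UNIV]]) auto
  then have e: "((\<lambda>x. E (fst x) *v snd x) \<longlongrightarrow> E t *v z) ?\<F>"
    unfolding continuous_on_def by (auto intro: tendsto_within_subset)
  have 1: "((\<lambda>x. V (fst x) [] (E (fst x) *v snd x) - V t [] (E (fst x) *v snd x)) \<longlongrightarrow> 0) ?\<F>"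
  proof (rule Lim_null_comparison)
    show "eventually (\<lambda>x. norm (V (fst x) [] (E (fst x) *v snd x) - V t [] (E (fst x) *v snd x)) \<le> C * \<bar>fst x - t\<bar>) ?\<F>"
      unfolding eventually_at_filter
    proof (intro always_eventually allI impI)
      fix x :: "real \<times> (real^'n)" assume "x \<in> {0..T} \<times> UNIV"
      then show "norm (V (fst x) [] (E (fst x) *v snd x) - V t [] (E (fst x) *v snd x)) \<le> C * \<bar>fst x - t\<bar>"
        using C(2)[of "fst x" t "E (fst x) *v snd x"] C(2)[of t "fst x" "E (fst x) *v snd x"] t
        by (cases "fst x \<le> t") (auto simp: abs_minus_commute)
    qed
    show "((\<lambda>x. C * \<bar>fst x - t\<bar>) \<longlongrightarrow> 0) ?\<F>"
      using tendsto_mult_left[OF tendsto_rabs[OF tendsto_diff[OF f1 tendsto_const[of t]]], of C] by simp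
  qed
  have "((\<lambda>x. V t [] (E (fst x) *v snd x)) \<longlongrightarrow> V t [] (E t *v z)) ?\<F>"
    using t by (intro flow_tendsto_space e) auto
  from tendsto_add[OF 1 this]
  show "((\<lambda>(t, z). sol_jet t [] z) \<longlongrightarrow> sol_jet t [] z) ?\<F>"
    by (simp add: sol_jet_def case_prod_unfold)
qed

text \<open>Stated for any operator of this form, because it is used for the perturbed operator with
  a = B + S and, along each walk path, for the unperturbed one with a = B.\<close>

lemma sol_is_solution:
  assumes L: "\<And>t g z. t \<in> {0..T} \<Longrightarrow> L t g z = trace (a t ** hessian g z) + (A *v z) \<bullet> gradient g z"
    and sym: "\<And>t. t \<in> {0..T} \<Longrightarrow> sym_nonneg_matrix (a t)"
  shows "is_solution T L f (\<lambda>t. sol_jet t [])"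
proof -
  obtain M' where J: "\<And>t. t \<in> {0..T} \<Longrightarrow> jet M' (sol_jet t)" using sol_jet_bounds by blast
  have Leq: "L t (sol_jet t []) z = rhs t z" if t: "t \<in> {0..T}" for t z
  proof -
    have s: "a t $ i $ j = a t $ j $ i" for i j
      using sym[OF t] unfolding sym_nonneg_matrix_def by (auto simp: transpose_def vec_eq_iff)
    have "trace (a t ** hessian (sol_jet t []) z) = (\<Sum>i\<in>UNIV. \<Sum>j\<in>UNIV. a t $ i $ j * sol_jet t [axis j 1, axis i 1] z)"
      by (simp add: trace_def matrix_matrix_mult_def hessian_def jet_pdiffs[OF J[OF t]])
    \<comment> \<open>The trace pairs the entry (i, j) with the derivative in the order j, i; the
      symmetry of \<open>a\<close> restores the order used in \<open>diffusion\<close>.\<close>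
    also have "\<dots> = (\<Sum>j\<in>UNIV. \<Sum>i\<in>UNIV. a t $ j $ i * sol_jet t [axis j 1, axis i 1] z)"
      by (subst sum.swap) (simp add: s)
    also have "\<dots> = diffusion (conj_cov A a t) (V t) [] (E t *v z)"
      using t by (subst diffusion_conj_cov[OF flow_jet]) (auto simp: sol_jet_def)
    finally have 1: "trace (a t ** hessian (sol_jet t []) z) = diffusion (conj_cov A a t) (V t) [] (E t *v z)" .
    have "(A *v z) \<bullet> gradient (sol_jet t []) z = (\<Sum>i\<in>UNIV. (A *v z) $ i * sol_jet t [axis i 1] z)"
      by (simp add: inner_vec_def gradient_def jet_pdiffs[OF J[OF t]])
    also have "\<dots> = sol_jet t [A *v z] z" using jet_expand[OF J[OF t], of "[]" "A *v z" "[]" z] by simp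
    finally show ?thesis using 1 L[OF t] by (simp add: rhs_def sol_jet_def)
  qed
  show ?thesis unfolding is_solution_def
  proof (intro conjI ballI allI)
    show "continuous_on ({0..T} \<times> UNIV) (\<lambda>(t, z). sol_jet t [] z)" by (rule sol_jet_continuous)
    show "bounded ((\<lambda>(t, z). sol_jet t [] z) ` ({0..T} \<times> UNIV))"
      unfolding bounded_iff using jet_bound[OF J, of _ "[]"] by (intro exI[of _ "M' 0"]) auto
    show "Cn_on UNIV 2 (sol_jet t [])" if "t \<in> {0..T}" for t by (rule jet_Cn_on[OF J[OF that]])
    fix t z assume t: "t \<in> {0..T}"
    have "set_integrable lborel {0..t} (\<lambda>s. f s z + rhs s z)"
      by (rule set_integrable_subset[OF total_integrable]) (use t in auto)
    moreover have "\<And>s. s \<in> {0..t} \<Longrightarrow> f s z + L s (sol_jet s []) z = f s z + rhs s z" using Leq t by auto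
    ultimately show "set_integrable lborel {0..t} (\<lambda>s. f s z + L s (sol_jet s []) z)"
      by (subst set_integrable_cong[OF refl]) auto
    show "sol_jet t [] z = (LBINT s:{0..t}. f s z + L s (sol_jet s []) z)"
      unfolding solution_equation[OF t] by (intro set_lebesgue_integral_cong) (use Leq t in auto)
  qed
qed

end

section \<open>The viscosity inequality for homogeneous solutions\<close>

text \<open>If no F n contained a relative neighbourhood in K, all the sets K - F n would be open
  and dense in K, yet their intersection is empty.\<close>

lemma Baire_closed_cover:
  fixes K :: "'a::euclidean_space set" and F :: "nat \<Rightarrow> 'a set"
  assumes "closed K" "K \<noteq> {}" "\<And>n. closed (F n)" "K \<subseteq> (\<Union>n. F n)"
  shows "\<exists>n t \<eta>. \<eta> > 0 \<and> t \<in> K \<and> K \<inter> ball t \<eta> \<subseteq> F n"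
proof (rule ccontr)
  assume contra: "\<not> ?thesis"
  have no: "\<not> K \<inter> ball t \<eta> \<subseteq> F n" if "\<eta> > 0" "t \<in> K" for n t \<eta>
    using contra that by blast
  define G where "G = range (\<lambda>n. K - F n)"
  have "K \<subseteq> closure (\<Inter>G)"
  proof (rule Baire[OF assms(1)])
    show "countable G" by (simp add: G_def)
    fix T assume "T \<in> G"
    then obtain n where T: "T = K - F n" by (auto simp: G_def)
    have "openin (top_of_set K) (K \<inter> - F n)"
      using assms(3)[of n] by (auto intro: openin_open_Int)
    then have "openin (top_of_set K) T" by (simp add: T Diff_eq)
    moreover have "x \<in> closure T" if "x \<in> K" for x
      unfolding closure_approachable
    proof (intro allI impI)
      fix e :: real assume "e > 0"
      with no[OF this that, of n] show "\<exists>y\<in>T. dist y x < e" by (auto simp: T dist_commute)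
    qed
    ultimately show "openin (top_of_set K) T \<and> K \<subseteq> closure T" by auto
  qed
  moreover have "\<Inter>G = {}" using assms(4) by (auto simp: G_def)
  ultimately show False using assms(2) by simp
qed

text \<open>The gaps of \<open>K\<close> need not be enumerated: near \<open>K\<close> their contribution is bounded by a small
  integral, and away from \<open>K\<close> one can go back to the last point of \<open>K\<close>.\<close>

lemma gap_integral_nonpos:
  fixes h :: "real \<Rightarrow> real"
  assumes K: "closed K" "s \<in> K" and st: "s \<le> t" and h: "set_integrable lborel {s..t} h"
    and gap: "\<And>x y. s \<le> x \<Longrightarrow> x < y \<Longrightarrow> y \<le> t \<Longrightarrow> x \<in> K \<Longrightarrow> {x<..<y} \<inter> K = {} \<Longrightarrow>
        (LBINT \<sigma>:{x<..y}. h \<sigma>) \<le> 0"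
  shows "(LBINT \<sigma>:{s<..t} - K. h \<sigma>) \<le> 0"
proof (rule field_le_epsilon)
  fix e :: real assume e: "e > 0"
  have Kb: "K \<in> sets borel" using K(1) by (rule borel_closed)
  have sub: "set_integrable lborel X h" if "X \<subseteq> {s..t}" "X \<in> sets borel" for X
    using set_integrable_subset[OF h] that by simp
  \<comment> \<open>Shrinking neighbourhoods of K. As K is closed, the sets V m - K decrease to the
    empty set, so the mass of h on them tends to 0.\<close>
  define V where "V m = {x. infdist x K < 1 / real (Suc m)}" for m
  have Vopen: "open (V m)" for m
    unfolding V_def by (intro open_Collect_less continuous_on_infdist continuous_intros)
  have KV: "K \<subseteq> V m" for m unfolding V_def using infdist_zero by auto
  have "(\<lambda>m. LBINT \<sigma>. indicator ({s<..t} \<inter> (V m - K)) \<sigma> *\<^sub>R \<bar>h \<sigma>\<bar>) \<longlonglongrightarrow> integral\<^sup>L lborel (\<lambda>_::real. 0::real)"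
  proof (rule integral_dominated_convergence[where w = "\<lambda>\<sigma>. indicator {s..t} \<sigma> *\<^sub>R \<bar>h \<sigma>\<bar>"])
    show "integrable lborel (\<lambda>\<sigma>. indicator {s..t} \<sigma> *\<^sub>R \<bar>h \<sigma>\<bar>)"
      using set_integrable_abs[OF h] by (simp add: set_integrable_def)
    show "(\<lambda>\<sigma>. indicator ({s<..t} \<inter> (V m - K)) \<sigma> *\<^sub>R \<bar>h \<sigma>\<bar>) \<in> borel_measurable lborel" for m
    proof -
      have "set_integrable lborel ({s<..t} \<inter> (V m - K)) (\<lambda>\<sigma>. \<bar>h \<sigma>\<bar>)"
        by (intro set_integrable_abs sub) (use Kb Vopen[of m] in auto)
      then show ?thesis unfolding set_integrable_def by (rule borel_measurable_integrable)
    qed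
    show "AE \<sigma> in lborel. (\<lambda>m. indicator ({s<..t} \<inter> (V m - K)) \<sigma> *\<^sub>R \<bar>h \<sigma>\<bar>) \<longlonglongrightarrow> 0"
    proof (rule AE_I2)
      fix \<sigma> :: real
      show "(\<lambda>m. indicator ({s<..t} \<inter> (V m - K)) \<sigma> *\<^sub>R \<bar>h \<sigma>\<bar>) \<longlonglongrightarrow> 0"
      proof (cases "\<sigma> \<in> K")
        case True then show ?thesis by simp
      next
        case False
        then have "infdist \<sigma> K > 0"
          using K by (metis in_closed_iff_infdist_zero empty_iff infdist_nonneg order_le_less)
        then obtain m0 where m0: "1 / real (Suc m0) < infdist \<sigma> K" using nat_approx_posE by blast
        have "indicator ({s<..t} \<inter> (V m - K)) \<sigma> *\<^sub>R \<bar>h \<sigma>\<bar> = 0" if "m \<ge> m0" for m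
        proof -
          have "1 / real (Suc m) \<le> 1 / real (Suc m0)" using that by (simp add: frac_le)
          then have "\<sigma> \<notin> V m" using m0 by (simp add: V_def)
          then show ?thesis by simp
        qed
        then show ?thesis by (intro tendsto_eventually) (auto simp: eventually_sequentially)
      qed
    qed
    show "AE x in lborel. norm (indicator ({s<..t} \<inter> (V m - K)) x *\<^sub>R \<bar>h x\<bar>) \<le> indicator {s..t} x *\<^sub>R \<bar>h x\<bar>" for m
      by (intro AE_I2) (auto simp: indicator_def)
  qed simp_all
  then have "eventually (\<lambda>m. (LBINT \<sigma>. indicator ({s<..t} \<inter> (V m - K)) \<sigma> *\<^sub>R \<bar>h \<sigma>\<bar>) < e) sequentially"
    using e by (intro order_tendstoD) auto
  then obtain m where m: "(LBINT \<sigma>:{s<..t} \<inter> (V m - K). \<bar>h \<sigma>\<bar>) < e"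
    unfolding set_lebesgue_integral_def by (auto simp: eventually_sequentially)
  \<comment> \<open>\<open>D\<close> is the integral to be bounded, \<open>G\<close> the absolute
    mass of h off K but within \<open>V m\<close>. The inequality D \<le> G is propagated from s to
    t by real induction.\<close>
  define D where "D \<tau> = (LBINT \<sigma>:{s<..\<tau>} - K. h \<sigma>)" for \<tau>
  define G where "G \<tau> = (LBINT \<sigma>:{s<..\<tau>} \<inter> (V m - K). \<bar>h \<sigma>\<bar>)" for \<tau>
  have Dadd: "D y = D x + (LBINT \<sigma>:{x<..y} - K. h \<sigma>)" if "s \<le> x" "x \<le> y" "y \<le> t" for x y
  proof -
    have "{s<..y} - K = ({s<..x} - K) \<union> ({x<..y} - K)" using that by auto
    then show ?thesis unfolding D_def using that
      by (simp, intro set_integral_Un sub) (use Kb in auto)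
  qed
  have Gadd: "G y = G x + (LBINT \<sigma>:{x<..y} \<inter> (V m - K). \<bar>h \<sigma>\<bar>)" if "s \<le> x" "x \<le> y" "y \<le> t" for x y
  proof -
    have "{s<..y} \<inter> (V m - K) = ({s<..x} \<inter> (V m - K)) \<union> ({x<..y} \<inter> (V m - K))" using that by auto
    then show ?thesis unfolding G_def using that
      by (simp, intro set_integral_Un set_integrable_abs sub) (use Kb Vopen[of m] in auto)
  qed
  have nn: "0 \<le> (LBINT \<sigma>:X. \<bar>h \<sigma>\<bar>)" for X
    unfolding set_lebesgue_integral_def by (intro integral_nonneg_AE AE_I2) (simp add: indicator_def)
  \<comment> \<open>Inside \<open>V m\<close> everything off K is charged to
    \<open>G\<close>.\<close>
  have near: "D y \<le> G y" if "s \<le> x" "x \<le> y" "y \<le> t" "{x..y} \<subseteq> V m" "D x \<le> G x" for x y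
  proof -
    have eq: "{x<..y} \<inter> (V m - K) = {x<..y} - K" using that(4) by (auto simp: subset_eq)
    have "(LBINT \<sigma>:{x<..y} - K. h \<sigma>) \<le> (LBINT \<sigma>:{x<..y} - K. \<bar>h \<sigma>\<bar>)"
      by (intro set_integral_mono set_integrable_abs sub) (use that Kb in auto)
    then show ?thesis using that Dadd[of x y] Gadd[of x y] unfolding eq by simp
  qed
  \<comment> \<open>From a point off K one goes back to the last point x of K; in between lies a
    gap, where the hypothesis applies and \<open>D\<close> does not grow.\<close>
  have far: "D y \<le> G y" if y: "s \<le> y" "y \<le> t" "y \<notin> K" and IH: "\<And>x. s \<le> x \<Longrightarrow> x < y \<Longrightarrow> x \<in> K \<Longrightarrow> D x \<le> G x" for y
  proof -
    define x where "x = Sup (K \<inter> {s..y})"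
    have ne: "K \<inter> {s..y} \<noteq> {}" using K y by auto
    have comp: "compact (K \<inter> {s..y})" using K by (intro closed_Int_compact) auto
    then have x: "x \<in> K \<inter> {s..y}"
      unfolding x_def using ne closed_contains_Sup compact_imp_closed compact_imp_bounded bounded_imp_bdd_above by metis
    have up: "u \<le> x" if "u \<in> K \<inter> {s..y}" for u
      unfolding x_def using that comp by (intro cSup_upper) (auto simp: compact_imp_bounded bounded_imp_bdd_above)
    have xy: "x < y" using x y by (metis IntD1 IntD2 atLeastAtMost_iff order_le_less)
    have gp: "{x<..<y} \<inter> K = {}" using up x by fastforce
    have "u \<notin> K" if "x < u" "u \<le> y" for u
      using gp y that by (cases "u = y") (auto simp: disjoint_iff)
    then have eq: "{x<..y} - K = {x<..y}" by auto
    have "(LBINT \<sigma>:{x<..y} - K. h \<sigma>) \<le> 0" unfolding eq using gap[of x y] x xy y gp by auto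
    then have "D y \<le> D x" using Dadd[of x y] x xy y by simp
    also have "\<dots> \<le> G x" using IH[of x] x xy by simp
    also have "\<dots> \<le> G y" using Gadd[of x y] nn x xy y by simp
    finally show ?thesis .
  qed
  have Vnear: "\<exists>\<gamma>>0. ball x \<gamma> \<subseteq> V m" if "x \<in> K" for x
    using Vopen[of m] KV[of m] that by (meson openE subsetD)
  have "D t \<le> G t"
  proof (rule real_right_induction[where a = s and b = t])
    show "D \<tau> \<le> G \<tau>" if \<tau>: "s < \<tau>" "\<tau> \<le> t" and below: "\<And>x. s \<le> x \<Longrightarrow> x < \<tau> \<Longrightarrow> D x \<le> G x" for \<tau>
    proof (cases "\<tau> \<in> K")
      case True
      from Vnear[OF True] obtain \<gamma> where \<gamma>: "\<gamma> > 0" "ball \<tau> \<gamma> \<subseteq> V m" by blast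
      define x where "x = max s (\<tau> - \<gamma>/2)"
      have x: "s \<le> x" "x < \<tau>" "{x..\<tau>} \<subseteq> ball \<tau> \<gamma>" using \<tau> \<gamma>(1) by (auto simp: x_def dist_real_def)
      then show ?thesis using near[of x \<tau>] below[of x] \<tau> \<gamma>(2) by auto
    next
      case False then show ?thesis using far[of \<tau>] below \<tau> by auto
    qed
    show "\<exists>\<gamma>>0. \<forall>y. x < y \<and> y < x + \<gamma> \<and> y \<le> t \<longrightarrow> D y \<le> G y"
      if x: "s \<le> x" "x < t" and below: "\<And>y. s \<le> y \<Longrightarrow> y \<le> x \<Longrightarrow> D y \<le> G y" for x
    proof (cases "x \<in> K")
      case True
      from Vnear[OF True] obtain \<gamma> where \<gamma>: "\<gamma> > 0" "ball x \<gamma> \<subseteq> V m" by blast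
      have "D y \<le> G y" if y: "x < y" "y < x + \<gamma>" "y \<le> t" for y
      proof -
        have "{x..y} \<subseteq> ball x \<gamma>" using y by (auto simp: dist_real_def)
        then show ?thesis using near[of x y] below[of x] x y \<gamma>(2) by auto
      qed
      then show ?thesis using \<gamma>(1) by blast
    next
      case False
      then obtain \<gamma> where \<gamma>: "\<gamma> > 0" "ball x \<gamma> \<subseteq> - K" using K by (meson open_Compl openE ComplI)
      have "D y \<le> G y" if y: "x < y" "y < x + \<gamma>" "y \<le> t" for y
      proof -
        have out: "u \<notin> K" if "x < u" "u \<le> y" for u using that y \<gamma>(2) by (auto simp: dist_real_def subset_eq)
        show ?thesis
        proof (rule far)
          show "D u \<le> G u" if u: "s \<le> u" "u < y" "u \<in> K" for u
            using below[of u] out[of u] u by (cases "u \<le> x") auto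
        qed (use x y out in auto)
      qed
      then show ?thesis using \<gamma>(1) by blast
    qed
  qed (use st in \<open>auto simp: D_def G_def set_lebesgue_integral_def\<close>)
  then show "(LBINT \<sigma>:{s<..t} - K. h \<sigma>) \<le> 0 + e" using m by (simp add: D_def G_def)
qed

section \<open>Touching from above and test functions\<close>

text \<open>If c > 0, then g' is positive just to the right of 0, and g increases there.\<close>

lemma has_second_order_max_conditions:
  fixes g g' :: "real \<Rightarrow> real"
  assumes \<rho>: "\<rho> > 0" and max: "\<And>r. \<bar>r\<bar> < \<rho> \<Longrightarrow> g r \<le> g 0"
    and d: "\<And>r. (g has_real_derivative g' r) (at r)" and dd: "(g' has_real_derivative c) (at 0)"
  shows "g' 0 = 0" "c \<le> 0"
proof -
  show 0: "g' 0 = 0"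
    by (rule DERIV_local_max[OF d \<rho>]) (use max in auto)
  show "c \<le> 0"
  proof (rule ccontr)
    assume "\<not> c \<le> 0"
    then obtain d0 where d0: "d0 > 0" "\<And>h. 0 < h \<Longrightarrow> h < d0 \<Longrightarrow> g' 0 < g' (0 + h)"
      using DERIV_pos_inc_right[OF dd] by auto
    define h where "h = min d0 \<rho> / 2"
    have h: "0 < h" "h < d0" "h < \<rho>" using d0(1) \<rho> by (auto simp: h_def min_def)
    obtain \<xi> where \<xi>: "0 < \<xi>" "\<xi> < h" "g h - g 0 = (h - 0) * g' \<xi>"
      using MVT2[OF h(1), of g g'] d by auto
    have "g' \<xi> > 0" using d0(2)[of \<xi>] \<xi> h 0 by simp
    then have "g h > g 0" using \<xi> h(1) by (metis diff_gt_0_iff_gt diff_zero mult_pos_pos)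
    then show False using max[of h] h by simp
  qed
qed

definition entry_norm :: "real^'n^'n::finite \<Rightarrow> real" where
  "entry_norm M = (\<Sum>i\<in>UNIV. \<Sum>j\<in>UNIV. \<bar>M $ i $ j\<bar>)"

lemma quadratic_form_le_entry_norm:
  fixes M :: "real^'n^'n::finite"
  shows "\<bar>(M *v x) \<bullet> y\<bar> \<le> entry_norm M * norm x * norm y"
proof -
  have "\<bar>(M *v x) \<bullet> y\<bar> \<le> (\<Sum>i\<in>UNIV. \<Sum>j\<in>UNIV. \<bar>M $ i $ j * x $ j * y $ i\<bar>)"
    unfolding quadratic_form_sum by (intro order_trans[OF sum_abs] sum_mono order_refl)
  also have "\<dots> \<le> (\<Sum>i\<in>UNIV. \<Sum>j\<in>UNIV. \<bar>M $ i $ j\<bar> * norm x * norm y)"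
    unfolding abs_mult by (intro sum_mono mult_mono component_le_norm_cart) auto
  finally show ?thesis by (simp add: entry_norm_def sum_distrib_right)
qed

lemma entry_norm_nonneg: "entry_norm M \<ge> 0"
  by (simp add: entry_norm_def sum_nonneg)

lemma norm_matrix_vector_le:
  fixes M :: "real^'n^'n::finite"
  shows "norm (M *v x) \<le> entry_norm M * norm x"
proof (cases "M *v x = 0")
  case False
  have "norm (M *v x) * norm (M *v x) \<le> (entry_norm M * norm x) * norm (M *v x)"
    using quadratic_form_le_entry_norm[of M x "M *v x"] by (simp add: power2_norm_eq_inner[symmetric] power2_eq_square)
  then show ?thesis using False by simp
qed (simp add: entry_norm_nonneg)

text \<open>The family is stable under adding \<epsilon> |z - z1|^2 + \<epsilon> (t1 - t), and it
  contains the barrier of \<open>gap_growth\<close> as well as the comparison function of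
  \<open>homogeneous_solution_nonpos\<close>.\<close>

definition quad_test :: "(real \<Rightarrow> real) \<Rightarrow> real^'n \<Rightarrow> (real \<Rightarrow> real) \<Rightarrow> real \<Rightarrow> real^'n::finite \<Rightarrow> real" where
  "quad_test \<alpha> \<beta> \<kappa> t z = \<alpha> t + \<beta> \<bullet> z + \<kappa> t * (z \<bullet> z)"

lemma quad_test_diff:
  "quad_test \<alpha> \<beta> \<kappa> t y = quad_test \<alpha> \<beta> \<kappa> t z + (\<beta> + (2 * \<kappa> t) *\<^sub>R z) \<bullet> (y - z) + \<kappa> t * (norm (y - z))\<^sup>2"
  by (simp add: quad_test_def power2_norm_eq_inner inner_diff inner_add algebra_simps inner_commute)

definition C1_time :: "(real \<Rightarrow> real) \<Rightarrow> (real \<Rightarrow> real) \<Rightarrow> bool" where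
  "C1_time \<alpha> \<alpha>' \<longleftrightarrow> (\<forall>t. (\<alpha> has_real_derivative \<alpha>' t) (at t)) \<and> continuous_on UNIV \<alpha>'"

lemma C1_time_continuous: "C1_time \<alpha> \<alpha>' \<Longrightarrow> continuous_on S \<alpha>"
  unfolding C1_time_def by (meson DERIV_isCont continuous_at_imp_continuous_on)

lemma C1_time_affine: "C1_time (\<lambda>t. c + d * t) (\<lambda>_. d)"
  unfolding C1_time_def by (auto intro!: derivative_eq_intros)

lemma C1_time_add: "C1_time \<alpha> \<alpha>' \<Longrightarrow> C1_time \<kappa> \<kappa>' \<Longrightarrow> C1_time (\<lambda>t. \<alpha> t + \<kappa> t) (\<lambda>t. \<alpha>' t + \<kappa>' t)"
  unfolding C1_time_def by (auto intro!: derivative_eq_intros continuous_intros)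

text \<open>The difference of two solutions, with the information that the notion of solution gives:
  at each time continuous first and second derivatives in space, and in time only joint continuity
  of the values and the integral equation at each point.\<close>

locale homogeneous_solution =
  fixes T W :: real and A :: "real^'n^'n::finite" and a :: "real \<Rightarrow> real^'n^'n"
    and w :: "real \<Rightarrow> real^'n \<Rightarrow> real" and Dw :: "real \<Rightarrow> real^'n \<Rightarrow> real^'n"
    and Hw :: "real \<Rightarrow> real^'n \<Rightarrow> real^'n^'n" and ell :: "real \<Rightarrow> real^'n \<Rightarrow> real"
  assumes T: "T > 0"
    and w_cont: "continuous_on ({0..T} \<times> UNIV) (\<lambda>(t, z). w t z)"
    and w_bd: "\<And>t z. t \<in> {0..T} \<Longrightarrow> \<bar>w t z\<bar> \<le> W"
    and D1: "\<And>t z v r. t \<in> {0..T} \<Longrightarrow>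
        ((\<lambda>r. w t (z + r *\<^sub>R v)) has_real_derivative Dw t (z + r *\<^sub>R v) \<bullet> v) (at r)"
    and D2: "\<And>t z v r. t \<in> {0..T} \<Longrightarrow>
        ((\<lambda>r. Dw t (z + r *\<^sub>R v) \<bullet> v) has_real_derivative (Hw t (z + r *\<^sub>R v) *v v) \<bullet> v) (at r)"
    and Dw_cont: "\<And>t. t \<in> {0..T} \<Longrightarrow> continuous_on UNIV (Dw t)"
    and Hw_cont: "\<And>t. t \<in> {0..T} \<Longrightarrow> continuous_on UNIV (Hw t)"
    and a_cont: "continuous_on {0..T} a"
    and a_psd: "\<And>t. t \<in> {0..T} \<Longrightarrow> sym_nonneg_matrix (a t)"
    and ell: "\<And>t z. ell t z = trace (a t ** Hw t z) + (A *v z) \<bullet> Dw t z"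
    and ell_int: "\<And>t z. t \<in> {0..T} \<Longrightarrow> set_integrable lborel {0..t} (\<lambda>s. ell s z)"
    and w_eq: "\<And>t z. t \<in> {0..T} \<Longrightarrow> w t z = (LBINT s:{0..t}. ell s z)"
begin

text \<open>The conditions for a maximum along each line through z give Dw = p and a bound 2
  \<kappa> on the form of Hw; the nonnegative matrix \<open>a\<close> turns the latter into a bound
  on the trace.\<close>

lemma touched_from_above:
  assumes t: "t \<in> {0..T}" and \<rho>: "\<rho> > 0"
    and touch: "\<And>y. norm (y - z) < \<rho> \<Longrightarrow> w t y \<le> w t z + p \<bullet> (y - z) + \<kappa> * (norm (y - z))\<^sup>2"
  shows "ell t z \<le> 2 * \<kappa> * trace (a t) + (A *v z) \<bullet> p"
proof -
  have *: "Dw t z \<bullet> v = p \<bullet> v \<and> (Hw t z *v v) \<bullet> v \<le> 2 * \<kappa> * (norm v)\<^sup>2" for v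
  proof (cases "v = 0")
    case False
    define g where "g r = w t (z + r *\<^sub>R v) - r * (p \<bullet> v) - \<kappa> * (r\<^sup>2 * (norm v)\<^sup>2)" for r
    define g' where "g' r = Dw t (z + r *\<^sub>R v) \<bullet> v - p \<bullet> v - \<kappa> * (2 * r * (norm v)\<^sup>2)" for r
    have nv: "\<rho> / norm v > 0" using False \<rho> by simp
    have max: "g r \<le> g 0" if "\<bar>r\<bar> < \<rho> / norm v" for r
    proof -
      have "norm (z + r *\<^sub>R v - z) < \<rho>" using that False by (simp add: field_simps)
      from touch[OF this] show ?thesis by (simp add: g_def power_mult_distrib)
    qed
    have d: "(g has_real_derivative g' r) (at r)" for r
      unfolding g_def g'_def by (auto intro!: derivative_eq_intros D1[OF t])
    have "(g' has_real_derivative (Hw t (z + 0 *\<^sub>R v) *v v) \<bullet> v - 0 - \<kappa> * (2 * (norm v)\<^sup>2)) (at 0)"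
      unfolding g'_def using D2[OF t, of z v 0] by (auto intro!: derivative_eq_intros)
    from has_second_order_max_conditions[OF nv max d this]
    show ?thesis by (simp add: g'_def)
  qed simp
  have p: "Dw t z = p" using * by (metis vector_eq_ldot inner_commute)
  have "trace (a t ** Hw t z) \<le> 2 * \<kappa> * trace (a t)"
    by (rule trace_mult_le[OF a_psd[OF t]]) (use * in auto)
  then show ?thesis by (simp add: ell p)
qed

text \<open>The time derivative minus the operator, applied to
  \<open>quad_test \<alpha> \<beta> \<kappa>\<close>; where it is positive, the test function is a
  strict supersolution.\<close>

definition test_defect :: "(real \<Rightarrow> real) \<Rightarrow> real^'n \<Rightarrow> (real \<Rightarrow> real) \<Rightarrow> (real \<Rightarrow> real) \<Rightarrow> real \<Rightarrow> real^'n \<Rightarrow> real" where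
  "test_defect \<alpha>' \<beta> \<kappa> \<kappa>' t z =
     \<alpha>' t + \<kappa>' t * (z \<bullet> z) - (2 * \<kappa> t * trace (a t) + (A *v z) \<bullet> (\<beta> + (2 * \<kappa> t) *\<^sub>R z))"

text \<open>\<open>w\<close> is touched from above at \<open>(t1, z1)\<close> by a strict supersolution. Test functions of the form
  \<open>\<alpha>(t) + \<beta>\<cdot>z + \<kappa>(t) |z|\<^sup>2\<close> suffice.\<close>

definition nonvisc :: "real \<Rightarrow> real^'n \<Rightarrow> bool" where
  "nonvisc t1 z1 \<longleftrightarrow> t1 \<in> {0..T} \<and> (\<exists>\<alpha> \<alpha>' \<beta> \<kappa> \<kappa>' \<rho>. 0 < \<rho> \<and> \<rho> \<le> t1 \<and> C1_time \<alpha> \<alpha>' \<and> C1_time \<kappa> \<kappa>' \<and>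
     (\<forall>s\<in>{t1 - \<rho>..t1}. \<forall>y\<in>cball z1 \<rho>. w s y - quad_test \<alpha> \<beta> \<kappa> s y \<le> w t1 z1 - quad_test \<alpha> \<beta> \<kappa> t1 z1) \<and>
     test_defect \<alpha>' \<beta> \<kappa> \<kappa>' t1 z1 > 0)"

lemma nonviscI:
  assumes "t1 \<in> {0..T}" "0 < \<rho>" "\<rho> \<le> t1" "C1_time \<alpha> \<alpha>'" "C1_time \<kappa> \<kappa>'"
    "\<forall>s\<in>{t1 - \<rho>..t1}. \<forall>y\<in>cball z1 \<rho>. w s y - quad_test \<alpha> \<beta> \<kappa> s y \<le> w t1 z1 - quad_test \<alpha> \<beta> \<kappa> t1 z1"
    "test_defect \<alpha>' \<beta> \<kappa> \<kappa>' t1 z1 > 0"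
  shows "nonvisc t1 z1"
  unfolding nonvisc_def
  by (rule conjI, rule assms, rule exI[of _ \<alpha>], rule exI[of _ \<alpha>'], rule exI[of _ \<beta>], rule exI[of _ \<kappa>],
      rule exI[of _ \<kappa>'], rule exI[of _ \<rho>], intro conjI assms)

lemma test_defect_continuous:
  assumes "C1_time \<alpha> \<alpha>'" "C1_time \<kappa> \<kappa>'"
  shows "continuous_on ({0..T} \<times> UNIV) (\<lambda>(t, z). test_defect \<alpha>' \<beta> \<kappa> \<kappa>' t z)"
proof -
  have 1: "continuous_on ({0..T} \<times> UNIV) (\<lambda>x::real \<times> (real^'n). \<gamma> (fst x))" if "continuous_on UNIV \<gamma>" for \<gamma> :: "real \<Rightarrow> real"
    by (rule continuous_on_compose2[OF that]) (auto intro!: continuous_intros)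
  have 2: "continuous_on ({0..T} \<times> UNIV) (\<lambda>x::real \<times> (real^'n). a (fst x))"
    by (rule continuous_on_compose2[OF a_cont]) (auto intro!: continuous_intros)
  have 3: "continuous_on ({0..T} \<times> UNIV) (\<lambda>x::real \<times> (real^'n). trace (a (fst x)))"
    unfolding trace_def by (intro continuous_intros 2)
  have 4: "continuous_on ({0..T} \<times> UNIV) (\<lambda>x::real \<times> (real^'n). A *v snd x)"
    by (intro continuous_on_compose2[OF linear_continuous_on[OF matrix_vector_mul_bounded_linear]]) (auto intro!: continuous_intros)
  show ?thesis
    unfolding test_defect_def case_prod_beta
    by (intro continuous_intros 1 2 3 4 C1_time_continuous[OF assms(2)])
       (use assms in \<open>auto simp: C1_time_def\<close>)
qed

lemma quad_test_continuous:
  fixes S :: "(real \<times> (real^'n)) set"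
  assumes "C1_time \<alpha> \<alpha>'" "C1_time \<kappa> \<kappa>'"
  shows "continuous_on S (\<lambda>(t, z). quad_test \<alpha> \<beta> \<kappa> t z)"
proof -
  have 1: "continuous_on S (\<lambda>x::real \<times> (real^'n). \<gamma> (fst x))" if "continuous_on UNIV \<gamma>" for \<gamma> :: "real \<Rightarrow> real"
    by (rule continuous_on_compose2[OF that]) (auto intro!: continuous_intros)
  show ?thesis unfolding quad_test_def case_prod_beta
    by (intro continuous_intros 1 C1_time_continuous[OF assms(1)] C1_time_continuous[OF assms(2)])
qed

lemma excess_continuous:
  assumes "C1_time \<alpha> \<alpha>'" "C1_time \<kappa> \<kappa>'"
  shows "continuous_on ({0..T} \<times> UNIV) (\<lambda>(t, z). w t z - quad_test \<alpha> \<beta> \<kappa> t z)"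
  using continuous_on_diff[OF w_cont quad_test_continuous[OF assms]] by (simp add: case_prod_beta)

text \<open>A smaller cylinder that ends at the maximum point (s, y) fits into the given one, since
  y lies in the open ball and s after the initial time.\<close>

lemma nonvisc_of_cylinder_max:
  assumes "0 \<le> r" "r < s" "s \<le> T" "dist z y < \<rho>"
    and "C1_time \<alpha> \<alpha>'" "C1_time \<kappa> \<kappa>'"
    and max: "\<And>s' y'. s' \<in> {r..s} \<Longrightarrow> y' \<in> cball z \<rho> \<Longrightarrow>
        w s' y' - quad_test \<alpha> \<beta> \<kappa> s' y' \<le> w s y - quad_test \<alpha> \<beta> \<kappa> s y"
    and "test_defect \<alpha>' \<beta> \<kappa> \<kappa>' s y > 0"
  shows "nonvisc s y"
proof -
  define \<eta> where "\<eta> = min (s - r) (\<rho> - dist z y)"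
  have \<eta>: "0 < \<eta>" "\<eta> \<le> s" "r \<le> s - \<eta>" using assms(1-4) by (auto simp: \<eta>_def)
  have "cball y \<eta> \<subseteq> cball z \<rho>"
  proof
    fix x assume "x \<in> cball y \<eta>"
    then have "dist z x \<le> dist z y + \<eta>" using dist_triangle[of z x y] by simp
    then show "x \<in> cball z \<rho>" by (simp add: \<eta>_def)
  qed
  then have "\<forall>s'\<in>{s - \<eta>..s}. \<forall>y'\<in>cball y \<eta>.
      w s' y' - quad_test \<alpha> \<beta> \<kappa> s' y' \<le> w s y - quad_test \<alpha> \<beta> \<kappa> s y"
    using max \<eta>(3) by (auto simp: subset_eq)
  moreover have "s \<in> {0..T}" using assms by auto
  ultimately show ?thesis
    using \<eta>(1,2) assms(5,6,8) by (intro nonviscI)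
qed

section \<open>Times of semiconcavity and growth across gaps\<close>

text \<open>At every point of the ball a paraboloid of opening n touches w from above. The condition
  involves only values of w, which are continuous in time, so it passes to limits in time; the bound
  on p provides the compactness for this.\<close>

definition semiconcave_times :: "real \<Rightarrow> nat \<Rightarrow> real set" where
  "semiconcave_times R n = {t \<in> {0..T}. \<forall>z\<in>cball 0 R. \<exists>p. norm p \<le> real n \<and>
     (\<forall>y\<in>cball z 1. w t y \<le> w t z + p \<bullet> (y - z) + real n * (norm (y - z))\<^sup>2)}"

lemma w_cont_time: "t \<in> {0..T} \<Longrightarrow> (\<And>j. x j \<in> {0..T}) \<Longrightarrow> x \<longlonglongrightarrow> t \<Longrightarrow> (\<lambda>j. w (x j) y) \<longlonglongrightarrow> w t y"
proof -
  assume *: "t \<in> {0..T}" "\<And>j. x j \<in> {0..T}" "x \<longlonglongrightarrow> t"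
  have "continuous_on {0..T} (\<lambda>s. case (s, y) of (t, z) \<Rightarrow> w t z)"
    by (rule continuous_on_compose2[OF w_cont]) (auto intro!: continuous_intros)
  then show ?thesis using * unfolding continuous_on_sequentially by (auto simp: o_def)
qed

lemma closed_semiconcave_times: "closed (semiconcave_times R n)"
  unfolding closed_sequential_limits
proof (intro allI impI)
  fix x t assume "(\<forall>j. x j \<in> semiconcave_times R n) \<and> x \<longlonglongrightarrow> t"
  then have x: "\<And>j. x j \<in> semiconcave_times R n" "x \<longlonglongrightarrow> t" by auto
  have xT: "x j \<in> {0..T}" for j using x(1)[of j] by (simp add: semiconcave_times_def)
  have t: "t \<in> {0..T}" using xT x(2) closed_atLeastAtMost[of 0 T] unfolding closed_sequential_limits by blast
  have "\<exists>p. norm p \<le> real n \<and> (\<forall>y\<in>cball z 1. w t y \<le> w t z + p \<bullet> (y - z) + real n * (norm (y - z))\<^sup>2)"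
    if z: "z \<in> cball 0 R" for z
  proof -
    have "\<forall>j. \<exists>p. norm p \<le> real n \<and> (\<forall>y\<in>cball z 1. w (x j) y \<le> w (x j) z + p \<bullet> (y - z) + real n * (norm (y - z))\<^sup>2)"
      using x(1) z by (auto simp: semiconcave_times_def)
    then obtain p where p: "\<And>j. norm (p j) \<le> real n"
      "\<And>j y. y\<in>cball z 1 \<Longrightarrow> w (x j) y \<le> w (x j) z + p j \<bullet> (y - z) + real n * (norm (y - z))\<^sup>2" by metis
    obtain l r where l: "l \<in> cball (0::real^'n) (real n)" "strict_mono r" "(p \<circ> r) \<longlonglongrightarrow> l"
      using compact_cball[of "0::real^'n" "real n"] p(1) unfolding compact_def by (metis dist_0_norm mem_cball)
    have lim: "(\<lambda>j. w ((x \<circ> r) j) y) \<longlonglongrightarrow> w t y" for y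
      using w_cont_time[OF t, of "x \<circ> r"] xT LIMSEQ_subseq_LIMSEQ[OF x(2) l(2)] by auto
    have "w t y \<le> w t z + l \<bullet> (y - z) + real n * (norm (y - z))\<^sup>2" if y: "y \<in> cball z 1" for y
    proof (rule LIMSEQ_le[OF lim])
      show "(\<lambda>j. w ((x \<circ> r) j) z + (p \<circ> r) j \<bullet> (y - z) + real n * (norm (y - z))\<^sup>2)
         \<longlonglongrightarrow> w t z + l \<bullet> (y - z) + real n * (norm (y - z))\<^sup>2"
        by (intro tendsto_intros lim l(3))
    qed (use p(2)[OF y] in auto)
    then show ?thesis using l(1) by auto
  qed
  then show "t \<in> semiconcave_times R n" using t by (auto simp: semiconcave_times_def)
qed

text \<open>Taylor's formula at a fixed time, on a compact ball; the constant may depend on the time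
  in an uncontrolled way.\<close>

lemma semiconcave_times_cover:
  assumes t: "t \<in> {0..T}"
  shows "\<exists>n. t \<in> semiconcave_times R n"
proof -
  have "compact ((\<lambda>z. norm (Dw t z)) ` cball 0 R)"
    by (intro compact_continuous_image continuous_intros continuous_on_subset[OF Dw_cont[OF t]]) auto
  then obtain G where G: "\<And>z. z \<in> cball 0 R \<Longrightarrow> norm (Dw t z) \<le> G"
    using compact_imp_bounded bounded_imp_bdd_above unfolding bdd_above_def by (metis image_eqI)
  \<comment> \<open>The radius is R + 1, because the expansion reaches up to distance 1 from a point
    of the ball of radius R.\<close>
  have "compact ((\<lambda>z. entry_norm (Hw t z)) ` cball 0 (R + 1))"
    unfolding entry_norm_def
    by (intro compact_continuous_image continuous_intros continuous_on_subset[OF Hw_cont[OF t]]) auto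
  then obtain N where N: "\<And>z. z \<in> cball 0 (R + 1) \<Longrightarrow> entry_norm (Hw t z) \<le> N"
    using compact_imp_bounded bounded_imp_bdd_above unfolding bdd_above_def by (metis image_eqI)
  obtain n where n: "real n \<ge> max G N" using real_arch_simple by blast
  have "w t y \<le> w t z + Dw t z \<bullet> (y - z) + real n * (norm (y - z))\<^sup>2"
    if z: "z \<in> cball 0 R" and y: "y \<in> cball z 1" for z y
  proof -
    define v where "v = y - z"
    define diff where "diff m = (if m = 0 then (\<lambda>r. w t (z + r *\<^sub>R v)) else if m = 1 then (\<lambda>r. Dw t (z + r *\<^sub>R v) \<bullet> v)
        else (\<lambda>r. (Hw t (z + r *\<^sub>R v) *v v) \<bullet> v))" for m :: nat
    have "\<forall>m x. m < 2 \<and> 0 \<le> x \<and> x \<le> 1 \<longrightarrow> (diff m has_real_derivative diff (Suc m) x) (at x)"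
      using D1[OF t] D2[OF t] by (auto simp: diff_def less_2_cases_iff)
    from Maclaurin2[of 1 diff "diff 0" 2, OF _ _ this] obtain \<xi> where \<xi>: "0 < \<xi>" "\<xi> \<le> 1"
       "diff 0 1 = (\<Sum>m<2. diff m 0 / fact m * 1 ^ m) + diff 2 \<xi> / fact 2 * 1\<^sup>2" by auto
    have "norm (\<xi> *\<^sub>R v) \<le> 1" using \<xi> y by (simp add: v_def dist_norm norm_minus_commute mult_le_one)
    then have "norm (z + \<xi> *\<^sub>R v) \<le> R + 1" using z norm_triangle_ineq[of z "\<xi> *\<^sub>R v"] by simp
    then have "entry_norm (Hw t (z + \<xi> *\<^sub>R v)) \<le> real n" using N[of "z + \<xi> *\<^sub>R v"] n by simp
    then have "entry_norm (Hw t (z + \<xi> *\<^sub>R v)) * norm v * norm v \<le> real n * norm v * norm v"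
      by (intro mult_right_mono) auto
    then have "(Hw t (z + \<xi> *\<^sub>R v) *v v) \<bullet> v \<le> real n * (norm v)\<^sup>2"
      using quadratic_form_le_entry_norm[of "Hw t (z + \<xi> *\<^sub>R v)" v v] by (simp add: power2_eq_square mult.assoc)
    moreover have "0 \<le> real n * (norm v)\<^sup>2" by simp
    moreover have "w t y = w t z + Dw t z \<bullet> v + (Hw t (z + \<xi> *\<^sub>R v) *v v) \<bullet> v / 2"
      using \<xi>(3) by (simp add: diff_def numeral_2_eq_2 v_def)
    ultimately show ?thesis unfolding v_def by linarith
  qed
  moreover have "norm (Dw t z) \<le> real n" if "z \<in> cball 0 R" for z using G[OF that] n by simp
  ultimately have "t \<in> semiconcave_times R n" using t unfolding semiconcave_times_def by blast
  then show ?thesis by blast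
qed

end

lemma (in homogeneous_solution) w_diff_integral:
  assumes "0 \<le> s" "s \<le> t" "t \<le> T"
  shows "set_integrable lborel {s..t} (\<lambda>\<sigma>. ell \<sigma> z)"
    and "w t z - w s z = (LBINT \<sigma>:{s<..t}. ell \<sigma> z)"
proof -
  have i: "set_integrable lborel {0..t} (\<lambda>\<sigma>. ell \<sigma> z)" using ell_int assms by auto
  show "set_integrable lborel {s..t} (\<lambda>\<sigma>. ell \<sigma> z)"
    by (rule set_integrable_subset[OF i]) (use assms in auto)
  have "{0..t} = {0..s} \<union> {s<..t}" using assms by auto
  then have "(LBINT \<sigma>:{0..t}. ell \<sigma> z) = (LBINT \<sigma>:{0..s}. ell \<sigma> z) + (LBINT \<sigma>:{s<..t}. ell \<sigma> z)"
    using assms by (simp, intro set_integral_Un set_integrable_subset[OF i]) auto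
  then show "w t z - w s z = (LBINT \<sigma>:{s<..t}. ell \<sigma> z)"
    using w_eq[of t z] w_eq[of s z] assms by simp
qed

lemma (in homogeneous_solution) gap_growth:
  assumes x: "0 \<le> x" "x < y" "y \<le> T" and conc: "x \<in> semiconcave_times R n"
    and V: "\<And>s y'. x < s \<Longrightarrow> s < y \<Longrightarrow> y' \<in> ball 0 R \<Longrightarrow> \<not> nonvisc s y'"
    and z: "cball z \<rho> \<subseteq> ball 0 R" and \<rho>: "0 < \<rho>" "\<rho> \<le> 1"
    and m: "m \<ge> real n" "m * \<rho>\<^sup>2 \<ge> 2 * W + real n * \<rho>"
    and C: "C > 2 * m * Ta + NA * R * (real n + 2 * m * \<rho>)"
    and Ta: "\<And>t. t \<in> {0..T} \<Longrightarrow> trace (a t) \<le> Ta" and NA: "\<And>z. norm (A *v z) \<le> NA * norm z" "NA \<ge> 0"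
  shows "w y z - w x z \<le> C * (y - x)"
proof (rule ccontr)
  assume contra: "\<not> ?thesis"
  have zR: "z \<in> ball 0 R" using z \<rho> by (meson centre_in_cball less_imp_le subsetD)
  have R: "R > 0" using zR by (metis ball_empty empty_iff not_le)
  have m0: "m \<ge> 0" using m(1) by (meson of_nat_0_le_iff order_trans)
  have "z \<in> cball 0 R" using zR by auto
  then have "\<exists>p. norm p \<le> real n \<and> (\<forall>y\<in>cball z 1. w x y \<le> w x z + p \<bullet> (y - z) + real n * (norm (y - z))\<^sup>2)"
    using conc unfolding semiconcave_times_def by blast
  then obtain p where p: "norm p \<le> real n"
    "\<And>y. y \<in> cball z 1 \<Longrightarrow> w x y \<le> w x z + p \<bullet> (y - z) + real n * (norm (y - z))\<^sup>2"
    by blast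
  define \<alpha> where "\<alpha> t = (w x z - p \<bullet> z + m * (z \<bullet> z) - C * x) + C * t" for t
  define \<beta> where "\<beta> = p - (2 * m) *\<^sub>R z"
  define \<kappa> where "\<kappa> = (\<lambda>t::real. m + 0 * t)"
  define \<phi> where "\<phi> = quad_test \<alpha> \<beta> \<kappa>"
  have \<alpha>: "C1_time \<alpha> (\<lambda>_. C)" and \<kappa>: "C1_time \<kappa> (\<lambda>_. 0)"
    unfolding \<alpha>_def \<kappa>_def by (rule C1_time_affine)+
  have \<phi>: "\<phi> t y' = w x z + p \<bullet> (y' - z) + m * (norm (y' - z))\<^sup>2 + C * (t - x)" for t y'
    by (simp add: \<phi>_def quad_test_def \<alpha>_def \<beta>_def \<kappa>_def power2_norm_eq_inner inner_diff algebra_simps inner_commute)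
  \<comment> \<open>The end time y is not covered by V. By continuity the excess is already positive
    at some b < y, and the maximum is sought on [x, b].\<close>
  have lim: "((\<lambda>t. w t z - \<phi> t z) \<longlongrightarrow> w y z - \<phi> y z) (at_left y)"
  proof -
    have "continuous_on {0..T} (\<lambda>t. case (t, z) of (t, z) \<Rightarrow> w t z - \<phi> t z)"
      unfolding \<phi>_def by (rule continuous_on_compose2[OF excess_continuous[OF \<alpha> \<kappa>]]) (auto intro!: continuous_intros)
    then have "continuous_on {x..y} (\<lambda>t. w t z - \<phi> t z)" using x by (auto elim: continuous_on_subset)
    then show ?thesis unfolding continuous_on_def using x(2) by (metis at_within_Icc_at_left atLeastAtMost_iff less_imp_le order_refl)
  qed
  have "0 < w y z - \<phi> y z" using contra by (simp add: \<phi> not_le)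
  from order_tendstoD(1)[OF lim this] have "eventually (\<lambda>t. 0 < w t z - \<phi> t z \<and> t \<in> {x<..<y}) (at_left y)"
    using eventually_at_left_real[OF x(2)] by (auto elim: eventually_elim2)
  then obtain b where b: "x < b" "b < y" "0 < w b z - \<phi> b z"
    using eventually_happens trivial_limit_at_left_real by force
  have "continuous_on ({x..b} \<times> cball z \<rho>) (\<lambda>(t, y). w t y - \<phi> t y)"
    unfolding \<phi>_def by (rule continuous_on_subset[OF excess_continuous[OF \<alpha> \<kappa>]]) (use x b in auto)
  moreover have "compact ({x..b} \<times> cball z \<rho>)" by (intro compact_Times) auto
  moreover have "(b, z) \<in> {x..b} \<times> cball z \<rho>" using b \<rho> by auto
  ultimately obtain q where q: "q \<in> {x..b} \<times> cball z \<rho>"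
    "\<And>q'. q' \<in> {x..b} \<times> cball z \<rho> \<Longrightarrow> (case q' of (t, y) \<Rightarrow> w t y - \<phi> t y) \<le> (case q of (t, y) \<Rightarrow> w t y - \<phi> t y)"
    using continuous_attains_sup[of "{x..b} \<times> cball z \<rho>" "\<lambda>(t, y). w t y - \<phi> t y"] by auto
  obtain s y' where sy: "q = (s, y')" by force
  have pos: "0 < w s y' - \<phi> s y'" using q(2)[of "(b, z)"] b \<rho> by (simp add: sy)
  have s: "x \<le> s" "s \<le> b" and y': "norm (y' - z) \<le> \<rho>" using q(1) by (auto simp: sy dist_norm norm_minus_commute)
  \<comment> \<open>At time x the paraboloid of opening n, hence also the one of opening m, lies
    above w.\<close>
  have "s \<noteq> x"
  proof
    assume "s = x"
    moreover have "w x y' \<le> w x z + p \<bullet> (y' - z) + real n * (norm (y' - z))\<^sup>2"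
      using y' \<rho> by (intro p(2)) (auto simp: dist_norm norm_minus_commute)
    moreover have "real n * (norm (y' - z))\<^sup>2 \<le> m * (norm (y' - z))\<^sup>2" using m by (intro mult_right_mono) auto
    ultimately show False using pos by (simp add: \<phi>)
  qed
  have py: "\<bar>p \<bullet> (y' - z)\<bar> \<le> real n * \<rho>"
    using Cauchy_Schwarz_ineq2[of p "y' - z"] mult_mono[OF p(1) y'] by simp
  have Cs: "0 \<le> C * (s - x)"
  proof -
    have "trace (a x) \<ge> 0" by (rule trace_nonneg[OF a_psd]) (use x in auto)
    then have "Ta \<ge> 0" using Ta[of x] x by simp
    then have "0 \<le> 2 * m * Ta + NA * R * (real n + 2 * m * \<rho>)" using m0 \<rho> R NA(2) by auto
    then show ?thesis using C s by simp
  qed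
  \<comment> \<open>On the sphere, m \<rho>^2 is at least the oscillation 2 W of w plus the size of
    the linear term.\<close>
  have "norm (y' - z) \<noteq> \<rho>"
  proof
    assume "norm (y' - z) = \<rho>"
    then have "\<phi> s y' = w x z + p \<bullet> (y' - z) + m * \<rho>\<^sup>2 + C * (s - x)" by (simp add: \<phi>)
    moreover have "\<bar>w x z\<bar> \<le> W" "\<bar>w s y'\<bar> \<le> W" using w_bd x s b by auto
    ultimately show False using pos py m(2) Cs by linarith
  qed
  then have yi: "norm (y' - z) < \<rho>" using y' by simp
  have y'R: "y' \<in> ball 0 R" using z y' by (auto simp: dist_norm norm_minus_commute subset_eq)
  have "nonvisc s y'"
  proof (rule nonvisc_of_cylinder_max[where r = x and z = z and \<rho> = \<rho> and \<alpha> = \<alpha> and \<beta> = \<beta> and \<kappa> = \<kappa>, OF _ _ _ _ \<alpha> \<kappa>])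
    show "w t u - quad_test \<alpha> \<beta> \<kappa> t u \<le> w s y' - quad_test \<alpha> \<beta> \<kappa> s y'" if "t \<in> {x..s}" "u \<in> cball z \<rho>" for t u
      using q(2)[of "(t, u)"] that s by (auto simp: sy \<phi>_def)
    have "(A *v y') \<bullet> (\<beta> + (2 * m) *\<^sub>R y') \<le> norm (A *v y') * norm (p + (2 * m) *\<^sub>R (y' - z))"
      using Cauchy_Schwarz_ineq2[of "A *v y'" "p + (2 * m) *\<^sub>R (y' - z)"] by (simp add: \<beta>_def algebra_simps)
    also have "\<dots> \<le> (NA * R) * (real n + 2 * m * \<rho>)"
    proof (intro mult_mono)
      have "NA * norm y' \<le> NA * R" using y'R NA(2) by (intro mult_left_mono) auto
      then show "norm (A *v y') \<le> NA * R" using NA(1)[of y'] by simp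
      have "norm (p + (2 * m) *\<^sub>R (y' - z)) \<le> norm p + 2 * m * norm (y' - z)"
        using norm_triangle_ineq[of p "(2 * m) *\<^sub>R (y' - z)"] m0 by simp
      also have "\<dots> \<le> real n + 2 * m * \<rho>" using p(1) y' m0 by (intro add_mono mult_left_mono) auto
      finally show "norm (p + (2 * m) *\<^sub>R (y' - z)) \<le> real n + 2 * m * \<rho>" .
    qed (use R NA(2) in auto)
    finally have "(A *v y') \<bullet> (\<beta> + (2 * m) *\<^sub>R y') \<le> NA * R * (real n + 2 * m * \<rho>)" .
    moreover have "2 * m * trace (a s) \<le> 2 * m * Ta" using Ta[of s] s x b m0 by (intro mult_left_mono) auto
    ultimately show "0 < test_defect (\<lambda>_. C) \<beta> \<kappa> (\<lambda>_. 0) s y'"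
      using C by (simp add: test_defect_def \<kappa>_def)
  qed (use x s b \<open>s \<noteq> x\<close> yi in \<open>auto simp: dist_norm norm_minus_commute\<close>)
  then show False using V[of s y'] s b \<open>s \<noteq> x\<close> y'R by auto
qed

context homogeneous_solution
begin

lemma trace_bounded: "\<exists>Ta. \<forall>t\<in>{0..T}. trace (a t) \<le> Ta"
proof -
  have "compact ((\<lambda>t. trace (a t)) ` {0..T})"
    unfolding trace_def by (intro compact_continuous_image continuous_intros a_cont compact_Icc)
  then show ?thesis
    using compact_imp_bounded bounded_imp_bdd_above unfolding bdd_above_def by (metis image_eqI)
qed

text \<open>Growth of \<open>w\<close> starting from a time at which \<open>w\<close> is semiconcave: the equation is used on \<open>K\<close>,
  the barrier of \<open>gap_growth\<close> on the gaps of \<open>K\<close>.\<close>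

lemma growth_from_closed_set:
  assumes K: "closed K" "s \<in> K" and st: "0 \<le> s" "s \<le> t" "t \<le> T"
    and gap: "\<And>x y. s \<le> x \<Longrightarrow> x < y \<Longrightarrow> y \<le> t \<Longrightarrow> x \<in> K \<Longrightarrow> {x<..<y} \<inter> K = {} \<Longrightarrow> w y z - w x z \<le> C * (y - x)"
  shows "w t z - w s z \<le> (LBINT \<sigma>:{s<..t} \<inter> K. ell \<sigma> z) + C * measure lebesgue ({s<..t} - K)"
proof -
  have Kb: "K \<in> sets borel" using K(1) by (rule borel_closed)
  note i = w_diff_integral(1)[OF st, of z]
  have sub: "set_integrable lborel X (\<lambda>\<sigma>. ell \<sigma> z)" if "X \<subseteq> {s..t}" "X \<in> sets borel" for X
    using set_integrable_subset[OF i] that by simp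
  have csub: "set_integrable lborel X (\<lambda>\<sigma>. C)" if "X \<subseteq> {s..t}" "X \<in> sets borel" for X
    by (rule set_integrable_subset[OF borel_integrable_atLeastAtMost'[of s t "\<lambda>_. C"]]) (use that in auto)
  have const: "(LBINT \<sigma>:X. C) = C * measure lebesgue X" if "X \<subseteq> {s..t}" "X \<in> sets borel" for X
    using that by (simp add: set_lebesgue_integral_def measure_completion)
  \<comment> \<open>Subtracting the rate C turns the growth bound on the gaps into a nonpositive
    integral.\<close>
  have "(LBINT \<sigma>:{s<..t} - K. ell \<sigma> z - C) \<le> 0"
  proof (rule gap_integral_nonpos[OF K st(2)])
    show "set_integrable lborel {s..t} (\<lambda>\<sigma>. ell \<sigma> z - C)" by (intro set_integral_diff(1) i csub) auto
    show "(LBINT \<sigma>:{x<..y}. ell \<sigma> z - C) \<le> 0"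
      if xy: "s \<le> x" "x < y" "y \<le> t" "x \<in> K" "{x<..<y} \<inter> K = {}" for x y
    proof -
      have sb: "{x<..y} \<subseteq> {s..t}" using xy by auto
      have "(LBINT \<sigma>:{x<..y}. ell \<sigma> z - C) = (LBINT \<sigma>:{x<..y}. ell \<sigma> z) - (LBINT \<sigma>:{x<..y}. C)"
        by (intro set_integral_diff(2) sub csub) (use xy in auto)
      also have "\<dots> = w y z - w x z - C * (y - x)"
        using w_diff_integral(2)[of x y z] const[OF sb] xy st by (simp add: measure_completion)
      finally show ?thesis using gap[OF xy] by simp
    qed
  qed
  also have "(LBINT \<sigma>:{s<..t} - K. ell \<sigma> z - C) = (LBINT \<sigma>:{s<..t} - K. ell \<sigma> z) - (LBINT \<sigma>:{s<..t} - K. C)"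
    by (intro set_integral_diff(2) sub csub) (use Kb in auto)
  also have "(LBINT \<sigma>:{s<..t} - K. C) = C * measure lebesgue ({s<..t} - K)"
    by (rule const) (use Kb in auto)
  finally have 1: "(LBINT \<sigma>:{s<..t} - K. ell \<sigma> z) \<le> C * measure lebesgue ({s<..t} - K)" by simp
  have "{s<..t} = ({s<..t} \<inter> K) \<union> ({s<..t} - K)" by auto
  then have "(LBINT \<sigma>:{s<..t}. ell \<sigma> z) = (LBINT \<sigma>:({s<..t} \<inter> K) \<union> ({s<..t} - K). ell \<sigma> z)" by simp
  also have "\<dots> = (LBINT \<sigma>:{s<..t} \<inter> K. ell \<sigma> z) + (LBINT \<sigma>:{s<..t} - K. ell \<sigma> z)"
    by (intro set_integral_Un sub) (use Kb in auto)
  finally show ?thesis using 1 w_diff_integral(2)[OF st, of z] by simp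
qed

end

section \<open>The subsolution property\<close>

text \<open>Finite unions of members of a countable base. The compact sets in question, those of
  maximum points, vary with time; having countably many neighbourhoods for them allows times to be
  sorted into countably many sets.\<close>

lemma countable_compact_neighbourhoods:
  obtains U :: "nat \<Rightarrow> 'a::second_countable_topology set"
  where "\<And>j. open (U j)" "\<And>Z V. compact Z \<Longrightarrow> open V \<Longrightarrow> Z \<subseteq> V \<Longrightarrow> \<exists>j. Z \<subseteq> U j \<and> U j \<subseteq> V"
proof -
  obtain B :: "'a set set" where B: "countable B" "topological_basis B" using ex_countable_basis by blast
  define \<F> where "\<F> = Union ` {F. finite F \<and> F \<subseteq> B}"
  have cF: "countable \<F>" unfolding \<F>_def using countable_Collect_finite_subset[OF B(1)] by simp
  have neF: "\<F> \<noteq> {}" unfolding \<F>_def by blast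
  show thesis
  proof (rule that)
    have "open X" if "X \<in> \<F>" for X
    proof -
      from that obtain F where "X = \<Union>F" "F \<subseteq> B" unfolding \<F>_def by blast
      moreover have "open (\<Union>F)" by (rule open_Union) (use \<open>F \<subseteq> B\<close> topological_basis_open[OF B(2)] in blast)
      ultimately show ?thesis by simp
    qed
    then show "open (from_nat_into \<F> j)" for j using from_nat_into[OF neF] by blast
    fix Z V :: "'a set" assume Z: "compact Z" "open V" "Z \<subseteq> V"
    define G where "G = {b \<in> B. b \<subseteq> V}"
    have "Z \<subseteq> \<Union>G"
    proof
      fix x assume "x \<in> Z"
      then obtain b where "b \<in> B" "x \<in> b" "b \<subseteq> V"
        using topological_basisE[OF B(2) Z(2), of x] Z(3) by blast
      then show "x \<in> \<Union>G" by (auto simp: G_def)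
    qed
    moreover have "open b" if "b \<in> G" for b using that topological_basis_open[OF B(2)] by (auto simp: G_def)
    ultimately obtain F where F: "F \<subseteq> G" "finite F" "Z \<subseteq> \<Union>F" using compactE[OF Z(1)] by metis
    have "\<Union>F \<in> \<F>" unfolding \<F>_def using F by (auto simp: G_def)
    then obtain j where "from_nat_into \<F> j = \<Union>F" using from_nat_into_surj[OF cF] by metis
    then show "\<exists>j. Z \<subseteq> from_nat_into \<F> j \<and> from_nat_into \<F> j \<subseteq> V"
      using F by (intro exI[of _ j]) (auto simp: G_def)
  qed
qed

lemma set_integral_majorant:
  fixes h :: "real \<Rightarrow> real"
  assumes "s \<le> t" and h: "set_integrable lborel {s..t} h" and KO: "K \<in> sets borel" "KO \<in> sets borel"
    and le: "\<And>\<sigma>. \<sigma> \<in> {s<..t} \<inter> K \<Longrightarrow> h \<sigma> \<le> C" "\<And>\<sigma>. \<sigma> \<in> {s<..t} \<inter> KO \<Longrightarrow> h \<sigma> \<le> 0"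
  shows "(LBINT \<sigma>:{s<..t} \<inter> K. h \<sigma>) \<le> C * measure lebesgue ({s<..t} \<inter> K - KO)"
proof -
  have c: "set_integrable lborel ({s<..t} \<inter> K - KO) (\<lambda>\<sigma>. C)"
    by (rule set_integrable_subset[OF borel_integrable_atLeastAtMost'[of s t "\<lambda>_. C"]]) (use KO in auto)
  have "(LBINT \<sigma>:{s<..t} \<inter> K. h \<sigma>) \<le> (LBINT \<sigma>:{s<..t} \<inter> K - KO. C)"
    unfolding set_lebesgue_integral_def
  proof (rule integral_mono)
    show "integrable lborel (\<lambda>\<sigma>. indicator ({s<..t} \<inter> K) \<sigma> *\<^sub>R h \<sigma>)"
      using set_integrable_subset[OF h, of "{s<..t} \<inter> K"] KO unfolding set_integrable_def by fastforce
    show "integrable lborel (\<lambda>\<sigma>. indicator ({s<..t} \<inter> K - KO) \<sigma> *\<^sub>R C)"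
      using c by (simp add: set_integrable_def)
    show "indicator ({s<..t} \<inter> K) \<sigma> *\<^sub>R h \<sigma> \<le> indicator ({s<..t} \<inter> K - KO) \<sigma> *\<^sub>R C" for \<sigma>
      using le[of \<sigma>] by (auto simp: indicator_def)
  qed
  also have "\<dots> = C * measure lebesgue ({s<..t} \<inter> K - KO)"
    using KO by (simp add: set_lebesgue_integral_def measure_completion)
  finally show ?thesis .
qed

lemma C1_time_integral:
  assumes "C1_time \<alpha> \<alpha>'" "s \<le> t"
  shows "set_integrable lborel {s..t} \<alpha>'" "(LBINT \<sigma>:{s<..t}. \<alpha>' \<sigma>) = \<alpha> t - \<alpha> s"
proof -
  have c: "continuous_on S \<alpha>'" for S using assms(1) unfolding C1_time_def by (auto elim: continuous_on_subset)
  show i: "set_integrable lborel {s..t} \<alpha>'" by (rule borel_integrable_atLeastAtMost'[OF c])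
  have "(\<alpha>' has_integral (\<alpha> t - \<alpha> s)) {s..t}"
    using assms unfolding C1_time_def
    by (intro fundamental_theorem_of_calculus)
       (auto intro: has_field_derivative_at_within simp: has_real_derivative_iff_has_vector_derivative[symmetric])
  then have e: "(LBINT \<sigma>:{s..t}. \<alpha>' \<sigma>) = \<alpha> t - \<alpha> s"
    using set_borel_integral_eq_integral(2)[OF i] by (simp add: integral_unique)
  have "(LBINT \<sigma>:{s<..t}. \<alpha>' \<sigma>) = (LBINT \<sigma>:{s..t}. \<alpha>' \<sigma>)"
  proof (rule set_integral_cong_set)
    show "set_borel_measurable lborel {s<..t} \<alpha>'" "set_borel_measurable lborel {s..t} \<alpha>'"
      using borel_measurable_continuous_onI[OF c] by (auto simp: set_borel_measurable_def)
    have "AE x in lborel. x \<noteq> s" by (rule AE_lborel_singleton)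
    then show "AE x in lborel. (x \<in> {s..t}) = (x \<in> {s<..t})" by eventually_elim auto
  qed
  then show "(LBINT \<sigma>:{s<..t}. \<alpha>' \<sigma>) = \<alpha> t - \<alpha> s" using e by simp
qed

context homogeneous_solution
begin

text \<open>The largest excess \<open>M t\<close> of w over a test function would have to rise from
  at most m' to a value above m', and \<open>nonincreasing_up_to_small_sets\<close> forbids this. At
  a time s of K, the maximum points of the excess form a compact set, on a neighbourhood U j of
  which \<open>ell\<close> is below the time derivative of the test function. The times of K with
  this property for the same U j form the set \<open>KU j\<close>: on it the excess does not grow
  near its maximum points, and outside it the growth rate is at most C.\<close>

lemma no_nonvisc_in_ball: "\<not> nonvisc t0 z0" if z0: "z0 \<in> ball 0 R"
proof
  assume nv0: "nonvisc t0 z0"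
  \<comment> \<open>Bad times refer to one ball, so that the semiconcavity constant at a given time
    is uniform in space.\<close>
  define bad where "bad = {t. \<exists>z\<in>ball 0 R. nonvisc t z}"
  define K where "K = closure bad"
  have R: "R > 0" using z0 by (metis ball_empty empty_iff not_le)
  have badT: "bad \<subseteq> {0..T}" unfolding bad_def nonvisc_def by blast
  have Kc: "closed K" and KT: "K \<subseteq> {0..T}" unfolding K_def
    using closure_minimal[OF badT] by auto
  have badK: "bad \<subseteq> K" unfolding K_def by (rule closure_subset)
  have Kb: "K \<in> sets borel" using Kc by (rule borel_closed)
  have Kne: "K \<noteq> {}" using nv0 z0 badK unfolding bad_def by blast
  have "K \<subseteq> (\<Union>n. semiconcave_times R n)"
    using KT semiconcave_times_cover by blast
  from Baire_closed_cover[OF Kc Kne closed_semiconcave_times this]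
  obtain n t' \<eta> where \<eta>: "\<eta> > 0" "t' \<in> K" "K \<inter> ball t' \<eta> \<subseteq> semiconcave_times R n" by blast
  \<comment> \<open>The time t' is only a limit of bad times; a test function is available at a bad
    time close to it.\<close>
  obtain t1 where t1: "t1 \<in> bad" "dist t1 t' < \<eta>"
    using \<eta>(1,2) unfolding K_def closure_approachable by blast
  then obtain z1 where z1: "z1 \<in> ball 0 R" "nonvisc t1 z1" unfolding bad_def by blast
  then obtain \<alpha>\<^sub>0 \<alpha>\<^sub>0' \<beta>\<^sub>0 \<kappa>\<^sub>0 \<kappa>\<^sub>0' \<rho>0 where nv: "t1 \<in> {0..T}" "0 < \<rho>0" "\<rho>0 \<le> t1"
     "C1_time \<alpha>\<^sub>0 \<alpha>\<^sub>0'" "C1_time \<kappa>\<^sub>0 \<kappa>\<^sub>0'"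
     "\<And>s y. s\<in>{t1 - \<rho>0..t1} \<Longrightarrow> y\<in>cball z1 \<rho>0 \<Longrightarrow>
        w s y - quad_test \<alpha>\<^sub>0 \<beta>\<^sub>0 \<kappa>\<^sub>0 s y \<le> w t1 z1 - quad_test \<alpha>\<^sub>0 \<beta>\<^sub>0 \<kappa>\<^sub>0 t1 z1"
     "test_defect \<alpha>\<^sub>0' \<beta>\<^sub>0 \<kappa>\<^sub>0 \<kappa>\<^sub>0' t1 z1 > 0" unfolding nonvisc_def by blast
  text \<open>Adding \<open>\<epsilon> (|z - z\<^sub>1|\<^sup>2 + (t\<^sub>1 - t))\<close> makes the maximum strict.\<close>
  define d where "d = test_defect \<alpha>\<^sub>0' \<beta>\<^sub>0 \<kappa>\<^sub>0 \<kappa>\<^sub>0' t1 z1"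
  define \<epsilon> where "\<epsilon> = d / (2 * (1 + 2 * trace (a t1)))"
  have tr1: "trace (a t1) \<ge> 0" by (rule trace_nonneg[OF a_psd[OF nv(1)]])
  have d: "d > 0" using nv(7) by (simp add: d_def)
  have \<epsilon>: "\<epsilon> > 0" using d tr1 by (simp add: \<epsilon>_def)
  define \<alpha> where "\<alpha> t = \<alpha>\<^sub>0 t + (\<epsilon> * (z1 \<bullet> z1) + \<epsilon> * t1 + (- \<epsilon>) * t)" for t
  define \<alpha>' where "\<alpha>' t = \<alpha>\<^sub>0' t + (- \<epsilon>)" for t
  define \<beta> where "\<beta> = \<beta>\<^sub>0 - (2 * \<epsilon>) *\<^sub>R z1"
  define \<kappa> where "\<kappa> t = \<kappa>\<^sub>0 t + (\<epsilon> + 0 * t)" for t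
  define \<kappa>' where "\<kappa>' t = \<kappa>\<^sub>0' t + 0" for t :: real
  have \<alpha>: "C1_time \<alpha> \<alpha>'" unfolding \<alpha>_def[abs_def] \<alpha>'_def[abs_def] by (intro C1_time_add nv(4) C1_time_affine)
  have \<kappa>: "C1_time \<kappa> \<kappa>'" unfolding \<kappa>_def[abs_def] \<kappa>'_def[abs_def] by (intro C1_time_add nv(5) C1_time_affine)
  define \<phi> where "\<phi> = quad_test \<alpha> \<beta> \<kappa>"
  define \<Psi> where "\<Psi> t y = w t y - \<phi> t y" for t y
  have \<phi>: "\<phi> t y = quad_test \<alpha>\<^sub>0 \<beta>\<^sub>0 \<kappa>\<^sub>0 t y + \<epsilon> * (norm (y - z1))\<^sup>2 + \<epsilon> * (t1 - t)" for t y
    by (simp add: \<phi>_def quad_test_def \<alpha>_def \<beta>_def \<kappa>_def power2_norm_eq_inner inner_diff algebra_simps inner_commute)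
  \<comment> \<open>The gradient of the correction vanishes at z1, so it costs \<epsilon> in the
    time derivative and 2 \<epsilon> times the trace in the diffusion; the choice of \<epsilon>
    leaves half of the defect.\<close>
  have "test_defect \<alpha>' \<beta> \<kappa> \<kappa>' t1 z1 = d - \<epsilon> * (1 + 2 * trace (a t1))"
    by (simp add: test_defect_def d_def \<alpha>'_def \<beta>_def \<kappa>_def \<kappa>'_def algebra_simps)
  also have "\<dots> = d / 2" using tr1 by (simp add: \<epsilon>_def field_simps)
  finally have def1: "test_defect \<alpha>' \<beta> \<kappa> \<kappa>' t1 z1 > 0" using d by simp
  have "\<exists>\<rho>1>0. \<forall>x\<in>{0..T} \<times> UNIV. dist x (t1, z1) < \<rho>1 \<longrightarrow>
      dist (case x of (t, z) \<Rightarrow> test_defect \<alpha>' \<beta> \<kappa> \<kappa>' t z) (test_defect \<alpha>' \<beta> \<kappa> \<kappa>' t1 z1) < test_defect \<alpha>' \<beta> \<kappa> \<kappa>' t1 z1"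
    using test_defect_continuous[OF \<alpha> \<kappa>, of \<beta>] def1 nv(1) unfolding continuous_on_iff by force
  then obtain \<rho>1 where \<rho>1: "\<rho>1 > 0"
    "\<And>t z. t \<in> {0..T} \<Longrightarrow> dist (t, z) (t1, z1) < \<rho>1 \<Longrightarrow> test_defect \<alpha>' \<beta> \<kappa> \<kappa>' t z > 0"
    by (auto simp: dist_real_def) fastforce
  define \<mu> where "\<mu> = (R - norm z1) / 2"
  have \<mu>: "\<mu> > 0" using z1 by (simp add: \<mu>_def)
  \<comment> \<open>The cylinder has to lie in the one where w is touched, keep the defect positive,
    leave room \<mu> inside the ball of radius R, and have its times in the interval found by
    Baire's theorem.\<close>
  define \<rho> where "\<rho> = min (min (\<rho>0 / 2) (\<rho>1 / 4)) (min (\<mu> / 2) ((\<eta> - dist t1 t') / 2))"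
  have \<rho>: "\<rho> > 0" "\<rho> < \<rho>0" "2 * \<rho> < \<rho>1" "\<rho> < \<mu>" "\<rho> < \<eta> - dist t1 t'"
  proof -
    have "\<rho> \<le> \<rho>0 / 2" "\<rho> \<le> \<rho>1 / 4" "\<rho> \<le> \<mu> / 2" "\<rho> \<le> (\<eta> - dist t1 t') / 2"
      unfolding \<rho>_def by linarith+
    moreover show "\<rho> > 0" using nv(2) \<rho>1(1) \<mu> t1(2) by (simp add: \<rho>_def)
    moreover have "(\<eta> - dist t1 t') / 2 < \<eta> - dist t1 t'" using t1(2) by simp
    ultimately show "\<rho> < \<rho>0" "2 * \<rho> < \<rho>1" "\<rho> < \<mu>" "\<rho> < \<eta> - dist t1 t'"
      using nv(2) \<rho>1(1) \<mu> by linarith+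
  qed
  define r where "r = t1 - \<rho>"
  have r: "0 \<le> r" "r < t1" "t1 \<le> T" using \<rho> nv by (auto simp: r_def)
  have rI: "{r..t1} \<subseteq> ball t' \<eta>" using \<rho>(1,5) by (auto simp: r_def dist_real_def)
  have defpos: "test_defect \<alpha>' \<beta> \<kappa> \<kappa>' t z > 0" if "t \<in> {r..t1}" "z \<in> cball z1 \<rho>" for t z
  proof (rule \<rho>1(2))
    show "t \<in> {0..T}" using that r by auto
    have "dist (t, z) (t1, z1) \<le> dist t t1 + dist z z1"
      unfolding dist_Pair_Pair by (rule sqrt_sum_squares_le_sum) auto
    also have "\<dots> \<le> \<rho> + \<rho>" using that by (intro add_mono) (auto simp: r_def dist_real_def dist_commute)
    finally show "dist (t, z) (t1, z1) < \<rho>1" using \<rho> by simp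
  qed
  have ballR: "cball z \<rho>' \<subseteq> ball 0 R" if "z \<in> cball z1 \<rho>" "\<rho>' \<le> \<mu>" for z \<rho>'
  proof
    fix x assume "x \<in> cball z \<rho>'"
    then have "norm x \<le> norm z1 + norm (z - z1) + norm (x - z)" "norm (x - z) \<le> \<rho>'" "norm (z - z1) \<le> \<rho>"
      using norm_triangle_ineq[of z1 "z - z1"] norm_triangle_ineq[of z "x - z"] that
      by (auto simp: dist_norm norm_minus_commute)
    then have "norm x < norm z1 + 2 * \<mu>" using \<rho> that by linarith
    then show "x \<in> ball 0 R" by (simp add: \<mu>_def field_simps)
  qed
  have \<Psi>c: "continuous_on ({r..t1} \<times> cball z1 \<rho>) (\<lambda>(t, y). \<Psi> t y)"
    unfolding \<Psi>_def \<phi>_def by (rule continuous_on_subset[OF excess_continuous[OF \<alpha> \<kappa>]]) (use r in auto)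
  have comp: "compact ({r..t1} \<times> cball z1 \<rho>)" by (intro compact_Times) auto
  have ucont: "\<exists>\<delta>>0. \<forall>s\<in>{r..t1}. \<forall>t\<in>{r..t1}. \<bar>s - t\<bar> < \<delta> \<longrightarrow> (\<forall>y\<in>cball z1 \<rho>. \<bar>\<Psi> s y - \<Psi> t y\<bar> < e)"
    if e: "e > 0" for e
  proof -
    obtain \<delta> where \<delta>: "\<delta> > 0" "\<And>x x'. x \<in> {r..t1} \<times> cball z1 \<rho> \<Longrightarrow> x' \<in> {r..t1} \<times> cball z1 \<rho> \<Longrightarrow> dist x' x < \<delta> \<Longrightarrow>
       dist (case x' of (t, y) \<Rightarrow> \<Psi> t y) (case x of (t, y) \<Rightarrow> \<Psi> t y) < e"
      using uniformly_continuous_onE[OF compact_uniformly_continuous[OF \<Psi>c comp] e] by metis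
    have "\<bar>\<Psi> s y - \<Psi> t y\<bar> < e" if "s \<in> {r..t1}" "t \<in> {r..t1}" "\<bar>s - t\<bar> < \<delta>" "y \<in> cball z1 \<rho>" for s t y
      using \<delta>(2)[of "(t, y)" "(s, y)"] that by (simp add: dist_Pair_Pair dist_real_def)
    then show ?thesis using \<delta>(1) by blast
  qed
  have slice: "continuous_on (cball z1 \<rho>) (\<Psi> t)" if "t \<in> {r..t1}" for t
  proof -
    have "continuous_on (cball z1 \<rho>) (\<lambda>y. case (t, y) of (t, y) \<Rightarrow> \<Psi> t y)"
      by (rule continuous_on_compose2[OF \<Psi>c]) (use that in \<open>auto intro!: continuous_intros\<close>)
    then show ?thesis by simp
  qed
  define M where "M t = Sup (\<Psi> t ` cball z1 \<rho>)" for t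
  have attain: "\<exists>y\<in>cball z1 \<rho>. M t = \<Psi> t y \<and> (\<forall>u\<in>cball z1 \<rho>. \<Psi> t u \<le> \<Psi> t y)" if t: "t \<in> {r..t1}" for t
  proof -
    have "cball z1 \<rho> \<noteq> {}" using \<rho> by simp
    from continuous_attains_sup[OF compact_cball this slice[OF t]] obtain y where
      y: "y \<in> cball z1 \<rho>" "\<forall>u\<in>cball z1 \<rho>. \<Psi> t u \<le> \<Psi> t y" by blast
    then have "M t = \<Psi> t y" unfolding M_def by (intro cSup_eq_maximum) auto
    then show ?thesis using y by blast
  qed
  have Mge: "\<Psi> t u \<le> M t" if "t \<in> {r..t1}" "u \<in> cball z1 \<rho>" for t u
    using attain[OF that(1)] that(2) by auto
  have Mc: "continuous_on {r..t1} M"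
    unfolding continuous_on_iff
  proof (intro ballI allI impI)
    fix x and e :: real assume x: "x \<in> {r..t1}" "e > 0"
    from ucont[OF x(2)] obtain \<delta> where \<delta>: "\<delta> > 0" "\<And>s t y. s\<in>{r..t1} \<Longrightarrow> t\<in>{r..t1} \<Longrightarrow> \<bar>s - t\<bar> < \<delta> \<Longrightarrow> y\<in>cball z1 \<rho> \<Longrightarrow> \<bar>\<Psi> s y - \<Psi> t y\<bar> < e" by blast
    have "\<bar>M s - M x\<bar> < e" if s: "s \<in> {r..t1}" "\<bar>s - x\<bar> < \<delta>" for s
    proof -
      obtain y where y: "y \<in> cball z1 \<rho>" "M s = \<Psi> s y" using attain[OF s(1)] by blast
      obtain y' where y': "y' \<in> cball z1 \<rho>" "M x = \<Psi> x y'" using attain[OF x(1)] by blast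
      show ?thesis using \<delta>(2)[OF s(1) x(1) s(2) y(1)] \<delta>(2)[OF s(1) x(1) s(2) y'(1)]
          Mge[OF s(1) y'(1)] Mge[OF x(1) y(1)] y y' by linarith
    qed
    then show "\<exists>d>0. \<forall>x'\<in>{r..t1}. dist x' x < d \<longrightarrow> dist (M x') (M x) < e"
      using \<delta>(1) by (auto simp: dist_real_def)
  qed
  \<comment> \<open>A level above the excess on the initial and lateral boundary and below the
    excess at (t1, z1): the penalty is \<epsilon> \<rho> at the initial time and at least \<epsilon>
    \<rho>^2 on the lateral boundary.\<close>
  define m' where "m' = \<Psi> t1 z1 - min (\<epsilon> * \<rho>\<^sup>2) (\<epsilon> * \<rho>) / 2"
  have gapm: "min (\<epsilon> * \<rho>\<^sup>2) (\<epsilon> * \<rho>) > 0" using \<epsilon> \<rho> by simp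
  have strict: "\<Psi> t y < m'" if "t \<in> {r..t1}" "y \<in> cball z1 \<rho>" "t = r \<or> norm (y - z1) = \<rho>" for t y
  proof -
    have "w t y - quad_test \<alpha>\<^sub>0 \<beta>\<^sub>0 \<kappa>\<^sub>0 t y \<le> w t1 z1 - quad_test \<alpha>\<^sub>0 \<beta>\<^sub>0 \<kappa>\<^sub>0 t1 z1"
      using that \<rho> by (intro nv(6)) (auto simp: r_def)
    then have "\<Psi> t y \<le> \<Psi> t1 z1 - (\<epsilon> * (norm (y - z1))\<^sup>2 + \<epsilon> * (t1 - t))"
      by (simp add: \<Psi>_def \<phi>)
    moreover have "\<epsilon> * (norm (y - z1))\<^sup>2 + \<epsilon> * (t1 - t) \<ge> min (\<epsilon> * \<rho>\<^sup>2) (\<epsilon> * \<rho>)"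
      using that \<epsilon> by (auto simp: r_def intro: min.coboundedI1 min.coboundedI2)
    ultimately show ?thesis using gapm unfolding m'_def by linarith
  qed
  have inner: "s \<noteq> r \<and> dist z1 y < \<rho>" if "s \<in> {r..t1}" "y \<in> cball z1 \<rho>" "\<Psi> s y \<ge> m'" for s y
    using strict[OF that(1,2)] that by (force simp: dist_norm norm_minus_commute)
  obtain NA where NA: "\<And>z. norm (A *v z) \<le> NA * norm z" "NA \<ge> 0"
    using norm_matrix_vector_le[of A] entry_norm_nonneg[of A] by blast
  obtain Ta where Ta: "\<And>t. t \<in> {0..T} \<Longrightarrow> trace (a t) \<le> Ta" using trace_bounded by blast
  have Ta0: "Ta \<ge> 0" using Ta[OF nv(1)] tr1 by simp
  have W0: "W \<ge> 0" using w_bd[of 0 0] T by auto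
  define \<rho>' where "\<rho>' = min \<mu> 1"
  have \<rho>': "0 < \<rho>'" "\<rho>' \<le> 1" "\<rho>' \<le> \<mu>" using \<mu> by (auto simp: \<rho>'_def)
  \<comment> \<open>The smallest opening that \<open>gap_growth\<close> admits for the radius
    \<rho>'. The summand 1 in \<open>C2\<close> below makes its condition on C strict.\<close>
  define m where "m = max (real n) ((2 * W + real n * \<rho>') / \<rho>'\<^sup>2)"
  have m: "m \<ge> real n" "m * \<rho>'\<^sup>2 \<ge> 2 * W + real n * \<rho>'"
  proof -
    have "(2 * W + real n * \<rho>') / \<rho>'\<^sup>2 * \<rho>'\<^sup>2 \<le> m * \<rho>'\<^sup>2" unfolding m_def by (intro mult_right_mono) auto
    then show "m * \<rho>'\<^sup>2 \<ge> 2 * W + real n * \<rho>'" using \<rho>'(1) by simp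
  qed (simp add: m_def)
  define C2 where "C2 = 2 * m * Ta + NA * R * (real n + 2 * m * \<rho>') + 1"
  have C2: "C2 \<ge> 0" unfolding C2_def using m(1) Ta0 NA(2) R \<rho>' by (auto intro!: add_nonneg_nonneg mult_nonneg_nonneg order_trans[OF of_nat_0_le_iff m(1)])
  have gapw: "w y z - w x z \<le> C2 * (y - x)"
    if "r \<le> x" "x < y" "y \<le> t1" "x \<in> K" "{x<..<y} \<inter> K = {}" "z \<in> cball z1 \<rho>" for x y z
  proof (rule gap_growth[where R = R and n = n and \<rho> = \<rho>' and m = m])
    have "x \<in> ball t' \<eta>" by (rule subsetD[OF rI]) (use that in auto)
    then show "x \<in> semiconcave_times R n" using \<eta>(3) that by blast
    show "\<not> nonvisc s y'" if "x < s" "s < y" "y' \<in> ball 0 R" for s y'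
      using that \<open>{x<..<y} \<inter> K = {}\<close> badK unfolding bad_def by fastforce
    show "cball z \<rho>' \<subseteq> ball 0 R" using ballR[of z \<rho>'] that \<rho>' by blast
    show "2 * m * Ta + NA * R * (real n + 2 * m * \<rho>') < C2" by (simp add: C2_def)
  qed (use r that \<rho>' m Ta NA in auto)
  \<comment> \<open>At times of K the touching paraboloids bound \<open>ell\<close> from above,
    uniformly in space.\<close>
  have ellK: "ell s z \<le> C2" if s: "s \<in> K" "s \<in> {r..t1}" and z: "z \<in> cball z1 \<rho>" for s z
  proof -
    have sT: "s \<in> {0..T}" using s r by auto
    have zR: "z \<in> cball 0 R" using ballR[OF z, of 0] \<mu> by auto
    have "s \<in> semiconcave_times R n" using \<eta>(3) rI s by blast
    then obtain p where p: "norm p \<le> real n"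
      "\<And>y. y\<in>cball z 1 \<Longrightarrow> w s y \<le> w s z + p \<bullet> (y - z) + real n * (norm (y - z))\<^sup>2"
      using zR unfolding semiconcave_times_def by blast
    have "ell s z \<le> 2 * real n * trace (a s) + (A *v z) \<bullet> p"
      by (rule touched_from_above[OF sT, of 1]) (use p(2) in \<open>auto simp: dist_norm norm_minus_commute\<close>)
    also have "(A *v z) \<bullet> p \<le> (NA * R) * real n"
    proof -
      have "NA * norm z \<le> NA * R" using zR NA(2) by (intro mult_left_mono) auto
      then have "norm (A *v z) * norm p \<le> (NA * R) * real n"
        using NA(1)[of z] p(1) NA(2) R by (intro mult_mono) auto
      then show ?thesis using norm_cauchy_schwarz[of "A *v z" p] by simp
    qed
    also have "2 * real n * trace (a s) + (NA * R) * real n \<le> C2"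
    proof -
      have "real n * trace (a s) \<le> m * Ta"
        using Ta[OF sT] m(1) trace_nonneg[OF a_psd[OF sT]] by (intro mult_mono) (auto intro: order_trans[OF of_nat_0_le_iff])
      moreover have "0 \<le> NA * R * (2 * m * \<rho>')" using NA(2) R m(1) \<rho>' by (auto intro: order_trans[OF of_nat_0_le_iff])
      ultimately show ?thesis by (simp add: C2_def algebra_simps)
    qed
    finally show ?thesis by simp
  qed
  define \<phi>t where "\<phi>t \<sigma> y = \<alpha>' \<sigma> + \<kappa>' \<sigma> * (y \<bullet> y)" for \<sigma> and y :: "real^'n"
  have \<phi>t_def_eq: "test_defect \<alpha>' \<beta> \<kappa> \<kappa>' t y = \<phi>t t y - (2 * \<kappa> t * trace (a t) + (A *v y) \<bullet> (\<beta> + (2 * \<kappa> t) *\<^sub>R y))" for t y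
    by (simp add: test_defect_def \<phi>t_def)
  have cont': "continuous_on S \<alpha>'" "continuous_on S \<kappa>'" for S
    using \<alpha> \<kappa> unfolding C1_time_def by (auto elim: continuous_on_subset)
  have C1y: "C1_time (\<lambda>t. \<phi> t y) (\<lambda>t. \<phi>t t y)" for y
    using \<alpha> \<kappa> unfolding C1_time_def \<phi>_def quad_test_def \<phi>t_def
    by (auto intro!: derivative_eq_intros continuous_intros)
  obtain C5 where C5: "C5 \<ge> 0" "\<And>\<sigma> y. \<sigma> \<in> {r..t1} \<Longrightarrow> y \<in> cball z1 \<rho> \<Longrightarrow> \<bar>\<phi>t \<sigma> y\<bar> \<le> C5"
  proof -
    have "continuous_on ({r..t1} \<times> cball z1 \<rho>) (\<lambda>x. norm (\<phi>t (fst x) (snd x)))"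
      unfolding \<phi>t_def by (intro continuous_intros continuous_on_compose2[OF cont'(1)[of UNIV]] continuous_on_compose2[OF cont'(2)[of UNIV]]) auto
    from compact_imp_bounded[OF compact_continuous_image[OF this comp]] obtain C where
      "\<forall>v\<in>(\<lambda>x. norm (\<phi>t (fst x) (snd x))) ` ({r..t1} \<times> cball z1 \<rho>). norm v \<le> C"
      unfolding bounded_iff by blast
    then have C: "norm (\<phi>t (fst x) (snd x)) \<le> C" if "x \<in> {r..t1} \<times> cball z1 \<rho>" for x
      using that by force
    show thesis
    proof (rule that)
      show "max C 0 \<ge> 0" by simp
      show "\<bar>\<phi>t \<sigma> y\<bar> \<le> max C 0" if "\<sigma> \<in> {r..t1}" "y \<in> cball z1 \<rho>" for \<sigma> y
        using C[of "(\<sigma>, y)"] that by simp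
    qed
  qed
  define C where "C = C2 + C5"
  have C0: "C \<ge> 0" using C2 C5 by (simp add: C_def)
  \<comment> \<open>Growth of the excess at a fixed point. The gaps of K cost the rate of the
    barrier, the times of K outside \<open>KO\<close> the bound \<open>ellK\<close>, both increased
    by the bound \<open>C5\<close> on the time derivative of the test function; the times in
    \<open>KO\<close> cost nothing.\<close>
  have \<Psi>step: "\<Psi> t y - \<Psi> s y \<le> C * measure lebesgue ({s..t} - KO)"
    if s: "s \<in> K" "s \<in> {r..t1}" and t: "s < t" "t \<le> t1" and y: "y \<in> cball z1 \<rho>"
      and KO: "KO \<in> sets borel" "KO \<subseteq> K" "\<And>\<sigma>. \<sigma> \<in> {s<..t} \<inter> KO \<Longrightarrow> ell \<sigma> y \<le> \<phi>t \<sigma> y" for s t y KO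
  proof -
    have st: "0 \<le> s" "s \<le> t" "t \<le> T" using s t r by auto
    have "w t y - w s y \<le> (LBINT \<sigma>:{s<..t} \<inter> K. ell \<sigma> y) + C2 * measure lebesgue ({s<..t} - K)"
      by (rule growth_from_closed_set[OF Kc s(1) st]) (use gapw y s t in auto)
    moreover have "\<phi> t y - \<phi> s y = (LBINT \<sigma>:{s<..t} \<inter> K. \<phi>t \<sigma> y) + (LBINT \<sigma>:{s<..t} - K. \<phi>t \<sigma> y)"
    proof -
      have "{s<..t} = ({s<..t} \<inter> K) \<union> ({s<..t} - K)" by auto
      then have "(LBINT \<sigma>:{s<..t}. \<phi>t \<sigma> y) = (LBINT \<sigma>:({s<..t} \<inter> K) \<union> ({s<..t} - K). \<phi>t \<sigma> y)" by simp
      also have "\<dots> = (LBINT \<sigma>:{s<..t} \<inter> K. \<phi>t \<sigma> y) + (LBINT \<sigma>:{s<..t} - K. \<phi>t \<sigma> y)"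
        by (intro set_integral_Un set_integrable_subset[OF C1_time_integral(1)[OF C1y st(2)]]) (use Kb in auto)
      finally show ?thesis using C1_time_integral(2)[OF C1y st(2)] by simp
    qed
    moreover have "(LBINT \<sigma>:{s<..t} - K. - \<phi>t \<sigma> y) \<le> C5 * measure lebesgue ({s<..t} - K)"
    proof -
      have "(LBINT \<sigma>:{s<..t} \<inter> (- K). - \<phi>t \<sigma> y) \<le> C5 * measure lebesgue ({s<..t} \<inter> (- K) - {})"
      proof (rule set_integral_majorant[OF st(2)])
        show "set_integrable lborel {s..t} (\<lambda>\<sigma>. - \<phi>t \<sigma> y)"
          by (rule C1_time_integral(1)[OF _ st(2), of "\<lambda>t. - \<phi> t y"])
             (use C1y[of y] in \<open>auto simp: C1_time_def intro!: derivative_eq_intros continuous_intros\<close>)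
        show "- \<phi>t \<sigma> y \<le> C5" if "\<sigma> \<in> {s<..t} \<inter> - K" for \<sigma>
          using C5(2)[of \<sigma> y] that s t y by auto
      qed (use Kb in auto)
      then show ?thesis by (simp add: Diff_eq)
    qed
    moreover have "(LBINT \<sigma>:{s<..t} - K. - \<phi>t \<sigma> y) = - (LBINT \<sigma>:{s<..t} - K. \<phi>t \<sigma> y)"
      by (rule set_integral_uminus) (rule set_integrable_subset[OF C1_time_integral(1)[OF C1y st(2)]], use Kb in auto)
    moreover have "(LBINT \<sigma>:{s<..t} \<inter> K. ell \<sigma> y - \<phi>t \<sigma> y) \<le> C * measure lebesgue ({s<..t} \<inter> K - KO)"
    proof (rule set_integral_majorant[OF st(2) _ Kb KO(1)])
      show "set_integrable lborel {s..t} (\<lambda>\<sigma>. ell \<sigma> y - \<phi>t \<sigma> y)"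
        by (intro set_integral_diff(1) w_diff_integral(1)[OF st] C1_time_integral(1)[OF C1y st(2)])
      show "ell \<sigma> y - \<phi>t \<sigma> y \<le> C" if "\<sigma> \<in> {s<..t} \<inter> K" for \<sigma>
        using C5(2)[of \<sigma> y] ellK[of \<sigma> y] that s t y by (auto simp: C_def)
      show "ell \<sigma> y - \<phi>t \<sigma> y \<le> 0" if "\<sigma> \<in> {s<..t} \<inter> KO" for \<sigma> using KO(3)[OF that] by simp
    qed
    moreover have "(LBINT \<sigma>:{s<..t} \<inter> K. ell \<sigma> y - \<phi>t \<sigma> y) = (LBINT \<sigma>:{s<..t} \<inter> K. ell \<sigma> y) - (LBINT \<sigma>:{s<..t} \<inter> K. \<phi>t \<sigma> y)"
      by (intro set_integral_diff(2) set_integrable_subset[OF C1_time_integral(1)[OF C1y st(2)]]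
          set_integrable_subset[OF w_diff_integral(1)[OF st]]) (use Kb in auto)
    moreover have "measure lebesgue ({s<..t} \<inter> K - KO) + measure lebesgue ({s<..t} - K) = measure lebesgue ({s<..t} - KO)"
    proof -
      have lm: "X \<in> lmeasurable" if "X \<subseteq> {s..t}" "X \<in> sets borel" for X
        using that by (intro fmeasurableI2[OF lmeasurable_cbox[of s t]]) auto
      have "{s<..t} - KO = ({s<..t} \<inter> K - KO) \<union> ({s<..t} - K)" using KO(2) by auto
      then show ?thesis using measure_Un3[of "{s<..t} \<inter> K - KO" lebesgue "{s<..t} - K"] lm[of "{s<..t} \<inter> K - KO"] lm[of "{s<..t} - K"] Kb KO
        by (simp add: Int_Diff Int_commute Diff_Int_distrib2 subset_iff)
    qed
    ultimately have "\<Psi> t y - \<Psi> s y \<le> C * measure lebesgue ({s<..t} \<inter> K - KO) + C * measure lebesgue ({s<..t} - K)"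
      unfolding \<Psi>_def C_def by (simp add: algebra_simps)
    also have "\<dots> = C * measure lebesgue ({s<..t} - KO)"
      using \<open>_ + _ = measure lebesgue ({s<..t} - KO)\<close> by (simp add: distrib_left[symmetric])
    also have "\<dots> \<le> C * measure lebesgue ({s..t} - KO)"
    proof (intro mult_left_mono measure_mono_fmeasurable)
      show "{s..t} - KO \<in> lmeasurable"
        using KO by (intro fmeasurableI2[OF lmeasurable_cbox[of s t]]) auto
    qed (use C0 KO in auto)
    finally show ?thesis .
  qed
  \<comment> \<open>An increase of the maximum from a level not below m' would produce a maximum
    inside the cylinder, hence a bad time, and there is none away from K.\<close>
  have noninc: "M t \<le> M s" if s: "r \<le> s" "s < t" "t \<le> t1" "M s \<ge> m'" and noK: "{s..t} \<inter> K = {}" for s t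
  proof (rule ccontr)
    assume lt: "\<not> M t \<le> M s"
    have "continuous_on ({s..t} \<times> cball z1 \<rho>) (\<lambda>(t, y). \<Psi> t y)"
      by (rule continuous_on_subset[OF \<Psi>c]) (use s in auto)
    moreover have "compact ({s..t} \<times> cball z1 \<rho>)" by (intro compact_Times) auto
    moreover have "{s..t} \<times> cball z1 \<rho> \<noteq> {}" using s \<rho> by auto
    ultimately obtain q where q: "q \<in> {s..t} \<times> cball z1 \<rho>"
      "\<And>q'. q' \<in> {s..t} \<times> cball z1 \<rho> \<Longrightarrow> (case q' of (t, y) \<Rightarrow> \<Psi> t y) \<le> (case q of (t, y) \<Rightarrow> \<Psi> t y)"
      using continuous_attains_sup by metis
    obtain \<sigma> y where \<sigma>y: "q = (\<sigma>, y)" by force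
    have \<sigma>: "\<sigma> \<in> {s..t}" "y \<in> cball z1 \<rho>" using q(1) by (auto simp: \<sigma>y)
    obtain yt where "yt \<in> cball z1 \<rho>" "M t = \<Psi> t yt" using attain[of t] s by auto
    then have big: "\<Psi> \<sigma> y \<ge> M t" using q(2)[of "(t, yt)"] s by (simp add: \<sigma>y)
    then have "\<Psi> \<sigma> y \<ge> m'" "\<Psi> \<sigma> y > M s" using lt s by auto
    then have in': "dist z1 y < \<rho>" and "\<sigma> \<noteq> s" using inner[of \<sigma> y] Mge[of s y] \<sigma> s by auto
    have "nonvisc \<sigma> y"
    proof (rule nonvisc_of_cylinder_max[where r = s and z = z1 and \<rho> = \<rho> and \<alpha> = \<alpha> and \<beta> = \<beta> and \<kappa> = \<kappa>, OF _ _ _ in' \<alpha> \<kappa>])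
      show "w t' u - quad_test \<alpha> \<beta> \<kappa> t' u \<le> w \<sigma> y - quad_test \<alpha> \<beta> \<kappa> \<sigma> y" if "t' \<in> {s..\<sigma>}" "u \<in> cball z1 \<rho>" for t' u
        using q(2)[of "(t', u)"] that \<sigma> by (auto simp: \<sigma>y \<Psi>_def \<phi>_def)
      show "0 < test_defect \<alpha>' \<beta> \<kappa> \<kappa>' \<sigma> y" by (rule defpos) (use \<sigma> s in auto)
    qed (use s r \<sigma> \<open>\<sigma> \<noteq> s\<close> in auto)
    moreover have "y \<in> ball 0 R" using ballR[OF \<sigma>(2), of 0] \<mu> by auto
    ultimately have "\<sigma> \<in> K" using badK unfolding bad_def by blast
    then show False using noK \<sigma> by auto
  qed
  obtain U :: "nat \<Rightarrow> (real^'n) set" where U: "\<And>j. open (U j)"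
    "\<And>Z V. compact Z \<Longrightarrow> open V \<Longrightarrow> Z \<subseteq> V \<Longrightarrow> \<exists>j. Z \<subseteq> U j \<and> U j \<subseteq> V"
    by (rule countable_compact_neighbourhoods) blast
  obtain D :: "(real^'n) set" where D: "countable D" "\<And>X. open X \<Longrightarrow> X \<noteq> {} \<Longrightarrow> \<exists>d\<in>D. d \<in> X"
    using countable_dense_exists by blast
  \<comment> \<open>The inequality is imposed on a countable dense set of points only, which makes
    \<open>KU j\<close> a Borel set; continuity in space recovers it at the other points
    (\<open>KUle\<close>).\<close>
  define KU where "KU j = {\<sigma> \<in> K \<inter> {r..t1}. \<forall>y\<in>D \<inter> U j \<inter> ball z1 \<rho>. ell \<sigma> y \<le> \<phi>t \<sigma> y}" for j
  have KUb: "KU j \<in> sets borel" for j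
  proof -
    have m: "(\<lambda>\<sigma>. indicator {0..T} \<sigma> * ell \<sigma> y) \<in> borel_measurable borel" for y
      using ell_int[of T y] T borel_measurable_integrable unfolding set_integrable_def by fastforce
    have m': "(\<lambda>\<sigma>. \<phi>t \<sigma> y) \<in> borel_measurable borel" for y
      unfolding \<phi>t_def using cont'[of UNIV] by (intro borel_measurable_add borel_measurable_times borel_measurable_continuous_onI) auto
    have "(\<Union>y\<in>D \<inter> U j \<inter> ball z1 \<rho>. {\<sigma> \<in> space borel. \<phi>t \<sigma> y < indicator {0..T} \<sigma> * ell \<sigma> y}) \<in> sets borel"
    proof (rule sets.countable_UN')
      show "countable (D \<inter> U j \<inter> ball z1 \<rho>)" using D(1) by (auto intro: countable_subset)
      have "{\<sigma> \<in> space borel. \<phi>t \<sigma> y < indicator {0..T} \<sigma> * ell \<sigma> y} \<in> sets borel" for y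
        by (intro borel_measurable_less m m')
      then show "(\<lambda>y. {\<sigma> \<in> space borel. \<phi>t \<sigma> y < indicator {0..T} \<sigma> * ell \<sigma> y}) ` (D \<inter> U j \<inter> ball z1 \<rho>) \<subseteq> sets borel"
        by blast
    qed
    moreover have "KU j = (K \<inter> {r..t1}) - (\<Union>y\<in>D \<inter> U j \<inter> ball z1 \<rho>. {\<sigma> \<in> space borel. \<phi>t \<sigma> y < indicator {0..T} \<sigma> * ell \<sigma> y})"
    proof -
      have "\<not> (\<phi>t \<sigma> y < indicator {0..T} \<sigma> * ell \<sigma> y) \<longleftrightarrow> ell \<sigma> y \<le> \<phi>t \<sigma> y" if "\<sigma> \<in> K" for \<sigma> y
        using KT that by (auto simp: subset_eq not_less)
      then show ?thesis unfolding KU_def by (simp only: space_borel) blast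
    qed
    ultimately show ?thesis using Kb by auto
  qed
  have ellc: "continuous_on UNIV (\<lambda>y. ell \<sigma> y - \<phi>t \<sigma> y)" if "\<sigma> \<in> {r..t1}" for \<sigma>
  proof -
    have \<sigma>: "\<sigma> \<in> {0..T}" using that r by auto
    have "continuous_on UNIV (\<lambda>y. A *v y)" by (rule linear_continuous_on[OF matrix_vector_mul_bounded_linear])
    then show ?thesis unfolding ell \<phi>t_def trace_def matrix_matrix_mult_def
      by (auto intro!: continuous_intros Dw_cont[OF \<sigma>] Hw_cont[OF \<sigma>])
  qed
  have KUle: "ell \<sigma> y \<le> \<phi>t \<sigma> y" if "\<sigma> \<in> KU j" "y \<in> U j" "y \<in> ball z1 \<rho>" for \<sigma> y j
  proof (rule ccontr)
    assume gt: "\<not> ell \<sigma> y \<le> \<phi>t \<sigma> y"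
    define X where "X = {y. 0 < ell \<sigma> y - \<phi>t \<sigma> y} \<inter> U j \<inter> ball z1 \<rho>"
    have "\<sigma> \<in> {r..t1}" using that by (simp add: KU_def)
    then have "open {y. 0 < ell \<sigma> y - \<phi>t \<sigma> y}" by (intro open_Collect_less continuous_on_const ellc)
    then have "open X" unfolding X_def using U(1) by (intro open_Int) auto
    moreover have "y \<in> X" using gt that by (simp add: X_def)
    ultimately obtain d where "d \<in> D" "d \<in> X" using D(2) by blast
    then have "d \<in> D \<inter> U j \<inter> ball z1 \<rho>" "\<not> ell \<sigma> d \<le> \<phi>t \<sigma> d" by (auto simp: X_def)
    then show False using that(1) unfolding KU_def by blast
  qed
  \<comment> \<open>Index 0 covers the times from which the maximum does not grow at all, as nothing
    lies outside UNIV.\<close>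
  define E where "E k = (case k of 0 \<Rightarrow> UNIV | Suc j \<Rightarrow> KU j)" for k
  \<comment> \<open>Truncation at m' confines the argument to levels at which the maximum points are
    inside the cylinder.\<close>
  have "max (M t1) m' \<le> max (M r) m'"
  proof (rule nonincreasing_up_to_small_sets[where E = E and C = C and M = "\<lambda>t. max (M t) m'"])
    show "continuous_on {r..t1} (\<lambda>t. max (M t) m')" by (intro continuous_intros Mc)
    show "E k \<in> sets lebesgue" for k using KUb by (cases k) (auto simp: E_def)
    fix s assume s: "r \<le> s" "s < t1"
    consider "M s < m'" | "M s \<ge> m'" "s \<notin> K" | "M s \<ge> m'" "s \<in> K" by linarith
    then show "\<exists>k \<gamma>. s \<in> E k \<and> 0 < \<gamma> \<and> (\<forall>t. s < t \<and> t < s + \<gamma> \<and> t \<le> t1 \<longrightarrow>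
        max (M t) m' - max (M s) m' \<le> C * measure lebesgue ({s..t} - E k))"
    proof cases
      case 1
      obtain \<delta> where \<delta>: "\<delta> > 0" "\<And>t. t \<in> {r..t1} \<Longrightarrow> \<bar>t - s\<bar> < \<delta> \<Longrightarrow> \<bar>M t - M s\<bar> < m' - M s"
        using Mc 1 s unfolding continuous_on_iff dist_real_def
        by (metis atLeastAtMost_iff diff_gt_0_iff_gt less_imp_le)
      have "M t < m'" if "s < t" "t < s + \<delta>" "t \<le> t1" for t using \<delta>(2)[of t] that s by auto
      then show ?thesis using \<delta>(1) 1 by (intro exI[of _ "0::nat"] exI[of _ \<delta>]) (auto simp: E_def max_def less_imp_le)
    next
      case 2
      then obtain \<gamma> where \<gamma>: "\<gamma> > 0" "ball s \<gamma> \<subseteq> - K" using Kc by (meson open_Compl openE ComplI)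
      have "M t \<le> M s" if t: "s < t" "t < s + \<gamma>" "t \<le> t1" for t
      proof (rule noninc)
        have "{s..t} \<subseteq> ball s \<gamma>" using t by (auto simp: dist_real_def)
        then show "{s..t} \<inter> K = {}" using \<gamma>(2) by auto
      qed (use s t 2 in auto)
      then show ?thesis using \<gamma>(1) by (intro exI[of _ "0::nat"] exI[of _ \<gamma>]) (auto simp: E_def max_def intro: order_trans)
    next
      case 3
      have sI: "s \<in> {r..t1}" and sT: "s \<in> {0..T}" using s r by auto
      \<comment> \<open>At each of these points the test function touches w from above, so the
        positive defect makes \<open>ell\<close> strictly smaller than the time derivative of the
        test function.\<close>
      define Z where "Z = {y \<in> cball z1 \<rho>. \<Psi> s y = M s}"
      have Zc: "compact Z"
      proof -
        have "closed (cball z1 \<rho> \<inter> \<Psi> s -` {M s})" by (intro continuous_closed_preimage slice[OF sI]) auto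
        then have "compact (cball z1 \<rho> \<inter> (cball z1 \<rho> \<inter> \<Psi> s -` {M s}))" by (intro compact_Int_closed) auto
        moreover have "Z = cball z1 \<rho> \<inter> (cball z1 \<rho> \<inter> \<Psi> s -` {M s})" by (auto simp: Z_def)
        ultimately show ?thesis by simp
      qed
      have Zin: "y \<in> {y. ell s y - \<phi>t s y < 0} \<inter> ball z1 \<rho>" if "y \<in> Z" for y
      proof -
        have y: "y \<in> cball z1 \<rho>" "\<Psi> s y = M s" using that by (auto simp: Z_def)
        have yb: "dist z1 y < \<rho>" using inner[OF sI y(1)] y 3 by simp
        have "ell s y \<le> 2 * \<kappa> s * trace (a s) + (A *v y) \<bullet> (\<beta> + (2 * \<kappa> s) *\<^sub>R y)"
        proof (rule touched_from_above[OF sT])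
          show "\<rho> - dist z1 y > 0" using yb by simp
          fix u assume "norm (u - y) < \<rho> - dist z1 y"
          then have "u \<in> cball z1 \<rho>" using dist_triangle[of z1 u y] by (simp add: dist_norm norm_minus_commute)
          then have "\<Psi> s u \<le> \<Psi> s y" using Mge[OF sI] y by simp
          then show "w s u \<le> w s y + (\<beta> + (2 * \<kappa> s) *\<^sub>R y) \<bullet> (u - y) + \<kappa> s * (norm (u - y))\<^sup>2"
            unfolding \<Psi>_def \<phi>_def quad_test_diff[of \<alpha> \<beta> \<kappa> s u y] by simp
        qed
        then have "ell s y < \<phi>t s y" using defpos[OF sI y(1)] by (simp add: \<phi>t_def_eq)
        then show ?thesis using yb by simp
      qed
      have "open ({y. ell s y - \<phi>t s y < 0} \<inter> ball z1 \<rho>)"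
        by (intro open_Int open_Collect_less continuous_on_const ellc sI) auto
      from U(2)[OF Zc this] Zin obtain j where j: "Z \<subseteq> U j" "U j \<subseteq> {y. ell s y - \<phi>t s y < 0} \<inter> ball z1 \<rho>" by blast
      have sKU: "s \<in> KU j" using j(2) sI 3 by (force simp: KU_def)
      \<comment> \<open>Outside U j the excess at time s stays below its maximum by a fixed amount.
        Uniform continuity in time then keeps the maximum points of nearby times in U j.\<close>
      obtain \<gamma> where \<gamma>: "\<gamma> > 0" "\<And>t y. t \<in> {r..t1} \<Longrightarrow> \<bar>t - s\<bar> < \<gamma> \<Longrightarrow> y \<in> cball z1 \<rho> \<Longrightarrow> \<Psi> t y = M t \<Longrightarrow> y \<in> U j"
      proof (cases "cball z1 \<rho> - U j = {}")
        case True
        then show ?thesis by (intro that[of 1]) auto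
      next
        case False
        have "compact (cball z1 \<rho> - U j)" using U(1) by (intro compact_diff) auto
        moreover have "continuous_on (cball z1 \<rho> - U j) (\<Psi> s)" by (rule continuous_on_subset[OF slice[OF sI]]) auto
        ultimately obtain x where x: "x \<in> cball z1 \<rho> - U j" "\<And>u. u \<in> cball z1 \<rho> - U j \<Longrightarrow> \<Psi> s u \<le> \<Psi> s x"
          using continuous_attains_sup[of "cball z1 \<rho> - U j" "\<Psi> s"] False by blast
        have "\<Psi> s x < M s" using x(1) j(1) Mge[OF sI, of x] by (force simp: Z_def)
        define e0 where "e0 = (M s - \<Psi> s x) / 2"
        have "e0 > 0" using \<open>\<Psi> s x < M s\<close> by (simp add: e0_def)
        from ucont[OF this] obtain \<delta> where \<delta>: "\<delta> > 0" "\<And>s t y. s\<in>{r..t1} \<Longrightarrow> t\<in>{r..t1} \<Longrightarrow> \<bar>s - t\<bar> < \<delta> \<Longrightarrow> y\<in>cball z1 \<rho> \<Longrightarrow> \<bar>\<Psi> s y - \<Psi> t y\<bar> < e0"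
          unfolding e0_def by blast
        show ?thesis
        proof (rule that[OF \<delta>(1)])
          fix t y assume t: "t \<in> {r..t1}" "\<bar>t - s\<bar> < \<delta>" "y \<in> cball z1 \<rho>" "\<Psi> t y = M t"
          show "y \<in> U j"
          proof (rule ccontr)
            assume "y \<notin> U j"
            then have "\<Psi> s y \<le> \<Psi> s x" using x(2) t by blast
            moreover have "\<bar>\<Psi> t y - \<Psi> s y\<bar> < e0" by (rule \<delta>(2)) (use t sI in auto)
            moreover obtain ys where ys: "ys \<in> cball z1 \<rho>" "M s = \<Psi> s ys" using attain[OF sI] by blast
            moreover have "\<bar>\<Psi> t ys - \<Psi> s ys\<bar> < e0" by (rule \<delta>(2)) (use t sI ys in auto)
            moreover have "\<Psi> t ys \<le> M t" using Mge t(1) ys(1) by blast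
            ultimately have "\<Psi> t y < \<Psi> s x + e0" "M s - e0 < M t" by linarith+
            moreover have "\<Psi> s x + e0 = M s - e0" by (simp add: e0_def field_simps)
            ultimately show False using t(4) by linarith
          qed
        qed
      qed
      have "M t - M s \<le> C * measure lebesgue ({s..t} - KU j)" if t: "s < t" "t < s + \<gamma>" "t \<le> t1" for t
      proof -
        have tI: "t \<in> {r..t1}" using t s by auto
        obtain y where y: "y \<in> cball z1 \<rho>" "M t = \<Psi> t y" using attain[OF tI] by blast
        have yU: "y \<in> U j" using \<gamma>(2)[OF tI _ y(1)] y(2) t by auto
        then have yb: "y \<in> ball z1 \<rho>" using j(2) by blast
        \<comment> \<open>The point y is a maximum point at time t and a mere competitor at time
          s.\<close>
        have "M t - M s \<le> \<Psi> t y - \<Psi> s y" using y Mge[OF sI y(1)] by simp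
        also have "\<dots> \<le> C * measure lebesgue ({s..t} - KU j)"
          by (rule \<Psi>step) (use 3 sI t y KUb KUle[OF _ yU yb] in \<open>auto simp: KU_def\<close>)
        finally show ?thesis .
      qed
      moreover have "0 \<le> C * measure lebesgue ({s..t} - KU j)" for t using C0 by simp
      ultimately have "max (M t) m' - max (M s) m' \<le> C * measure lebesgue ({s..t} - KU j)"
        if "s < t" "t < s + \<gamma>" "t \<le> t1" for t using 3(1) that by (smt (verit))
      then show ?thesis using sKU \<gamma>(1) by (intro exI[of _ "Suc j"] exI[of _ \<gamma>]) (auto simp: E_def)
    qed
  qed (use r C0 in auto)
  moreover have "M r \<le> m'"
  proof -
    obtain y where "y \<in> cball z1 \<rho>" "M r = \<Psi> r y" using attain[of r] r by auto
    then show ?thesis using strict[of r y] r by simp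
  qed
  moreover have "\<Psi> t1 z1 \<le> M t1" by (rule Mge) (use r \<rho> in auto)
  moreover have "m' < \<Psi> t1 z1" using gapm by (simp add: m'_def)
  ultimately show False by simp
qed

section \<open>The maximum principle on the whole space\<close>

text \<open>Comparison with \<epsilon> e^{lam t} (1 + |z|^2), a strict supersolution whose growth at
  infinity beats the bounded w. A positive excess would have a maximum inside a large cylinder,
  against \<open>no_nonvisc_in_ball\<close>.\<close>

lemma homogeneous_solution_nonpos:
  assumes t: "t \<in> {0..T}"
  shows "w t z \<le> 0"
proof (rule field_le_epsilon)
  fix e :: real assume e: "e > 0"
  obtain NA where NA: "\<And>z. norm (A *v z) \<le> NA * norm z" "NA \<ge> 0"
    using norm_matrix_vector_le[of A] entry_norm_nonneg[of A] by blast
  obtain Ta where Ta: "\<And>t. t \<in> {0..T} \<Longrightarrow> trace (a t) \<le> Ta" using trace_bounded by blast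
  \<comment> \<open>Dominates the trace and the drift applied to 1 + |z|^2, with 1 to spare for
    strictness.\<close>
  define lam where "lam = 2 * \<bar>Ta\<bar> + 2 * NA + 1"
  \<comment> \<open>Makes the comparison function at the given point z at most e for all times up to
    T.\<close>
  define \<epsilon> where "\<epsilon> = e / ((1 + z \<bullet> z) * exp (lam * T))"
  have \<epsilon>: "\<epsilon> > 0" using e by (simp add: \<epsilon>_def add_pos_nonneg)
  have l0: "lam \<ge> 0" using NA(2) by (simp add: lam_def)
  define \<kappa> where "\<kappa> t = \<epsilon> * exp (lam * t)" for t
  define \<kappa>' where "\<kappa>' t = \<epsilon> * lam * exp (lam * t)" for t
  have \<kappa>: "C1_time \<kappa> \<kappa>'"
    unfolding C1_time_def \<kappa>_def[abs_def] \<kappa>'_def[abs_def] by (auto intro!: derivative_eq_intros continuous_intros)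
  define \<phi> where "\<phi> = quad_test \<kappa> (0 :: real^'n) \<kappa>"
  have \<phi>: "\<phi> t y = \<kappa> t * (1 + y \<bullet> y)" for t y by (simp add: \<phi>_def quad_test_def algebra_simps)
  have kpos: "\<kappa> t > 0" for t using \<epsilon> by (simp add: \<kappa>_def)
  have kmono: "\<kappa> 0 \<le> \<kappa> t" if "t \<ge> 0" for t using \<epsilon> l0 that by (simp add: \<kappa>_def mult_left_mono)
  have le: "w t z \<le> \<phi> t z"
  proof (rule ccontr)
    assume contra: "\<not> w t z \<le> \<phi> t z"
    \<comment> \<open>Large enough for z to be inside and for the comparison function to exceed the
      bound of w on the sphere.\<close>
    define R where "R = max (norm z + 1) (sqrt ((\<bar>W\<bar> + 1) / \<epsilon>))"
    have R: "norm z < R" by (simp add: R_def less_max_iff_disj)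
    have R2: "\<epsilon> * R\<^sup>2 \<ge> \<bar>W\<bar> + 1"
    proof -
      have "sqrt ((\<bar>W\<bar> + 1) / \<epsilon>) ^ 2 \<le> R\<^sup>2" using \<epsilon> by (intro power_mono) (auto simp: R_def)
      then show ?thesis using \<epsilon> by (simp add: field_simps)
    qed
    have "continuous_on ({0..T} \<times> cball 0 R) (\<lambda>(t, y). w t y - \<phi> t y)"
      unfolding \<phi>_def by (rule continuous_on_subset[OF excess_continuous[OF \<kappa> \<kappa>]]) auto
    moreover have "compact ({0..T} \<times> cball (0::real^'n) R)" by (intro compact_Times) auto
    moreover have ne: "(t, z) \<in> {0..T} \<times> cball 0 R" using t R by auto
    moreover from ne have "{0..T} \<times> cball (0::real^'n) R \<noteq> {}" by blast
    ultimately obtain q where q: "q \<in> {0..T} \<times> cball 0 R"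
      "\<And>q'. q' \<in> {0..T} \<times> cball 0 R \<Longrightarrow> (case q' of (t, y) \<Rightarrow> w t y - \<phi> t y) \<le> (case q of (t, y) \<Rightarrow> w t y - \<phi> t y)"
      using continuous_attains_sup[of "{0..T} \<times> cball 0 R" "\<lambda>(t, y). w t y - \<phi> t y"] by blast
    obtain s y where sy: "q = (s, y)" by force
    have s: "s \<in> {0..T}" and y: "norm y \<le> R" using q(1) by (auto simp: sy)
    have pos: "w s y - \<phi> s y > 0" using q(2)[OF ne] contra by (simp add: sy)
    have phipos: "\<phi> u x > 0" for u x using kpos[of u] by (simp add: \<phi> add_pos_nonneg)
    have s0: "s \<noteq> 0"
    proof
      assume "s = 0"
      moreover have "w 0 y = 0"
      proof -
        have "(LBINT x. indicator {0} x *\<^sub>R ell x y) = 0"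
          by (rule integral_eq_zero_AE, rule AE_mp[OF AE_lborel_singleton[of 0]], rule AE_I2)
             (auto simp: indicator_def)
        then show ?thesis using w_eq[of 0 y] T by (simp add: set_lebesgue_integral_def)
      qed
      ultimately show False using pos phipos[of s y] by simp
    qed
    have "norm y \<noteq> R"
    proof
      assume "norm y = R"
      then have "y \<bullet> y = R\<^sup>2" by (simp add: power2_norm_eq_inner[symmetric])
      moreover have "\<epsilon> * (1 + R\<^sup>2) \<le> \<kappa> s * (1 + R\<^sup>2)"
        using kmono[of s] s by (intro mult_right_mono) (auto simp: \<kappa>_def)
      ultimately have "\<bar>W\<bar> + 1 \<le> \<phi> s y" using R2 \<epsilon> by (simp add: \<phi> distrib_left)
      then show False using pos w_bd[OF s, of y] by simp
    qed
    have "nonvisc s y"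
    proof (rule nonvisc_of_cylinder_max[where r = 0 and z = 0 and \<rho> = R and \<alpha> = \<kappa> and \<beta> = 0 and \<kappa> = \<kappa>, OF _ _ _ _ \<kappa> \<kappa>])
      show "w t' u - quad_test \<kappa> 0 \<kappa> t' u \<le> w s y - quad_test \<kappa> 0 \<kappa> s y" if "t' \<in> {0..s}" "u \<in> cball 0 R" for t' u
        using q(2)[of "(t', u)"] that s by (auto simp: sy \<phi>_def)
      have "(A *v y) \<bullet> y \<le> NA * (y \<bullet> y)"
      proof -
        have "(A *v y) \<bullet> y \<le> norm (A *v y) * norm y" by (rule norm_cauchy_schwarz)
        also have "\<dots> \<le> NA * norm y * norm y" by (intro mult_right_mono NA) auto
        finally show ?thesis by (simp add: power2_norm_eq_inner[symmetric] power2_eq_square)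
      qed
      moreover have "trace (a s) \<le> \<bar>Ta\<bar>" using Ta[OF s] by simp
      moreover have "0 \<le> \<bar>Ta\<bar> * (y \<bullet> y)" "0 \<le> y \<bullet> y" by auto
      ultimately have *: "(A *v y) \<bullet> y \<le> NA * (y \<bullet> y)" "trace (a s) \<le> \<bar>Ta\<bar>" "0 \<le> \<bar>Ta\<bar> * (y \<bullet> y)" "0 \<le> y \<bullet> y"
        by blast+
      have "0 < lam * (1 + y \<bullet> y) - (2 * trace (a s) + 2 * ((A *v y) \<bullet> y))"
      proof -
        have "lam * (1 + y \<bullet> y) = 2 * \<bar>Ta\<bar> + 2 * NA + 1 + 2 * (\<bar>Ta\<bar> * (y \<bullet> y)) + 2 * (NA * (y \<bullet> y)) + y \<bullet> y"
          by (simp add: lam_def algebra_simps)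
        then show ?thesis using * NA(2) by linarith
      qed
      then have "0 < \<kappa> s * (lam * (1 + y \<bullet> y) - (2 * trace (a s) + 2 * ((A *v y) \<bullet> y)))"
        using kpos by (rule mult_pos_pos[rotated])
      then show "0 < test_defect \<kappa>' 0 \<kappa> \<kappa>' s y"
        by (simp add: test_defect_def \<kappa>'_def \<kappa>_def algebra_simps)
    qed (use s s0 y \<open>norm y \<noteq> R\<close> in auto)
    moreover have "y \<in> ball 0 (norm y + 1)" by simp
    ultimately show False using no_nonvisc_in_ball by blast
  qed
  also have "\<phi> t z \<le> e"
  proof -
    have "exp (lam * t) \<le> exp (lam * T)" using t l0 by (simp add: mult_left_mono)
    then have "\<kappa> t * (1 + z \<bullet> z) \<le> \<epsilon> * exp (lam * T) * (1 + z \<bullet> z)"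
      unfolding \<kappa>_def using \<epsilon> by (intro mult_right_mono mult_left_mono) auto
    also have "\<dots> = e" unfolding \<epsilon>_def by (simp add: add_pos_nonneg less_imp_neq[symmetric] add_nonneg_eq_0_iff)
    finally show ?thesis by (simp add: \<phi>)
  qed
  finally show "w t z \<le> 0 + e" by simp
qed

end

section \<open>Comparison of solutions\<close>

lemma C2_along_lines:
  fixes g :: "real^'n::finite \<Rightarrow> real"
  assumes C2: "Cn_on UNIV 2 g"
  shows "((\<lambda>r. g (z + r *\<^sub>R v)) has_real_derivative gradient g (z + r *\<^sub>R v) \<bullet> v) (at r)"
    and "((\<lambda>r. gradient g (z + r *\<^sub>R v) \<bullet> v) has_real_derivative (hessian g (z + r *\<^sub>R v) *v v) \<bullet> v) (at r)"
    and "continuous_on UNIV (gradient g)" "continuous_on UNIV (hessian g)"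
proof -
  have UNIV_space: "coord_space UNIV = (UNIV :: (real^'n) set)" by (simp add: coord_space_def)
  have c: "continuous_on UNIV (pdiffs ps g)" if "length ps \<le> 2" for ps
    using C2 that unfolding Cn_on_def UNIV_space by (auto simp: multi_indices_def)
  have d: "((\<lambda>h. pdiffs ps g (x + h *\<^sub>R axis p 1)) has_real_derivative pdiffs (p # ps) g x) (at 0)" if "length ps < 2" for ps x p
  proof -
    have "(\<lambda>h. pdiffs ps g (x + h *\<^sub>R axis p 1)) field_differentiable (at 0)"
      using C2 that unfolding Cn_on_def UNIV_space by (auto simp: multi_indices_def)
    then have "((\<lambda>h. pdiffs ps g (x + h *\<^sub>R axis p 1)) has_real_derivative deriv (\<lambda>h. pdiffs ps g (x + h *\<^sub>R axis p 1)) 0) (at 0)"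
      by (simp add: DERIV_deriv_iff_field_differentiable)
    then show ?thesis by (simp add: pdiffs_def pdiff_def)
  qed
  have D: "(pdiffs ps g has_derivative (\<lambda>v. \<Sum>p\<in>UNIV. v $ p * pdiffs (p # ps) g x)) (at x)" if "length ps < 2" for ps x
    by (rule has_derivative_of_continuous_partials) (use d c that in auto)
  have line: "((\<lambda>r. pdiffs ps g (z + r *\<^sub>R v)) has_real_derivative (\<Sum>p\<in>UNIV. v $ p * pdiffs (p # ps) g (z + r *\<^sub>R v))) (at r)" if "length ps < 2" for ps
    by (rule has_real_derivative_along_line[OF D[OF that]])
  have nil: "pdiffs [] g = g" by (simp add: pdiffs_def)
  show "((\<lambda>r. g (z + r *\<^sub>R v)) has_real_derivative gradient g (z + r *\<^sub>R v) \<bullet> v) (at r)"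
    using line[of "[]"] by (simp add: nil gradient_def inner_vec_def mult.commute)
  have "((\<lambda>r. \<Sum>p\<in>UNIV. pdiffs [p] g (z + r *\<^sub>R v) * v $ p) has_real_derivative
      (\<Sum>p\<in>UNIV. (\<Sum>q\<in>UNIV. v $ q * pdiffs [q, p] g (z + r *\<^sub>R v)) * v $ p)) (at r)"
    by (intro DERIV_sum DERIV_cmult_right line) simp
  moreover have "(\<Sum>p\<in>UNIV. (\<Sum>q\<in>UNIV. v $ q * pdiffs [q, p] g (z + r *\<^sub>R v)) * v $ p) = (hessian g (z + r *\<^sub>R v) *v v) \<bullet> v"
    unfolding quadratic_form_sum by (subst sum.swap) (simp add: hessian_def sum_distrib_left sum_distrib_right mult_ac)
  ultimately show "((\<lambda>r. gradient g (z + r *\<^sub>R v) \<bullet> v) has_real_derivative (hessian g (z + r *\<^sub>R v) *v v) \<bullet> v) (at r)"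
    by (simp add: gradient_def inner_vec_def)
  show "continuous_on UNIV (gradient g)" unfolding gradient_def[abs_def]
    by (intro continuous_on_vec_lambda c) simp
  show "continuous_on UNIV (hessian g)" unfolding hessian_def[abs_def]
    by (intro continuous_on_vec_lambda c) simp
qed

lemma matrix_mult_add_left: "(P + Q) ** R = P ** R + Q ** (R :: real^'n^'n::finite)"
  and matrix_mult_diff_right: "P ** (Q - R) = P ** Q - P ** (R :: real^'n^'n::finite)"
  by (simp_all add: matrix_matrix_mult_def vec_eq_iff sum.distrib sum_subtractf algebra_simps)

lemma trace_plus: "trace (P + Q) = trace P + trace (Q :: real^'n^'n::finite)"
  and trace_minus: "trace (P - Q) = trace P - trace (Q :: real^'n^'n::finite)"
  by (simp_all add: trace_def sum.distrib sum_subtractf)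

lemma solution_le:
  fixes A B :: "real^'n^'n::finite"
  assumes T: "T > 0" and a: "continuous_on {0..T} S" "\<And>t. t \<in> {0..T} \<Longrightarrow> sym_nonneg_matrix (B + S t)"
    and v: "is_solution T (L_ou_S A B S) f v" and w: "is_solution T (L_ou_S A B S) f w" and t: "t \<in> {0..T}"
  shows "v t z \<le> w t z"
proof -
  obtain bv bw where bd: "\<And>t z. t \<in> {0..T} \<Longrightarrow> \<bar>v t z\<bar> \<le> bv" "\<And>t z. t \<in> {0..T} \<Longrightarrow> \<bar>w t z\<bar> \<le> bw"
    using v w unfolding is_solution_def bounded_iff by fastforce
  note Cv = C2_along_lines[of "v _"] and Cw = C2_along_lines[of "w _"]
  have C2: "Cn_on UNIV 2 (v t)" "Cn_on UNIV 2 (w t)" if "t \<in> {0..T}" for t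
    using v w that unfolding is_solution_def by auto
  define ell where "ell t z = L_ou_S A B S t (v t) z - L_ou_S A B S t (w t) z" for t z
  have int: "set_integrable lborel {0..t} (\<lambda>s. f s z + L_ou_S A B S s (v s) z)" "set_integrable lborel {0..t} (\<lambda>s. f s z + L_ou_S A B S s (w s) z)"
    if "t \<in> {0..T}" for t z
    using v w that unfolding is_solution_def by auto
  have eq: "ell s z = (f s z + L_ou_S A B S s (v s) z) - (f s z + L_ou_S A B S s (w s) z)" for s z by (simp add: ell_def)
  interpret homogeneous_solution T "bv + bw" A "\<lambda>t. B + S t" "\<lambda>t z. v t z - w t z"
    "\<lambda>t z. gradient (v t) z - gradient (w t) z" "\<lambda>t z. hessian (v t) z - hessian (w t) z" ell
  proof
    show "continuous_on ({0..T} \<times> UNIV) (\<lambda>(t, z). v t z - w t z)"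
      using v w continuous_on_diff unfolding is_solution_def case_prod_unfold by blast
    show "\<bar>v t z - w t z\<bar> \<le> bv + bw" if "t \<in> {0..T}" for t z using bd[OF that, of z] by linarith
    show "((\<lambda>r. v t (z + r *\<^sub>R u) - w t (z + r *\<^sub>R u)) has_real_derivative (gradient (v t) (z + r *\<^sub>R u) - gradient (w t) (z + r *\<^sub>R u)) \<bullet> u) (at r)"
      if "t \<in> {0..T}" for t z u r
      unfolding inner_diff_left by (intro DERIV_diff C2_along_lines(1) C2 that)
    show "((\<lambda>r. (gradient (v t) (z + r *\<^sub>R u) - gradient (w t) (z + r *\<^sub>R u)) \<bullet> u) has_real_derivative
        ((hessian (v t) (z + r *\<^sub>R u) - hessian (w t) (z + r *\<^sub>R u)) *v u) \<bullet> u) (at r)"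
      if "t \<in> {0..T}" for t z u r
      unfolding inner_diff_left matrix_vector_mult_diff_rdistrib by (intro DERIV_diff C2_along_lines(2) C2 that)
    show "continuous_on UNIV (\<lambda>z. gradient (v t) z - gradient (w t) z)" if "t \<in> {0..T}" for t
      by (intro continuous_on_diff C2_along_lines(3) C2 that)
    show "continuous_on UNIV (\<lambda>z. hessian (v t) z - hessian (w t) z)" if "t \<in> {0..T}" for t
      by (intro continuous_on_diff C2_along_lines(4) C2 that)
    show "ell t z = trace ((B + S t) ** (hessian (v t) z - hessian (w t) z)) + (A *v z) \<bullet> (gradient (v t) z - gradient (w t) z)" for t z
      by (simp add: ell_def L_ou_S_def L_ou_def matrix_mult_add_left matrix_mult_diff_right trace_plus trace_minus inner_diff_right)
    show "set_integrable lborel {0..t} (\<lambda>s. ell s z)" if "t \<in> {0..T}" for t z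
      unfolding eq by (intro set_integral_diff(1) int that)
    show "v t z - w t z = (LBINT s:{0..t}. ell s z)" if "t \<in> {0..T}" for t z
      unfolding eq set_integral_diff(2)[OF int[OF that]] using v w that unfolding is_solution_def by auto
    show "continuous_on {0..T} (\<lambda>t. B + S t)" by (intro continuous_intros a(1))
  qed (use T a in auto)
  show ?thesis using homogeneous_solution_nonpos[OF t, of z] by simp
qed

section \<open>The anisotropic norm of averages and limits\<close>

text \<open>Being monotone and superadditive, it lets lower bounds pass through the sums and suprema
  of which the Hoelder norms are built; convexity and lower semicontinuity of the norm are thus used
  in one go.\<close>

definition mean_liminf :: "(nat \<Rightarrow> 'w set) \<Rightarrow> (nat \<Rightarrow> 'w \<Rightarrow> ennreal) \<Rightarrow> ennreal" where
  "mean_liminf \<Omega> x = liminf (\<lambda>m. \<Sum>\<omega>\<in>\<Omega> m. ennreal (1 / card (\<Omega> m)) * x m \<omega>)"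

lemma mean_liminf_mono:
  assumes "\<And>m \<omega>. \<omega> \<in> \<Omega> m \<Longrightarrow> x m \<omega> \<le> y m \<omega>"
  shows "mean_liminf \<Omega> x \<le> mean_liminf \<Omega> y"
  unfolding mean_liminf_def
  by (intro Liminf_mono always_eventually allI sum_mono mult_left_mono assms) auto

lemma mean_liminf_le:
  assumes \<Omega>: "\<And>m. finite (\<Omega> m)" "\<And>m. \<Omega> m \<noteq> {}" and x: "\<And>m \<omega>. \<omega> \<in> \<Omega> m \<Longrightarrow> x m \<omega> \<le> D"
  shows "mean_liminf \<Omega> x \<le> D"
proof -
  have "(\<Sum>\<omega>\<in>\<Omega> m. ennreal (1 / card (\<Omega> m)) * D) = D" for m
  proof -
    have "card (\<Omega> m) > 0" using \<Omega> by (simp add: card_gt_0_iff)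
    then have "(\<Sum>\<omega>\<in>\<Omega> m. ennreal (1 / card (\<Omega> m))) = 1"
      by (subst sum_ennreal) auto
    then show ?thesis by (simp only: sum_distrib_right[symmetric] mult_1)
  qed
  then have "mean_liminf \<Omega> (\<lambda>_ _. D) = D" unfolding mean_liminf_def by (simp add: Liminf_const)
  then show ?thesis using mean_liminf_mono[of \<Omega> x "\<lambda>_ _. D"] x by simp
qed

lemma liminf_superadditive:
  fixes x y :: "nat \<Rightarrow> ennreal"
  shows "liminf x + liminf y \<le> liminf (\<lambda>m. x m + y m)"
proof -
  have "liminf x + liminf y = (SUP n. (INF m\<in>{n..}. x m) + (INF m\<in>{n..}. y m))"
    unfolding liminf_SUP_INF
    by (intro ennreal_SUP_add[symmetric] incseq_SucI INF_superset_mono) auto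
  also have "\<dots> \<le> (SUP n. INF m\<in>{n..}. x m + y m)"
    by (intro SUP_mono' INF_greatest add_mono INF_lower)
  finally show ?thesis by (simp add: liminf_SUP_INF)
qed

lemma mean_liminf_add: "mean_liminf \<Omega> x + mean_liminf \<Omega> y \<le> mean_liminf \<Omega> (\<lambda>m \<omega>. x m \<omega> + y m \<omega>)"
  unfolding mean_liminf_def using liminf_superadditive
  by (simp add: distrib_left sum.distrib)

lemma mean_liminf_sum:
  assumes "finite I" "\<And>i. i \<in> I \<Longrightarrow> h i \<le> mean_liminf \<Omega> (x i)"
  shows "(\<Sum>i\<in>I. h i) \<le> mean_liminf \<Omega> (\<lambda>m \<omega>. \<Sum>i\<in>I. x i m \<omega>)"
  using assms
proof (induction I rule: finite_induct)
  case (insert i I)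
  have "(\<Sum>i\<in>insert i I. h i) \<le> mean_liminf \<Omega> (x i) + mean_liminf \<Omega> (\<lambda>m \<omega>. \<Sum>i\<in>I. x i m \<omega>)"
    using insert by (simp add: add_mono)
  also have "\<dots> \<le> mean_liminf \<Omega> (\<lambda>m \<omega>. x i m \<omega> + (\<Sum>i\<in>I. x i m \<omega>))" by (rule mean_liminf_add)
  finally show ?case using insert by simp
qed simp

lemma mean_liminf_SUP:
  assumes "\<And>i. i \<in> I \<Longrightarrow> h i \<le> mean_liminf \<Omega> (x i)"
  shows "(SUP i\<in>I. h i) \<le> mean_liminf \<Omega> (\<lambda>m \<omega>. SUP i\<in>I. x i m \<omega>)"
proof (rule SUP_least)
  fix i assume i: "i \<in> I"
  have "h i \<le> mean_liminf \<Omega> (x i)" by (rule assms[OF i])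
  also have "\<dots> \<le> mean_liminf \<Omega> (\<lambda>m \<omega>. SUP i\<in>I. x i m \<omega>)"
    by (intro mean_liminf_mono SUP_upper i)
  finally show "h i \<le> \<dots>" .
qed

text \<open>The innermost case: the triangle inequality for each average, combined with continuity
  of the absolute value in the limit.\<close>

lemma mean_liminf_abs:
  fixes g :: "nat \<Rightarrow> 'w \<Rightarrow> real"
  assumes lim: "(\<lambda>m. \<Sum>\<omega>\<in>\<Omega> m. 1 / card (\<Omega> m) * g m \<omega>) \<longlonglongrightarrow> b"
  shows "ennreal \<bar>b\<bar> \<le> mean_liminf \<Omega> (\<lambda>m \<omega>. ennreal \<bar>g m \<omega>\<bar>)"
proof -
  have "(\<lambda>m. ennreal \<bar>\<Sum>\<omega>\<in>\<Omega> m. 1 / card (\<Omega> m) * g m \<omega>\<bar>) \<longlonglongrightarrow> ennreal \<bar>b\<bar>"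
    by (intro tendsto_ennrealI tendsto_rabs lim)
  then have "ennreal \<bar>b\<bar> = liminf (\<lambda>m. ennreal \<bar>\<Sum>\<omega>\<in>\<Omega> m. 1 / card (\<Omega> m) * g m \<omega>\<bar>)"
    using lim_imp_Liminf by force
  also have "\<dots> \<le> mean_liminf \<Omega> (\<lambda>m \<omega>. ennreal \<bar>g m \<omega>\<bar>)"
    unfolding mean_liminf_def
  proof (intro Liminf_mono always_eventually allI)
    fix m
    have "ennreal \<bar>\<Sum>\<omega>\<in>\<Omega> m. 1 / card (\<Omega> m) * g m \<omega>\<bar> \<le> ennreal (\<Sum>\<omega>\<in>\<Omega> m. 1 / card (\<Omega> m) * \<bar>g m \<omega>\<bar>)"
      by (intro ennreal_leI order_trans[OF sum_abs]) (simp add: abs_mult)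
    also have "\<dots> = (\<Sum>\<omega>\<in>\<Omega> m. ennreal (1 / card (\<Omega> m)) * ennreal \<bar>g m \<omega>\<bar>)"
    proof -
      have "(\<Sum>\<omega>\<in>\<Omega> m. ennreal (1 / card (\<Omega> m)) * ennreal \<bar>g m \<omega>\<bar>) = (\<Sum>\<omega>\<in>\<Omega> m. ennreal (1 / card (\<Omega> m) * \<bar>g m \<omega>\<bar>))"
        by (intro sum.cong refl ennreal_mult[symmetric]) auto
      also have "\<dots> = ennreal (\<Sum>\<omega>\<in>\<Omega> m. 1 / card (\<Omega> m) * \<bar>g m \<omega>\<bar>)"
        by (rule sum_ennreal) auto
      finally show ?thesis by simp
    qed
    finally show "ennreal \<bar>\<Sum>\<omega>\<in>\<Omega> m. 1 / card (\<Omega> m) * g m \<omega>\<bar> \<le> (\<Sum>\<omega>\<in>\<Omega> m. ennreal (1 / card (\<Omega> m)) * ennreal \<bar>g m \<omega>\<bar>)" .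
  qed
  finally show ?thesis .
qed

text \<open>For jets all derivatives exist, so the case distinction in \<open>holder_norm\<close>
  disappears and only sums and suprema of absolute values remain.\<close>

lemma holder_norm_jet:
  fixes G :: "(real^'n::finite) list \<Rightarrow> real^'n \<Rightarrow> real"
  assumes G: "jet M G"
  shows "holder_norm I \<gamma> (\<lambda>x. G [] (z0 + x)) =
     (\<Sum>i\<le>nat \<lfloor>\<gamma>\<rfloor>. SUP ps\<in>multi_indices I i. SUP x\<in>coord_space I. ennreal \<bar>G (map (\<lambda>p. axis p 1) ps) (z0 + x)\<bar>)
   + (SUP ps\<in>multi_indices I (nat \<lfloor>\<gamma>\<rfloor>). SUP (x, y)\<in>{(x, y). x \<in> coord_space I \<and> y \<in> coord_space I \<and> x \<noteq> y}.
        ennreal (\<bar>G (map (\<lambda>p. axis p 1) ps) (z0 + x) - G (map (\<lambda>p. axis p 1) ps) (z0 + y)\<bar> / norm (x - y) powr frac \<gamma>))"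
proof -
  have J: "jet M (\<lambda>vs x. G vs (z0 + x))" using jet_translate[OF G, of z0] by (simp add: add.commute)
  have p: "pdiffs ps (\<lambda>x. G [] (z0 + x)) = (\<lambda>x. G (map (\<lambda>p. axis p 1) ps) (z0 + x))" for ps
    using jet_pdiffs[OF J, of ps] by simp
  have "Cn_on I n (\<lambda>x. G [] (z0 + x))" for n using jet_Cn_on[OF J, of I n] by simp
  then show ?thesis unfolding holder_norm_def Let_def Cn_norm_def holder_seminorm_def p by simp
qed

text \<open>Every quantity under the suprema is the absolute value of a linear expression in
  derivatives, for which \<open>lim\<close> gives convergence. The constants may depend on m and
  \<omega>: they serve to identify partial derivatives with members of the jet, and no estimate uses
  their size.\<close>

lemma aniso_holder_norm_mean_limit:
  fixes G :: "nat \<Rightarrow> 'w \<Rightarrow> (real^'n::finite) list \<Rightarrow> real^'n \<Rightarrow> real"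
  assumes G: "\<And>m \<omega>. \<omega> \<in> \<Omega> m \<Longrightarrow> jet (M m \<omega>) (G m \<omega>)" and H: "jet M' H"
    and lim: "\<And>vs x. (\<lambda>m. \<Sum>\<omega>\<in>\<Omega> m. 1 / card (\<Omega> m) * G m \<omega> vs x) \<longlonglongrightarrow> H vs x"
  shows "aniso_holder_norm blk k \<gamma> (H []) \<le> mean_liminf \<Omega> (\<lambda>m \<omega>. aniso_holder_norm blk k \<gamma> (G m \<omega> []))"
proof -
  have hn: "holder_norm I \<gamma> (\<lambda>x. H [] (z0 + x)) \<le> mean_liminf \<Omega> (\<lambda>m \<omega>. holder_norm I \<gamma> (\<lambda>x. G m \<omega> [] (z0 + x)))" for I z0 \<gamma>
  proof -
    let ?e = "map (\<lambda>p. axis p 1) :: 'n list \<Rightarrow> (real^'n) list"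
    have q: "ennreal (\<bar>H vs x - H vs y\<bar> / r) \<le> mean_liminf \<Omega> (\<lambda>m \<omega>. ennreal (\<bar>G m \<omega> vs x - G m \<omega> vs y\<bar> / r))" if r: "r \<ge> 0" for vs x y r
    proof -
      have "(\<lambda>m. \<Sum>\<omega>\<in>\<Omega> m. 1 / card (\<Omega> m) * ((G m \<omega> vs x - G m \<omega> vs y) / r)) \<longlonglongrightarrow> (H vs x - H vs y) / r"
      proof -
        have "(\<lambda>m. ((\<Sum>\<omega>\<in>\<Omega> m. 1 / card (\<Omega> m) * G m \<omega> vs x) - (\<Sum>\<omega>\<in>\<Omega> m. 1 / card (\<Omega> m) * G m \<omega> vs y)) * (1 / r)) \<longlonglongrightarrow> (H vs x - H vs y) * (1 / r)"
          by (intro tendsto_mult_right tendsto_diff lim)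
        then show ?thesis by (simp add: sum_subtractf[symmetric] sum_distrib_right diff_divide_distrib[symmetric] right_diff_distrib[symmetric] sum_divide_distrib)
      qed
      from mean_liminf_abs[OF this] show ?thesis using r by (simp add: abs_divide)
    qed
    have "(\<Sum>i\<le>nat \<lfloor>\<gamma>\<rfloor>. SUP ps\<in>multi_indices I i. SUP x\<in>coord_space I. ennreal \<bar>H (?e ps) (z0 + x)\<bar>)
      + (SUP ps\<in>multi_indices I (nat \<lfloor>\<gamma>\<rfloor>). SUP (x, y)\<in>{(x, y). x \<in> coord_space I \<and> y \<in> coord_space I \<and> x \<noteq> y}.
        ennreal (\<bar>H (?e ps) (z0 + x) - H (?e ps) (z0 + y)\<bar> / norm (x - y) powr frac \<gamma>))
      \<le> mean_liminf \<Omega> (\<lambda>m \<omega>. \<Sum>i\<le>nat \<lfloor>\<gamma>\<rfloor>. SUP ps\<in>multi_indices I i. SUP x\<in>coord_space I. ennreal \<bar>G m \<omega> (?e ps) (z0 + x)\<bar>)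
      + mean_liminf \<Omega> (\<lambda>m \<omega>. SUP ps\<in>multi_indices I (nat \<lfloor>\<gamma>\<rfloor>). SUP (x, y)\<in>{(x, y). x \<in> coord_space I \<and> y \<in> coord_space I \<and> x \<noteq> y}.
        ennreal (\<bar>G m \<omega> (?e ps) (z0 + x) - G m \<omega> (?e ps) (z0 + y)\<bar> / norm (x - y) powr frac \<gamma>))"
      unfolding case_prod_unfold
      by (intro add_mono mean_liminf_sum mean_liminf_SUP mean_liminf_abs lim q) auto
    also have "\<dots> \<le> mean_liminf \<Omega> (\<lambda>m \<omega>. (\<Sum>i\<le>nat \<lfloor>\<gamma>\<rfloor>. SUP ps\<in>multi_indices I i. SUP x\<in>coord_space I. ennreal \<bar>G m \<omega> (?e ps) (z0 + x)\<bar>)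
      + (SUP ps\<in>multi_indices I (nat \<lfloor>\<gamma>\<rfloor>). SUP (x, y)\<in>{(x, y). x \<in> coord_space I \<and> y \<in> coord_space I \<and> x \<noteq> y}.
        ennreal (\<bar>G m \<omega> (?e ps) (z0 + x) - G m \<omega> (?e ps) (z0 + y)\<bar> / norm (x - y) powr frac \<gamma>)))"
      by (rule mean_liminf_add)
    also have "\<dots> \<le> mean_liminf \<Omega> (\<lambda>m \<omega>. holder_norm I \<gamma> (\<lambda>x. G m \<omega> [] (z0 + x)))"
      by (rule mean_liminf_mono) (simp add: holder_norm_jet[OF G])
    finally show ?thesis by (simp add: holder_norm_jet[OF H])
  qed
  have "aniso_holder_norm blk k \<gamma> (H []) \<le>
     mean_liminf \<Omega> (\<lambda>m \<omega>. SUP z0. holder_norm (block blk 0) \<gamma> (\<lambda>x. G m \<omega> [] (z0 + x)))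
     + mean_liminf \<Omega> (\<lambda>m \<omega>. \<Sum>i=1..k. SUP z0. holder_norm (block blk i) (\<gamma> / (1 + 2 * real i)) (\<lambda>x. G m \<omega> [] (z0 + x)))"
    unfolding aniso_holder_norm_def
    by (intro add_mono mean_liminf_sum mean_liminf_SUP hn) auto
  also have "\<dots> \<le> mean_liminf \<Omega> (\<lambda>m \<omega>. aniso_holder_norm blk k \<gamma> (G m \<omega> []))"
    unfolding aniso_holder_norm_def by (rule mean_liminf_add)
  finally show ?thesis .
qed

text \<open>The base point of the slices runs over the whole space, so a translation only permutes
  the slices.\<close>

lemma aniso_holder_norm_translate:
  "aniso_holder_norm blk k \<gamma> (\<lambda>z. \<phi> (z + y)) = aniso_holder_norm blk k \<gamma> (\<phi> :: real^'n::finite \<Rightarrow> real)"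
proof -
  have "(SUP z0. g (\<lambda>x. \<phi> (z0 + x + y))) = (SUP z0. g (\<lambda>x. \<phi> (z0 + x)) :: ennreal)" for g
  proof -
    have "(SUP z0. g (\<lambda>x. \<phi> (z0 + x + y))) = (SUP z0. (\<lambda>z0. g (\<lambda>x. \<phi> (z0 + x))) (z0 + y))"
      by (simp add: add_ac)
    also have "\<dots> = (SUP z0\<in>range (\<lambda>z0. z0 + y). g (\<lambda>x. \<phi> (z0 + x)))" by (simp only: image_image)
    also have "range (\<lambda>z0. z0 + y) = UNIV" by (metis surj_def diff_add_cancel)
    finally show ?thesis .
  qed
  then show ?thesis unfolding aniso_holder_norm_def by simp
qed

section \<open>Sources\<close>

lemma Bb_bounds:
  fixes f :: "real \<Rightarrow> real^'n::finite \<Rightarrow> real"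
  assumes f: "f \<in> Bb_Cc_infty T"
  obtains m where "\<And>s ps x. s \<in> {0..T} \<Longrightarrow> \<bar>pdiffs ps (f s) x\<bar> \<le> m (length ps)"
proof (rule that)
  fix s and ps :: "'n list" and x :: "real^'n" assume s: "s \<in> {0..T}"
  let ?S = "SUP t\<in>{0..T}. Cn_norm UNIV (length ps) (f t)"
  have fin: "?S < top" using f unfolding Bb_Cc_infty_def by (auto simp: infinity_ennreal_def)
  have "ennreal \<bar>pdiffs ps (f s) x\<bar> \<le> (SUP qs\<in>multi_indices UNIV (length ps). SUP x\<in>coord_space UNIV. ennreal \<bar>pdiffs qs (f s) x\<bar>)"
    by (rule SUP_upper2[of ps], simp add: multi_indices_def, rule SUP_upper) (simp add: coord_space_def)
  also have "\<dots> \<le> Cn_norm UNIV (length ps) (f s)"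
    unfolding Cn_norm_def
    by (rule member_le_sum[where f = "\<lambda>i. SUP qs\<in>multi_indices UNIV i. SUP x\<in>coord_space UNIV. ennreal \<bar>pdiffs qs (f s) x\<bar>"]) auto
  also have "\<dots> \<le> ?S" by (rule SUP_upper[OF s])
  finally have "enn2real (ennreal \<bar>pdiffs ps (f s) x\<bar>) \<le> enn2real ?S" by (rule enn2real_mono[OF _ fin])
  then show "\<bar>pdiffs ps (f s) x\<bar> \<le> (\<lambda>n. enn2real (SUP t\<in>{0..T}. Cn_norm UNIV n (f t))) (length ps)" by simp
qed

text \<open>The source and its derivatives in the moving frame, continued by 0 outside [0, T] so
  that bounds and measurability hold on the whole line.\<close>

definition source_frame :: "real^'n^'n::finite \<Rightarrow> real \<Rightarrow> (real \<Rightarrow> real^'n \<Rightarrow> real) \<Rightarrow> real \<Rightarrow> (real^'n) list \<Rightarrow> real^'n \<Rightarrow> real" where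
  "source_frame A T f s vs x = (if s \<in> {0..T} then
     contract (map ((*v) (matrix_exp A (- s))) vs) (\<lambda>qs. pdiffs qs (f s) (matrix_exp A (- s) *v x)) else 0)"

lemma source_frame_value: "s \<in> {0..T} \<Longrightarrow> source_frame A T f s [] x = f s (matrix_exp A (- s) *v x)"
  by (simp add: source_frame_def pdiffs_def)

lemma source_frame_jet:
  fixes f :: "real \<Rightarrow> real^'n::finite \<Rightarrow> real"
  assumes f: "f \<in> Bb_Cc_infty T"
  obtains M where "\<And>s. jet M (source_frame A T f s)"
proof -
  obtain m where m: "\<And>s ps x. s \<in> {0..T} \<Longrightarrow> \<bar>pdiffs ps (f s) x\<bar> \<le> m (length ps)" using Bb_bounds[OF f] by blast
  obtain c where c: "c \<ge> 1" "\<And>t x. \<bar>t\<bar> \<le> T \<Longrightarrow> norm (matrix_exp A t *v x) \<le> c * norm x"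
    using matrix_exp_bounds[of T A] by metis
  define M where "M k = \<bar>c ^ k * (3 * m k * real CARD('n) ^ k)\<bar>" for k
  have "jet M (source_frame A T f s)" for s
  proof (cases "s \<in> {0..T}")
    case True
    have "jet (\<lambda>k. 3 * m k * real CARD('n) ^ k) (\<lambda>vs x. contract vs (\<lambda>qs. pdiffs qs (f s) x))"
      by (rule jet_of_partials) (use f True m in \<open>auto simp: Bb_Cc_infty_def\<close>)
    from jet_compose_linear[OF this, of "(*v) (matrix_exp A (- s))" c]
    have "jet (\<lambda>k. c ^ k * (3 * m k * real CARD('n) ^ k)) (source_frame A T f s)"
      unfolding source_frame_def[abs_def] using True c by (auto simp: matrix_vector_mul_linear)
    then show ?thesis by (rule jet_mono) (simp add: M_def)
  next
    case False
    have "source_frame A T f s = (\<lambda>_ _. 0)" using False by (intro ext) (simp only: source_frame_def if_False)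
    moreover have "jet M (\<lambda>_ _. 0)" by (rule jetI) (auto simp: M_def norm_prod_nonneg)
    ultimately show ?thesis by simp
  qed
  then show thesis using that by blast
qed

text \<open>Each point has its own finite set of discontinuities in time. Those of a countable dense
  set of points form \<open>N\<close>; the Lipschitz bound in space, uniform in time, carries right
  continuity over to all points, and \<open>jet_tendsto_of_values\<close> to the
  derivatives.\<close>

lemma Bb_jet_source:
  fixes g :: "real \<Rightarrow> real^'n::finite \<Rightarrow> real"
  assumes g: "g \<in> Bb_Cc_infty T" and F: "\<And>s. jet M (F s)"
    and Fg: "\<And>s x. s \<in> {0..T} \<Longrightarrow> F s [] x = g s (matrix_exp A (- s) *v x)"
    and F0: "\<And>s vs x. s \<notin> {0..T} \<Longrightarrow> F s vs x = 0"
  obtains N where "jet_source T M F N"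
proof -
  obtain D :: "(real^'n) set" where D: "countable D" "\<And>X. open X \<Longrightarrow> X \<noteq> {} \<Longrightarrow> \<exists>d\<in>D. d \<in> X"
    using countable_dense_exists by blast
  have "\<forall>z. \<exists>P. finite P \<and> (\<forall>t\<in>{0..T} - P. continuous (at t within {0..T}) (\<lambda>s. g s z))"
    using g unfolding Bb_Cc_infty_def by blast
  then obtain P where P: "\<And>z. finite (P z)" "\<And>z t. t \<in> {0..T} - P z \<Longrightarrow> continuous (at t within {0..T}) (\<lambda>s. g s z)"
    by metis
  define N where "N = (\<Union>z\<in>D. P z)"
  have N: "countable N" unfolding N_def using D(1) P(1) by (intro countable_UN) (auto intro: countable_finite)
  obtain c where c: "c \<ge> 1" "\<And>t x. \<bar>t\<bar> \<le> T \<Longrightarrow> norm (matrix_exp A t *v x) \<le> c * norm x"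
    using matrix_exp_bounds[of T A] by metis
  have gF: "g s z = F s [] (matrix_exp A s *v z)" if "s \<in> {0..T}" for s z
    using Fg[OF that, of "matrix_exp A s *v z"] by (simp add: matrix_exp_inverse_vec)
  have M1: "M 1 \<ge> 0" by (rule jet_nonneg[OF F])
  have lip: "\<bar>g s z - g s z'\<bar> \<le> M 1 * c * norm (z - z')" if s: "s \<in> {0..T}" for s z z'
  proof -
    have "\<bar>g s z - g s z'\<bar> \<le> M 1 * norm (matrix_exp A s *v z - matrix_exp A s *v z')"
      using jet_lipschitz[OF F[of s], of "[]" "matrix_exp A s *v z" "matrix_exp A s *v z'"] by (simp add: gF[OF s])
    also have "\<dots> \<le> M 1 * (c * norm (z - z'))"
      using c(2)[of s "z - z'"] s M1 by (intro mult_left_mono) (auto simp: matrix_vector_mult_diff_distrib)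
    finally show ?thesis by simp
  qed
  have right: "((\<lambda>h. g (s + h) z) \<longlongrightarrow> g s z) (at_right 0)" if s: "0 \<le> s" "s < T" "s \<notin> N" for s z
  proof (rule tendstoI)
    fix e :: real assume e: "e > 0"
    have mc: "M 1 * c \<ge> 0" using M1 c by simp
    \<comment> \<open>Moving z to the nearby dense point costs at most e/3 at each of the two
      times.\<close>
    define \<delta> where "\<delta> = e / 3 / (M 1 * c + 1)"
    have \<delta>: "\<delta> > 0" using e mc by (simp add: \<delta>_def)
    obtain d where d: "d \<in> D" "d \<in> ball z \<delta>" using D(2)[of "ball z \<delta>"] \<delta> by auto
    have sm: "M 1 * c * norm (z - d) \<le> e / 3"
    proof -
      have "M 1 * c * norm (z - d) \<le> (M 1 * c + 1) * \<delta>" using d(2) mc by (intro mult_mono) (auto simp: dist_norm)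
      also have "\<dots> = e / 3"
      proof -
        have "M 1 * c + 1 \<noteq> 0" using mc by simp
        from nonzero_eq_divide_eq[OF this, THEN iffD1, OF \<delta>_def] show ?thesis by (simp add: mult.commute)
      qed
      finally show ?thesis .
    qed
    have "s \<in> {0..T} - P d" using s d(1) by (auto simp: N_def)
    from P(2)[OF this] have "((\<lambda>r. g r d) \<longlongrightarrow> g s d) (at s within {s..T})"
      using s unfolding continuous_within by (auto elim: tendsto_within_subset)
    then have "((\<lambda>r. g r d) \<longlongrightarrow> g s d) (at_right s)" using s by (simp add: at_within_Icc_at_right)
    then have "((\<lambda>h. g (s + h) d) \<longlongrightarrow> g s d) (at_right 0)"
      by (subst (asm) at_right_to_0) (simp add: filterlim_filtermap add.commute)
    then have "eventually (\<lambda>h. dist (g (s + h) d) (g s d) < e / 3) (at_right 0)" using e by (intro tendstoD) auto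
    moreover have "eventually (\<lambda>h. 0 < h \<and> h < T - s) (at_right 0)"
      using s by (auto simp: eventually_at_right_field intro!: exI[of _ "T - s"])
    ultimately show "eventually (\<lambda>h. dist (g (s + h) z) (g s z) < e) (at_right 0)"
    proof eventually_elim
      case (elim h)
      have "\<bar>g (s + h) z - g (s + h) d\<bar> \<le> e / 3" "\<bar>g s z - g s d\<bar> \<le> e / 3"
        using lip[of "s + h" z d] lip[of s z d] sm elim s by auto
      then show ?case using elim unfolding dist_real_def by linarith
    qed
  qed
  have "jet_source T M F N"
  proof
    show "jet M (F s)" for s by (rule F)
    show "countable N" by (rule N)
    have "(\<lambda>s. F s [] x) \<in> borel_measurable borel" for x
    proof -
      have gm: "(\<lambda>(t, z). g t z) \<in> borel_measurable (restrict_space borel ({0..T} \<times> UNIV))"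
        using g unfolding Bb_Cc_infty_def by blast
      have "(\<lambda>s. (s, matrix_exp A (- s) *v x)) \<in> borel_measurable borel"
      proof (rule borel_measurable_continuous_onI)
        have "continuous_on UNIV (\<lambda>s. matrix_exp A s *v x)"
          by (intro continuous_at_imp_continuous_on ballI has_vector_derivative_continuous[OF matrix_exp_vec_derivative])
        then show "continuous_on UNIV (\<lambda>s. (s, matrix_exp A (- s) *v x))"
          by (intro continuous_intros continuous_on_compose2[where f = uminus and g = "\<lambda>s. matrix_exp A s *v x"]) (auto intro!: continuous_intros)
      qed
      then have "(\<lambda>s. (s, matrix_exp A (- s) *v x)) \<in> restrict_space borel {0..T} \<rightarrow>\<^sub>M restrict_space borel ({0..T} \<times> UNIV)"
        by (intro measurable_restrict_space3) auto
      from measurable_compose[OF this gm]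
      have "(\<lambda>s. g s (matrix_exp A (- s) *v x)) \<in> borel_measurable (restrict_space borel {0..T})" by simp
      then have "(\<lambda>s. indicator {0..T} s *\<^sub>R g s (matrix_exp A (- s) *v x)) \<in> borel_measurable borel"
        by (subst (asm) borel_measurable_restrict_space_iff) (auto simp: mult.commute)
      moreover have "F s [] x = indicator {0..T} s *\<^sub>R g s (matrix_exp A (- s) *v x)" for s
        using Fg[of s x] F0[of s "[]" x] by (auto simp: indicator_def)
      ultimately show ?thesis by simp
    qed
    then show "(\<lambda>s. F s vs x) \<in> borel_measurable borel" for vs x by (rule jet_measurable_of_values[OF F])
    show "((\<lambda>h. F (s + h) vs x) \<longlongrightarrow> F s vs x) (at_right 0)" if s: "0 \<le> s" "s < T" "s \<notin> N" for s vs x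
    proof (rule jet_tendsto_of_values[OF F F])
      fix x
      have cE: "continuous_on {0..T} (\<lambda>s. matrix_exp A (- s) *v x)"
        by (rule continuous_on_compose2[where f = uminus and g = "\<lambda>s. matrix_exp A s *v x" and t = UNIV])
           (auto intro!: continuous_intros continuous_at_imp_continuous_on has_vector_derivative_continuous[OF matrix_exp_vec_derivative])
      have "((\<lambda>h. matrix_exp A (- (s + h)) *v x) \<longlongrightarrow> matrix_exp A (- s) *v x) (at_right 0)"
      proof -
        have "continuous_on {s..T} (\<lambda>s. matrix_exp A (- s) *v x)" using cE s by (auto elim: continuous_on_subset)
        then have "((\<lambda>s. matrix_exp A (- s) *v x) \<longlongrightarrow> matrix_exp A (- s) *v x) (at_right s)"
          using s by (simp add: continuous_on_def at_within_Icc_at_right[symmetric])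
        then show ?thesis by (subst (asm) at_right_to_0) (simp add: filterlim_filtermap add.commute)
      qed
      then have n0: "((\<lambda>h. norm (matrix_exp A (- (s + h)) *v x - matrix_exp A (- s) *v x)) \<longlongrightarrow> 0) (at_right 0)"
        by (simp add: tendsto_norm_zero_iff LIM_zero_iff)
      have ev: "eventually (\<lambda>h. 0 < h \<and> h < T - s) (at_right 0)"
        using s by (auto simp: eventually_at_right_field intro!: exI[of _ "T - s"])
      have "((\<lambda>h. F (s + h) [] x - g (s + h) (matrix_exp A (- s) *v x)) \<longlongrightarrow> 0) (at_right 0)"
      proof (rule Lim_null_comparison)
        show "eventually (\<lambda>h. norm (F (s + h) [] x - g (s + h) (matrix_exp A (- s) *v x)) \<le> M 1 * c * norm (matrix_exp A (- (s + h)) *v x - matrix_exp A (- s) *v x)) (at_right 0)"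
          using ev
        proof eventually_elim
          case (elim h)
          then have sh: "s + h \<in> {0..T}" using s by auto
          show ?case using lip[OF sh] by (simp add: Fg[OF sh])
        qed
        show "((\<lambda>h. M 1 * c * norm (matrix_exp A (- (s + h)) *v x - matrix_exp A (- s) *v x)) \<longlongrightarrow> 0) (at_right 0)"
          using tendsto_mult_left[OF n0, of "M 1 * c"] by simp
      qed
      from tendsto_add[OF this right[OF s, of "matrix_exp A (- s) *v x"]]
      show "((\<lambda>h. F (s + h) [] x) \<longlongrightarrow> F s [] x) (at_right 0)" using Fg[of s x] s by simp
    qed
  qed
  then show thesis by (rule that)
qed

text \<open>The shift takes finitely many values y. At a point z the discontinuities therefore lie
  among the jumps of the shift and the finitely many finite sets belonging to the points z -
  y.\<close>

lemma Bb_step_translate: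
  fixes f :: "real \<Rightarrow> real^'n::finite \<Rightarrow> real"
  assumes f: "f \<in> Bb_Cc_infty T" and c: "c \<in> borel_measurable borel" "finite (c ` {0..T})"
    and P: "finite P" "\<And>t. t \<in> {0..T} - P \<Longrightarrow> eventually (\<lambda>r. c r = c t) (at t within {0..T})"
  shows "(\<lambda>s z. f s (z - c s)) \<in> Bb_Cc_infty T"
proof -
  from finite_imp_bounded[OF c(2)] obtain R where "\<forall>x\<in>c ` {0..T}. norm x \<le> R" unfolding bounded_iff by blast
  then have R: "\<And>s. s \<in> {0..T} \<Longrightarrow> norm (c s) \<le> R" by auto
  have tr: "pdiffs ps (\<lambda>z. f s (z - c s)) = (\<lambda>z. pdiffs ps (f s) (z - c s))" for ps s
  proof (induction ps)
    case (Cons p ps)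
    then show ?case by (simp add: pdiffs_def pdiff_def fun_eq_iff add_diff_eq[symmetric] diff_add_eq)
  qed (simp add: pdiffs_def)
  have UNIV_space: "coord_space UNIV = (UNIV :: (real^'n) set)" by (simp add: coord_space_def)
  show ?thesis unfolding Bb_Cc_infty_def mem_Collect_eq
  proof (intro conjI ballI allI)
    have fm: "(\<lambda>(t, z). f t z) \<in> borel_measurable (restrict_space borel ({0..T} \<times> UNIV))"
      using f unfolding Bb_Cc_infty_def by blast
    have "(\<lambda>x::real \<times> (real^'n). (fst x, snd x - c (fst x))) \<in> borel_measurable borel"
      using c(1) by (simp add: borel_prod[symmetric])
    then have "(\<lambda>x::real \<times> (real^'n). (fst x, snd x - c (fst x))) \<in> restrict_space borel ({0..T} \<times> UNIV) \<rightarrow>\<^sub>M restrict_space borel ({0..T} \<times> UNIV)"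
      by (intro measurable_restrict_space3) auto
    from measurable_compose[OF this fm] show "(\<lambda>(s, z). f s (z - c s)) \<in> borel_measurable (restrict_space borel ({0..T} \<times> UNIV))"
      by (simp add: case_prod_unfold)
    have "(\<lambda>(s, z). f s (z - c s)) ` ({0..T} \<times> UNIV) \<subseteq> (\<lambda>(t, z). f t z) ` ({0..T} \<times> UNIV)" by force
    moreover have "bounded ((\<lambda>(t, z). f t z) ` ({0..T} \<times> UNIV))" using f unfolding Bb_Cc_infty_def by blast
    ultimately show "bounded ((\<lambda>(s, z). f s (z - c s)) ` ({0..T} \<times> UNIV))" by (rule bounded_subset[rotated])
    obtain a r where ar: "\<And>t. t \<in> {0..T} \<Longrightarrow> closure {z. f t z \<noteq> 0} \<subseteq> ball a r"
      using f unfolding Bb_Cc_infty_def by blast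
    have sup: "closure {z. f t (z - c t) \<noteq> 0} \<subseteq> cball a (r + R)" if "t \<in> {0..T}" for t
    proof (rule closure_minimal)
      show "{z. f t (z - c t) \<noteq> 0} \<subseteq> cball a (r + R)"
      proof
        fix z assume "z \<in> {z. f t (z - c t) \<noteq> 0}"
        then have "z - c t \<in> ball a r" using ar[OF that] closure_subset[of "{z. f t z \<noteq> 0}"] by blast
        then have "norm (z - c t - a) < r" by (simp add: dist_norm norm_minus_commute)
        moreover have "norm (z - a) \<le> norm (z - c t - a) + norm (c t)"
          using norm_triangle_ineq[of "z - c t - a" "c t"] by (simp add: algebra_simps)
        ultimately show "z \<in> cball a (r + R)" using R[OF that] by (simp add: dist_norm norm_minus_commute)
      qed
    qed simp
    show "Cn_on UNIV n (\<lambda>z. f t (z - c t))" if "t \<in> {0..T}" for t n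
    proof -
      have C: "Cn_on UNIV n (f t)" using f that unfolding Bb_Cc_infty_def by blast
      show ?thesis unfolding Cn_on_def UNIV_space tr
      proof (intro conjI allI impI ballI)
        fix m ps assume "m \<le> n" "ps \<in> multi_indices (UNIV :: 'n set) m"
        then have "continuous_on UNIV (pdiffs ps (f t))" using C unfolding Cn_on_def UNIV_space by blast
        then show "continuous_on UNIV (\<lambda>z. pdiffs ps (f t) (z - c t))"
          by (rule continuous_on_compose2) (auto intro!: continuous_intros)
      next
        fix m ps p x assume "m < n" "ps \<in> multi_indices (UNIV :: 'n set) m"
        then have "(\<lambda>h. pdiffs ps (f t) (x - c t + h *\<^sub>R axis p 1)) field_differentiable at 0"
          using C unfolding Cn_on_def UNIV_space by blast
        then show "(\<lambda>h. pdiffs ps (f t) (x + h *\<^sub>R axis p 1 - c t)) field_differentiable at 0"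
          by (simp add: algebra_simps)
      qed
    qed
    show "compact (closure {z. f t (z - c t) \<noteq> 0})" if "t \<in> {0..T}" for t
      using sup[OF that] by (meson bounded_cball bounded_subset closed_closure compact_eq_bounded_closed)
    show "\<exists>a R. \<forall>t\<in>{0..T}. closure {z. f t (z - c t) \<noteq> 0} \<subseteq> ball a R"
    proof (intro exI ballI)
      show "closure {z. f t (z - c t) \<noteq> 0} \<subseteq> ball a (r + R + 1)" if "t \<in> {0..T}" for t
        using sup[OF that] by force
    qed
    show "(SUP t\<in>{0..T}. Cn_norm UNIV n (\<lambda>z. f t (z - c t))) < \<infinity>" for n
    proof -
      have "Cn_norm UNIV n (\<lambda>z. f t (z - c t)) \<le> Cn_norm UNIV n (f t)" for t
        unfolding Cn_norm_def tr UNIV_space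
        by (intro sum_mono SUP_mono' SUP_least) (auto intro: SUP_upper)
      then have "(SUP t\<in>{0..T}. Cn_norm UNIV n (\<lambda>z. f t (z - c t))) \<le> (SUP t\<in>{0..T}. Cn_norm UNIV n (f t))"
        by (intro SUP_mono') auto
      also have "\<dots> < \<infinity>" using f unfolding Bb_Cc_infty_def by blast
      finally show ?thesis .
    qed
    fix z
    have "\<forall>z. \<exists>Q. finite Q \<and> (\<forall>t\<in>{0..T} - Q. continuous (at t within {0..T}) (\<lambda>s. f s z))"
      using f unfolding Bb_Cc_infty_def by blast
    then obtain Q where Q: "\<And>z. finite (Q z)" "\<And>z t. t \<in> {0..T} - Q z \<Longrightarrow> continuous (at t within {0..T}) (\<lambda>s. f s z)"
      by metis
    show "\<exists>Q. finite Q \<and> (\<forall>t\<in>{0..T} - Q. continuous (at t within {0..T}) (\<lambda>s. f s (z - c s)))"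
    proof (intro exI conjI ballI)
      show "finite (P \<union> (\<Union>y\<in>c ` {0..T}. Q (z - y)))" by (intro finite_UnI P(1) finite_UN_I[OF c(2)] Q(1))
      fix t assume t: "t \<in> {0..T} - (P \<union> (\<Union>y\<in>c ` {0..T}. Q (z - y)))"
      then have "continuous (at t within {0..T}) (\<lambda>s. f s (z - c t))" by (intro Q(2)) auto
      moreover have "eventually (\<lambda>r. f r (z - c t) = f r (z - c r)) (at t within {0..T})"
        using P(2)[of t] t by (auto elim!: eventually_mono)
      ultimately show "continuous (at t within {0..T}) (\<lambda>s. f s (z - c s))"
        unfolding continuous_within by (rule Lim_transform_eventually)
    qed
  qed
qed

text \<open>Two meshes are superposed: one will carry the index of the walk, the other a frozen time
  of the flow of A.\<close>

lemma floor_step_function: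
  fixes d :: "int \<Rightarrow> int \<Rightarrow> 'a::euclidean_space" and \<kappa>1 \<kappa>2 T :: real
  assumes pos: "\<kappa>1 > 0" "\<kappa>2 > 0"
  defines "c \<equiv> (\<lambda>s. d \<lfloor>\<kappa>1 * s\<rfloor> \<lfloor>\<kappa>2 * s\<rfloor>)"
  shows "c \<in> borel_measurable borel" "finite (c ` {0..T})"
    "\<exists>P. finite P \<and> (\<forall>t\<in>{0..T} - P. eventually (\<lambda>r. c r = c t) (at t within {0..T}))"
proof -
  have m: "(\<lambda>s. \<lfloor>\<kappa> * s\<rfloor>) \<in> borel \<rightarrow>\<^sub>M count_space UNIV" for \<kappa> :: real by measurable
  have "(\<lambda>s. (\<lfloor>\<kappa>1 * s\<rfloor>, \<lfloor>\<kappa>2 * s\<rfloor>)) \<in> borel \<rightarrow>\<^sub>M count_space UNIV \<Otimes>\<^sub>M count_space UNIV"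
    by (intro measurable_Pair m)
  then have "(\<lambda>s. (\<lfloor>\<kappa>1 * s\<rfloor>, \<lfloor>\<kappa>2 * s\<rfloor>)) \<in> borel \<rightarrow>\<^sub>M count_space UNIV"
    by (simp add: pair_measure_countable)
  from measurable_compose[OF this, of "\<lambda>(i, j). d i j" borel] show "c \<in> borel_measurable borel"
    by (simp add: c_def)
  have fl: "\<lfloor>\<kappa> * s\<rfloor> \<in> {0..\<lfloor>\<kappa> * T\<rfloor>}" if "\<kappa> > 0" "s \<in> {0..T}" for \<kappa> s
    using that by (auto intro!: floor_mono mult_left_mono)
  have "c ` {0..T} \<subseteq> (\<lambda>(i, j). d i j) ` ({0..\<lfloor>\<kappa>1 * T\<rfloor>} \<times> {0..\<lfloor>\<kappa>2 * T\<rfloor>})"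
    using fl[OF pos(1)] fl[OF pos(2)] unfolding c_def by force
  then show "finite (c ` {0..T})" by (rule finite_subset) auto
  have const: "eventually (\<lambda>r. \<lfloor>\<kappa> * r\<rfloor> = \<lfloor>\<kappa> * t\<rfloor>) (at t within X)" if "\<kappa> * t \<notin> \<int>" for \<kappa> t :: real and X
  proof -
    have "real_of_int \<lfloor>\<kappa> * t\<rfloor> < \<kappa> * t" using that by (metis Ints_of_int less_eq_real_def of_int_floor_le)
    moreover have "((\<lambda>r. \<kappa> * r) \<longlongrightarrow> \<kappa> * t) (at t within X)" by (intro tendsto_intros)
    ultimately have "eventually (\<lambda>r. real_of_int \<lfloor>\<kappa> * t\<rfloor> < \<kappa> * r \<and> \<kappa> * r < real_of_int \<lfloor>\<kappa> * t\<rfloor> + 1) (at t within X)"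
      by (intro eventually_conj order_tendstoD) auto
    then show ?thesis by eventually_elim linarith
  qed
  define P where "P \<kappa> = (\<lambda>i. real_of_int i / \<kappa>) ` {0..\<lfloor>\<kappa> * T\<rfloor>}" for \<kappa>
  have inP: "t \<in> P \<kappa>" if "t \<in> {0..T}" "\<kappa> > 0" "\<kappa> * t \<in> \<int>" for t \<kappa>
  proof -
    from that(3) have "\<kappa> * t = real_of_int \<lfloor>\<kappa> * t\<rfloor>" by (metis Ints_cases floor_of_int)
    then have "t = real_of_int \<lfloor>\<kappa> * t\<rfloor> / \<kappa>" using that by (simp add: field_simps)
    then show ?thesis unfolding P_def using fl[OF that(2,1)] by blast
  qed
  have "eventually (\<lambda>r. c r = c t) (at t within {0..T})" if t: "t \<in> {0..T} - (P \<kappa>1 \<union> P \<kappa>2)" for t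
  proof -
    have "\<kappa>1 * t \<notin> \<int>" "\<kappa>2 * t \<notin> \<int>" using inP[of t] pos t by auto
    from eventually_conj[OF const[OF this(1)] const[OF this(2)], of "{0..T}"]
    show ?thesis by eventually_elim (simp add: c_def)
  qed
  then show "\<exists>P. finite P \<and> (\<forall>t\<in>{0..T} - P. eventually (\<lambda>r. c r = c t) (at t within {0..T}))"
    by (intro exI[of _ "P \<kappa>1 \<union> P \<kappa>2"]) (auto simp: P_def)
qed

section \<open>Random walk paths\<close>

lemma walk_steps_commute: "walk_step Q (walk_steps Qs g) = walk_steps Qs (walk_step Q g)"
  by (induction Qs) (simp_all add: walk_step_commute[of Q] flip: walk_step_commute)

lemma walk_steps_append: "walk_steps (Ps @ Qs) g = walk_steps Ps (walk_steps Qs g)"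
  by (induction Ps) simp_all

text \<open>Induction on the number of increments, summing over the last one separately. Increments
  outside [a, b) do not enter the argument of g and only contribute to the count, hence the full
  power m on the right.\<close>

lemma walk_average:
  fixes Q :: "nat \<Rightarrow> real^'n^'n::finite"
  assumes "a \<le> b" "b \<le> m"
  shows "(\<Sum>w\<in>PiE {..<m} (\<lambda>_. UNIV). g (x + (\<Sum>j\<in>{a..<b}. walk_shift (Q j) (w j))))
     = (2 * real CARD('n)) ^ m * walk_steps (map Q [a..<b]) g x"
  using assms
proof (induction m arbitrary: b x)
  case 0
  then show ?case by simp
next
  case (Suc m)
  define W where "W m = PiE {..<m} (\<lambda>_. UNIV :: ('n \<times> bool) set)" for m :: nat
  have card: "card (W k) = (2 * CARD('n)) ^ k" for k
    by (simp add: W_def card_PiE card_cartesian_product UNIV_Times_UNIV[symmetric] del: UNIV_Times_UNIV)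
  have split: "(\<Sum>w\<in>W (Suc m). h w) = (\<Sum>i\<in>UNIV. \<Sum>w\<in>W m. h (w(m := i)))" for h :: "(nat \<Rightarrow> 'n \<times> bool) \<Rightarrow> real"
  proof -
    have "W (Suc m) = (\<lambda>(y, w). w(m := y)) ` (UNIV \<times> W m)"
      unfolding W_def lessThan_Suc by (rule PiE_insert_eq)
    moreover have "inj_on (\<lambda>(y, w). w(m := y)) (UNIV \<times> W m)"
      unfolding W_def by (rule inj_combinator) simp
    ultimately have "(\<Sum>w\<in>W (Suc m). h w) = (\<Sum>z\<in>UNIV \<times> W m. h (case z of (y, w) \<Rightarrow> w(m := y)))"
      by (simp add: sum.reindex)
    then show ?thesis by (simp add: sum.cartesian_product case_prod_unfold)
  qed
  note IH = Suc.IH[folded W_def]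
  have "(\<Sum>w\<in>W (Suc m). g (x + (\<Sum>j\<in>{a..<b}. walk_shift (Q j) (w j))))
     = (2 * real CARD('n)) ^ Suc m * walk_steps (map Q [a..<b]) g x"
  proof (cases "b \<le> m")
    case True
    have "(\<Sum>w\<in>W m. g (x + (\<Sum>j\<in>{a..<b}. walk_shift (Q j) ((w(m := i)) j)))) = (2 * real CARD('n)) ^ m * walk_steps (map Q [a..<b]) g x" for i
    proof -
      have "(\<Sum>j\<in>{a..<b}. walk_shift (Q j) ((w(m := i)) j)) = (\<Sum>j\<in>{a..<b}. walk_shift (Q j) (w j))" for w
        using True by (intro sum.cong) auto
      then show ?thesis using IH[OF Suc.prems(1) True] by simp
    qed
    then show ?thesis unfolding split
      by (simp add: card_cartesian_product UNIV_Times_UNIV[symmetric] del: UNIV_Times_UNIV)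
  next
    case False
    then have b: "b = Suc m" using Suc.prems by simp
    show ?thesis
    proof (cases "a = Suc m")
      case True
      then show ?thesis using card[of "Suc m"] by (simp add: b)
    next
      case False
      then have am: "a \<le> m" using Suc.prems b by simp
      have "(\<Sum>w\<in>W m. g (x + (\<Sum>j\<in>{a..<b}. walk_shift (Q j) ((w(m := i)) j))))
         = (2 * real CARD('n)) ^ m * walk_steps (map Q [a..<m]) g (x + walk_shift (Q m) i)" for i
      proof -
        have "(\<Sum>j\<in>{a..<b}. walk_shift (Q j) ((w(m := i)) j)) = (\<Sum>j\<in>{a..<m}. walk_shift (Q j) (w j)) + walk_shift (Q m) i" for w
          using am by (simp add: b)
        then show ?thesis using IH[OF am order_refl, of "x + walk_shift (Q m) i"] by (simp add: add_ac)
      qed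
      then have "(\<Sum>w\<in>W (Suc m). g (x + (\<Sum>j\<in>{a..<b}. walk_shift (Q j) (w j))))
         = (2 * real CARD('n)) ^ m * (\<Sum>i\<in>UNIV. walk_steps (map Q [a..<m]) g (x + walk_shift (Q m) i))"
        unfolding split by (simp add: sum_distrib_left)
      also have "\<dots> = (2 * real CARD('n)) ^ Suc m * walk_step (Q m) (walk_steps (map Q [a..<m]) g) x"
        by (simp add: walk_step_def)
      also have "walk_step (Q m) (walk_steps (map Q [a..<m]) g) = walk_steps (map Q [a..<b]) g"
        using am by (simp add: b walk_steps_commute walk_steps_append)
      finally show ?thesis .
    qed
  qed
  then show ?case by (simp add: W_def)
qed

section \<open>Averaging the shifted problems\<close>

lemma walk_average_heat:
  fixes Q :: "nat \<Rightarrow> real^'n^'n::finite"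
  assumes ab: "a \<le> b" "b \<le> m" and G: "jet M G" and Q: "\<And>j. j < m \<Longrightarrow> sym_nonneg_matrix (Q j)"
  shows "\<bar>(\<Sum>w\<in>PiE {..<m} (\<lambda>_. UNIV). G vs (x + (\<Sum>j\<in>{a..<b}. walk_shift (Q j) (w j)))) / (2 * real CARD('n)) ^ m
      - heat (\<Sum>j\<in>{a..<b}. Q j) G vs x\<bar>
     \<le> 12 * real CARD('n) * M (length vs + 4) * norm_prod vs * (\<Sum>j\<in>{a..<b}. (trace (Q j))\<^sup>2)"
proof -
  have "(\<Sum>j\<in>{a..<b}. Q j) = sum_list (map Q [a..<b])" by (simp add: sum_list_distinct_conv_sum_set)
  moreover have "(\<Sum>j\<in>{a..<b}. (trace (Q j))\<^sup>2) = (\<Sum>Q\<leftarrow>map Q [a..<b]. (trace Q)\<^sup>2)"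
    by (simp add: sum_list_distinct_conv_sum_set o_def)
  moreover have "sym_nonneg_matrix P" if "P \<in> set (map Q [a..<b])" for P using that Q ab by auto
  ultimately show ?thesis
    unfolding walk_average[OF ab, where g = "G vs"] using walk_steps_heat[OF G, of "map Q [a..<b]" vs x] by simp
qed

definition sign_paths :: "nat \<Rightarrow> (nat \<Rightarrow> 'n::finite \<times> bool) set" where
  "sign_paths n = PiE {..<n} (\<lambda>_. UNIV)"

lemma sign_paths: "finite (sign_paths n)" "sign_paths n \<noteq> {}"
    "real (card (sign_paths n :: (nat \<Rightarrow> 'n::finite \<times> bool) set)) = (2 * real CARD('n)) ^ n"
  by (auto simp: sign_paths_def card_PiE card_cartesian_product finite_PiE PiE_eq_empty_iff
      UNIV_Times_UNIV[symmetric] mult.commute simp del: UNIV_Times_UNIV)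

definition mesh_cov :: "(real \<Rightarrow> real^'n^'n::finite) \<Rightarrow> real \<Rightarrow> nat \<Rightarrow> nat \<Rightarrow> real^'n^'n" where
  "mesh_cov b T n j = cov_int b (T / n * j) (T / n * (j + 1))"

definition mesh_index :: "real \<Rightarrow> nat \<Rightarrow> real \<Rightarrow> nat" where
  "mesh_index T n t = nat \<lfloor>n / T * t\<rfloor>"

definition walk_path :: "(real \<Rightarrow> real^'n^'n::finite) \<Rightarrow> real \<Rightarrow> nat \<Rightarrow> (nat \<Rightarrow> 'n \<times> bool) \<Rightarrow> nat \<Rightarrow> real^'n" where
  "walk_path b T n w i = (\<Sum>j<i. walk_shift (mesh_cov b T n j) (w j))"

lemma mesh_index:
  assumes "T > 0" "n > 0" "0 \<le> t" "t \<le> T"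
  shows "T / n * mesh_index T n t \<le> t" "t \<le> T / n * mesh_index T n t + T / n" "mesh_index T n t \<le> n"
    "0 \<le> s \<Longrightarrow> s \<le> t \<Longrightarrow> mesh_index T n s \<le> mesh_index T n t"
proof -
  have nt: "real (mesh_index T n t) = real_of_int \<lfloor>n / T * t\<rfloor>" using assms by (simp add: mesh_index_def)
  have le: "T / n * x \<le> T / n * y \<longleftrightarrow> x \<le> y" for x y using assms by (intro mult_le_cancel_left_pos) simp
  have e: "T / n * (n / T * t) = t" using assms by simp
  show "T / n * mesh_index T n t \<le> t" using le[of "real_of_int \<lfloor>n / T * t\<rfloor>" "n / T * t"] by (simp only: e nt) simp
  have "T / n * (n / T * t) \<le> T / n * (real_of_int \<lfloor>n / T * t\<rfloor> + 1)" unfolding le by linarith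
  then show "t \<le> T / n * mesh_index T n t + T / n" unfolding e nt by (simp add: distrib_left)
  have "n / T * t \<le> n / T * T" using assms by (intro mult_left_mono) auto
  then have "n / T * t \<le> n" using assms by simp
  then show "mesh_index T n t \<le> n" unfolding mesh_index_def by linarith
  show "mesh_index T n s \<le> mesh_index T n t" if "0 \<le> s" "s \<le> t"
    unfolding mesh_index_def using that assms by (intro nat_mono floor_mono mult_left_mono) auto
qed

context covariance_path
begin

lemma mesh_point: "(n :: nat) > 0 \<Longrightarrow> (i :: nat) \<le> n \<Longrightarrow> T / n * real i \<le> T"
  using T by (simp add: field_simps)

lemma mesh_cov_psd: "j < n \<Longrightarrow> sym_nonneg_matrix (mesh_cov b T n j)"
  unfolding mesh_cov_def using T mesh_point[of n "j + 1"] by (intro cov_int_psd) (auto simp: add.commute)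

lemma mesh_cov_sum:
  assumes "i \<le> j" "j \<le> n" "n > 0"
  shows "(\<Sum>l\<in>{i..<j}. mesh_cov b T n l) = cov_int b (T / n * i) (T / n * j)"
  using assms
proof (induction j rule: dec_induct)
  case base
  then show ?case by (simp add: cov_int_def vec_eq_iff)
next
  case (step j)
  have "cov_int b (T / n * i) (T / n * (j + 1)) = cov_int b (T / n * i) (T / n * j) + cov_int b (T / n * j) (T / n * (j + 1))"
    using T step mesh_point[of n "j + 1"] by (intro cov_int_add mult_left_mono) (auto simp: add.commute)
  then show ?case using step by (simp add: mesh_cov_def add.commute)
qed

text \<open>Between s and t the walk makes the steps of the mesh cells from the index of s to that
  of t. Their total covariance differs from that of [s, t] by at most one cell at either end, and
  passing from the steps to the Gaussian costs at most n local errors of order 1/n^2.\<close>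

lemma walk_average_cov:
  obtains c where "c \<ge> 0" "\<And>n s t M G vs x. n > 0 \<Longrightarrow> 0 \<le> s \<Longrightarrow> s \<le> t \<Longrightarrow> t \<le> T \<Longrightarrow> jet M G \<Longrightarrow>
     \<bar>(\<Sum>w\<in>sign_paths n. 1 / card (sign_paths n :: (nat \<Rightarrow> 'n \<times> bool) set) *
         G vs (x + walk_path b T n w (mesh_index T n t) - walk_path b T n w (mesh_index T n s)))
       - heat (cov_int b s t) G vs x\<bar> \<le> c * (M (length vs + 2) + M (length vs + 4)) * norm_prod vs / n"
proof -
  obtain c where c: "c \<ge> 0" "\<And>s t. 0 \<le> s \<Longrightarrow> s \<le> t \<Longrightarrow> t \<le> T \<Longrightarrow> trace (cov_int b s t) \<le> c * (t - s)"
    using cov_int_trace_le by blast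
  define C where "C = 12 * real CARD('n) * (c * T)\<^sup>2 + 4 * (c * T)"
  have cT: "c * T \<ge> 0" using c T by simp
  show thesis
  proof (rule that)
    show "C \<ge> 0" using cT by (simp add: C_def)
    fix n :: nat and s t :: real and M and G :: "(real^'n) list \<Rightarrow> real^'n \<Rightarrow> real" and vs :: "(real^'n) list" and x
    assume n: "n > 0" and st: "0 \<le> s" "s \<le> t" "t \<le> T" and G: "jet M G"
    define i j where "i = mesh_index T n s" and "j = mesh_index T n t"
    define h where "h = T / n"
    have h: "h > 0" using T n by (simp add: h_def)
    have ij: "i \<le> j" "j \<le> n" and s: "h * i \<le> s" "s \<le> h * i + h" and t: "h * j \<le> t" "t \<le> h * j + h"
      unfolding i_def j_def h_def using mesh_index[OF T n] st by auto
    have hij: "h * i \<le> h * j" "0 \<le> h * i" using ij h by auto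
    define W where "W = (sign_paths n :: (nat \<Rightarrow> 'n \<times> bool) set)"
    let ?Q = "mesh_cov b T n"
    define m2 m4 where "m2 = M (length vs + 2) * norm_prod vs" and "m4 = M (length vs + 4) * norm_prod vs"
    have m: "m2 \<ge> 0" "m4 \<ge> 0" unfolding m2_def m4_def by (auto intro!: mult_nonneg_nonneg jet_nonneg[OF G] norm_prod_nonneg)
    have p: "walk_path b T n w j - walk_path b T n w i = (\<Sum>l\<in>{i..<j}. walk_shift (?Q l) (w l))" for w
      unfolding walk_path_def using ij sum_diff_nat_ivl[of 0 i j "\<lambda>l. walk_shift (?Q l) (w l)"] by (simp add: atLeast0LessThan)
    have p': "x + walk_path b T n w j - walk_path b T n w i = x + (\<Sum>l\<in>{i..<j}. walk_shift (?Q l) (w l))" for w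
      using p[of w] by (simp add: algebra_simps)
    have avg: "(\<Sum>w\<in>W. 1 / real (card W) * G vs (x + walk_path b T n w j - walk_path b T n w i))
       = (\<Sum>w\<in>PiE {..<n} (\<lambda>_. UNIV). G vs (x + (\<Sum>l\<in>{i..<j}. walk_shift (?Q l) (w l)))) / (2 * real CARD('n)) ^ n"
      unfolding p' W_def sign_paths(3) by (simp add: sign_paths_def sum_divide_distrib)
    have tr: "(trace (?Q l))\<^sup>2 \<le> (c * h)\<^sup>2" if "l < n" for l
    proof -
      have "T / n * (l + 1) \<le> T" using mesh_point[OF n, of "l + 1"] that by (simp add: add.commute)
      then have "trace (?Q l) \<le> c * (T / n * (l + 1) - T / n * l)"
        unfolding mesh_cov_def using T n by (intro c(2)) (auto simp: add.commute intro!: divide_right_mono mult_left_mono)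
      also have "\<dots> = c * h" by (simp add: h_def algebra_simps add_divide_distrib)
      finally show ?thesis using trace_nonneg[OF mesh_cov_psd[OF that]] by (intro power_mono) auto
    qed
    have "(\<Sum>l\<in>{i..<j}. (trace (?Q l))\<^sup>2) \<le> (\<Sum>l\<in>{i..<j}. (c * h)\<^sup>2)" using ij by (intro sum_mono tr) auto
    also have "\<dots> \<le> n * (c * h)\<^sup>2" using ij by (simp add: mult_right_mono)
    also have "\<dots> = (c * T)\<^sup>2 / n" using n by (simp add: h_def power2_eq_square)
    finally have sq: "(\<Sum>l\<in>{i..<j}. (trace (?Q l))\<^sup>2) \<le> (c * T)\<^sup>2 / n" .
    have 1: "\<bar>(\<Sum>w\<in>W. 1 / real (card W) * G vs (x + walk_path b T n w j - walk_path b T n w i)) - heat (cov_int b (h * i) (h * j)) G vs x\<bar>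
       \<le> 12 * real CARD('n) * m4 * ((c * T)\<^sup>2 / n)"
    proof -
      have "\<bar>(\<Sum>w\<in>W. 1 / real (card W) * G vs (x + walk_path b T n w j - walk_path b T n w i)) - heat (\<Sum>l\<in>{i..<j}. ?Q l) G vs x\<bar>
         \<le> 12 * real CARD('n) * M (length vs + 4) * norm_prod vs * (\<Sum>l\<in>{i..<j}. (trace (?Q l))\<^sup>2)"
        unfolding avg by (rule walk_average_heat[OF ij G mesh_cov_psd])
      also have "\<dots> \<le> 12 * real CARD('n) * M (length vs + 4) * norm_prod vs * ((c * T)\<^sup>2 / n)"
        using m by (intro mult_left_mono sq) (auto simp: m4_def mult.assoc)
      finally show ?thesis using mesh_cov_sum[OF ij n] by (simp add: m4_def h_def mult.assoc)
    qed
    \<comment> \<open>Adding a covariance of trace at most c h changes the Gaussian average by order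
      h; this is applied once at each end.\<close>
    have shift: "\<bar>heat (P + R) G vs x - heat R G vs x\<bar> \<le> 2 * m2 * (c * h)"
      if "sym_nonneg_matrix P" "sym_nonneg_matrix R" "trace P \<le> c * h" for P R
    proof -
      have "\<bar>heat (P + R) G vs x - heat R G vs x\<bar> \<le> 2 * M (length vs + 2) * norm_prod vs * trace P"
        unfolding heat_semigroup[OF G that(1,2)] by (rule heat_first_order[OF jet_heat[OF G that(2)] that(1)])
      also have "\<dots> \<le> 2 * M (length vs + 2) * norm_prod vs * (c * h)"
        using m that(3) by (intro mult_left_mono) (auto simp: m2_def mult.assoc)
      finally show ?thesis by (simp add: m2_def mult.assoc)
    qed
    have trle: "trace (cov_int b u v) \<le> c * h" if "0 \<le> u" "u \<le> v" "v \<le> T" "v \<le> u + h" for u v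
      using c(2)[OF that(1-3)] mult_left_mono[of "v - u" h c] c(1) that by auto
    have 2: "\<bar>heat (cov_int b (h * i) t) G vs x - heat (cov_int b s t) G vs x\<bar> \<le> 2 * m2 * (c * h)"
      using shift[of "cov_int b (h * i) s" "cov_int b s t"] cov_int_add[of "h * i" s t] s st hij
      by (auto simp: cov_int_psd trle)
    have 3: "\<bar>heat (cov_int b (h * i) t) G vs x - heat (cov_int b (h * i) (h * j)) G vs x\<bar> \<le> 2 * m2 * (c * h)"
      using shift[of "cov_int b (h * j) t" "cov_int b (h * i) (h * j)"] cov_int_add[of "h * i" "h * j" t] t st hij
      by (auto simp: cov_int_psd trle add.commute)
    have "\<bar>(\<Sum>w\<in>W. 1 / real (card W) * G vs (x + walk_path b T n w j - walk_path b T n w i)) - heat (cov_int b s t) G vs x\<bar>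
       \<le> 12 * real CARD('n) * m4 * ((c * T)\<^sup>2 / n) + 4 * m2 * (c * h)"
      using 1 2 3 by linarith
    also have "\<dots> = (12 * real CARD('n) * (c * T)\<^sup>2 * m4 + 4 * (c * T) * m2) / n"
      by (simp add: h_def add_divide_distrib mult_ac)
    also have "\<dots> \<le> (C * m4 + C * m2) / n"
      unfolding C_def using m cT by (intro divide_right_mono add_mono mult_right_mono) auto
    finally show "\<bar>(\<Sum>w\<in>sign_paths n. 1 / card (sign_paths n :: (nat \<Rightarrow> 'n \<times> bool) set) *
         G vs (x + walk_path b T n w (mesh_index T n t) - walk_path b T n w (mesh_index T n s)))
       - heat (cov_int b s t) G vs x\<bar> \<le> C * (M (length vs + 2) + M (length vs + 4)) * norm_prod vs / n"
      unfolding W_def i_def j_def m2_def m4_def by (simp add: algebra_simps)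
  qed
qed

end

text \<open>The average over paths is taken under the integral over s. With the shift Y_s in the
  source and Y_t outside, the semigroup of b1 acts on the source at x + Y_t - Y_s, and by
  \<open>walk_average_cov\<close> averaging adds the semigroup of b2. The shift \<open>e\<close> of
  the source may miss Y by 1/n, because a step function in the original coordinates is not a step
  function in the moving frame.\<close>

lemma random_shift_flow:
  fixes b1 b2 b3 :: "real \<Rightarrow> real^'n^'n::finite"
  assumes b1: "covariance_path T b1" and b2: "covariance_path T b2" and b3: "heat_evolution T b3 M F N"
    and add: "\<And>s t. 0 \<le> s \<Longrightarrow> s \<le> t \<Longrightarrow> t \<le> T \<Longrightarrow> cov_int b3 s t = cov_int b2 s t + cov_int b1 s t"
  obtains K where "\<And>n t vs x (e :: (nat \<Rightarrow> 'n \<times> bool) \<Rightarrow> real \<Rightarrow> real^'n). n > 0 \<Longrightarrow> t \<in> {0..T} \<Longrightarrow>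
     (\<And>w. w \<in> sign_paths n \<Longrightarrow> \<exists>N'. jet_source T M (\<lambda>s vs x. F s vs (x - e w s)) N') \<Longrightarrow>
     (\<And>w s. w \<in> sign_paths n \<Longrightarrow> s \<in> {0..T} \<Longrightarrow> norm (e w s - walk_path b2 T n w (mesh_index T n s)) \<le> 1 / n) \<Longrightarrow>
     \<bar>(\<Sum>w\<in>sign_paths n. 1 / card (sign_paths n :: (nat \<Rightarrow> 'n \<times> bool) set) *
         heat_flow b1 (\<lambda>s vs x. F s vs (x - e w s)) t vs (x + walk_path b2 T n w (mesh_index T n t)))
       - heat_flow b3 F t vs x\<bar> \<le> K vs / n"
proof -
  interpret b1: covariance_path T b1 by (rule b1)
  interpret b2: covariance_path T b2 by (rule b2)
  interpret b3: heat_evolution T b3 M F N by (rule b3)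
  obtain c where c: "c \<ge> 0" "\<And>n s t M G vs x. n > 0 \<Longrightarrow> 0 \<le> s \<Longrightarrow> s \<le> t \<Longrightarrow> t \<le> T \<Longrightarrow> jet M G \<Longrightarrow>
     \<bar>(\<Sum>w\<in>sign_paths n. 1 / card (sign_paths n :: (nat \<Rightarrow> 'n \<times> bool) set) *
         G vs (x + walk_path b2 T n w (mesh_index T n t) - walk_path b2 T n w (mesh_index T n s)))
       - heat (cov_int b2 s t) G vs x\<bar> \<le> c * (M (length vs + 2) + M (length vs + 4)) * norm_prod vs / n"
    using b2.walk_average_cov by blast
  define K where "K vs = T * ((M (length vs + 1) + c * (M (length vs + 2) + M (length vs + 4))) * norm_prod vs)" for vs :: "(real^'n) list"
  show thesis
  proof (rule that[of K])
    fix n :: nat and t :: real and vs :: "(real^'n) list" and x :: "real^'n" and e :: "(nat \<Rightarrow> 'n \<times> bool) \<Rightarrow> real \<Rightarrow> real^'n"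
    assume n: "n > 0" and t: "t \<in> {0..T}"
      and J: "\<And>w. w \<in> sign_paths n \<Longrightarrow> \<exists>N'. jet_source T M (\<lambda>s vs x. F s vs (x - e w s)) N'"
      and e: "\<And>w s. w \<in> sign_paths n \<Longrightarrow> s \<in> {0..T} \<Longrightarrow> norm (e w s - walk_path b2 T n w (mesh_index T n s)) \<le> 1 / n"
    define W where "W = (sign_paths n :: (nat \<Rightarrow> 'n \<times> bool) set)"
    have W: "finite W" "real (card W) > 0" using sign_paths(1,2)[of n] unfolding W_def by (auto simp: card_gt_0_iff)
    define Y where "Y w s = walk_path b2 T n w (mesh_index T n s)" for w s
    define H where "H s = heat (cov_int b1 s t) (F s)" for s
    have H: "jet M (H s)" if "s \<in> {0..t}" for s
      unfolding H_def using that t by (intro jet_heat b3.F_jet b1.cov_int_psd) auto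
    have tr: "heat (cov_int b1 s t) (\<lambda>vs x. F s vs (x - y)) vs x = H s vs (x - y)" if "s \<in> {0..t}" for s y x
      using heat_translate[OF b3.F_jet b1.cov_int_psd, of s t s "- y" vs x] that t unfolding H_def by simp
    have int: "set_integrable lborel {0..t} (\<lambda>s. heat (cov_int b1 s t) (\<lambda>vs x. F s vs (x - e w s)) vs (x + Y w t))" if w: "w \<in> W" for w
    proof -
      obtain N' where "jet_source T M (\<lambda>s vs x. F s vs (x - e w s)) N'" using J[of w] w unfolding W_def by blast
      then interpret h: heat_evolution T b1 M "\<lambda>s vs x. F s vs (x - e w s)" N'
        using b1 by (intro heat_evolution.intro)
      show ?thesis using t by (intro h.integrand_integrable) auto
    qed
    have "(\<Sum>w\<in>W. 1 / real (card W) * heat_flow b1 (\<lambda>s vs x. F s vs (x - e w s)) t vs (x + Y w t))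
       = (LBINT s:{0..t}. \<Sum>w\<in>W. 1 / real (card W) * heat (cov_int b1 s t) (\<lambda>vs x. F s vs (x - e w s)) vs (x + Y w t))"
      unfolding heat_flow_def using int by (subst set_integral_finite_sum) (auto simp: set_integrable_mult_right)
    moreover have isum: "set_integrable lborel {0..t} (\<lambda>s. \<Sum>w\<in>W. 1 / real (card W) * heat (cov_int b1 s t) (\<lambda>vs x. F s vs (x - e w s)) vs (x + Y w t))"
      using int by (intro set_integrable_finite_sum) auto
    moreover have i3: "set_integrable lborel {0..t} (\<lambda>s. heat (cov_int b3 s t) (F s) vs x)"
      using t by (intro b3.integrand_integrable) auto
    ultimately have eq: "(\<Sum>w\<in>W. 1 / real (card W) * heat_flow b1 (\<lambda>s vs x. F s vs (x - e w s)) t vs (x + Y w t)) - heat_flow b3 F t vs x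
       = (LBINT s:{0..t}. (\<Sum>w\<in>W. 1 / real (card W) * heat (cov_int b1 s t) (\<lambda>vs x. F s vs (x - e w s)) vs (x + Y w t)) - heat (cov_int b3 s t) (F s) vs x)"
      by (simp add: heat_flow_def set_integral_diff)
    define k where "k = (M (length vs + 1) + c * (M (length vs + 2) + M (length vs + 4))) * norm_prod vs / n"
    have m1: "M (length vs + 1) * norm_prod vs \<ge> 0" by (intro mult_nonneg_nonneg jet_nonneg[OF b3.F_jet] norm_prod_nonneg)
    have pt: "\<bar>(\<Sum>w\<in>W. 1 / real (card W) * heat (cov_int b1 s t) (\<lambda>vs x. F s vs (x - e w s)) vs (x + Y w t)) - heat (cov_int b3 s t) (F s) vs x - 0\<bar> \<le> k"
      if s: "s \<in> {0..t}" for s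
    proof -
      have "\<bar>H s vs (x + Y w t - e w s) - H s vs (x + Y w t - Y w s)\<bar> \<le> M (length vs + 1) * norm_prod vs / n" if w: "w \<in> W" for w
      proof -
        have "norm (x + Y w t - e w s - (x + Y w t - Y w s)) = norm (e w s - Y w s)" by (simp add: norm_minus_commute)
        also have "\<dots> \<le> 1 / n" unfolding Y_def using e[of w s] w s t by (simp add: W_def)
        finally have "M (length vs + 1) * norm_prod vs * norm (x + Y w t - e w s - (x + Y w t - Y w s)) \<le> M (length vs + 1) * norm_prod vs * (1 / n)"
          by (intro mult_left_mono m1)
        then show ?thesis using jet_lipschitz[OF H[OF s], of vs "x + Y w t - e w s" "x + Y w t - Y w s"] by simp
      qed
      then have "\<bar>\<Sum>w\<in>W. 1 / real (card W) * (H s vs (x + Y w t - e w s) - H s vs (x + Y w t - Y w s))\<bar> \<le> (\<Sum>w\<in>W. 1 / real (card W) * (M (length vs + 1) * norm_prod vs / n))"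
        by (intro order_trans[OF sum_abs] sum_mono, unfold abs_mult, intro mult_mono) auto
      also have "\<dots> = M (length vs + 1) * norm_prod vs / n" using W by auto
      finally have 1: "\<bar>(\<Sum>w\<in>W. 1 / real (card W) * H s vs (x + Y w t - e w s)) - (\<Sum>w\<in>W. 1 / real (card W) * H s vs (x + Y w t - Y w s))\<bar> \<le> M (length vs + 1) * norm_prod vs / n"
        by (simp add: sum_subtractf right_diff_distrib)
      have 2: "\<bar>(\<Sum>w\<in>W. 1 / real (card W) * H s vs (x + Y w t - Y w s)) - heat (cov_int b2 s t) (H s) vs x\<bar> \<le> c * (M (length vs + 2) + M (length vs + 4)) * norm_prod vs / n"
        unfolding W_def Y_def using s t n by (intro c(2) H) auto
      have 3: "heat (cov_int b2 s t) (H s) vs x = heat (cov_int b3 s t) (F s) vs x"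
        unfolding H_def using s t by (simp add: add heat_semigroup[OF b3.F_jet] b1.cov_int_psd b2.cov_int_psd)
      have "k = M (length vs + 1) * norm_prod vs / n + c * (M (length vs + 2) + M (length vs + 4)) * norm_prod vs / n"
        unfolding k_def by (simp add: distrib_right add_divide_distrib)
      then show ?thesis using 1 2 by (simp add: tr[OF s] 3)
    qed
    have k: "0 \<le> k" using pt[of 0] t by force
    have "\<bar>(LBINT s:{0..t}. (\<Sum>w\<in>W. 1 / real (card W) * heat (cov_int b1 s t) (\<lambda>vs x. F s vs (x - e w s)) vs (x + Y w t)) - heat (cov_int b3 s t) (F s) vs x) - (t - 0) * 0\<bar> \<le> (t - 0) * k"
      using t by (intro set_integral_bound_Icc set_integral_diff isum i3 pt) auto
    also have "\<dots> \<le> T * k" using t k by (intro mult_right_mono) auto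
    finally show "\<bar>(\<Sum>w\<in>sign_paths n. 1 / card (sign_paths n :: (nat \<Rightarrow> 'n \<times> bool) set) *
         heat_flow b1 (\<lambda>s vs x. F s vs (x - e w s)) t vs (x + walk_path b2 T n w (mesh_index T n t)))
       - heat_flow b3 F t vs x\<bar> \<le> K vs / n"
      using eq unfolding W_def Y_def by (simp add: K_def k_def)
  qed
qed

text \<open>The shift e^{-sA} Y_s is not a step function, as the flow moves between the jumps of the
  walk. The flow is therefore frozen on a second mesh, of width 1/l.\<close>

lemma step_approximation:
  fixes A :: "real^'n^'n::finite" and y :: "'w \<Rightarrow> nat \<Rightarrow> real^'n"
  assumes T: "T > 0" and n: "n > 0" and W: "finite W"
  obtains c where "\<And>w. c w \<in> borel_measurable borel" "\<And>w. finite (c w ` {0..T})"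
    "\<And>w. \<exists>P. finite P \<and> (\<forall>t\<in>{0..T} - P. eventually (\<lambda>r. c w r = c w t) (at t within {0..T}))"
    "\<And>w s. w \<in> W \<Longrightarrow> s \<in> {0..T} \<Longrightarrow> norm (matrix_exp A s *v c w s - y w (mesh_index T n s)) \<le> 1 / n"
proof -
  obtain a where a: "a \<ge> 1" "\<And>t x. \<bar>t\<bar> \<le> T \<Longrightarrow> norm (matrix_exp A t *v x) \<le> a * norm x"
    "\<And>s t x. \<bar>s\<bar> \<le> T \<Longrightarrow> \<bar>t\<bar> \<le> T \<Longrightarrow> norm (matrix_exp A t *v x - matrix_exp A s *v x) \<le> a * \<bar>t - s\<bar> * norm x"
    using matrix_exp_bounds[of T A] by metis
  have "finite ((\<lambda>(w, i). y w i) ` (W \<times> {..n}))" using W by simp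
  from finite_imp_bounded[OF this] obtain R where "\<forall>u\<in>(\<lambda>(w, i). y w i) ` (W \<times> {..n}). norm u \<le> R" unfolding bounded_iff by blast
  then have R: "norm (y w i) \<le> \<bar>R\<bar>" if "w \<in> W" "i \<le> n" for w i using that by force
  \<comment> \<open>With this l the freezing error, at most a a |R| / l, does not exceed 1/n; the
    summand 1 keeps l positive.\<close>
  define l where "l = n * (a * a * \<bar>R\<bar>) + 1"
  have l: "l > 0" "a * a * \<bar>R\<bar> / l \<le> 1 / n"
  proof -
    have "n * (a * a * \<bar>R\<bar>) \<ge> 0" using a by simp
    then show "l > 0" unfolding l_def by linarith
    then show "a * a * \<bar>R\<bar> / l \<le> 1 / n" using n by (simp add: divide_le_eq le_divide_eq pos_divide_le_eq l_def mult.commute)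
  qed
  define d where "d w i j = matrix_exp A (- (real_of_int i / l)) *v y w (nat j)" for w i j
  define c where "c w s = d w \<lfloor>l * s\<rfloor> \<lfloor>real n / T * s\<rfloor>" for w s
  have pos: "real n / T > 0" using n T by simp
  show thesis
  proof (rule that[of c])
    show "c w \<in> borel_measurable borel" for w unfolding c_def[abs_def] by (rule floor_step_function[OF l(1) pos])
    show "finite (c w ` {0..T})" for w unfolding c_def[abs_def] by (rule floor_step_function[OF l(1) pos])
    show "\<exists>P. finite P \<and> (\<forall>t\<in>{0..T} - P. eventually (\<lambda>r. c w r = c w t) (at t within {0..T}))" for w
      unfolding c_def[abs_def] by (rule floor_step_function[OF l(1) pos])
    fix w s assume w: "w \<in> W" and s: "s \<in> {0..T}"
    define r where "r = real_of_int \<lfloor>l * s\<rfloor> / l"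
    define u where "u = y w (mesh_index T n s)"
    have r: "0 \<le> r" "r \<le> s" "s - r \<le> 1 / l"
    proof -
      show "0 \<le> r" unfolding r_def using l s by simp
      show "r \<le> s" unfolding r_def using l by (simp add: divide_le_eq mult.commute)
      have "s * l \<le> real_of_int \<lfloor>l * s\<rfloor> + 1" by (subst mult.commute) linarith
      then have "s \<le> (real_of_int \<lfloor>l * s\<rfloor> + 1) / l" using l by (simp add: le_divide_eq)
      then show "s - r \<le> 1 / l" unfolding r_def by (simp add: add_divide_distrib)
    qed
    have u: "norm u \<le> \<bar>R\<bar>" unfolding u_def using mesh_index(3)[OF T n] s w by (intro R) auto
    have cs: "c w s = matrix_exp A (- r) *v u" by (simp add: c_def d_def r_def u_def mesh_index_def)
    have "u = matrix_exp A s *v (matrix_exp A (- s) *v u)" using matrix_exp_inverse_vec[of A "- s" u] by simp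
    then have "norm (matrix_exp A s *v c w s - u) = norm (matrix_exp A s *v (matrix_exp A (- r) *v u - matrix_exp A (- s) *v u))"
      unfolding cs matrix_vector_mult_diff_distrib by metis
    also have "\<dots> \<le> a * norm (matrix_exp A (- r) *v u - matrix_exp A (- s) *v u)" using s by (intro a(2)) auto
    also have "\<dots> \<le> a * (a * \<bar>- r - - s\<bar> * norm u)" using a(1) s r by (intro mult_left_mono a(3)) auto
    also have "\<dots> \<le> a * (a * (1 / l) * \<bar>R\<bar>)" using a(1) r u l by (intro mult_left_mono mult_mono) auto
    also have "\<dots> \<le> 1 / n" using l(2) by (simp add: mult.assoc)
    finally show "norm (matrix_exp A s *v c w s - y w (mesh_index T n s)) \<le> 1 / n" by (simp add: u_def)
  qed
qed

section \<open>The estimate for the perturbed problem\<close>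

lemma sym_nonneg_of_elliptic:
  fixes B :: "real^'n^'n::finite"
  assumes B: "elliptic_first_block blk \<nu> B" and nu: "\<nu> > 0"
  shows "sym_nonneg_matrix B"
proof -
  have "0 \<le> (B *v \<xi>) \<bullet> \<xi>" for \<xi>
  proof -
    \<comment> \<open>B sees only the coordinates of block 0, where ellipticity is assumed, so \<xi>
      may be replaced by its projection.\<close>
    define \<eta> :: "real^'n" where "\<eta> = (\<chi> p. if p \<in> block blk 0 then \<xi> $ p else 0)"
    have z: "B $ p $ q = 0" if "\<not> (p \<in> block blk 0 \<and> q \<in> block blk 0)" for p q
      using B that unfolding elliptic_first_block_def by blast
    have e: "B $ p $ q * \<xi> $ q * \<xi> $ p = B $ p $ q * \<eta> $ q * \<eta> $ p" for p q
      by (cases "p \<in> block blk 0 \<and> q \<in> block blk 0") (auto simp: \<eta>_def z)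
    have "(B *v \<xi>) \<bullet> \<xi> = (B *v \<eta>) \<bullet> \<eta>"
      by (simp add: inner_vec_def matrix_vector_mult_def sum_distrib_right e)
    moreover have "\<eta> \<in> coord_space (block blk 0)" by (simp add: coord_space_def \<eta>_def)
    then have "\<nu> * (norm \<eta>)\<^sup>2 \<le> (B *v \<eta>) \<bullet> \<eta>" using B unfolding elliptic_first_block_def by blast
    moreover have "0 \<le> \<nu> * (norm \<eta>)\<^sup>2" using nu by simp
    ultimately show ?thesis by linarith
  qed
  moreover have "transpose B = B" using B unfolding elliptic_first_block_def by blast
  ultimately show ?thesis unfolding sym_nonneg_matrix_def by blast
qed

lemma cov_int_conj_add:
  assumes b: "covariance_path T (conj_cov A a)" "covariance_path T (conj_cov A a')" and st: "0 \<le> s" "t \<le> T"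
  shows "cov_int (conj_cov A (\<lambda>t. a t + a' t)) s t = cov_int (conj_cov A a') s t + cov_int (conj_cov A a) s t"
proof -
  interpret b1: covariance_path T "conj_cov A a" by (rule b)
  interpret b2: covariance_path T "conj_cov A a'" by (rule b)
  show ?thesis
    by (simp add: cov_int_def vec_eq_iff conj_cov_add
        Henstock_Kurzweil_Integration.integral_add[OF b1.entry_integrable[OF st] b2.entry_integrable[OF st]])
qed

lemma conj_covariance_path:
  assumes "T > 0" "continuous_on {0..T} a" "\<And>t. t \<in> {0..T} \<Longrightarrow> sym_nonneg_matrix (a t)"
  shows "covariance_path T (conj_cov A a)"
  by unfold_locales (use assms in \<open>auto intro: conj_cov_continuous conj_cov_psd\<close>)

text \<open>The estimate at a single time t. The time is fixed before averaging, since the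
  translation of the solutions depends on t; the shifted sources do not.\<close>

lemma schauder_norm_transfer:
  fixes A B :: "real^'n^'n::finite" and S :: "real \<Rightarrow> real^'n^'n"
  assumes T: "T > 0" and B: "sym_nonneg_matrix B"
    and S: "continuous_on {0..T} S" "\<And>t. t \<in> {0..T} \<Longrightarrow> sym_nonneg_matrix (S t)"
    and unperturbed: "\<And>f u. f \<in> Bb_Cc_infty T \<Longrightarrow> is_solution T (\<lambda>t. L_ou A B) f u \<Longrightarrow> schauder_estimate T blk k \<beta> C f u"
    and f: "f \<in> Bb_Cc_infty T" and ou: "ou_evolution T A (\<lambda>t. B + S t) M F N f"
    and F0: "\<And>s vs x. s \<notin> {0..T} \<Longrightarrow> F s vs x = 0"
    and t: "t \<in> {0..T}"
  shows "aniso_holder_norm blk k (2 + \<beta>) (ou_evolution.sol_jet A (\<lambda>t. B + S t) F t [])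
     \<le> ennreal C * (SUP t\<in>{0..T}. aniso_holder_norm blk k \<beta> (f t))"
proof -
  interpret ou: ou_evolution T A "\<lambda>t. B + S t" M F N f by (rule ou)
  let ?E = "matrix_exp A"
  define b1 b2 where "b1 = conj_cov A (\<lambda>_. B)" and "b2 = conj_cov A S"
  have b1: "covariance_path T b1" unfolding b1_def by (intro conj_covariance_path T B continuous_on_const)
  have b2: "covariance_path T b2" unfolding b2_def by (intro conj_covariance_path T S)
  have add: "cov_int (conj_cov A (\<lambda>t. B + S t)) s t = cov_int b2 s t + cov_int b1 s t" if "0 \<le> s" "s \<le> t" "t \<le> T" for s t
    using cov_int_conj_add[OF b1[unfolded b1_def] b2[unfolded b2_def] that(1,3)] by (simp add: b1_def b2_def)
  obtain K where K: "\<And>n t vs x (e :: (nat \<Rightarrow> 'n \<times> bool) \<Rightarrow> real \<Rightarrow> real^'n). n > 0 \<Longrightarrow> t \<in> {0..T} \<Longrightarrow>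
     (\<And>w. w \<in> sign_paths n \<Longrightarrow> \<exists>N'. jet_source T M (\<lambda>s vs x. F s vs (x - e w s)) N') \<Longrightarrow>
     (\<And>w s. w \<in> sign_paths n \<Longrightarrow> s \<in> {0..T} \<Longrightarrow> norm (e w s - walk_path b2 T n w (mesh_index T n s)) \<le> 1 / n) \<Longrightarrow>
     \<bar>(\<Sum>w\<in>sign_paths n. 1 / card (sign_paths n :: (nat \<Rightarrow> 'n \<times> bool) set) *
         heat_flow b1 (\<lambda>s vs x. F s vs (x - e w s)) t vs (x + walk_path b2 T n w (mesh_index T n t)))
       - heat_flow (conj_cov A (\<lambda>t. B + S t)) F t vs x\<bar> \<le> K vs / n"
    using random_shift_flow[OF b1 b2 ou.heat_evolution_axioms add] by blast
  \<comment> \<open>The properties are bundled so that an approximation can be chosen for all n at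
    once.\<close>
  define approx where "approx n c \<longleftrightarrow> (\<forall>w. c w \<in> borel_measurable borel) \<and> (\<forall>w. finite (c w ` {0..T})) \<and>
     (\<forall>w. \<exists>P. finite P \<and> (\<forall>t\<in>{0..T} - P. eventually (\<lambda>r. c w r = c w t) (at t within {0..T}))) \<and>
     (\<forall>w\<in>sign_paths n. \<forall>s\<in>{0..T}. norm (?E s *v c w s - walk_path b2 T n w (mesh_index T n s)) \<le> 1 / n)"
    for n and c :: "(nat \<Rightarrow> 'n \<times> bool) \<Rightarrow> real \<Rightarrow> real^'n"
  have "\<exists>c. approx n c" if n: "n > 0" for n
  proof (rule step_approximation[OF T n sign_paths(1)[of n], where A = A and y = "walk_path b2 T n"])
    fix c :: "(nat \<Rightarrow> 'n \<times> bool) \<Rightarrow> real \<Rightarrow> real^'n"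
    assume "\<And>w. c w \<in> borel_measurable borel" "\<And>w. finite (c w ` {0..T})"
      "\<And>w. \<exists>P. finite P \<and> (\<forall>t\<in>{0..T} - P. eventually (\<lambda>r. c w r = c w t) (at t within {0..T}))"
      "\<And>w s. w \<in> sign_paths n \<Longrightarrow> s \<in> {0..T} \<Longrightarrow> norm (?E s *v c w s - walk_path b2 T n w (mesh_index T n s)) \<le> 1 / n"
    then have "approx n c" unfolding approx_def by (intro conjI allI ballI)
    then show ?thesis by blast
  qed
  then obtain c where "\<And>n. n > 0 \<Longrightarrow> approx n (c n)" by metis
  then have c: "\<And>n w. n > 0 \<Longrightarrow> c n w \<in> borel_measurable borel" "\<And>n w. n > 0 \<Longrightarrow> finite (c n w ` {0..T})"
     "\<And>n w. n > 0 \<Longrightarrow> \<exists>P. finite P \<and> (\<forall>t\<in>{0..T} - P. eventually (\<lambda>r. c n w r = c n w t) (at t within {0..T}))"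
     "\<And>n w s. n > 0 \<Longrightarrow> w \<in> sign_paths n \<Longrightarrow> s \<in> {0..T} \<Longrightarrow> norm (?E s *v c n w s - walk_path b2 T n w (mesh_index T n s)) \<le> 1 / n"
    unfolding approx_def by (simp_all only: Ball_def)
  define fc where "fc n w s z = f s (z - c n w s)" for n w s z
  define Fc where "Fc n w s vs x = F s vs (x - ?E s *v c n w s)" for n w s vs x
  have fc: "fc n w \<in> Bb_Cc_infty T" if n: "n > 0" for n w
  proof -
    obtain P where P: "finite P" "\<And>t. t \<in> {0..T} - P \<Longrightarrow> eventually (\<lambda>r. c n w r = c n w t) (at t within {0..T})"
      using c(3)[OF n, of w] by blast
    show ?thesis unfolding fc_def[abs_def] by (rule Bb_step_translate[OF f c(1)[OF n] c(2)[OF n] P])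
  qed
  have Fc0: "Fc n w s [] x = fc n w s (?E (- s) *v x)" if "s \<in> {0..T}" for n w s x
    unfolding Fc_def fc_def using ou.F_f[OF that] by (simp add: matrix_vector_mult_diff_distrib matrix_exp_inverse_vec)
  have js: "\<exists>N'. jet_source T M (Fc n w) N'" if n: "n > 0" for n w
  proof -
    have J: "jet M (Fc n w s)" for s
      using jet_translate[OF ou.F_jet, of s "- (?E s *v c n w s)"] by (simp add: Fc_def[abs_def])
    have Z: "Fc n w s vs x = 0" if "s \<notin> {0..T}" for s vs x by (simp only: Fc_def F0[OF that])
    show ?thesis by (rule Bb_jet_source[OF fc[OF n] J Fc0 Z]) blast+
  qed
  have ev: "\<exists>N'. ou_evolution T A (\<lambda>_. B) M (Fc n w) N' (fc n w)" if n: "n > 0" for n w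
  proof -
    obtain N' where "jet_source T M (Fc n w) N'" using js[OF n] by blast
    then have "ou_evolution T A (\<lambda>_. B) M (Fc n w) N' (fc n w)"
      using b1 Fc0 by (intro ou_evolution.intro heat_evolution.intro ou_evolution_axioms.intro) (auto simp: b1_def)
    then show ?thesis by blast
  qed
  define sol where "sol n w = ou_evolution.sol_jet A (\<lambda>_. B) (Fc n w)" for n w
  \<comment> \<open>The walk lives in the moving frame; e^{-tA} brings its end point back to the
    coordinates of z.\<close>
  define y where "y n w = ?E (- t) *v walk_path b2 T n w (mesh_index T n t)" for n w
  \<comment> \<open>The index m + 1 keeps the number of mesh cells positive.\<close>
  define G where "G m w vs z = sol (Suc m) w t vs (z + y (Suc m) w)" for m w vs z
  define W :: "nat \<Rightarrow> (nat \<Rightarrow> 'n \<times> bool) set" where "W m = sign_paths (Suc m)" for m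
  define D where "D = ennreal C * (SUP t\<in>{0..T}. aniso_holder_norm blk k \<beta> (f t))"
  have bound: "aniso_holder_norm blk k (2 + \<beta>) (G m w []) \<le> D" for m w
  proof -
    obtain N' where "ou_evolution T A (\<lambda>_. B) M (Fc (Suc m) w) N' (fc (Suc m) w)" using ev[of "Suc m" w] by blast
    then interpret o: ou_evolution T A "\<lambda>_. B" M "Fc (Suc m) w" N' "fc (Suc m) w" .
    have "is_solution T (\<lambda>t. L_ou A B) (fc (Suc m) w) (\<lambda>t. o.sol_jet t [])"
      by (rule o.sol_is_solution) (auto simp: L_ou_def B)
    then have "schauder_estimate T blk k \<beta> C (fc (Suc m) w) (\<lambda>t. o.sol_jet t [])" by (intro unperturbed fc) auto
    then have "(SUP t\<in>{0..T}. aniso_holder_norm blk k (2 + \<beta>) (o.sol_jet t [])) \<le> ennreal C * (SUP t\<in>{0..T}. aniso_holder_norm blk k \<beta> (fc (Suc m) w t))"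
      unfolding schauder_estimate_def .
    moreover have "aniso_holder_norm blk k \<beta> (fc (Suc m) w s) = aniso_holder_norm blk k \<beta> (f s)" for s
      using aniso_holder_norm_translate[of blk k \<beta> "f s" "- c (Suc m) w s"] by (simp add: fc_def[abs_def])
    ultimately have "(SUP t\<in>{0..T}. aniso_holder_norm blk k (2 + \<beta>) (o.sol_jet t [])) \<le> D" by (simp add: D_def)
    then have "aniso_holder_norm blk k (2 + \<beta>) (o.sol_jet t []) \<le> D" using SUP_upper[OF t] order_trans by metis
    then show ?thesis
      using aniso_holder_norm_translate[of blk k "2 + \<beta>" "o.sol_jet t []" "y (Suc m) w"] by (simp add: G_def[abs_def] sol_def)
  qed
  have "\<exists>M'. jet M' (G m w)" for m w
  proof -
    obtain N' where "ou_evolution T A (\<lambda>_. B) M (Fc (Suc m) w) N' (fc (Suc m) w)" using ev[of "Suc m" w] by blast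
    then interpret o: ou_evolution T A "\<lambda>_. B" M "Fc (Suc m) w" N' "fc (Suc m) w" .
    obtain M' where "\<And>t. t \<in> {0..T} \<Longrightarrow> jet M' (o.sol_jet t)" using o.sol_jet_bounds by blast
    from jet_translate[OF this[OF t]] show ?thesis unfolding G_def[abs_def] sol_def by blast
  qed
  then obtain MG where MG: "\<And>m w. jet (MG m w) (G m w)" by metis
  obtain M' where M': "jet M' (ou.sol_jet t)" using ou.sol_jet_bounds t by metis
  have "(\<lambda>m. \<Sum>w\<in>W m. 1 / card (W m) * G m w vs z) \<longlonglongrightarrow> ou.sol_jet t vs z" for vs z
  proof -
    \<comment> \<open>Directions transported into the frame, where \<open>random_shift_flow\<close>
      compares the flows.\<close>
    let ?vs = "map ((*v) (?E t)) vs"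
    have le: "norm ((\<Sum>w\<in>W m. 1 / card (W m) * G m w vs z) - ou.sol_jet t vs z) \<le> K ?vs / Suc m" for m
    proof -
      have "G m w vs z = heat_flow b1 (Fc (Suc m) w) t ?vs (?E t *v z + walk_path b2 T (Suc m) w (mesh_index T (Suc m) t))" for w
      proof -
        obtain N' where "ou_evolution T A (\<lambda>_. B) M (Fc (Suc m) w) N' (fc (Suc m) w)" using ev[of "Suc m" w] by blast
        then interpret o: ou_evolution T A "\<lambda>_. B" M "Fc (Suc m) w" N' "fc (Suc m) w" .
        show ?thesis
          by (simp add: G_def sol_def o.sol_jet_def b1_def y_def matrix_vector_right_distrib matrix_exp_inverse_vec)
      qed
      then show ?thesis
        using K[of "Suc m" t "\<lambda>w s. ?E s *v c (Suc m) w s" ?vs "?E t *v z"] t js[of "Suc m"] c(4)[of "Suc m"]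
        by (simp add: W_def ou.sol_jet_def Fc_def[abs_def])
    qed
    have "(\<lambda>m. K ?vs / Suc m) \<longlonglongrightarrow> 0" by (rule tendsto_divide_0[OF tendsto_const]) (rule filterlim_compose[OF filterlim_real_sequentially filterlim_Suc, THEN filterlim_at_top_imp_at_infinity])
    then have "(\<lambda>m. (\<Sum>w\<in>W m. 1 / card (W m) * G m w vs z) - ou.sol_jet t vs z) \<longlonglongrightarrow> 0"
      by (rule Lim_null_comparison[rotated]) (use le in auto)
    then show ?thesis by (simp add: LIM_zero_iff)
  qed
  from aniso_holder_norm_mean_limit[OF MG M' this]
  have "aniso_holder_norm blk k (2 + \<beta>) (ou.sol_jet t []) \<le> mean_liminf W (\<lambda>m w. aniso_holder_norm blk k (2 + \<beta>) (G m w []))" .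
  also have "\<dots> \<le> D" by (rule mean_liminf_le) (use bound in \<open>auto simp: W_def sign_paths\<close>)
  finally show ?thesis by (simp add: D_def)
qed

theorem mainTheorem3:
  fixes T \<nu> \<beta> C :: real
    and blk :: "'n::finite \<Rightarrow> nat" and k :: nat
    and A B :: "real^'n^'n"
    and S :: "real \<Rightarrow> real^'n^'n"
  assumes T_pos: "T > 0"
    and blocks: "range blk = {0..k}"
    and nu_pos: "\<nu> > 0"
    and B_form: "elliptic_first_block blk \<nu> B"
    and kalman: "kalman_rank A B k = CARD('n)"
    and A_form: "kalman_block_form blk k A"
    and beta: "0 < \<beta>" "\<beta> < 1"
    and C_pos: "C > 0"
    and unperturbed: "\<And>f u. f \<in> Bb_Cc_infty T \<Longrightarrow> is_solution T (\<lambda>t. L_ou A B) f u \<Longrightarrow>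
          schauder_estimate T blk k \<beta> C f u"
    and S_cont: "continuous_on {0..T} S"
    and S_nonneg: "\<And>t. t \<in> {0..T} \<Longrightarrow> sym_nonneg_matrix (S t)"
  shows "\<forall>f\<in>Bb_Cc_infty T. \<exists>u\<^sub>S.
           is_unique_solution T (L_ou_S A B S) f u\<^sub>S \<and> schauder_estimate T blk k \<beta> C f u\<^sub>S"
proof
  fix f :: "real \<Rightarrow> real^'n \<Rightarrow> real" assume f: "f \<in> Bb_Cc_infty T"
  have B: "sym_nonneg_matrix B" by (rule sym_nonneg_of_elliptic[OF B_form nu_pos])
  have BS: "sym_nonneg_matrix (B + S t)" if "t \<in> {0..T}" for t by (intro sym_nonneg_add B S_nonneg that)
  have BSc: "continuous_on {0..T} (\<lambda>t. B + S t)" by (intro continuous_intros S_cont)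
  obtain M where J: "\<And>s. jet M (source_frame A T f s)" using source_frame_jet[OF f] by blast
  have F0: "source_frame A T f s vs x = 0" if "s \<notin> {0..T}" for s vs x using that by (simp only: source_frame_def if_False)
  obtain N where N: "jet_source T M (source_frame A T f) N"
    by (rule Bb_jet_source[OF f J source_frame_value F0])
  have ou: "ou_evolution T A (\<lambda>t. B + S t) M (source_frame A T f) N f"
    by (intro ou_evolution.intro heat_evolution.intro ou_evolution_axioms.intro conj_covariance_path T_pos BSc BS N)
       (auto intro: source_frame_value)
  interpret ou_evolution T A "\<lambda>t. B + S t" M "source_frame A T f" N f by (rule ou)
  have sol: "is_solution T (L_ou_S A B S) f (\<lambda>t. sol_jet t [])"
    by (rule sol_is_solution) (simp_all add: L_ou_S_def L_ou_def matrix_mult_add_left trace_plus BS)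
  \<comment> \<open>Comparison in both orders.\<close>
  have "w t = sol_jet t []" if w: "is_solution T (L_ou_S A B S) f w" and t: "t \<in> {0..T}" for w t
    by (intro ext antisym solution_le[OF T_pos S_cont BS w sol t] solution_le[OF T_pos S_cont BS sol w t])
  then have "is_unique_solution T (L_ou_S A B S) f (\<lambda>t. sol_jet t [])"
    using sol unfolding is_unique_solution_def by blast
  moreover have "schauder_estimate T blk k \<beta> C f (\<lambda>t. sol_jet t [])"
    unfolding schauder_estimate_def
    by (intro SUP_least schauder_norm_transfer[OF T_pos B S_cont S_nonneg unperturbed f ou F0])
  ultimately show "\<exists>u\<^sub>S. is_unique_solution T (L_ou_S A B S) f u\<^sub>S \<and> schauder_estimate T blk k \<beta> C f u\<^sub>S" by blast
qed

end
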